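(* Every hereditary graph class with finite asymptotic dimension is Burling-controlled.
   Context: Graphs are finite, simple, undirected and have at least one vertex; graph classes are closed under isomorphism; $\mathbb{N}=\{1,2,\ldots\}$, $[k]=\{1,\ldots,k\}$. $\chi(G)$ is the chromatic number and $\omega(G)$ the maximum size of a clique of $G$; $N_G(v)$ is the set of neighbors of $v$ in $G$. For disjoint vertex sets $X,Y$, $XY$ denotes the set of edges $\{xy\colon x\in X,\,y\in Y\}$. A graph class is hereditary if it is closed under taking induced subgraphs. Asymptotic dimension. $d_G(x,y)$ is the shortest-path distance in $G$ ($\infty$ between different components). The diameter of $S\subseteq V(G)$ in $G$ is $\max_{x,y\in S}d_G(x,y)$. A family $\mathcal{U}$ of subsets of $V(G)$ is $\delta$-disjoint if all distinct $X,Y\in\mathcal{U}$ satisfy $\min_{x\in X}\min_{y\in Y}d_G(x,y)>\delta$, and $(k,\delta)$-disjoint if $\mathcal{U}=\bigcup_{i=1}^k\mathcal{U}_i$ where each $\mathcal{U}_i$, $i\in[k]$, is $\delta$-disjoint. A function $f\colon\{0,1,2,\ldots\}\to\mathbb{N}$ is a $d$-dimensional control function for $G$ if for every integer $\delta\ge0$ there is a $(d+1,\delta)$-disjoint partition of $V(G)$ into sets of diameter at most $f(\delta)$ in $G$. The asymptotic dimension of a graph class $\mathcal{G}$ is the minimum $d$ such that there is a $d$-dimensional control function common for all graphs in $\mathcal{G}$ (infinite if no such $d$ exists). Burling's sequence. A marked graph is a graph $G$ with a distinguished independent set of vertices $V_A(G)$; let $V_N(G)=V(G)\setminus V_A(G)$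 and $E_N(G)=\{uv\in E(G)\colon u,v\in V_N(G)\}$. The marked graphs $B_k$ ($k\ge1$) are defined by: $V(B_1)=V_A(B_1)=\{a\}$, $E(B_1)=\emptyset$; $V(B_2)=\{b,a\}$, $V_A(B_2)=\{a\}$, $E(B_2)=\{ba\}$; and for $k\ge2$, with $A=V_A(B_k)$, for each $a\in A$ let $B^a$ be an isomorphic copy of $B_k$ on a new vertex set (all these vertex sets and $V(B_k)$ pairwise disjoint), let $A^a=V_A(B^a)$, and for each $a\in A$, $v\in A^a$ let $b^a_v,c^a_v$ be two new vertices; then $V(B_{k+1})=V_N(B_k)\cup\bigcup_{a\in A}\bigl(V(B^a)\cup\{b^a_v,c^a_v\colon v\in A^a\}\bigr)$, $V_A(B_{k+1})=\bigcup_{a\in A}\bigl(A^a\cup\{c^a_v\colon v\in A^a\}\bigr)$, $E(B_{k+1})=E_N(B_k)\cup\bigcup_{a\in A}\Bigl(E(B^a)\cup\bigcup_{v\in A^a}\bigl(N_{B^a}(v)\{b^a_v\}\cup\{b^a_vc^a_v\}\cup N_{B_k}(a)\{v,c^a_v\}\bigr)\Bigr)$. $\beta(G)$ is the maximum $k$ such that $B_k$ (as an ordinary graph) is isomorphic to an induced subgraph of $G$. A graph class $\mathcal{G}$ is Burling-controlled if there is $f\colon\mathbb{N}\times\mathbb{N}\to\mathbb{N}$ such that for every $G\in\mathcal{G}$, every induced subgraph $H$ of $G$ satisfies $\chi(H)\le f(\omega(H),\beta(H))$. *)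

theory Defs
  imports Main "HOL-Library.Extended_Nat" "HOL-Library.Disjoint_Sets"
begin

section \<open>Finite simple graphs\<close>

record 'v graph =
  verts :: "'v set"
  edges :: "'v set set"

definition simple_graph :: "'v graph \<Rightarrow> bool" where
  "simple_graph G \<longleftrightarrow> finite (verts G) \<and> verts G \<noteq> {} \<and>
     (\<forall>e\<in>edges G. e \<subseteq> verts G \<and> card e = 2)"

definition nbrs :: "('v, 'm) graph_scheme \<Rightarrow> 'v \<Rightarrow> 'v set" where
  "nbrs G v = {u. {u, v} \<in> edges G}"

definition graph_iso :: "'v graph \<Rightarrow> 'w graph \<Rightarrow> bool" where
  "graph_iso G H \<longleftrightarrow> (\<exists>h. bij_betw h (verts G) (verts H) \<and>
     (\<forall>u\<in>verts G. \<forall>v\<in>verts G. {u, v} \<in> edges G \<longleftrightarrow> {h u, h v} \<in> edges H))"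

definition induced :: "'v graph \<Rightarrow> 'v set \<Rightarrow> 'v graph" where
  "induced G S = \<lparr>verts = S, edges = {e \<in> edges G. e \<subseteq> S}\<rparr>"

definition induced_subgraph :: "'v graph \<Rightarrow> 'v graph \<Rightarrow> bool" where
  "induced_subgraph H G \<longleftrightarrow> (\<exists>S. S \<subseteq> verts G \<and> S \<noteq> {} \<and> H = induced G S)"

definition proper_colouring :: "'v graph \<Rightarrow> nat \<Rightarrow> ('v \<Rightarrow> nat) \<Rightarrow> bool" where
  "proper_colouring G k c \<longleftrightarrow> c ` verts G \<subseteq> {1..k} \<and>
     (\<forall>u v. {u, v} \<in> edges G \<longrightarrow> c u \<noteq> c v)"

definition chromatic_number :: "'v graph \<Rightarrow> nat" where
  "chromatic_number G = (LEAST k. \<exists>c. proper_colouring G k c)"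

definition clique :: "'v graph \<Rightarrow> 'v set \<Rightarrow> bool" where
  "clique G K \<longleftrightarrow> K \<subseteq> verts G \<and> (\<forall>u\<in>K. \<forall>v\<in>K. u \<noteq> v \<longrightarrow> {u, v} \<in> edges G)"

definition clique_number :: "'v graph \<Rightarrow> nat" where
  "clique_number G = Max {card K | K. clique G K}"

text \<open>
  A graph class is a set of graphs on natural numbers. Since all graphs are finite and classes
  are closed under isomorphism, nothing is lost by fixing this countably infinite vertex supply.
\<close>

definition graph_class :: "nat graph set \<Rightarrow> bool" where
  "graph_class \<G> \<longleftrightarrow> (\<forall>G\<in>\<G>. simple_graph G) \<and>
     (\<forall>G\<in>\<G>. \<forall>H. simple_graph H \<and> graph_iso G H \<longrightarrow> H \<in> \<G>)"

definition hereditary :: "nat graph set \<Rightarrow> bool" where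
  "hereditary \<G> \<longleftrightarrow> (\<forall>G\<in>\<G>. \<forall>H. induced_subgraph H G \<longrightarrow> H \<in> \<G>)"


section \<open>Asymptotic dimension\<close>

definition path_between :: "'v graph \<Rightarrow> 'v \<Rightarrow> 'v list \<Rightarrow> 'v \<Rightarrow> bool" where
  "path_between G x p y \<longleftrightarrow> p \<noteq> [] \<and> hd p = x \<and> last p = y \<and> set p \<subseteq> verts G \<and> distinct p \<and>
     (\<forall>i. Suc i < length p \<longrightarrow> {p ! i, p ! Suc i} \<in> edges G)"

text \<open>The infimum of the empty set in \<^typ>\<open>enat\<close> is \<open>\<infinity>\<close>, as required for distinct components.\<close>

definition gdist :: "'v graph \<Rightarrow> 'v \<Rightarrow> 'v \<Rightarrow> enat" where
  "gdist G x y = (INF p\<in>{p. path_between G x p y}. enat (length p - 1))"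

definition gdiam :: "'v graph \<Rightarrow> 'v set \<Rightarrow> enat" where
  "gdiam G S = (SUP x\<in>S. SUP y\<in>S. gdist G x y)"

definition disjoint_family_at :: "'v graph \<Rightarrow> nat \<Rightarrow> 'v set set \<Rightarrow> bool" where
  "disjoint_family_at G \<delta> \<U> \<longleftrightarrow>
     (\<forall>X\<in>\<U>. \<forall>Y\<in>\<U>. X \<noteq> Y \<longrightarrow> (INF x\<in>X. INF y\<in>Y. gdist G x y) > enat \<delta>)"

definition multi_disjoint_at :: "'v graph \<Rightarrow> nat \<Rightarrow> nat \<Rightarrow> 'v set set \<Rightarrow> bool" where
  "multi_disjoint_at G k \<delta> \<U> \<longleftrightarrow>
     (\<exists>\<V>. \<U> = (\<Union>i\<in>{1..k}. \<V> i) \<and> (\<forall>i\<in>{1..k}. disjoint_family_at G \<delta> (\<V> i)))"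

definition control_function :: "nat \<Rightarrow> (nat \<Rightarrow> nat) \<Rightarrow> 'v graph \<Rightarrow> bool" where
  "control_function d f G \<longleftrightarrow> (\<forall>\<delta>. f \<delta> \<ge> 1) \<and>
     (\<forall>\<delta>. \<exists>\<P>. partition_on (verts G) \<P> \<and> multi_disjoint_at G (d + 1) \<delta> \<P> \<and>
            (\<forall>S\<in>\<P>. gdiam G S \<le> enat (f \<delta>)))"

definition asdim :: "'v graph set \<Rightarrow> enat" where
  "asdim \<G> = (INF d\<in>{d. \<exists>f. \<forall>G\<in>\<G>. control_function d f G}. enat d)"


section \<open>Burling's sequence\<close>

record 'v marked_graph = "'v graph" +
  marked :: "'v set"

definition nonmarked :: "'v marked_graph \<Rightarrow> 'v set" where
  "nonmarked G = verts G - marked G"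

definition nonmarked_edges :: "'v marked_graph \<Rightarrow> 'v set set" where
  "nonmarked_edges G = {e \<in> edges G. e \<subseteq> nonmarked G}"

text \<open>
  Vertex names that make all copies disjoint and all new vertices new: \<open>Old u\<close> is the vertex \<open>u\<close>
  of \<open>V\<^sub>N(B\<^sub>k)\<close>, \<open>Copy a x\<close> is the vertex of \<open>B\<^sup>a\<close> corresponding to \<open>x\<close>, and
  \<open>NewB a v\<close>, \<open>NewC a v\<close> are the two new vertices attached to the marked vertex \<open>Copy a v\<close> of \<open>B\<^sup>a\<close>.
\<close>

datatype bvert = RootA | RootB | Old bvert | Copy bvert bvert | NewB bvert bvert | NewC bvert bvert

definition burling_step :: "bvert marked_graph \<Rightarrow> bvert marked_graph" where
  "burling_step B = (let A = marked B in
     \<lparr>verts = Old ` nonmarked B \<union>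
        (\<Union>a\<in>A. Copy a ` verts B \<union> (\<Union>v\<in>A. {NewB a v, NewC a v})),
      edges = (`) Old ` nonmarked_edges B \<union>
        (\<Union>a\<in>A. (`) (Copy a) ` edges B \<union>
           (\<Union>v\<in>A. {{Copy a u, NewB a v} | u. u \<in> nbrs B v} \<union>
              {{NewB a v, NewC a v}} \<union>
              {{Old u, y} | u y. u \<in> nbrs B a \<and> y \<in> {Copy a v, NewC a v}})),
      marked = (\<Union>a\<in>A. Copy a ` A \<union> {NewC a v | v. v \<in> A})\<rparr>)"

text \<open>The sequence starts at index 1; the value at 0 is irrelevant.\<close>

fun burling :: "nat \<Rightarrow> bvert marked_graph" where
  "burling 0 = undefined"
| "burling (Suc 0) = \<lparr>verts = {RootA}, edges = {}, marked = {RootA}\<rparr>"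
| "burling (Suc (Suc 0)) = \<lparr>verts = {RootB, RootA}, edges = {{RootB, RootA}}, marked = {RootA}\<rparr>"
| "burling (Suc (Suc (Suc k))) = burling_step (burling (Suc (Suc k)))"

definition contains_burling :: "'v graph \<Rightarrow> nat \<Rightarrow> bool" where
  "contains_burling G k \<longleftrightarrow>
     (\<exists>H. induced_subgraph H G \<and> graph_iso (graph.truncate (burling k)) H)"

definition burling_number :: "'v graph \<Rightarrow> nat" where
  "burling_number G = Max {k. 1 \<le> k \<and> contains_burling G k}"

definition burling_controlled :: "nat graph set \<Rightarrow> bool" where
  "burling_controlled \<G> \<longleftrightarrow>
     (\<exists>f :: nat \<times> nat \<Rightarrow> nat. (\<forall>m\<ge>1. \<forall>n\<ge>1. f (m, n) \<ge> 1) \<and>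
        (\<forall>G\<in>\<G>. \<forall>H. induced_subgraph H G \<longrightarrow>
           chromatic_number H \<le> f (clique_number H, burling_number H)))"


subsection \<open>Well-definedness of the Burling number\<close>

definition is_marked_graph :: "'v marked_graph \<Rightarrow> bool" where
  "is_marked_graph B \<longleftrightarrow> simple_graph (graph.truncate B) \<and> marked B \<subseteq> verts B \<and>
     (\<forall>e\<in>edges B. \<not> e \<subseteq> marked B)"

lemma truncate_sel [simp]:
  "verts (graph.truncate B) = verts B" "edges (graph.truncate B) = edges B"
  by (simp_all add: graph.truncate_def)

lemma is_marked_graph_step:
  assumes B: "is_marked_graph B" and ne: "marked B \<noteq> {}"
  shows "is_marked_graph (burling_step B)"
    and "marked (burling_step B) \<noteq> {}"
    and "card (verts B) < card (verts (burling_step B))"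
proof -
  have fin: "finite (verts B)" "finite (marked B)" "marked B \<subseteq> verts B"
    using B finite_subset unfolding is_marked_graph_def simple_graph_def by auto
  have e: "e \<subseteq> verts B" "card e = 2" "\<not> e \<subseteq> marked B" if "e \<in> edges B" for e
    using B that unfolding is_marked_graph_def simple_graph_def by auto
  have nb: "u \<in> verts B" "v \<in> marked B \<Longrightarrow> u \<in> nonmarked B" if "u \<in> nbrs B v" for u v
    using e[of "{u, v}"] that unfolding nbrs_def nonmarked_def by auto
  have finV: "finite (verts (burling_step B))"
    using fin by (auto simp: burling_step_def Let_def nonmarked_def)
  obtain a where a: "a \<in> marked B" using ne by auto
  show ne': "marked (burling_step B) \<noteq> {}"
    using a by (auto simp: burling_step_def Let_def)
  have "Copy a ` verts B \<union> {NewB a a} \<subseteq> verts (burling_step B)"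
    using a by (auto simp: burling_step_def Let_def)
  then have "card (Copy a ` verts B \<union> {NewB a a}) \<le> card (verts (burling_step B))"
    using finV by (rule card_mono[rotated])
  moreover have "card (Copy a ` verts B \<union> {NewB a a}) = Suc (card (verts B))"
    using fin by (subst card_Un_disjoint) (auto simp: card_image inj_on_def)
  ultimately show "card (verts B) < card (verts (burling_step B))" by simp
  have "e' \<subseteq> verts (burling_step B) \<and> card e' = 2 \<and> \<not> e' \<subseteq> marked (burling_step B)"
    if e': "e' \<in> edges (burling_step B)" for e'
  proof -
    consider (old) e where "e \<in> edges B" "e \<subseteq> nonmarked B" "e' = Old ` e"
      | (copy) a e where "a \<in> marked B" "e \<in> edges B" "e' = Copy a ` e"
      | (b) a v u where "a \<in> marked B" "v \<in> marked B" "u \<in> nbrs B v" "e' = {Copy a u, NewB a v}"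
      | (bc) a v where "a \<in> marked B" "v \<in> marked B" "e' = {NewB a v, NewC a v}"
      | (n) a v u y where "a \<in> marked B" "v \<in> marked B" "u \<in> nbrs B a"
          "e' = {Old u, y}" "y = Copy a v \<or> y = NewC a v"
      using e' unfolding burling_step_def Let_def nonmarked_edges_def graph.simps
      by (elim UnE UN_E imageE CollectE exE conjE singletonE insertE; simp)
    then show ?thesis
    proof cases
      case old
      then have "e \<noteq> {}" "card e' = 2" using e[of e] by (auto simp: card_image inj_on_def)
      then show ?thesis using old by (auto simp: burling_step_def Let_def)
    next
      case copy
      then have "card e' = 2" using e[of e] by (simp add: card_image inj_on_def)
      moreover obtain x where "x \<in> e" "x \<notin> marked B" using copy e[of e] by blast
      ultimately show ?thesis using copy e[of e] by (auto simp: burling_step_def Let_def)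
    next
      case b
      then show ?thesis using nb[of u v] by (auto simp: burling_step_def Let_def)
    next
      case bc
      then show ?thesis by (auto simp: burling_step_def Let_def)
    next
      case n
      then show ?thesis using nb[of u a] fin by (auto simp: burling_step_def Let_def)
    qed
  qed
  moreover have "marked (burling_step B) \<subseteq> verts (burling_step B)"
    using fin by (auto simp: burling_step_def Let_def)
  ultimately show "is_marked_graph (burling_step B)"
    using finV ne' unfolding is_marked_graph_def simple_graph_def by auto
qed

lemma is_marked_graph_burling:
  "is_marked_graph (burling (Suc k)) \<and> marked (burling (Suc k)) \<noteq> {} \<and>
     Suc k \<le> card (verts (burling (Suc k)))"
proof (induction k)
  case (Suc k)
  then show ?case
    by (cases k) (use is_marked_graph_step[of "burling (Suc k)"] in
      \<open>auto simp: is_marked_graph_def simple_graph_def\<close>)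
qed (auto simp: is_marked_graph_def simple_graph_def)

lemma finite_contains_burling:
  assumes "simple_graph G"
  shows "finite {k. 1 \<le> k \<and> contains_burling G k}"
proof (rule finite_subset)
  show "{k. 1 \<le> k \<and> contains_burling G k} \<subseteq> {..card (verts G)}"
  proof clarsimp
    fix k :: nat assume "Suc 0 \<le> k" "contains_burling G k"
    then obtain S h where S: "S \<subseteq> verts G" and "bij_betw h (verts (burling k)) S"
      unfolding contains_burling_def induced_subgraph_def graph_iso_def induced_def by auto
    then have "card (verts (burling k)) = card S" by (simp add: bij_betw_same_card)
    moreover note S
    moreover have "k \<le> card (verts (burling k))"
      using \<open>Suc 0 \<le> k\<close> is_marked_graph_burling[of "k - 1"] by simp
    ultimately show "k \<le> card (verts G)"
      using assms card_mono[of "verts G" S] unfolding simple_graph_def by simp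
  qed
qed simp

lemma contains_burling_1:
  assumes "simple_graph G"
  shows "contains_burling G 1"
proof -
  obtain v where "v \<in> verts G" using assms unfolding simple_graph_def by auto
  moreover have "{v} \<notin> edges G" using assms unfolding simple_graph_def by fastforce
  ultimately show ?thesis
    unfolding contains_burling_def induced_subgraph_def graph_iso_def induced_def
    by (intro exI[of _ "\<lparr>verts = {v}, edges = {e \<in> edges G. e \<subseteq> {v}}\<rparr>"] conjI exI[of _ "{v}"]
        exI[of _ "\<lambda>_. v"]) (auto simp: bij_betw_def)
qed

end

theory Submission
  imports Defs Complex_Main "HOL-Library.Ramsey"
begin

text \<open>
  Finite asymptotic dimension excludes coarse copies of high-dimensional cubes: a colour class of a
  partition into bounded parts contains only few cube edges, because small subsets of a cube span few
  edges. By Ramsey's theorem this excludes large 1-subdivided complete graphs when the clique number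
  is bounded, even if adjacencies among the branch vertices and among the subdivision vertices are
  not controlled.

  The chromatic number is bounded in terms of the chromatic numbers of balls of some fixed radius,
  and the radius can be lowered to 2: if lowering it from \<open>s \<ge> 3\<close> failed, there would be many nested
  spheres of radius \<open>s\<close>, and geodesics to a conflict-free set of vertices of the innermost sphere
  would form a coarse cube. The conflict-free set is obtained by sampling; the required weights exist
  because the set system in question has bounded VC dimension, again by the absence of subdivisions.

  By induction on the clique number, neighbourhoods have bounded chromatic number. A sequence of
  graphs with unbounded chromatic number is replaced by its ultraproduct, where sets of unbounded
  chromatic number are called large. Large sets contain vertices, or more generally cliques of a
  suitable size \<open>j\<close>, with large second neighbourhoods. A longest chain of such cliques, whose length is
  bounded by the absence of subdivisions, leads to a large set in which neighbourhoods in suitable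
  covers are nested. Choosing two cliques one after the other then splits a region in the way in which
  a marked vertex is split in the recursive definition of \<open>B\<^sub>k\<close>, so that every \<open>B\<^sub>k\<close> occurs as an induced
  subgraph.
\<close>

section \<open>Colourings and balls for adjacency relations\<close>

text \<open>\<open>good\<close> asks for the control function on every induced subgraph. This is how
  heredity enters: an obstruction is tested in the subgraph induced by its own vertices, where the
  rest of the graph offers no short cuts, so only the adjacencies among these vertices matter. The
  descent stops at radius 2 because vertices next to two different centres may be adjacent. Then a
  point of the later region has distance at most 2 from the earlier centre, which is excluded only
  when balls of radius at least 2 were removed. Passing to an ultraproduct turns a hierarchy of
  bounds into one ideal: finite unions of small sets and neighbourhoods of vertices are small. The
  price is that covers by stable sets and control of radius 2 are available for internal sets only,
  so internality has to be tracked. Marked vertices of a Burling graph are embedded last. Until then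
  such a vertex is a large region together with a family of covers; any vertex of a cover with a
  neighbour in the region is a candidate, and all candidates have the prescribed neighbours in the
  part embedded so far.\<close>

definition colourable :: "('a \<Rightarrow> 'a \<Rightarrow> bool) \<Rightarrow> 'a set \<Rightarrow> nat \<Rightarrow> bool" where
  "colourable E S k \<longleftrightarrow> (\<exists>c. (\<forall>u\<in>S. c u < k) \<and> (\<forall>u\<in>S. \<forall>v\<in>S. E u v \<longrightarrow> c u \<noteq> c v))"

lemma colourable_mono: "colourable E T k \<Longrightarrow> S \<subseteq> T \<Longrightarrow> k \<le> l \<Longrightarrow> colourable E S l"
  unfolding colourable_def by (elim exE, rule exI) (auto dest: subsetD intro: less_le_trans)

lemma colourable_empty [simp]: "colourable E {} k"
  by (simp add: colourable_def)

lemma colourable_Un: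
  assumes "colourable E S k" "colourable E T l"
  shows "colourable E (S \<union> T) (k + l)"
proof -
  obtain c where c: "\<forall>u\<in>S. c u < k" "\<forall>u\<in>S. \<forall>v\<in>S. E u v \<longrightarrow> c u \<noteq> c v"
    using assms(1) unfolding colourable_def by blast
  obtain d where d: "\<forall>u\<in>T. d u < l" "\<forall>u\<in>T. \<forall>v\<in>T. E u v \<longrightarrow> d u \<noteq> d v"
    using assms(2) unfolding colourable_def by blast
  define e where "e = (\<lambda>u. if u \<in> S then c u else k + d u)"
  have "\<forall>u\<in>S\<union>T. e u < k + l"
    using c(1) d(1) by (auto simp: e_def trans_less_add1)
  moreover have "\<forall>u\<in>S\<union>T. \<forall>v\<in>S\<union>T. E u v \<longrightarrow> e u \<noteq> e v"
    using c(1,2) d(2) by (simp add: e_def) (metis UnE add_left_cancel not_add_less1)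
  ultimately show ?thesis unfolding colourable_def by blast
qed

lemma colourable_UN:
  assumes "finite I" "\<And>i. i \<in> I \<Longrightarrow> colourable E (A i) \<tau>"
  shows "colourable E (\<Union>i\<in>I. A i) (card I * \<tau>)"
  using assms
proof (induction I)
  case (insert i I)
  then have "colourable E (A i \<union> (\<Union>i\<in>I. A i)) (\<tau> + card I * \<tau>)"
    by (intro colourable_Un) auto
  then show ?case using insert by simp
qed simp

text \<open>Walks stay inside \<open>S\<close>, so this is the ball of the subgraph induced by
  \<open>S\<close>; it is empty if the centre is not in \<open>S\<close>.\<close>

primrec gball :: "('a \<Rightarrow> 'a \<Rightarrow> bool) \<Rightarrow> 'a set \<Rightarrow> 'a \<Rightarrow> nat \<Rightarrow> 'a set" where
  "gball E S x 0 = {x} \<inter> S"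
| "gball E S x (Suc n) = gball E S x n \<union> {v\<in>S. \<exists>u\<in>gball E S x n. E u v}"

lemma gball_subset: "gball E S x n \<subseteq> S"
  by (induction n) auto

lemma gball_centre: "x \<in> S \<Longrightarrow> x \<in> gball E S x n"
  by (induction n) auto

lemma gball_mono: "m \<le> n \<Longrightarrow> gball E S x m \<subseteq> gball E S x n"
  by (induction n) (auto simp: le_Suc_eq)

lemma gball_step: "y \<in> gball E S x n \<Longrightarrow> E y z \<Longrightarrow> z \<in> S \<Longrightarrow> z \<in> gball E S x (Suc n)"
  by auto

lemma gball_trans:
  "y \<in> gball E S x i \<Longrightarrow> z \<in> gball E S y j \<Longrightarrow> z \<in> gball E S x (i + j)"
  by (induction j arbitrary: z) auto

lemma gball_sym:
  assumes "symp E" "y \<in> gball E S x n"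
  shows "x \<in> gball E S y n"
  using assms(2)
proof (induction n arbitrary: y)
  case (Suc n)
  show ?case
  proof (cases "y \<in> gball E S x n")
    case True
    then show ?thesis using Suc.IH[OF True] by simp
  next
    case False
    then obtain u where u: "u \<in> gball E S x n" "E u y" "y \<in> S" using Suc.prems by auto
    have "u \<in> gball E S y 1"
      using u assms(1) gball_subset[of E S x n] by (auto dest: sympD)
    from gball_trans[OF this Suc.IH[OF u(1)]] show ?thesis by simp
  qed
qed auto

lemma gball_path:
  assumes "y \<in> gball E S x n"
  obtains p m where "m \<le> n" "p 0 = x" "p m = y" "\<forall>h\<le>m. p h \<in> S" "\<forall>h<m. E (p h) (p (Suc h))"
proof -
  have "\<exists>p m. m \<le> n \<and> p 0 = x \<and> p m = y \<and> (\<forall>h\<le>m. p h \<in> S) \<and> (\<forall>h<m. E (p h) (p (Suc h)))"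
    using assms
  proof (induction n arbitrary: y)
    case 0
    then show ?case by (intro exI[of _ "\<lambda>_. x"] exI[of _ 0]) auto
  next
    case (Suc n)
    show ?case
    proof (cases "y \<in> gball E S x n")
      case True
      then show ?thesis using Suc.IH le_SucI by meson
    next
      case False
      then obtain u where u: "u \<in> gball E S x n" "E u y" "y \<in> S" using Suc.prems by auto
      then obtain p m where p: "m \<le> n" "p 0 = x" "p m = u" "\<forall>h\<le>m. p h \<in> S"
        "\<forall>h<m. E (p h) (p (Suc h))" using Suc.IH by blast
      show ?thesis
        by (intro exI[of _ "p(Suc m := y)"] exI[of _ "Suc m"])
          (use p u in \<open>auto simp: le_Suc_eq less_Suc_eq\<close>)
    qed
  qed
  then show ?thesis using that by blast
qed

lemma path_gball:
  assumes "\<forall>h. i \<le> h \<and> h \<le> j \<longrightarrow> p h \<in> S" "\<forall>h. i \<le> h \<and> h < j \<longrightarrow> E (p h) (p (Suc h))" "i \<le> j"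
  shows "p j \<in> gball E S (p i) (j - i)"
  using assms(3,1,2)
proof (induction j rule: dec_induct)
  case (step n)
  then have "p n \<in> gball E S (p i) (n - i)" "E (p n) (p (Suc n))" "p (Suc n) \<in> S" by auto
  then show ?case using step(1) by (auto simp: Suc_diff_le)
qed auto


section \<open>Coarse cubes\<close>

text \<open>The Hamming distance of the cube whose vertices are the subsets of
  \<open>{..<D}\<close>.\<close>

definition sdist :: "'a set \<Rightarrow> 'a set \<Rightarrow> nat" where
  "sdist A B = card ((A - B) \<union> (B - A))"

lemma sdist_triangle:
  assumes "finite A" "finite B" "finite C"
  shows "sdist A C \<le> sdist A B + sdist B C"
proof -
  have "card ((A - C) \<union> (C - A)) \<le> card (((A - B) \<union> (B - A)) \<union> ((B - C) \<union> (C - B)))"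
    using assms by (intro card_mono) auto
  then show ?thesis unfolding sdist_def using card_Un_le le_trans by blast
qed

lemma sdist_sym: "sdist A B = sdist B A"
  by (simp add: sdist_def Un_commute)

lemma sdist_same [simp]: "sdist A A = 0"
  by (simp add: sdist_def)

lemma sdist_insert: "sdist A (insert i A) \<le> 1" "sdist (insert i A) A \<le> 1"
proof -
  have "(A - insert i A) \<union> (insert i A - A) \<subseteq> {i}" by auto
  from card_mono[OF _ this] show "sdist A (insert i A) \<le> 1" by (simp add: sdist_def)
  then show "sdist (insert i A) A \<le> 1" by (simp add: sdist_sym)
qed

text \<open>The edge between \<open>A\<close> and \<open>A \<union> {i}\<close> is encoded as the pair \<open>(A, i)\<close> with \<open>i \<notin> A\<close>.\<close>

definition cube_edges :: "nat \<Rightarrow> (nat set \<times> nat) set" where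
  "cube_edges D = {(A, i). i < D \<and> A \<subseteq> {..<D} - {i}}"

definition ends :: "nat set \<times> nat \<Rightarrow> nat set set" where
  "ends e = {fst e, insert (snd e) (fst e)}"

lemma fst_in_ends: "fst e \<in> ends e"
  by (simp add: ends_def)

lemma sdist_ends: "A \<in> ends e \<Longrightarrow> B \<in> ends e \<Longrightarrow> sdist A B \<le> 1"
  using sdist_insert[where A = "fst e" and i = "snd e"]
  unfolding ends_def by auto

lemma ends_subset: "e \<in> cube_edges D \<Longrightarrow> A \<in> ends e \<Longrightarrow> A \<subseteq> {..<D}"
  by (auto simp: cube_edges_def ends_def)

lemma finite_cube_edges [simp]: "finite (cube_edges D)"
  by (rule finite_subset[of _ "Pow {..<D} \<times> {..<D}"]) (auto simp: cube_edges_def)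

lemma card_cube_edges: "2 * card (cube_edges D) = D * 2 ^ D"
proof -
  have "cube_edges D = (\<lambda>(i, A). (A, i)) ` (SIGMA i:{..<D}. Pow ({..<D} - {i}))"
    by (auto simp: cube_edges_def image_def)
  moreover have "inj_on (\<lambda>(i, A). (A, i)) (SIGMA i:{..<D}. Pow ({..<D} - {i}))"
    by (auto simp: inj_on_def)
  ultimately have "card (cube_edges D) = card (SIGMA i:{..<D}. Pow ({..<D} - {i}))"
    by (simp add: card_image)
  also have "\<dots> = (\<Sum>i<D. 2 ^ (D - 1))"
    by (subst card_SigmaI) (auto simp: card_Pow)
  finally show ?thesis by (cases D) auto
qed

text \<open>The cube of the next dimension is two copies of the cube joined by a perfect matching; the
  part of the matching inside \<open>X\<close> is bounded by the smaller half of \<open>X\<close>.\<close>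

lemma cube_edges_inside_le:
  assumes "X \<subseteq> Pow {..<D}" "card X < 2 ^ m"
  shows "card {e \<in> cube_edges D. ends e \<subseteq> X} \<le> m * card X"
  using assms
proof (induction D arbitrary: X m)
  case 0
  have "{e \<in> cube_edges 0. ends e \<subseteq> X} = {}" by (auto simp: cube_edges_def)
  then show ?case by (simp only: card.empty le0)
next
  case (Suc D)
  define X0 where "X0 = {A \<in> X. D \<notin> A}"
  define X1 where "X1 = (\<lambda>A. A - {D}) ` {A \<in> X. D \<in> A}"
  have finX: "finite X" using Suc.prems(1) finite_subset by fastforce
  have XD: "x < Suc D" if "A \<in> X" "x \<in> A" for A x
    using Suc.prems(1) that by auto
  then have XD': "x < D" if "A \<in> X" "x \<in> A" "x \<noteq> D" for A x
    using that less_SucE by metis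
  have sub: "X0 \<subseteq> Pow {..<D}" "X1 \<subseteq> Pow {..<D}"
    using XD' by (auto simp: X0_def X1_def)
  have fin: "finite X0" "finite X1" using finX by (auto simp: X0_def X1_def)
  have cX1: "card X1 = card {A \<in> X. D \<in> A}"
    unfolding X1_def by (rule card_image) (auto simp: inj_on_def)
  have "X = X0 \<union> {A \<in> X. D \<in> A}" by (auto simp: X0_def)
  then have cX: "card X = card X0 + card X1"
    using finX cX1 card_Un_disjoint[of X0 "{A \<in> X. D \<in> A}"] fin by (auto simp: X0_def)
  define F where "F = (\<lambda>Y. {e \<in> cube_edges D. ends e \<subseteq> Y})"
  have finF: "finite (F Y)" for Y by (simp add: F_def)
  have cover: "{e \<in> cube_edges (Suc D). ends e \<subseteq> X}
      \<subseteq> F X0 \<union> (\<lambda>(A, i). (insert D A, i)) ` F X1 \<union> (\<lambda>A. (A, D)) ` (X0 \<inter> X1)"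
  proof
    fix e assume e: "e \<in> {e \<in> cube_edges (Suc D). ends e \<subseteq> X}"
    obtain A i where Ai: "e = (A, i)" by fastforce
    have i: "i < Suc D" "A \<subseteq> {..<Suc D} - {i}" "A \<in> X" "insert i A \<in> X"
      using e Ai by (auto simp: cube_edges_def ends_def)
    consider "i = D" | "i \<noteq> D" "D \<notin> A" | "i \<noteq> D" "D \<in> A" by blast
    then show "e \<in> F X0 \<union> (\<lambda>(A, i). (insert D A, i)) ` F X1 \<union> (\<lambda>A. (A, D)) ` (X0 \<inter> X1)"
    proof cases
      case 1
      then have "A = insert i A - {D}" using i by auto
      then have "A \<in> X0 \<inter> X1" using 1 i unfolding X0_def X1_def by blast
      then show ?thesis using Ai 1 by auto
    next
      case 2
      then have "(A, i) \<in> F X0"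
        using i by (auto simp: F_def X0_def cube_edges_def ends_def less_Suc_eq)
      then show ?thesis using Ai by auto
    next
      case 3
      have "(A - {D}, i) \<in> cube_edges D" using 3 i by (auto simp: cube_edges_def less_Suc_eq)
      moreover have "A - {D} \<in> X1" using 3 i unfolding X1_def by blast
      moreover have "insert i A - {D} \<in> X1" using 3 i unfolding X1_def by blast
      moreover have "insert i (A - {D}) = insert i A - {D}" using 3 by auto
      ultimately have "(A - {D}, i) \<in> F X1" by (auto simp: F_def ends_def)
      moreover have "e = (insert D (A - {D}), i)" using Ai 3 by auto
      ultimately show ?thesis by (auto simp: image_iff split: prod.splits)
    qed
  qed
  have bound: "card {e \<in> cube_edges (Suc D). ends e \<subseteq> X} \<le> card (F X0) + card (F X1) + card (X0 \<inter> X1)"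
  proof -
    have "card {e \<in> cube_edges (Suc D). ends e \<subseteq> X} \<le>
        card (F X0 \<union> (\<lambda>(A, i). (insert D A, i)) ` F X1 \<union> (\<lambda>A. (A, D)) ` (X0 \<inter> X1))"
      using cover fin finF by (intro card_mono) auto
    also have "\<dots> \<le> card (F X0) + card ((\<lambda>(A, i). (insert D A, i)) ` F X1) + card ((\<lambda>A. (A, D)) ` (X0 \<inter> X1))"
      by (meson add_le_mono card_Un_le le_refl le_trans)
    also have "\<dots> \<le> card (F X0) + card (F X1) + card (X0 \<inter> X1)"
      using finF fin by (intro add_mono card_image_le) auto
    finally show ?thesis .
  qed
  \<comment> \<open>The halves are symmetric, so let \<open>Y0\<close> be the smaller one. It has
    fewer than \<open>2 ^ (m - 1)\<close> elements, so its constant drops by one, and the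
    \<open>card Y0\<close> saved pays for the matching edges.\<close>
  have half: "card (F Y0) + card (F Y1) + card (X0 \<inter> X1) \<le> m * card X"
    if Y: "Y0 \<subseteq> Pow {..<D}" "Y1 \<subseteq> Pow {..<D}" "card Y0 \<le> card Y1" "card Y0 + card Y1 = card X"
      "card (X0 \<inter> X1) \<le> card Y0" for Y0 Y1
  proof (cases "card X = 0")
    case True
    have "card (F Y0) \<le> m * card Y0" "card (F Y1) \<le> m * card Y1"
      using Suc.IH[OF Y(1), of m] Suc.IH[OF Y(2), of m] Suc.prems Y(3,4) F_def by auto
    then show ?thesis using True Y by simp
  next
    case False
    then obtain k where m: "m = Suc k" using Suc.prems(2) by (cases m) auto
    then have "card Y0 < 2 ^ k" using Suc.prems(2) Y by simp
    then have "card (F Y0) \<le> k * card Y0" using Suc.IH[OF Y(1)] F_def by simp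
    moreover have "card (F Y1) \<le> m * card Y1"
      using Suc.IH[OF Y(2), of m] Suc.prems(2) Y F_def by simp
    moreover have "m * card X = k * card Y0 + card Y0 + m * card Y1"
      unfolding Y(4)[symmetric] m by (simp add: algebra_simps)
    ultimately show ?thesis using Y(5) by linarith
  qed
  have "card (X0 \<inter> X1) \<le> card X0" "card (X0 \<inter> X1) \<le> card X1"
    using fin by (auto intro: card_mono)
  then have "card (F X0) + card (F X1) + card (X0 \<inter> X1) \<le> m * card X"
    using half[of X0 X1] half[of X1 X0] sub cX by (cases "card X0 \<le> card X1") auto
  then show ?case using bound by linarith
qed

text \<open>A set of at most \<open>r\<close> elements arises by \<open>r\<close> insertions; the
  additional index \<open>D\<close> stands for inserting nothing, which explains the base
  \<open>D + 1\<close>.\<close>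

lemma card_small_subsets_le:
  "card {B. B \<subseteq> {..<D} \<and> card B \<le> r} \<le> (D + 1) ^ r"
proof (induction r)
  case 0
  have "{B. B \<subseteq> {..<D} \<and> card B \<le> 0} \<subseteq> {{}}"
    by (auto dest: finite_subset)
  from card_mono[OF _ this] show ?case by simp
next
  case (Suc r)
  let ?g = "\<lambda>(x, B). if x < D then insert x B else B"
  let ?P = "\<lambda>r. {B. B \<subseteq> {..<D} \<and> card B \<le> r}"
  have finP: "finite (?P r)" by (rule finite_subset[of _ "Pow {..<D}"]) auto
  have "?P (Suc r) \<subseteq> ?g ` ({..D} \<times> ?P r)"
  proof
    fix B assume B: "B \<in> ?P (Suc r)"
    show "B \<in> ?g ` ({..D} \<times> ?P r)"
    proof (cases "B = {}")
      case True
      then show ?thesis by (intro image_eqI[of _ _ "(D, {})"]) auto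
    next
      case False
      then obtain x where x: "x \<in> B" by blast
      then show ?thesis using B finite_subset[of B "{..<D}"]
        by (intro image_eqI[of _ _ "(x, B - {x})"]) (auto simp: insert_absorb)
    qed
  qed
  then have "card (?P (Suc r)) \<le> card (?g ` ({..D} \<times> ?P r))"
    using finP by (intro card_mono) auto
  also have "\<dots> \<le> card ({..D} \<times> ?P r)" using finP by (intro card_image_le) auto
  also have "\<dots> = (D + 1) * card (?P r)" by (simp add: card_cartesian_product)
  also have "\<dots> \<le> (D + 1) * (D + 1) ^ r" using Suc by (rule mult_le_mono2)
  finally show ?case by simp
qed

text \<open>Symmetric difference with \<open>A0\<close> is an isometry of the cube that moves the
  centre to the empty set.\<close>

lemma card_sdist_ball_le:
  assumes "A0 \<subseteq> {..<D}"
  shows "card {A. A \<subseteq> {..<D} \<and> sdist A A0 \<le> r} \<le> (D + 1) ^ r"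
proof -
  let ?g = "\<lambda>B. (A0 - B) \<union> (B - A0)"
  have fin: "finite {B. B \<subseteq> {..<D} \<and> card B \<le> r}"
    by (rule finite_subset[of _ "Pow {..<D}"]) auto
  have "{A. A \<subseteq> {..<D} \<and> sdist A A0 \<le> r} \<subseteq> ?g ` {B. B \<subseteq> {..<D} \<and> card B \<le> r}"
  proof
    fix A assume "A \<in> {A. A \<subseteq> {..<D} \<and> sdist A A0 \<le> r}"
    then show "A \<in> ?g ` {B. B \<subseteq> {..<D} \<and> card B \<le> r}"
      using assms by (intro image_eqI[of _ _ "(A - A0) \<union> (A0 - A)"]) (auto simp: sdist_def)
  qed
  then have "card {A. A \<subseteq> {..<D} \<and> sdist A A0 \<le> r} \<le> card (?g ` {B. B \<subseteq> {..<D} \<and> card B \<le> r})"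
    using fin by (intro card_mono) auto
  also have "\<dots> \<le> card {B. B \<subseteq> {..<D} \<and> card B \<le> r}" using fin by (rule card_image_le)
  finally show ?thesis using card_small_subsets_le le_trans by blast
qed

text \<open>A control function for \<open>S\<close>, with the partition given by a labelling \<open>p\<close> of its parts.\<close>

definition tame :: "nat \<Rightarrow> (nat \<Rightarrow> nat) \<Rightarrow> ('a \<Rightarrow> 'a \<Rightarrow> bool) \<Rightarrow> 'a set \<Rightarrow> bool" where
  "tame d f E S \<longleftrightarrow> (\<forall>\<delta>. \<exists>(p :: 'a \<Rightarrow> 'a set) c. (\<forall>u\<in>S. c u \<le> d) \<and>
     (\<forall>u\<in>S. \<forall>v\<in>S. p u = p v \<longrightarrow> v \<in> gball E S u (f \<delta>)) \<and>
     (\<forall>u\<in>S. \<forall>v\<in>S. c u = c v \<and> v \<in> gball E S u \<delta> \<longrightarrow> p u = p v))"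

text \<open>\<open>pos\<close> locates vertices in the cube and is a relation, since a vertex may
  belong to several cube vertices. Adjacent vertices are at most one cube step apart, which bounds
  distances in \<open>S\<close> from below; the last clause bounds the distance between the
  representatives \<open>\<rho> e\<close> of incident cube edges from above.\<close>

definition coarse_cube ::
  "nat \<Rightarrow> nat \<Rightarrow> ('a \<Rightarrow> 'a \<Rightarrow> bool) \<Rightarrow> 'a set \<Rightarrow> (nat set \<times> nat \<Rightarrow> 'a) \<Rightarrow> ('a \<Rightarrow> nat set \<Rightarrow> bool) \<Rightarrow> bool" where
  "coarse_cube D \<delta> E S \<rho> pos \<longleftrightarrow>
     (\<forall>u\<in>S. \<exists>A. pos u A) \<and> (\<forall>u\<in>S. \<forall>A. pos u A \<longrightarrow> A \<subseteq> {..<D}) \<and>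
     (\<forall>u\<in>S. \<forall>v\<in>S. \<forall>A B. pos u A \<and> pos v B \<and> (u = v \<or> E u v) \<longrightarrow> sdist A B \<le> 1) \<and>
     (\<forall>e\<in>cube_edges D. \<rho> e \<in> S \<and> (\<forall>A. pos (\<rho> e) A \<longrightarrow> A \<in> ends e)) \<and>
     (\<forall>e\<in>cube_edges D. \<forall>e'\<in>cube_edges D. ends e \<inter> ends e' \<noteq> {} \<longrightarrow> \<rho> e' \<in> gball E S (\<rho> e) \<delta>)"

text \<open>Choosing \<open>D + 1 = 2 ^ (2 * u)\<close> turns the first inequality into
  \<open>2 * u * r < m\<close>, so \<open>m\<close> is linear in \<open>u\<close> while
  \<open>D\<close> is exponential.\<close>

lemma exists_dimension: "\<exists>D m. (D + 1) ^ r < 2 ^ m \<and> a * m < (D::nat)"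
proof -
  define u where "u = 2 * (a * (r + 1)) + r + 1"
  have "a * (2 * u * r + 1) \<le> a * ((r + 1) * (2 * u))"
    unfolding u_def by (intro mult_le_mono2) (simp add: algebra_simps)
  also have "\<dots> \<le> u * u" unfolding u_def by (simp add: algebra_simps)
  also have "\<dots> < (u + 1) * (u + 1) - 1" by (simp add: u_def)
  also have "\<dots> \<le> 2 ^ u * 2 ^ u - 1"
    using less_exp[of u] by (intro diff_le_mono mult_le_mono) (auto simp: Suc_le_eq)
  also have "\<dots> = 2 ^ (2 * u) - 1" by (simp add: mult_2 power_add)
  finally have "a * (2 * u * r + 1) < 2 ^ (2 * u) - 1" .
  moreover have "((2 ^ (2 * u) - 1) + 1) ^ r < (2::nat) ^ (2 * u * r + 1)"
    by (simp add: power_mult[symmetric])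
  ultimately show ?thesis by blast
qed

text \<open>Label each cube edge by the colour and the part of its representative. Edges with one
  label touch cube vertices inside a Hamming ball of radius \<open>f \<delta> + 2\<close>, hence
  fewer than \<open>2 ^ m\<close> of them. For a fixed colour these vertex sets are disjoint, since
  representatives of edges with a common end are \<open>\<delta>\<close>-close and so lie in one
  part. Thus one colour has at most \<open>m * 2 ^ D\<close> edges, and \<open>d + 1\<close> colours
  are too few for all \<open>D * 2 ^ (D - 1)\<close> edges.\<close>

lemma no_coarse_cube:
  "\<exists>D. \<forall>E (S::'a set) \<rho> pos. tame d f E S \<longrightarrow> \<not> coarse_cube D \<delta> E S \<rho> pos"
proof -
  obtain D m where Dm: "(D + 1) ^ (f \<delta> + 2) < 2 ^ m" "(2 * (d + 1)) * m < D"
    using exists_dimension by blast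
  have False if tame: "tame d f E S" and cube: "coarse_cube D \<delta> E S \<rho> pos"
    for E and S :: "'a set" and \<rho> pos
  proof -
    obtain p :: "'a \<Rightarrow> 'a set" and c where pc: "(\<forall>u\<in>S. c u \<le> d) \<and>
        (\<forall>u\<in>S. \<forall>v\<in>S. p u = p v \<longrightarrow> v \<in> gball E S u (f \<delta>)) \<and>
        (\<forall>u\<in>S. \<forall>v\<in>S. c u = c v \<and> v \<in> gball E S u \<delta> \<longrightarrow> p u = p v)"
      using spec[OF tame[unfolded tame_def], of \<delta>] by (elim exE)
    have c: "\<forall>u\<in>S. c u \<le> d"
      and p1: "\<And>u v. u \<in> S \<Longrightarrow> v \<in> S \<Longrightarrow> p u = p v \<Longrightarrow> v \<in> gball E S u (f \<delta>)"
      and p2: "\<And>u v. u \<in> S \<Longrightarrow> v \<in> S \<Longrightarrow> c u = c v \<Longrightarrow> v \<in> gball E S u \<delta> \<Longrightarrow> p u = p v"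
      using pc by blast+
    have posE: "\<exists>A. pos u A" if "u \<in> S" for u
      using cube that unfolding coarse_cube_def by blast
    have posS: "A \<subseteq> {..<D}" if "u \<in> S" "pos u A" for u A
      using cube that unfolding coarse_cube_def by blast
    have near: "sdist A B \<le> 1" if "u \<in> S" "v \<in> S" "pos u A" "pos v B" "u = v \<or> E u v" for u v A B
      using cube that unfolding coarse_cube_def by blast
    have \<rho>S: "\<rho> e \<in> S" if "e \<in> cube_edges D" for e
      using cube that unfolding coarse_cube_def by blast
    have \<rho>pos: "A \<in> ends e" if "e \<in> cube_edges D" "pos (\<rho> e) A" for e A
      using cube that unfolding coarse_cube_def by blast
    have \<rho>ball: "\<rho> e' \<in> gball E S (\<rho> e) \<delta>"
      if "e \<in> cube_edges D" "e' \<in> cube_edges D" "ends e \<inter> ends e' \<noteq> {}" for e e'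
      using cube that unfolding coarse_cube_def by blast
    define P where "P = (\<lambda>u. SOME A. pos u A)"
    have P: "pos u (P u)" if "u \<in> S" for u unfolding P_def using posE[OF that] by (rule someI_ex)
    have Pfin: "finite (P u)" if "u \<in> S" for u
      using posS[OF that P[OF that]] finite_subset by blast
    have Pball: "sdist (P v) (P u) \<le> n" if "v \<in> gball E S u n" for u v n
      using that
    proof (induction n arbitrary: v)
      case (Suc n)
      show ?case
      proof (cases "v \<in> gball E S u n")
        case True
        then show ?thesis using Suc.IH by fastforce
      next
        case False
        then obtain z where z: "z \<in> gball E S u n" "E z v" "v \<in> S" using Suc.prems by auto
        have zS: "z \<in> S" using z gball_subset[of E S u n] by auto
        have uS: "u \<in> S"
        proof (rule ccontr)
          assume "u \<notin> S"
          then have "gball E S u n = {}" for n by (induction n) auto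
          then show False using z by simp
        qed
        have "sdist (P z) (P v) \<le> 1" using near P zS z by blast
        then have "sdist (P v) (P z) \<le> 1" by (simp add: sdist_sym)
        moreover have "sdist (P z) (P u) \<le> n" using Suc.IH z by blast
        moreover have "sdist (P v) (P u) \<le> sdist (P v) (P z) + sdist (P z) (P u)"
          using Pfin zS z uS by (intro sdist_triangle) auto
        ultimately show ?thesis by linarith
      qed
    qed auto
    define edg where "edg = (\<lambda>i q. {e \<in> cube_edges D. c (\<rho> e) = i \<and> p (\<rho> e) = q})"
    define X where "X = (\<lambda>i q. \<Union>e\<in>edg i q. ends e)"
    define Q where "Q = (\<lambda>i. (\<lambda>e. p (\<rho> e)) ` {e \<in> cube_edges D. c (\<rho> e) = i})"
    have finQ: "finite (Q i)" for i by (simp add: Q_def)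
    have XD: "X i q \<subseteq> Pow {..<D}" for i q
      unfolding X_def edg_def using ends_subset by blast
    then have finX: "finite (X i q)" for i q by (rule finite_subset) simp
    have cardX: "card (X i q) < 2 ^ m" for i q
    proof (cases "edg i q = {}")
      case True
      then show ?thesis by (simp add: X_def)
    next
      case False
      then obtain e0 where e0: "e0 \<in> edg i q" by blast
      then have r0: "\<rho> e0 \<in> S" using \<rho>S by (auto simp: edg_def)
      have "X i q \<subseteq> {A. A \<subseteq> {..<D} \<and> sdist A (P (\<rho> e0)) \<le> f \<delta> + 2}"
      proof
        fix A assume "A \<in> X i q"
        then obtain e where e: "e \<in> edg i q" "A \<in> ends e" by (auto simp: X_def)
        then have eD: "e \<in> cube_edges D" by (simp add: edg_def)
        have rS: "\<rho> e \<in> S" using eD \<rho>S by blast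
        have AD: "A \<subseteq> {..<D}" using ends_subset eD e by blast
        have "\<rho> e \<in> gball E S (\<rho> e0) (f \<delta>)" using p1 r0 rS e e0 by (auto simp: edg_def)
        then have "sdist (P (\<rho> e)) (P (\<rho> e0)) \<le> f \<delta>" by (rule Pball)
        moreover have "sdist A (P (\<rho> e)) \<le> 1"
          using \<rho>pos[OF eD P[OF rS]] e(2) by (rule sdist_ends[rotated])
        moreover have "sdist A (P (\<rho> e0)) \<le> sdist A (P (\<rho> e)) + sdist (P (\<rho> e)) (P (\<rho> e0))"
          using Pfin rS r0 AD finite_subset by (intro sdist_triangle) auto
        ultimately show "A \<in> {A. A \<subseteq> {..<D} \<and> sdist A (P (\<rho> e0)) \<le> f \<delta> + 2}" using AD by auto
      qed
      then have "card (X i q) \<le> card {A. A \<subseteq> {..<D} \<and> sdist A (P (\<rho> e0)) \<le> f \<delta> + 2}"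
        by (intro card_mono) (auto intro: finite_subset[of _ "Pow {..<D}"])
      also have "\<dots> \<le> (D + 1) ^ (f \<delta> + 2)"
        using posS[OF r0 P[OF r0]] by (rule card_sdist_ball_le)
      finally show ?thesis using Dm by linarith
    qed
    have edgX: "card (edg i q) \<le> m * card (X i q)" for i q
    proof -
      have "edg i q \<subseteq> {e \<in> cube_edges D. ends e \<subseteq> X i q}" by (auto simp: edg_def X_def)
      then have "card (edg i q) \<le> card {e \<in> cube_edges D. ends e \<subseteq> X i q}"
        by (intro card_mono) auto
      then show ?thesis using cube_edges_inside_le[OF XD cardX] le_trans by blast
    qed
    have disj: "X i q \<inter> X i q' = {}" if "q \<noteq> q'" for i q q'
    proof (rule ccontr)
      assume "X i q \<inter> X i q' \<noteq> {}"
      then obtain x where x: "x \<in> X i q" "x \<in> X i q'" by blast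
      obtain e where e: "e \<in> edg i q" "x \<in> ends e" using x(1) unfolding X_def by (elim UN_E)
      obtain e' where e': "e' \<in> edg i q'" "x \<in> ends e'" using x(2) unfolding X_def by (elim UN_E)
      have ee: "e \<in> edg i q" "e' \<in> edg i q'" "ends e \<inter> ends e' \<noteq> {}"
        using e e' by blast+
      have eD: "e \<in> cube_edges D" "e' \<in> cube_edges D" "c (\<rho> e) = c (\<rho> e')"
        using ee by (simp_all add: edg_def)
      have "p (\<rho> e) = p (\<rho> e')"
        by (rule p2) (use eD \<rho>S \<rho>ball ee(3) in blast)+
      then show False using ee that by (simp add: edg_def)
    qed
    have perc: "(\<Sum>q\<in>Q i. card (edg i q)) \<le> m * 2 ^ D" for i
    proof -
      have "(\<Sum>q\<in>Q i. card (edg i q)) \<le> (\<Sum>q\<in>Q i. m * card (X i q))" by (intro sum_mono edgX)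
      also have "\<dots> = m * (\<Sum>q\<in>Q i. card (X i q))" by (simp add: sum_distrib_left)
      also have "(\<Sum>q\<in>Q i. card (X i q)) = card (\<Union>q\<in>Q i. X i q)"
        using finX finQ disj by (subst card_UN_disjoint) auto
      also have "\<dots> \<le> card (Pow {..<D})" using XD by (intro card_mono) auto
      finally show ?thesis by (simp add: card_Pow)
    qed
    have "cube_edges D = (\<Union>i\<in>{..d}. \<Union>q\<in>Q i. edg i q)"
      using c \<rho>S by (auto simp: edg_def Q_def)
    then have "card (cube_edges D) \<le> (\<Sum>i\<le>d. card (\<Union>q\<in>Q i. edg i q))"
      using card_UN_le[of "{..d}" "\<lambda>i. \<Union>q\<in>Q i. edg i q"] by simp
    also have "\<dots> \<le> (\<Sum>i\<le>d. \<Sum>q\<in>Q i. card (edg i q))"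
      using finQ by (intro sum_mono card_UN_le)
    also have "\<dots> \<le> (\<Sum>i\<le>d. m * 2 ^ D)" by (intro sum_mono perc)
    finally have "card (cube_edges D) \<le> (d + 1) * m * 2 ^ D" by (simp add: algebra_simps)
    then have "D * 2 ^ D \<le> 2 * ((d + 1) * m * 2 ^ D)" using card_cube_edges[of D] by linarith
    then have "D * 2 ^ D \<le> (2 * (d + 1) * m) * 2 ^ D" by (simp add: algebra_simps)
    then have "D \<le> 2 * (d + 1) * m" by (subst (asm) mult_le_cancel2) simp
    then show False using Dm(2) by linarith
  qed
  then show ?thesis by blast
qed


section \<open>Ramsey's theorem and subdivided cubes\<close>

definition complete_set :: "('a \<Rightarrow> 'a \<Rightarrow> bool) \<Rightarrow> 'a set \<Rightarrow> bool" where
  "complete_set E K \<longleftrightarrow> (\<forall>u\<in>K. \<forall>v\<in>K. u \<noteq> v \<longrightarrow> E u v)"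

definition good :: "nat \<Rightarrow> nat \<Rightarrow> (nat \<Rightarrow> nat) \<Rightarrow> ('a \<Rightarrow> 'a \<Rightarrow> bool) \<Rightarrow> 'a set \<Rightarrow> bool" where
  "good \<omega> d f E V \<longleftrightarrow> finite V \<and> symp E \<and> irreflp E \<and> (\<forall>S\<subseteq>V. tame d f E S) \<and>
     (\<forall>K\<subseteq>V. complete_set E K \<longrightarrow> card K \<le> \<omega>)"

lemma good_subset: "good \<omega> d f E V \<Longrightarrow> S \<subseteq> V \<Longrightarrow> good \<omega> d f E S"
  unfolding good_def by (auto intro: finite_subset)

text \<open>This refutes each type of homogeneous adjacency that Ramsey's theorem may return; the
  vertices \<open>z k\<close> are distinct by irreflexivity.\<close>

lemma good_no_long_clique:
  assumes "good \<omega> d f E V" "\<omega> < m" "\<And>k. k < m \<Longrightarrow> z k \<in> V"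
    and adj: "\<And>k l. k < l \<Longrightarrow> l < m \<Longrightarrow> E (z k) (z l)"
  shows False
proof -
  have sym: "symp E" and irr: "irreflp E" using assms(1) by (auto simp: good_def)
  have ne: "E (z k) (z l)" if "k \<noteq> l" "k < m" "l < m" for k l
    using that adj sym by (cases k l rule: linorder_cases) (auto dest: sympD)
  then have "z k \<noteq> z l" if "k \<noteq> l" "k < m" "l < m" for k l
    using that irr unfolding irreflp_def by metis
  then have "inj_on z {..<m}" unfolding inj_on_def by blast
  then have "card (z ` {..<m}) = m" by (simp add: card_image)
  moreover have "complete_set E (z ` {..<m})" unfolding complete_set_def by (auto intro!: ne)
  moreover have "z ` {..<m} \<subseteq> V" using assms(3) by auto
  ultimately have "m \<le> \<omega>" using assms(1) unfolding good_def by metis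
  then show False using assms(2) by simp
qed

text \<open>\<open>y i j\<close> subdivides the edge \<open>ij\<close> of a complete graph on the \<open>w i\<close>; adjacencies among the
  \<open>w i\<close> and among the \<open>y i j\<close> are not restricted.\<close>

definition pattern :: "('a \<Rightarrow> 'a \<Rightarrow> bool) \<Rightarrow> 'a set \<Rightarrow> nat set \<Rightarrow> (nat \<Rightarrow> 'a) \<Rightarrow> (nat \<Rightarrow> nat \<Rightarrow> 'a) \<Rightarrow> bool" where
  "pattern E S I w y \<longleftrightarrow> (\<forall>i\<in>I. w i \<in> S) \<and>
     (\<forall>i\<in>I. \<forall>j\<in>I. i < j \<longrightarrow> y i j \<in> S \<and>
        (\<forall>l\<in>I. (y i j = w l \<or> E (y i j) (w l)) \<longleftrightarrow> l = i \<or> l = j))"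

lemma ramsey_homogeneous:
  "\<exists>N. \<forall>H::nat set. finite H \<and> N \<le> card H \<longrightarrow>
     (\<forall>P. \<exists>H'\<subseteq>H. card H' = M \<and> ((\<forall>X\<in>[H']\<^bsup>r\<^esup>. P X) \<or> (\<forall>X\<in>[H']\<^bsup>r\<^esup>. \<not> P X)))"
proof -
  obtain N where N: "partn_lst {..<N::nat} [M, M] r" using ramsey_full by blast
  have "\<exists>H'\<subseteq>H. card H' = M \<and> ((\<forall>X\<in>[H']\<^bsup>r\<^esup>. P X) \<or> (\<forall>X\<in>[H']\<^bsup>r\<^esup>. \<not> P X))"
    if H: "finite H" "N \<le> card H" for H :: "nat set" and P
  proof -
    obtain H0 where H0: "H0 \<subseteq> H" "card H0 = N" using H obtain_subset_with_card_n by metis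
    then have "finite H0" using H finite_subset by blast
    then obtain h where h: "bij_betw h {..<N} H0"
      using ex_bij_betw_nat_finite H0(2) lessThan_atLeast0 by metis
    define c where "c = (\<lambda>X. if P (h ` X) then 0 else (1::nat))"
    have "c \<in> [{..<N}]\<^bsup>r\<^esup> \<rightarrow> {..<length [M, M]}" by (auto simp: c_def)
    then obtain i U where U: "i < 2" "U \<in> [{..<N}]\<^bsup>M\<^esup>" "c ` ([U]\<^bsup>r\<^esup>) \<subseteq> {i}"
    proof -
      assume a: "\<And>i U. i < 2 \<Longrightarrow> U \<in> [{..<N}]\<^bsup>M\<^esup> \<Longrightarrow> c ` ([U]\<^bsup>r\<^esup>) \<subseteq> {i} \<Longrightarrow> thesis"
      assume "c \<in> [{..<N}]\<^bsup>r\<^esup> \<rightarrow> {..<length [M, M]}"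
      then obtain i where i: "i < length [M, M]" "monochromatic {..<N} ([M, M] ! i) r c i"
        using N unfolding partn_lst_def by blast
      then have "[M, M] ! i = M" by (auto simp: less_Suc_eq numeral_2_eq_2)
      then show thesis using i a unfolding monochromatic_def by (auto simp: numeral_2_eq_2)
    qed
    have UN: "U \<subseteq> {..<N}" "finite U" "card U = M" using U(2) by (auto simp: nsets_def)
    then have injU: "inj_on h U" using h inj_on_subset unfolding bij_betw_def by blast
    have sub: "h ` U \<subseteq> H" using UN h H0 unfolding bij_betw_def by blast
    have "P X \<longleftrightarrow> i = 0" if X: "X \<in> [h ` U]\<^bsup>r\<^esup>" for X
    proof -
      define Y where "Y = {u \<in> U. h u \<in> X}"
      have hY: "h ` Y = X" using X by (auto simp: Y_def nsets_def)
      have "inj_on h Y" by (rule inj_on_subset[OF injU]) (auto simp: Y_def)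
      then have "card Y = card X" using hY card_image[of h Y] by simp
      then have "card Y = r" using X by (simp add: nsets_def)
      then have "Y \<in> [U]\<^bsup>r\<^esup>" using UN by (auto simp: nsets_def Y_def)
      then have "c Y = i" using U(3) by blast
      then show ?thesis using hY by (auto simp: c_def split: if_splits)
    qed
    then show ?thesis
      using sub UN card_image[OF injU] by (intro exI[of _ "h ` U"]) auto
  qed
  then show ?thesis by blast
qed

text \<open>Homogeneity passes to subsets, so the predicates are treated one after another.\<close>

lemma ramsey_simultaneous:
  "\<exists>N. \<forall>H::nat set. finite H \<and> N \<le> card H \<longrightarrow>
     (\<forall>P. \<exists>H'\<subseteq>H. card H' = M \<and> (\<forall>t<k::nat. (\<forall>X\<in>[H']\<^bsup>r\<^esup>. P t X) \<or> (\<forall>X\<in>[H']\<^bsup>r\<^esup>. \<not> P t X)))"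
proof (induction k)
  case 0
  show ?case
    by (rule exI[of _ M]) (metis less_nat_zero_code obtain_subset_with_card_n)
next
  case (Suc k)
  then obtain N where N: "\<And>H P. finite H \<Longrightarrow> N \<le> card (H::nat set) \<Longrightarrow>
     \<exists>H'\<subseteq>H. card H' = M \<and> (\<forall>t<k::nat. (\<forall>X\<in>[H']\<^bsup>r\<^esup>. P t X) \<or> (\<forall>X\<in>[H']\<^bsup>r\<^esup>. \<not> P t X))"
    by metis
  obtain N' where N': "\<And>H P. finite H \<Longrightarrow> N' \<le> card (H::nat set) \<Longrightarrow>
     \<exists>H'\<subseteq>H. card H' = N \<and> ((\<forall>X\<in>[H']\<^bsup>r\<^esup>. P X) \<or> (\<forall>X\<in>[H']\<^bsup>r\<^esup>. \<not> P X))"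
    using ramsey_homogeneous[of N r] by metis
  have "\<exists>H'\<subseteq>H. card H' = M \<and> (\<forall>t<Suc k. (\<forall>X\<in>[H']\<^bsup>r\<^esup>. P t X) \<or> (\<forall>X\<in>[H']\<^bsup>r\<^esup>. \<not> P t X))"
    if H: "finite H" "N' \<le> card H" for H :: "nat set" and P
  proof -
    obtain H1 where H1: "H1 \<subseteq> H" "card H1 = N"
      "(\<forall>X\<in>[H1]\<^bsup>r\<^esup>. P k X) \<or> (\<forall>X\<in>[H1]\<^bsup>r\<^esup>. \<not> P k X)"
      using N'[OF H, of "P k"] by blast
    have "finite H1" using H1 H finite_subset by blast
    then obtain H2 where H2: "H2 \<subseteq> H1" "card H2 = M"
      "\<forall>t<k. (\<forall>X\<in>[H2]\<^bsup>r\<^esup>. P t X) \<or> (\<forall>X\<in>[H2]\<^bsup>r\<^esup>. \<not> P t X)"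
      using N[of H1 P] H1(2) by blast
    have "(\<forall>X\<in>[H2]\<^bsup>r\<^esup>. P k X) \<or> (\<forall>X\<in>[H2]\<^bsup>r\<^esup>. \<not> P k X)"
      using H1(3) nsets_mono[OF H2(1)] by blast
    then show ?thesis using H1 H2 by (intro exI[of _ H2]) (auto simp: less_Suc_eq)
  qed
  then show ?case by blast
qed

text \<open>Only edges between a lower half \<open>L\<close> and an upper half \<open>R\<close> of the index set are used, so that
  the relative order of two edges has few types; in every type, adjacency of the subdivision vertices
  would give a large clique.\<close>

lemma no_pattern:
  "\<exists>N. \<forall>E (V::'a set) w y. good \<omega> d f E V \<longrightarrow> \<not> pattern E V {..<N} w y"
proof -
  obtain D where D: "\<And>E (S::'a set) \<rho> pos. tame d f E S \<Longrightarrow> \<not> coarse_cube D 2 E S \<rho> pos"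
    using no_coarse_cube[of d f 2] by metis
  \<comment> \<open>Each half of the index set needs \<open>2 ^ D\<close> places for cube vertices
    and more than \<open>\<omega>\<close> places for a forbidden clique. Index \<open>m\<close>
    itself is kept free as a filler between the halves.\<close>
  define m where "m = 2 ^ D + \<omega> + 2"
  obtain N1 where N1: "\<And>H P. finite H \<Longrightarrow> N1 \<le> card (H::nat set) \<Longrightarrow>
     \<exists>H'\<subseteq>H. card H' = 2 * m \<and> (\<forall>t<4::nat. (\<forall>X\<in>[H']\<^bsup>4\<^esup>. P t X) \<or> (\<forall>X\<in>[H']\<^bsup>4\<^esup>. \<not> P t X))"
    using ramsey_simultaneous[of "2 * m" 4 4] by metis
  obtain N0 where N0: "\<And>H P. finite H \<Longrightarrow> N0 \<le> card (H::nat set) \<Longrightarrow>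
     \<exists>H'\<subseteq>H. card H' = N1 + \<omega> + 1 \<and> ((\<forall>X\<in>[H']\<^bsup>2\<^esup>. P X) \<or> (\<forall>X\<in>[H']\<^bsup>2\<^esup>. \<not> P X))"
    using ramsey_homogeneous[of "N1 + \<omega> + 1" 2] by metis
  have False if good: "good \<omega> d f E V" and pat: "pattern E V {..<N0} w y" for E and V :: "'a set" and w y
  proof -
    have sym: "symp E" and irr: "\<And>x. \<not> E x x"
      using good by (auto simp: good_def irreflp_def)
    have wV: "w i \<in> V" if "i < N0" for i using pat that unfolding pattern_def by blast
    have pat2: "\<forall>i\<in>{..<N0}. \<forall>j\<in>{..<N0}. i < j \<longrightarrow> y i j \<in> V \<and>
        (\<forall>l\<in>{..<N0}. (y i j = w l \<or> E (y i j) (w l)) \<longleftrightarrow> l = i \<or> l = j)"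
      using pat unfolding pattern_def by blast
    have yV: "y i j \<in> V" if "i < j" "j < N0" for i j
      using bspec[OF bspec[OF pat2, of i], of j] that by auto
    have ynear: "(y i j = w l \<or> E (y i j) (w l)) \<longleftrightarrow> l = i \<or> l = j" if "i < j" "j < N0" "l < N0" for i j l
      using bspec[OF bspec[OF pat2, of i], of j] that by fastforce
    obtain H0 where H0: "H0 \<subseteq> {..<N0}" "card H0 = N1 + \<omega> + 1"
      "(\<forall>X\<in>[H0]\<^bsup>2\<^esup>. E (w (Min X)) (w (Max X))) \<or> (\<forall>X\<in>[H0]\<^bsup>2\<^esup>. \<not> E (w (Min X)) (w (Max X)))"
      using N0[of "{..<N0}" "\<lambda>X. E (w (Min X)) (w (Max X))"] by auto
    have finH0: "finite H0" using H0 finite_subset by blast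
    have pair: "(\<forall>i\<in>H0. \<forall>j\<in>H0. i < j \<longrightarrow> E (w i) (w j)) \<or> (\<forall>i\<in>H0. \<forall>j\<in>H0. i < j \<longrightarrow> \<not> E (w i) (w j))"
    proof -
      have "{i, j} \<in> [H0]\<^bsup>2\<^esup> \<and> Min {i, j} = i \<and> Max {i, j} = j" if "i \<in> H0" "j \<in> H0" "i < j" for i j
        using that by auto
      then show ?thesis using H0(3) by metis
    qed
    have wnadj: "\<not> E (w i) (w j)" if "i \<in> H0" "j \<in> H0" for i j
    proof -
      have "\<not> (\<forall>i\<in>H0. \<forall>j\<in>H0. i < j \<longrightarrow> E (w i) (w j))"
      proof
        assume all: "\<forall>i\<in>H0. \<forall>j\<in>H0. i < j \<longrightarrow> E (w i) (w j)"
        let ?l = "sorted_list_of_set H0"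
        have len: "length ?l = N1 + \<omega> + 1" using H0(2) finH0 by simp
        have mem: "?l ! k \<in> H0" if "k < N1 + \<omega> + 1" for k
          using that len nth_mem[of k ?l] finH0 by simp
        have "?l ! k < ?l ! l" if "k < l" "l < N1 + \<omega> + 1" for k l
          using that len sorted_wrt_nth_less[OF strict_sorted_list_of_set[of H0]] by simp
        then show False
          using good_no_long_clique[OF good, of "N1 + \<omega> + 1" "\<lambda>k. w (?l ! k)"] all mem wV H0(1)
          by (auto simp: subset_eq)
      qed
      then have "\<forall>i\<in>H0. \<forall>j\<in>H0. i < j \<longrightarrow> \<not> E (w i) (w j)" using pair by blast
      then show ?thesis using that sym irr by (metis linorder_neqE_nat sympD)
    qed
    \<comment> \<open>For \<open>a < b < c < e\<close> these are the ways in which two edges from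
      the lower to the upper half can lie: crossing, nested, common lower end, common upper end. In
      the last two types one of the four indices is a filler, so a single Ramsey exponent covers all
      types.\<close>
    define Q where "Q = (\<lambda>(t::nat) a b c e. if t = 0 then E (y a c) (y b e)
      else if t = 1 then E (y a e) (y b c) else if t = 2 then E (y a c) (y a e) else E (y a e) (y b e))"
    obtain H1 where H1: "H1 \<subseteq> H0" "card H1 = 2 * m" and
      hom: "\<forall>t<4::nat. (\<forall>X\<in>[H1]\<^bsup>4\<^esup>. let l = sorted_list_of_set X in Q t (l ! 0) (l ! 1) (l ! 2) (l ! 3)) \<or>
        (\<forall>X\<in>[H1]\<^bsup>4\<^esup>. \<not> (let l = sorted_list_of_set X in Q t (l ! 0) (l ! 1) (l ! 2) (l ! 3)))"
      using N1[OF finH0, of "\<lambda>t X. let l = sorted_list_of_set X in Q t (l ! 0) (l ! 1) (l ! 2) (l ! 3)"] H0(2)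
      by auto
    have finH1: "finite H1" using H1 finH0 finite_subset by blast
    have four: "{a, b, c, e} \<in> [H1]\<^bsup>4\<^esup> \<and> sorted_list_of_set {a, b, c, e} = [a, b, c, e]"
      if "a \<in> H1" "b \<in> H1" "c \<in> H1" "e \<in> H1" "a < b" "b < c" "c < e" for a b c e
    proof -
      have "sorted_list_of_set (set [a, b, c, e]) = [a, b, c, e]"
        by (rule sorted_list_of_set.idem_if_sorted_distinct) (use that in auto)
      moreover have "{a, b, c, e} \<in> [H1]\<^bsup>4\<^esup>" using that by (simp add: nsets_def)
      ultimately show ?thesis by simp
    qed
    define h where "h = (\<lambda>i. sorted_list_of_set H1 ! i)"
    have hH: "h i \<in> H1" if "i < 2 * m" for i
      unfolding h_def using that H1(2) finH1 nth_mem[of i "sorted_list_of_set H1"] by simp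
    have hless: "h i < h j" if "i < j" "j < 2 * m" for i j
      unfolding h_def using that H1(2) finH1 sorted_wrt_nth_less[OF strict_sorted_list_of_set[of H1]] by simp
    have hN: "h i < N0" if "i < 2 * m" for i using hH[OF that] H1 H0 by blast
    have m2: "\<omega> < m" "2 \<le> m" "m + 2 ^ D < 2 * m" by (auto simp: m_def)
    have homQ: "(\<forall>i j k l. i < j \<and> j < k \<and> k < l \<and> l < 2 * m \<longrightarrow> Q t (h i) (h j) (h k) (h l)) \<or>
       (\<forall>i j k l. i < j \<and> j < k \<and> k < l \<and> l < 2 * m \<longrightarrow> \<not> Q t (h i) (h j) (h k) (h l))" if "t < 4" for t
    proof -
      have "{h i, h j, h k, h l} \<in> [H1]\<^bsup>4\<^esup> \<and> sorted_list_of_set {h i, h j, h k, h l} = [h i, h j, h k, h l]"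
        if "i < j \<and> j < k \<and> k < l \<and> l < 2 * m" for i j k l
        using that by (intro four hH hless) auto
      note f = this
      show ?thesis
      proof (cases "\<forall>X\<in>[H1]\<^bsup>4\<^esup>. let l = sorted_list_of_set X in Q t (l ! 0) (l ! 1) (l ! 2) (l ! 3)")
        case True
        have "Q t (h i) (h j) (h k) (h l)" if "i < j \<and> j < k \<and> k < l \<and> l < 2 * m" for i j k l
          using bspec[OF True conjunct1[OF f[OF that]]] conjunct2[OF f[OF that]] by (simp add: Let_def)
        then show ?thesis by blast
      next
        case False
        then have F: "\<forall>X\<in>[H1]\<^bsup>4\<^esup>. \<not> (let l = sorted_list_of_set X in Q t (l ! 0) (l ! 1) (l ! 2) (l ! 3))"
          using hom that by blast
        have "\<not> Q t (h i) (h j) (h k) (h l)" if "i < j \<and> j < k \<and> k < l \<and> l < 2 * m" for i j k l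
          using bspec[OF F conjunct1[OF f[OF that]]] conjunct2[OF f[OF that]] by (simp add: Let_def)
        then show ?thesis by blast
      qed
    qed
    have yhV: "y (h i) (h j) \<in> V" if "i < j" "j < 2 * m" for i j
      using that hless hN by (intro yV) auto
    have Q0: "\<not> Q 0 (h i) (h j) (h k) (h l)" if ijkl: "i < j" "j < k" "k < l" "l < 2 * m" for i j k l
    proof (rule ccontr)
      assume "\<not> ?thesis"
      then have all: "\<forall>i j k l. i < j \<and> j < k \<and> k < l \<and> l < 2 * m \<longrightarrow> Q 0 (h i) (h j) (h k) (h l)"
        using homQ[of 0] ijkl by auto
      have "E (y (h k) (h (m + k))) (y (h l) (h (m + l)))" if "k < l" "l < m" for k l
        using all[rule_format, of k l "m + k" "m + l"] that by (simp add: Q_def)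
      then show False
        using good_no_long_clique[OF good m2(1), of "\<lambda>k. y (h k) (h (m + k))"] yhV by auto
    qed
    have Q1: "\<not> Q 1 (h i) (h j) (h k) (h l)" if ijkl: "i < j" "j < k" "k < l" "l < 2 * m" for i j k l
    proof (rule ccontr)
      assume "\<not> ?thesis"
      then have all: "\<forall>i j k l. i < j \<and> j < k \<and> k < l \<and> l < 2 * m \<longrightarrow> Q 1 (h i) (h j) (h k) (h l)"
        using homQ[of 1] ijkl by auto
      have "E (y (h k) (h (2 * m - 1 - k))) (y (h l) (h (2 * m - 1 - l)))" if "k < l" "l < m" for k l
      proof -
        have "k < l \<and> l < 2 * m - 1 - l \<and> 2 * m - 1 - l < 2 * m - 1 - k \<and> 2 * m - 1 - k < 2 * m"
          using that by linarith
        from all[rule_format, OF this] show ?thesis by (simp add: Q_def)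
      qed
      then show False
        using good_no_long_clique[OF good m2(1), of "\<lambda>k. y (h k) (h (2 * m - 1 - k))"] yhV by auto
    qed
    have Q2: "\<not> Q 2 (h i) (h j) (h k) (h l)" if ijkl: "i < j" "j < k" "k < l" "l < 2 * m" for i j k l
    proof (rule ccontr)
      assume "\<not> ?thesis"
      then have all: "\<forall>i j k l. i < j \<and> j < k \<and> k < l \<and> l < 2 * m \<longrightarrow> Q 2 (h i) (h j) (h k) (h l)"
        using homQ[of 2] ijkl by auto
      have "E (y (h 0) (h (m + k))) (y (h 0) (h (m + l)))" if "k < l" "l < m" for k l
        using all[rule_format, of 0 1 "m + k" "m + l"] that m2 by (simp add: Q_def)
      then show False
        using good_no_long_clique[OF good m2(1), of "\<lambda>k. y (h 0) (h (m + k))"] yhV by auto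
    qed
    have Q3: "\<not> Q 3 (h i) (h j) (h k) (h l)" if ijkl: "i < j" "j < k" "k < l" "l < 2 * m" for i j k l
    proof (rule ccontr)
      assume "\<not> ?thesis"
      then have all: "\<forall>i j k l. i < j \<and> j < k \<and> k < l \<and> l < 2 * m \<longrightarrow> Q 3 (h i) (h j) (h k) (h l)"
        using homQ[of 3] ijkl by auto
      have "E (y (h k) (h (2 * m - 1))) (y (h l) (h (2 * m - 1)))" if "k < l" "l < m" for k l
      proof -
        have "k < l \<and> l < 2 * m - 2 \<and> 2 * m - 2 < 2 * m - 1 \<and> 2 * m - 1 < 2 * m"
          using that m2 by linarith
        from all[rule_format, OF this] show ?thesis by (simp add: Q_def)
      qed
      then show False
        using good_no_long_clique[OF good m2(1), of "\<lambda>k. y (h k) (h (2 * m - 1))"] yhV by auto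
    qed
    have ynadj_aux: "\<not> E (y (h i) (h j)) (y (h i') (h j'))"
      if "i < m" "i' < m" "m < j" "m < j'" "j < 2 * m" "j' < 2 * m" "i \<le> i'" for i j i' j'
    proof (cases "i = i'")
      case True
      then show ?thesis
        using Q2[of i m j j'] Q2[of i m j' j] that irr sym
        by (cases j j' rule: linorder_cases) (auto simp: Q_def dest: sympD)
    next
      case False
      then show ?thesis
        using Q0[of i i' j j'] Q1[of i i' j' j] Q3[of i i' m j] that
        by (cases j j' rule: linorder_cases) (auto simp: Q_def)
    qed
    have ynadj: "\<not> E (y (h i) (h j)) (y (h i') (h j'))"
      if "i < m" "i' < m" "m < j" "m < j'" "j < 2 * m" "j' < 2 * m" for i j i' j'
      using ynadj_aux[of i i' j j'] ynadj_aux[of i' i j' j] that sym by (meson nat_le_linear sympD)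
    obtain b where b: "bij_betw b (Pow {..<D}) {0..<card (Pow {..<D})}"
      using ex_bij_betw_finite_nat[of "Pow {..<D}"] by auto
    have bl: "b A < 2 ^ D" if "A \<subseteq> {..<D}" for A
      using bij_betwE[OF b] that by (auto simp: card_Pow)
    have binj: "A = B" if "b A = b B" "A \<subseteq> {..<D}" "B \<subseteq> {..<D}" for A B
      using bij_betw_imp_inj_on[OF b] that unfolding inj_on_def by auto
    \<comment> \<open>The cube is bipartite by parity: even sets go to the lower half and odd sets
      to the upper one, so every cube edge joins the halves. Odd sets start at \<open>m + 1\<close>
      because of the filler \<open>m\<close>.\<close>
    define g' where "g' = (\<lambda>A. if even (card A) then b A else m + 1 + b A)"
    define g where "g = (\<lambda>A. h (g' A))"
    have g': "g' A < 2 * m" if "A \<subseteq> {..<D}" for A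
      using bl[OF that] by (auto simp: g'_def m_def)
    have g'l: "g' A < m" if "A \<subseteq> {..<D}" "even (card A)" for A
      using bl[OF that(1)] that by (auto simp: g'_def m_def)
    have g'r: "m < g' A" if "odd (card A)" for A using that by (auto simp: g'_def)
    have gH: "g A \<in> H1" if "A \<subseteq> {..<D}" for A unfolding g_def using g'[OF that] by (rule hH)
    have gN: "g A < N0" if "A \<subseteq> {..<D}" for A using gH[OF that] H1 H0 by blast
    have hinj: "i = j" if "h i = h j" "i < 2 * m" "j < 2 * m" for i j
      using hless that by (metis less_irrefl linorder_neqE_nat)
    have ginj: "A = B" if "g A = g B" "A \<subseteq> {..<D}" "B \<subseteq> {..<D}" for A B
    proof -
      have "g' A = g' B" using hinj that g' unfolding g_def by blast
      then have "b A = b B"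
        using bl[OF that(2)] bl[OF that(3)] by (auto simp: g'_def m_def split: if_splits)
      then show ?thesis using binj that by blast
    qed
    \<comment> \<open>A pattern does not state that the \<open>w i\<close> are distinct. A third
      index \<open>j\<close> helps: the vertex subdividing \<open>g A\<close> and \<open>j\<close>
      is near \<open>w (g A)\<close> but not near \<open>w (g B)\<close>.\<close>
    have winj: "A = B" if eq: "w (g A) = w (g B)" and AB: "A \<subseteq> {..<D}" "B \<subseteq> {..<D}" for A B
    proof (rule ccontr)
      assume "A \<noteq> B"
      then have gne: "g A \<noteq> g B" using ginj AB by blast
      have "2 < card H1" using H1 m2 by simp
      then have "\<not> H1 \<subseteq> {g A, g B}"
        using card_mono[of "{g A, g B}" H1] gne by auto
      then obtain j where j: "j \<in> H1" "j \<noteq> g A" "j \<noteq> g B" by blast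
      then have jN: "j < N0" using H1 H0 by blast
      have "min (g A) j < max (g A) j" "max (g A) j < N0" using j jN gN[OF AB(1)] by auto
      from ynear[OF this, of "g A"] ynear[OF this, of "g B"] gN AB eq j gne
      show False by (auto simp: min_def max_def split: if_splits)
    qed
    define ev where "ev = (\<lambda>e::nat set \<times> nat. if even (card (fst e)) then fst e else insert (snd e) (fst e))"
    define od where "od = (\<lambda>e::nat set \<times> nat. if even (card (fst e)) then insert (snd e) (fst e) else fst e)"
    have ends: "ends e = {ev e, od e}" for e by (auto simp: ends_def ev_def od_def)
    have par: "even (card (ev e))" "odd (card (od e))" if e: "e \<in> cube_edges D" for e
    proof -
      have "finite (fst e)" "snd e \<notin> fst e" using e finite_subset[of "fst e" "{..<D} - {snd e}"]
        by (auto simp: cube_edges_def)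
      then show "even (card (ev e))" "odd (card (od e))" by (auto simp: ev_def od_def)
    qed
    have sub: "ev e \<subseteq> {..<D}" "od e \<subseteq> {..<D}" if "e \<in> cube_edges D" for e
      using ends_subset[OF that] ends by auto
    define Y where "Y = (\<lambda>e. y (g (ev e)) (g (od e)))"
    have gless: "g (ev e) < g (od e)" if "e \<in> cube_edges D" for e
    proof -
      have "g' (ev e) < m" using g'l[OF sub(1)[OF that] par(1)[OF that]] .
      moreover have "m < g' (od e)" using g'r[OF par(2)[OF that]] .
      ultimately have "g' (ev e) < g' (od e)" by (rule less_trans)
      then show ?thesis unfolding g_def using g'[OF sub(2)[OF that]] by (rule hless)
    qed
    have nY: "(Y e = w (g A) \<or> E (Y e) (w (g A))) \<longleftrightarrow> A \<in> ends e" if "e \<in> cube_edges D" "A \<subseteq> {..<D}" for e A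
      unfolding Y_def ends
      using ynear[OF gless[OF that(1)] gN[OF sub(2)[OF that(1)]] gN[OF that(2)]] ginj sub[OF that(1)] that(2)
      by auto
    have YY: "\<not> E (Y e) (Y e')" if "e \<in> cube_edges D" "e' \<in> cube_edges D" for e e'
      unfolding Y_def g_def using that by (intro ynadj g'l g'r g' sub par)
    have ww: "\<not> E (w (g A)) (w (g B))" if "A \<subseteq> {..<D}" "B \<subseteq> {..<D}" for A B
      using wnadj gH that H1 by blast
    have Yw: "Y e \<noteq> w (g A)" if "e \<in> cube_edges D" "A \<subseteq> {..<D}" for e A
    proof
      assume eq: "Y e = w (g A)"
      have "ev e \<noteq> od e" using par[OF that(1)] by auto
      then obtain B where B: "B \<in> ends e" "B \<noteq> A" using ends by auto
      have BD: "B \<subseteq> {..<D}" using B ends_subset that by blast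
      have "w (g A) = w (g B) \<or> E (w (g A)) (w (g B))" using nY[OF that(1) BD] B eq by simp
      then show False using winj ww B(2) BD that by blast
    qed
    have Yends: "ends e = ends e'" if "Y e = Y e'" "e \<in> cube_edges D" "e' \<in> cube_edges D" for e e'
    proof -
      have "A \<in> ends e \<longleftrightarrow> A \<in> ends e'" if "A \<subseteq> {..<D}" for A
        using nY[of e A] nY[of e' A] that \<open>Y e = Y e'\<close> \<open>e \<in> cube_edges D\<close> \<open>e' \<in> cube_edges D\<close> by simp
      then show ?thesis using ends_subset[OF that(2)] ends_subset[OF that(3)] by blast
    qed
    define S where "S = (\<lambda>A. w (g A)) ` Pow {..<D} \<union> Y ` cube_edges D"
    have "S \<subseteq> V"
      unfolding S_def Y_def using wV gN yV gless sub by auto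
    then have "tame d f E S" using good by (auto simp: good_def)
    \<comment> \<open>A subdivision vertex lies between both ends of its edge; it is placed at the
      end \<open>fst e\<close>.\<close>
    define pos where "pos = (\<lambda>u A. (A \<subseteq> {..<D} \<and> u = w (g A)) \<or> (\<exists>e\<in>cube_edges D. u = Y e \<and> A = fst e))"
    have fstD: "fst e \<subseteq> {..<D}" if "e \<in> cube_edges D" for e using that fst_in_ends ends_subset by blast
    have "coarse_cube D 2 E S Y pos"
      unfolding coarse_cube_def
    proof (intro conjI ballI allI impI)
      fix u assume "u \<in> S" then show "\<exists>A. pos u A" unfolding S_def pos_def by blast
    next
      fix u A assume "u \<in> S" "pos u A" then show "A \<subseteq> {..<D}" unfolding pos_def using fstD by blast
    next
      fix u v A B assume uv: "u \<in> S" "v \<in> S" and a: "pos u A \<and> pos v B \<and> (u = v \<or> E u v)"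
      have mixed: "sdist A B \<le> 1" if "A \<subseteq> {..<D}" "u = w (g A)" "e \<in> cube_edges D" "v = Y e" "B = fst e"
        "u = v \<or> E v u" for u v A B e
        using nY[OF that(3,1)] that sdist_ends[OF _ fst_in_ends[of e]] by auto
      have a': "u = v \<or> E v u" "u = v \<or> E u v" using a sym by (auto dest: sympD)
      consider (1) "A \<subseteq> {..<D}" "u = w (g A)" "B \<subseteq> {..<D}" "v = w (g B)"
        | (2) e where "A \<subseteq> {..<D}" "u = w (g A)" "e \<in> cube_edges D" "v = Y e" "B = fst e"
        | (3) e where "B \<subseteq> {..<D}" "v = w (g B)" "e \<in> cube_edges D" "u = Y e" "A = fst e"
        | (4) e e' where "e \<in> cube_edges D" "u = Y e" "A = fst e" "e' \<in> cube_edges D" "v = Y e'" "B = fst e'"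
        using a unfolding pos_def by blast
      then show "sdist A B \<le> 1"
      proof cases
        case 1
        then have "A = B" using a' ww winj by blast
        then show ?thesis by simp
      next
        case 2
        then show ?thesis using mixed a' by blast
      next
        case 3
        then have "sdist B A \<le> 1" using mixed a' by blast
        then show ?thesis by (simp add: sdist_sym)
      next
        case 4
        then have "u = v" using a' YY by blast
        then have "ends e = ends e'" using Yends 4 by blast
        then show ?thesis using 4 fst_in_ends sdist_ends by metis
      qed
    next
      fix e assume "e \<in> cube_edges D" then show "Y e \<in> S" by (simp add: S_def)
    next
      fix e A assume e: "e \<in> cube_edges D" "pos (Y e) A"
      then consider "A \<subseteq> {..<D}" "Y e = w (g A)" | e' where "e' \<in> cube_edges D" "Y e = Y e'" "A = fst e'"
        unfolding pos_def by blast
      then show "A \<in> ends e"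
      proof cases
        case 1
        then show ?thesis using nY e by blast
      next
        case 2
        then show ?thesis using Yends[OF 2(2) e(1) 2(1)] fst_in_ends by blast
      qed
    next
      fix e e' assume e: "e \<in> cube_edges D" "e' \<in> cube_edges D" "ends e \<inter> ends e' \<noteq> {}"
      then obtain A where A: "A \<in> ends e" "A \<in> ends e'" by blast
      have AD: "A \<subseteq> {..<D}" using A e ends_subset by blast
      have E1: "E (Y e) (w (g A))" using nY[OF e(1) AD] A Yw[OF e(1) AD] by blast
      have E2: "E (w (g A)) (Y e')" using nY[OF e(2) AD] A Yw[OF e(2) AD] sym by (blast dest: sympD)
      have "w (g A) \<in> S" "Y e \<in> S" "Y e' \<in> S" using AD e by (auto simp: S_def)
      then have "Y e' \<in> gball E S (Y e) (Suc (Suc 0))"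
        using E1 E2 gball_centre[of "Y e" S E 0] by (intro gball_step[of "w (g A)"] gball_step[of "Y e" E S]) auto
      then show "Y e' \<in> gball E S (Y e) 2" by (simp add: numeral_2_eq_2)
    qed
    then show False using D \<open>tame d f E S\<close> by blast
  qed
  then show ?thesis by blast
qed


section \<open>Epsilon nets and light weightings\<close>

definition shatters :: "'a set set \<Rightarrow> 'a set \<Rightarrow> bool" where
  "shatters \<R> F \<longleftrightarrow> (\<forall>B\<subseteq>F. \<exists>R\<in>\<R>. R \<inter> F = B)"

lemma shatters_subset:
  assumes "shatters \<R> F" "F' \<subseteq> F"
  shows "shatters \<R> F'"
  unfolding shatters_def
proof (intro allI impI)
  fix B assume B: "B \<subseteq> F'"
  then obtain R where R: "R \<in> \<R>" "R \<inter> F = B" using assms unfolding shatters_def by blast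
  then have "R \<inter> F' = B" using B assms(2) by blast
  then show "\<exists>R\<in>\<R>. R \<inter> F' = B" using R by blast
qed

text \<open>Pajor's strengthening of the Sauer-Shelah lemma. Split the family by membership of
  \<open>z\<close>: a set shattered by either half is shattered by the family, and a set
  \<open>F\<close> shattered by both halves also yields \<open>insert z F\<close>, so it is counted
  twice.\<close>

lemma pajor:
  assumes "finite Z" "\<R> \<subseteq> Pow Z"
  shows "card \<R> \<le> card {F. F \<subseteq> Z \<and> shatters \<R> F}"
  using assms
proof (induction Z arbitrary: \<R>)
  case empty
  then consider "\<R> = {}" | "\<R> = {{}}" by (auto simp: subset_singleton_iff)
  then show ?case
  proof cases
    case 2
    then have "{F. F \<subseteq> {} \<and> shatters \<R> F} = {{}}" by (auto simp: shatters_def)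
    then show ?thesis using 2 by simp
  qed simp
next
  case (insert z Z)
  define R0 where "R0 = {R \<in> \<R>. z \<notin> R}"
  define R1 where "R1 = (\<lambda>R. R - {z}) ` {R \<in> \<R>. z \<in> R}"
  define sh where "sh = (\<lambda>\<R>. {F. F \<subseteq> Z \<and> shatters \<R> F})"
  have fsh: "finite (sh \<R>)" for \<R>
    unfolding sh_def by (rule finite_subset[of _ "Pow Z"]) (use insert.hyps in auto)
  have finR: "finite \<R>" using insert finite_subset[of \<R> "Pow (insert z Z)"] by auto
  have R0: "R0 \<subseteq> Pow Z" using insert.prems unfolding R0_def by blast
  have R1: "R1 \<subseteq> Pow Z" using insert.prems unfolding R1_def by blast
  have c1: "card R1 = card {R \<in> \<R>. z \<in> R}"
    unfolding R1_def by (rule card_image) (auto simp: inj_on_def)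
  have "\<R> = R0 \<union> {R \<in> \<R>. z \<in> R}" by (auto simp: R0_def)
  moreover have "card (R0 \<union> {R \<in> \<R>. z \<in> R}) = card R0 + card {R \<in> \<R>. z \<in> R}"
    by (rule card_Un_disjoint) (use finR in \<open>auto simp: R0_def\<close>)
  ultimately have cR: "card \<R> = card R0 + card R1" using c1 by simp
  have s01: "shatters \<R> F" if F: "F \<subseteq> Z" "shatters R0 F \<or> shatters R1 F" for F
    unfolding shatters_def
  proof (intro allI impI)
    fix B assume B: "B \<subseteq> F"
    consider R where "R \<in> R0" "R \<inter> F = B" | R where "R \<in> R1" "R \<inter> F = B"
      using F B unfolding shatters_def by blast
    then show "\<exists>R\<in>\<R>. R \<inter> F = B"
    proof cases
      case 1
      then show ?thesis unfolding R0_def by blast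
    next
      case 2
      then obtain R' where R': "R' \<in> \<R>" "R = R' - {z}" unfolding R1_def by blast
      then have "R' \<inter> F = B" using 2 F insert.hyps by blast
      then show ?thesis using R' by blast
    qed
  qed
  have s2: "shatters \<R> (insert z F)" if F: "F \<subseteq> Z" "shatters R0 F" "shatters R1 F" for F
    unfolding shatters_def
  proof (intro allI impI)
    fix B assume B: "B \<subseteq> insert z F"
    show "\<exists>R\<in>\<R>. R \<inter> insert z F = B"
    proof (cases "z \<in> B")
      case True
      have "B - {z} \<subseteq> F" using B by blast
      then obtain R where "R \<in> R1" "R \<inter> F = B - {z}" using F(3) unfolding shatters_def by blast
      then obtain R' where R': "R' \<in> \<R>" "z \<in> R'" "(R' - {z}) \<inter> F = B - {z}" unfolding R1_def by blast
      then have "R' \<inter> insert z F = B" using True F insert.hyps by blast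
      then show ?thesis using R' by blast
    next
      case False
      then have "B \<subseteq> F" using B by blast
      then obtain R where "R \<in> R0" "R \<inter> F = B" using F(2) unfolding shatters_def by blast
      then have "R \<in> \<R>" "R \<inter> insert z F = B" unfolding R0_def by auto
      then show ?thesis by blast
    qed
  qed
  have zF: "z \<notin> F" if "F \<in> sh \<R>'" for F \<R>' using that insert.hyps by (auto simp: sh_def)
  have inj: "inj_on (insert z) (sh R0 \<inter> sh R1)"
  proof (rule inj_onI)
    fix F G assume "F \<in> sh R0 \<inter> sh R1" "G \<in> sh R0 \<inter> sh R1" "insert z F = insert z G"
    then show "F = G" using zF[of F R0] zF[of G R0] by (simp add: insert_ident)
  qed
  have "card R0 + card R1 \<le> card (sh R0) + card (sh R1)"
    using insert.IH[OF R0] insert.IH[OF R1] by (simp add: sh_def)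
  also have "\<dots> = card (sh R0 \<union> sh R1) + card (sh R0 \<inter> sh R1)"
    using fsh[of R0] fsh[of R1] by (rule card_Un_Int)
  also have "card (sh R0 \<inter> sh R1) = card (insert z ` (sh R0 \<inter> sh R1))"
    using inj by (simp add: card_image)
  also have "card (sh R0 \<union> sh R1) + card (insert z ` (sh R0 \<inter> sh R1)) =
      card ((sh R0 \<union> sh R1) \<union> insert z ` (sh R0 \<inter> sh R1))"
    by (rule card_Un_disjoint[symmetric]) (use fsh zF in auto)
  also have "\<dots> \<le> card {F. F \<subseteq> insert z Z \<and> shatters \<R> F}"
  proof (rule card_mono)
    show "finite {F. F \<subseteq> insert z Z \<and> shatters \<R> F}"
      by (rule finite_subset[of _ "Pow (insert z Z)"]) (use insert.hyps in auto)
    show "(sh R0 \<union> sh R1) \<union> insert z ` (sh R0 \<inter> sh R1) \<subseteq> {F. F \<subseteq> insert z Z \<and> shatters \<R> F}"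
      using s01 s2 unfolding sh_def by blast
  qed
  finally show ?case using cR by simp
qed

lemma card_small_subsets_le':
  assumes "finite Z"
  shows "card {B. B \<subseteq> Z \<and> card B \<le> r} \<le> (card Z + 1) ^ r"
proof -
  obtain h where h: "bij_betw h {..<card Z} Z"
    using ex_bij_betw_nat_finite[OF assms] lessThan_atLeast0 by metis
  let ?P = "{B. B \<subseteq> {..<card Z} \<and> card B \<le> r}"
  have fin: "finite ?P" by (rule finite_subset[of _ "Pow {..<card Z}"]) auto
  have "{B. B \<subseteq> Z \<and> card B \<le> r} \<subseteq> (image h) ` ?P"
  proof
    fix B assume B: "B \<in> {B. B \<subseteq> Z \<and> card B \<le> r}"
    define B' where "B' = {i \<in> {..<card Z}. h i \<in> B}"
    have "B \<subseteq> h ` {..<card Z}" using B h by (simp add: bij_betw_def)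
    then have "h ` B' = B" by (auto simp: B'_def)
    have "inj_on h B'"
      by (rule inj_on_subset[of h "{..<card Z}"]) (use h in \<open>auto simp: bij_betw_def B'_def\<close>)
    then have "card B' = card B" using \<open>h ` B' = B\<close> card_image[of h B'] by simp
    then have "B' \<in> ?P" using B by (auto simp: B'_def)
    then show "B \<in> (image h) ` ?P" using \<open>h ` B' = B\<close> by blast
  qed
  then have "card {B. B \<subseteq> Z \<and> card B \<le> r} \<le> card ((image h) ` ?P)"
    using fin by (intro card_mono) auto
  also have "\<dots> \<le> card ?P" using fin by (rule card_image_le)
  finally show ?thesis using card_small_subsets_le le_trans by blast
qed

text \<open>By \<open>pajor\<close> it suffices to count the shattered sets, and these have fewer
  than \<open>D\<close> elements because shattering passes to subsets.\<close>

lemma sauer: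
  assumes "finite Z" "\<R> \<subseteq> Pow Z" "\<And>F. F \<subseteq> Z \<Longrightarrow> card F = D \<Longrightarrow> \<not> shatters \<R> F"
  shows "card \<R> \<le> (card Z + 1) ^ D"
proof -
  have "{F. F \<subseteq> Z \<and> shatters \<R> F} \<subseteq> {F. F \<subseteq> Z \<and> card F \<le> D}"
  proof (rule subsetI, rule ccontr)
    fix F assume F: "F \<in> {F. F \<subseteq> Z \<and> shatters \<R> F}" "F \<notin> {F. F \<subseteq> Z \<and> card F \<le> D}"
    then have "D \<le> card F" by auto
    then obtain F' where "F' \<subseteq> F" "card F' = D" using obtain_subset_with_card_n by metis
    then show False using assms(3)[of F'] F shatters_subset by blast
  qed
  moreover have "finite {F. F \<subseteq> Z \<and> card F \<le> D}"
    by (rule finite_subset[of _ "Pow Z"]) (use assms(1) in auto)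
  ultimately have "card {F. F \<subseteq> Z \<and> shatters \<R> F} \<le> card {F. F \<subseteq> Z \<and> card F \<le> D}"
    by (rule card_mono[rotated])
  then show ?thesis
    using pajor[OF assms(1,2)] card_small_subsets_le'[OF assms(1), of D] by linarith
qed

section \<open>Epsilon nets by double sampling\<close>

definition swap :: "nat set \<Rightarrow> (nat \<Rightarrow> 'a) \<times> (nat \<Rightarrow> 'a) \<Rightarrow> (nat \<Rightarrow> 'a) \<times> (nat \<Rightarrow> 'a)" where
  "swap \<sigma> z = (\<lambda>i. if i \<in> \<sigma> then snd z i else fst z i, \<lambda>i. if i \<in> \<sigma> then fst z i else snd z i)"

lemma swap_swap [simp]: "swap \<sigma> (swap \<sigma> z) = z"
  by (cases z) (auto simp: swap_def)

text \<open>Double sampling: if no sample of size \<open>N\<close> is a net, then many pairs of samples are such that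
  some large member is missed by the first and hit at least \<open>k\<close> times by the second. Swapping the
  coordinates of the pair at random makes this unlikely for each of the few traces.\<close>

lemma epsilon_net:
  assumes K: "1 \<le> K"
  shows "\<exists>M. \<forall>(\<Omega>::'a set) \<R>. finite \<Omega> \<and> \<Omega> \<noteq> {} \<and> \<R> \<subseteq> Pow \<Omega> \<and> (\<forall>R\<in>\<R>. card \<Omega> \<le> K * card R) \<and>
     (\<forall>F\<subseteq>\<Omega>. card F = D \<longrightarrow> \<not> shatters \<R> F) \<longrightarrow>
     (\<exists>Z\<subseteq>\<Omega>. card Z \<le> M \<and> (\<forall>R\<in>\<R>. R \<inter> Z \<noteq> {}))"
proof -
  \<comment> \<open>\<open>D'\<close> is only an upper bound for \<open>2 * N\<close> and
    \<open>2 * K\<close>: one factor \<open>D' + 1\<close> absorbs \<open>2 * K\<close>, the other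
    \<open>D\<close> factors absorb \<open>(2 * N + 1) ^ D\<close>.\<close>
  obtain D' k where k: "(D' + 1) ^ (D + 1) < 2 ^ k" "(8 * K) * k < D'"
    using exists_dimension by blast
  have k1: "1 \<le> k"
  proof (rule ccontr)
    assume "\<not> 1 \<le> k"
    then have "k = 0" by simp
    with k(1) have "(D' + 1) ^ (D + 1) < 1" by (simp only: power_0)
    then show False by simp
  qed
  define N where "N = 2 * K * k"
  have kN: "k \<le> N" using K by (simp add: N_def)
  have big: "2 * K * (2 * N + 1) ^ D < 2 ^ k"
  proof -
    have "1 \<le> K * k" using K k1 by simp
    then have "2 * N + 1 \<le> D' + 1" using k(2) unfolding N_def by linarith
    then have a: "(2 * N + 1) ^ D \<le> (D' + 1) ^ D" by (rule power_mono) simp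
    have "K * 1 \<le> K * k" using k1 by (rule mult_le_mono2)
    then have b: "2 * K \<le> D' + 1" using k(2) by linarith
    have "2 * K * (2 * N + 1) ^ D \<le> (D' + 1) * (D' + 1) ^ D" using a b by (rule mult_le_mono[rotated])
    then show ?thesis using k(1) by simp
  qed
  have main: "\<exists>Z\<subseteq>\<Omega>. card Z \<le> N \<and> (\<forall>R\<in>\<R>. R \<inter> Z \<noteq> {})"
    if fin: "finite \<Omega>" and ne: "\<Omega> \<noteq> {}" and sub: "\<R> \<subseteq> Pow \<Omega>"
      and large: "\<forall>R\<in>\<R>. card \<Omega> \<le> K * card R"
      and vc: "\<forall>F\<subseteq>\<Omega>. card F = D \<longrightarrow> \<not> shatters \<R> F" for \<Omega> :: "'a set" and \<R>
  proof (rule ccontr)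
    assume no: "\<not> ?thesis"
    define n where "n = card \<Omega>"
    have n0: "0 < n" using fin ne by (simp add: n_def card_gt_0_iff)
    define X where "X = (\<Pi>\<^sub>E i\<in>{..<N}. \<Omega>)"
    have finX: "finite X" unfolding X_def using fin by (intro finite_PiE) auto
    have cX: "card X = n ^ N" unfolding X_def by (simp add: card_PiE n_def)
    define hits where "hits = (\<lambda>y R. card {i\<in>{..<N}. y i \<in> (R::'a set)})"
    have hitsN: "hits y R \<le> N" for y R
      unfolding hits_def using card_mono[of "{..<N}" "{i\<in>{..<N}. y i \<in> R}"] by auto
    define gd where "gd = (\<lambda>R. {y \<in> X. k \<le> hits y R})"
    \<comment> \<open>A sample hits \<open>R\<close> at least \<open>N / K = 2 * k\<close> times on
      average. Samples with fewer than \<open>k\<close> hits contribute at most \<open>k\<close> to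
      this mean and the others at most \<open>N\<close> each, so the others make up a fraction of at
      least \<open>k / N = 1 / (2 * K)\<close>.\<close>
    have gd: "n ^ N \<le> 2 * K * card (gd R)" if R: "R \<in> \<R>" for R
    proof -
      have RO: "R \<subseteq> \<Omega>" using R sub by blast
      have coord: "n * card {y\<in>X. y i \<in> R} = card R * n ^ N" if i: "i < N" for i
      proof -
        have "{y\<in>X. y i \<in> R} = (\<Pi>\<^sub>E j\<in>{..<N}. if j = i then R else \<Omega>)"
        proof (intro set_eqI iffI)
          fix y assume "y \<in> {y\<in>X. y i \<in> R}"
          then show "y \<in> (\<Pi>\<^sub>E j\<in>{..<N}. if j = i then R else \<Omega>)"
            unfolding X_def by (auto simp: PiE_iff)
        next
          fix y assume y: "y \<in> (\<Pi>\<^sub>E j\<in>{..<N}. if j = i then R else \<Omega>)"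
          then have "y j \<in> (if j = i then R else \<Omega>)" if "j < N" for j
            using that by (auto simp: PiE_iff)
          then have "y j \<in> \<Omega>" if "j < N" for j
            using that RO by (metis subsetD)
          moreover have "y i \<in> R" using y i by (auto simp: PiE_iff split: if_splits)
          ultimately show "y \<in> {y\<in>X. y i \<in> R}"
            using y unfolding X_def by (auto simp: PiE_iff)
        qed
        then have "card {y\<in>X. y i \<in> R} = (\<Prod>j<N. if j = i then card R else n)"
          by (simp add: card_PiE n_def if_distrib cong: if_cong)
        also have "\<dots> = card R * n ^ (N - 1)"
        proof -
          have "(\<Prod>j<N. if j = i then card R else n) =
              card R * (\<Prod>j\<in>{..<N}-{i}. if j = i then card R else n)"
            using i by (subst prod.remove[of _ i]) auto
          also have "(\<Prod>j\<in>{..<N}-{i}. if j = i then card R else n) = (\<Prod>j\<in>{..<N}-{i}. n)"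
            by (rule prod.cong) auto
          finally show ?thesis using i by simp
        qed
        finally show ?thesis using i by (cases N) auto
      qed
      have "(\<Sum>y\<in>X. hits y R) = (\<Sum>y\<in>X. \<Sum>i<N. if y i \<in> R then 1 else 0)"
        unfolding hits_def by (intro sum.cong refl) (simp add: sum.If_cases Int_def)
      also have "\<dots> = (\<Sum>i<N. \<Sum>y\<in>X. if y i \<in> R then 1 else 0)" by (rule sum.swap)
      also have "\<dots> = (\<Sum>i<N. card {y\<in>X. y i \<in> R})"
        using finX by (intro sum.cong refl) (simp add: sum.If_cases Int_def)
      finally have tot: "(\<Sum>y\<in>X. hits y R) = (\<Sum>i<N. card {y\<in>X. y i \<in> R})" .
      have "n * (\<Sum>y\<in>X. hits y R) = (\<Sum>i<N. n * card {y\<in>X. y i \<in> R})"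
        by (simp add: tot sum_distrib_left)
      also have "\<dots> = N * (card R * n ^ N)" using coord by simp
      finally have "K * (n * (\<Sum>y\<in>X. hits y R)) = (K * card R) * (N * n ^ N)"
        by (simp add: algebra_simps)
      moreover have "n * (N * n ^ N) \<le> (K * card R) * (N * n ^ N)"
        using large R by (intro mult_le_mono1) (simp add: n_def)
      ultimately have "n * (N * n ^ N) \<le> K * (n * (\<Sum>y\<in>X. hits y R))" by linarith
      then have "n * (N * n ^ N) \<le> n * (K * (\<Sum>y\<in>X. hits y R))" by (simp only: mult.left_commute)
      then have lower: "N * n ^ N \<le> K * (\<Sum>y\<in>X. hits y R)" using n0 by simp
      have "(\<Sum>y\<in>X. hits y R) \<le> (\<Sum>y\<in>X. (if y \<in> gd R then N else 0) + k)"
      proof (rule sum_mono)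
        fix y assume "y \<in> X"
        then show "hits y R \<le> (if y \<in> gd R then N else 0) + k"
          using hitsN[of y R] by (auto simp: gd_def)
      qed
      also have "\<dots> = N * card (gd R) + k * n ^ N"
      proof -
        have "X \<inter> {y. y \<in> gd R} = gd R" by (auto simp: gd_def)
        then show ?thesis using finX by (simp add: sum.distrib sum.If_cases cX)
      qed
      finally have "N * n ^ N \<le> K * (N * card (gd R) + k * n ^ N)"
        using lower by (meson le_trans mult_le_mono2)
      then have "(K * k) * n ^ N + (K * k) * n ^ N \<le> (K * k) * (2 * K * card (gd R)) + (K * k) * n ^ N"
        unfolding N_def by (simp add: algebra_simps)
      then have "(K * k) * n ^ N \<le> (K * k) * (2 * K * card (gd R))" by linarith
      then show ?thesis using K k1 by simp
    qed
    define A where "A = {z \<in> X \<times> X. \<exists>R\<in>\<R>. R \<inter> fst z ` {..<N} = {} \<and> k \<le> hits (snd z) R}"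
    have finA: "finite A" unfolding A_def using finX by simp
    have cardA: "n ^ N * n ^ N \<le> 2 * K * card A"
    proof -
      have ex: "\<exists>R\<in>\<R>. R \<inter> x ` {..<N} = {}" if "x \<in> X" for x
      proof -
        have "x ` {..<N} \<subseteq> \<Omega>" using that unfolding X_def by (auto simp: PiE_iff)
        moreover have "card (x ` {..<N}) \<le> N" using card_image_le[of "{..<N}" x] by simp
        ultimately show ?thesis using no by metis
      qed
      define r where "r = (\<lambda>x. SOME R. R \<in> \<R> \<and> R \<inter> x ` {..<N} = {})"
      have r: "r x \<in> \<R>" "r x \<inter> x ` {..<N} = {}" if "x \<in> X" for x
      proof -
        have "\<exists>R. R \<in> \<R> \<and> R \<inter> x ` {..<N} = {}" using ex[OF that] by blast
        from someI_ex[OF this] show "r x \<in> \<R>" "r x \<inter> x ` {..<N} = {}" unfolding r_def by auto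
      qed
      have "(SIGMA x:X. gd (r x)) \<subseteq> A"
      proof
        fix z assume "z \<in> (SIGMA x:X. gd (r x))"
        then obtain x y where "z = (x, y)" "x \<in> X" "y \<in> X" "k \<le> hits y (r x)" by (auto simp: gd_def)
        then show "z \<in> A" using r[of x] unfolding A_def by auto
      qed
      then have "card (SIGMA x:X. gd (r x)) \<le> card A" using finA by (rule card_mono[rotated])
      moreover have "card (SIGMA x:X. gd (r x)) = (\<Sum>x\<in>X. card (gd (r x)))"
        using finX by (intro card_SigmaI) (auto simp: gd_def)
      moreover have "(\<Sum>x\<in>X. n ^ N) \<le> (\<Sum>x\<in>X. 2 * K * card (gd (r x)))"
        by (intro sum_mono gd r)
      ultimately have "(\<Sum>x\<in>X. n ^ N) \<le> 2 * K * (\<Sum>x\<in>X. card (gd (r x)))"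
        and "(\<Sum>x\<in>X. card (gd (r x))) \<le> card A"
        unfolding sum_distrib_left[symmetric] by simp_all
      then have "(\<Sum>x\<in>X. n ^ N) \<le> 2 * K * card A"
        using mult_le_mono2 order_trans by blast
      then show ?thesis by (simp add: cX)
    qed
    have swapX: "swap \<sigma> z \<in> X \<times> X" if "z \<in> X \<times> X" for \<sigma> z
    proof -
      have "fst z \<in> X" "snd z \<in> X" using that by auto
      then have "(\<lambda>i. if i \<in> \<sigma> then fst z i else snd z i) \<in> X" "(\<lambda>i. if i \<in> \<sigma> then snd z i else fst z i) \<in> X"
        unfolding X_def PiE_iff extensional_def by simp_all
      then show ?thesis by (simp add: swap_def)
    qed
    have cswap: "card {z \<in> X \<times> X. swap \<sigma> z \<in> A} = card A" for \<sigma>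
    proof -
      have "{z \<in> X \<times> X. swap \<sigma> z \<in> A} = swap \<sigma> ` A"
      proof (intro set_eqI iffI)
        fix z assume "z \<in> {z \<in> X \<times> X. swap \<sigma> z \<in> A}"
        then show "z \<in> swap \<sigma> ` A" by (intro image_eqI[of _ _ "swap \<sigma> z"]) auto
      next
        fix z assume "z \<in> swap \<sigma> ` A"
        then obtain u where u: "u \<in> A" "z = swap \<sigma> u" by blast
        then have "u \<in> X \<times> X" by (simp add: A_def)
        then show "z \<in> {z \<in> X \<times> X. swap \<sigma> z \<in> A}" using u swapX[of u \<sigma>] by simp
      qed
      moreover have "inj_on (swap \<sigma>) A" by (rule inj_on_inverseI[of _ "swap \<sigma>"]) simp
      ultimately show ?thesis by (simp add: card_image)
    qed
    \<comment> \<open>For a fixed pair only the traces on its at most \<open>2 * N\<close> points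
      matter, and \<open>sauer\<close> bounds their number. A trace \<open>Q\<close> that the first
      sample misses after swapping determines the swap on every coordinate where one of the two
      samples lies in \<open>Q\<close>; there are at least \<open>k\<close> such
      coordinates.\<close>
    have fibre: "card {\<sigma> \<in> Pow {..<N}. swap \<sigma> z \<in> A} \<le> (2 * N + 1) ^ D * 2 ^ (N - k)"
      if z: "z \<in> X \<times> X" for z
    proof -
      obtain x y where xy: "z = (x, y)" by fastforce
      define Z where "Z = x ` {..<N} \<union> y ` {..<N}"
      have ZO: "Z \<subseteq> \<Omega>" using z xy by (auto simp: Z_def X_def PiE_iff)
      have finZ: "finite Z" by (simp add: Z_def)
      have cZ: "card Z \<le> 2 * N"
        unfolding Z_def using card_Un_le[of "x ` {..<N}" "y ` {..<N}"]
          card_image_le[of "{..<N}" x] card_image_le[of "{..<N}" y] by simp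
      define T where "T = (\<lambda>R. R \<inter> Z) ` \<R>"
      have "\<not> shatters T F" if F: "F \<subseteq> Z" "card F = D" for F
      proof
        assume sh: "shatters T F"
        have "shatters \<R> F"
          unfolding shatters_def
        proof (intro allI impI)
          fix B assume "B \<subseteq> F"
          then obtain R where "R \<in> \<R>" "(R \<inter> Z) \<inter> F = B" using sh unfolding shatters_def T_def by blast
          then show "\<exists>R\<in>\<R>. R \<inter> F = B" using F(1) by (intro bexI[of _ R]) auto
        qed
        then show False using vc F ZO by blast
      qed
      then have "card T \<le> (card Z + 1) ^ D"
        by (intro sauer finZ) (auto simp: T_def)
      also have "\<dots> \<le> (2 * N + 1) ^ D" using cZ by (intro power_mono) auto
      finally have cT: "card T \<le> (2 * N + 1) ^ D" .
      have finT: "finite T" by (rule finite_subset[of _ "Pow Z"]) (use finZ in \<open>auto simp: T_def\<close>)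
      define bad where "bad = (\<lambda>Q. {\<sigma> \<in> Pow {..<N}. (\<forall>i<N. fst (swap \<sigma> z) i \<notin> Q) \<and> k \<le> hits (snd (swap \<sigma> z)) Q})"
      have cbad: "card (bad Q) \<le> 2 ^ (N - k)" for Q
      proof (cases "bad Q = {}")
        case False
        define J where "J = {i \<in> {..<N}. x i \<in> Q \<or> y i \<in> Q}"
        have J: "\<sigma> \<inter> J = {i \<in> J. x i \<in> Q} \<and> k \<le> card J" if \<sigma>: "\<sigma> \<in> bad Q" for \<sigma>
        proof
          have f: "(if i \<in> \<sigma> then y i else x i) \<notin> Q" if "i < N" for i
            using \<sigma> that by (auto simp: bad_def swap_def xy)
          show "\<sigma> \<inter> J = {i \<in> J. x i \<in> Q}"
          proof (intro set_eqI iffI)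
            fix i assume "i \<in> \<sigma> \<inter> J"
            then show "i \<in> {i \<in> J. x i \<in> Q}" using f[of i] by (auto simp: J_def)
          next
            fix i assume "i \<in> {i \<in> J. x i \<in> Q}"
            then show "i \<in> \<sigma> \<inter> J" using f[of i] by (auto simp: J_def split: if_splits)
          qed
          have "{i\<in>{..<N}. snd (swap \<sigma> z) i \<in> Q} \<subseteq> J" by (auto simp: J_def swap_def xy)
          then have "hits (snd (swap \<sigma> z)) Q \<le> card J"
            unfolding hits_def by (intro card_mono) (auto simp: J_def)
          then show "k \<le> card J" using \<sigma> by (auto simp: bad_def)
        qed
        have kJ: "k \<le> card J" using J False by blast
        have JN: "J \<subseteq> {..<N}" by (auto simp: J_def)
        have "bad Q \<subseteq> (\<lambda>B. {i \<in> J. x i \<in> Q} \<union> B) ` Pow ({..<N} - J)"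
        proof
          fix \<sigma> assume \<sigma>: "\<sigma> \<in> bad Q"
          then have "\<sigma> \<subseteq> {..<N}" by (auto simp: bad_def)
          moreover have "\<sigma> = {i \<in> J. x i \<in> Q} \<union> (\<sigma> - J)" using J[OF \<sigma>] by blast
          ultimately show "\<sigma> \<in> (\<lambda>B. {i \<in> J. x i \<in> Q} \<union> B) ` Pow ({..<N} - J)" by blast
        qed
        then have "card (bad Q) \<le> card ((\<lambda>B. {i \<in> J. x i \<in> Q} \<union> B) ` Pow ({..<N} - J))"
          by (intro card_mono) auto
        also have "\<dots> \<le> card (Pow ({..<N} - J))" by (intro card_image_le) auto
        also have "\<dots> = 2 ^ (N - card J)" using JN by (simp add: card_Pow card_Diff_subset finite_subset)
        also have "\<dots> \<le> 2 ^ (N - k)" using kJ by (intro power_increasing) auto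
        finally show ?thesis .
      qed simp
      have "{\<sigma> \<in> Pow {..<N}. swap \<sigma> z \<in> A} \<subseteq> (\<Union>Q\<in>T. bad Q)"
      proof
        fix \<sigma> assume "\<sigma> \<in> {\<sigma> \<in> Pow {..<N}. swap \<sigma> z \<in> A}"
        then obtain R where R: "\<sigma> \<subseteq> {..<N}" "R \<in> \<R>" "R \<inter> fst (swap \<sigma> z) ` {..<N} = {}"
          "k \<le> hits (snd (swap \<sigma> z)) R" by (auto simp: A_def)
        have inZ: "snd (swap \<sigma> z) i \<in> Z" if "i < N" for i
          using that by (auto simp: swap_def xy Z_def)
        have "{i\<in>{..<N}. snd (swap \<sigma> z) i \<in> R \<inter> Z} = {i\<in>{..<N}. snd (swap \<sigma> z) i \<in> R}"
          using inZ by auto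
        then have "hits (snd (swap \<sigma> z)) (R \<inter> Z) = hits (snd (swap \<sigma> z)) R"
          unfolding hits_def by metis
        moreover have "\<forall>i<N. fst (swap \<sigma> z) i \<notin> R \<inter> Z" using R(3) by blast
        ultimately have "\<sigma> \<in> bad (R \<inter> Z)" using R unfolding bad_def by simp
        then show "\<sigma> \<in> (\<Union>Q\<in>T. bad Q)" using R(2) by (auto simp: T_def)
      qed
      moreover have "finite (\<Union>Q\<in>T. bad Q)" using finT by (auto simp: bad_def)
      ultimately have "card {\<sigma> \<in> Pow {..<N}. swap \<sigma> z \<in> A} \<le> card (\<Union>Q\<in>T. bad Q)"
        by (rule card_mono[rotated])
      also have "\<dots> \<le> (\<Sum>Q\<in>T. card (bad Q))" using finT by (rule card_UN_le)
      also have "\<dots> \<le> (\<Sum>Q\<in>T. 2 ^ (N - k))" by (intro sum_mono cbad)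
      also have "\<dots> \<le> (2 * N + 1) ^ D * 2 ^ (N - k)" using cT by simp
      finally show ?thesis .
    qed
    have "2 ^ N * card A = (\<Sum>\<sigma>\<in>Pow {..<N}. card {z \<in> X \<times> X. swap \<sigma> z \<in> A})"
      by (simp add: cswap card_Pow)
    also have "\<dots> = (\<Sum>\<sigma>\<in>Pow {..<N}. \<Sum>z\<in>X \<times> X. if swap \<sigma> z \<in> A then 1 else 0)"
      using finX by (intro sum.cong refl) (simp add: sum.If_cases Int_def)
    also have "\<dots> = (\<Sum>z\<in>X \<times> X. \<Sum>\<sigma>\<in>Pow {..<N}. if swap \<sigma> z \<in> A then 1 else 0)"
      by (rule sum.swap)
    also have "\<dots> = (\<Sum>z\<in>X \<times> X. card {\<sigma> \<in> Pow {..<N}. swap \<sigma> z \<in> A})"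
      by (intro sum.cong refl) (simp add: sum.If_cases Int_def)
    also have "\<dots> \<le> (\<Sum>z\<in>X \<times> X. (2 * N + 1) ^ D * 2 ^ (N - k))" by (intro sum_mono fibre)
    also have "\<dots> = (n ^ N * n ^ N) * ((2 * N + 1) ^ D * 2 ^ (N - k))"
      by (simp add: card_cartesian_product cX)
    finally have up: "2 ^ N * card A \<le> (n ^ N * n ^ N) * ((2 * N + 1) ^ D * 2 ^ (N - k))" .
    have "(n ^ N * n ^ N) * 2 ^ N \<le> (2 * K * card A) * 2 ^ N" using cardA by (rule mult_le_mono1)
    also have "\<dots> = 2 * K * (2 ^ N * card A)" by simp
    also have "\<dots> \<le> 2 * K * ((n ^ N * n ^ N) * ((2 * N + 1) ^ D * 2 ^ (N - k)))"
      using up by (rule mult_le_mono2)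
    finally have "(n ^ N * n ^ N) * 2 ^ N \<le> (n ^ N * n ^ N) * (2 * K * (2 * N + 1) ^ D * 2 ^ (N - k))"
      by (simp add: algebra_simps)
    then have "2 ^ N \<le> 2 * K * (2 * N + 1) ^ D * 2 ^ (N - k)"
      using n0 by (subst (asm) mult_le_cancel1) simp
    moreover have "2 ^ N = 2 ^ k * (2::nat) ^ (N - k)" using kN by (simp add: power_add[symmetric])
    ultimately have "2 ^ k * 2 ^ (N - k) \<le> 2 * K * (2 * N + 1) ^ D * (2::nat) ^ (N - k)" by metis
    then have "2 ^ k \<le> 2 * K * (2 * N + 1) ^ D" by (subst (asm) mult_le_cancel2) simp
    then show False using big by linarith
  qed
  show ?thesis by (rule exI[of _ N], intro allI impI, elim conjE, rule main) assumption+
qed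

text \<open>Shattering in the dual system: the indices \<open>t\<close> are the points, and
  \<open>d\<close> stands for the set of all \<open>t\<close> with
  \<open>d \<in> S t\<close>.\<close>

definition dual_shattered :: "('t \<Rightarrow> 'd set) \<Rightarrow> 'd set \<Rightarrow> 't set \<Rightarrow> bool" where
  "dual_shattered S C F \<longleftrightarrow> (\<forall>B\<subseteq>F. \<exists>d\<in>C. \<forall>t\<in>F. d \<in> S t \<longleftrightarrow> t \<in> B)"

text \<open>If every weighting has a heavy member, then repeatedly halving the weight of a heavy member
  produces a sequence of members that covers every point with positive density; an epsilon net of
  the sequence is then a bounded cover.\<close>

lemma light_weights:
  assumes K: "1 \<le> K"
  shows "\<exists>M. \<forall>(C::'d set) (T::'t set) S. finite C \<and> C \<noteq> {} \<and>
     (\<forall>F\<subseteq>T. finite F \<and> card F = D \<longrightarrow> \<not> dual_shattered S C F) \<and>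
     (\<forall>F\<subseteq>T. finite F \<and> card F \<le> M \<longrightarrow> \<not> C \<subseteq> (\<Union>t\<in>F. S t)) \<longrightarrow>
     (\<exists>l::'d \<Rightarrow> real. (\<forall>d. 0 \<le> l d) \<and> 0 < sum l C \<and> (\<forall>t\<in>T. real K * sum l (C \<inter> S t) < sum l C))"
proof -
  have "1 \<le> 4 * K" using K by simp
  from epsilon_net[OF this, of D] obtain M where
    M: "\<And>(\<Omega>::nat set) \<R>. finite \<Omega> \<Longrightarrow> \<Omega> \<noteq> {} \<Longrightarrow> \<R> \<subseteq> Pow \<Omega> \<Longrightarrow>
      (\<forall>R\<in>\<R>. card \<Omega> \<le> 4 * K * card R) \<Longrightarrow> (\<forall>F\<subseteq>\<Omega>. card F = D \<longrightarrow> \<not> shatters \<R> F) \<Longrightarrow>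
     (\<exists>Z\<subseteq>\<Omega>. card Z \<le> M \<and> (\<forall>R\<in>\<R>. R \<inter> Z \<noteq> {}))"
    by metis
  have main: "\<exists>l::'d \<Rightarrow> real. (\<forall>d. 0 \<le> l d) \<and> 0 < sum l C \<and> (\<forall>t\<in>T. real K * sum l (C \<inter> S t) < sum l C)"
    if finC: "finite C" and neC: "C \<noteq> {}"
      and vc: "\<forall>F\<subseteq>T. finite F \<and> card F = D \<longrightarrow> \<not> dual_shattered S C F"
      and nocover: "\<forall>F\<subseteq>T. finite F \<and> card F \<le> M \<longrightarrow> \<not> C \<subseteq> (\<Union>t\<in>F. S t)"
    for C :: "'d set" and T :: "'t set" and S
  proof (rule ccontr)
    assume no: "\<not> ?thesis"
    have "\<exists>t. t \<in> T \<and> sum l C \<le> real K * sum l (C \<inter> S t)"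
      if "\<forall>d. 0 \<le> l d" "0 < sum l C" for l :: "'d \<Rightarrow> real"
      using no that by (metis not_less)
    then obtain pick where pick: "\<And>l::'d \<Rightarrow> real. \<forall>d. 0 \<le> l d \<Longrightarrow> 0 < sum l C \<Longrightarrow>
        pick l \<in> T \<and> sum l C \<le> real K * sum l (C \<inter> S (pick l))"
      by metis
    define L where "L = rec_nat (\<lambda>_. 1::real) (\<lambda>_ l d. if d \<in> S (pick l) then l d / 2 else l d)"
    define t where "t = (\<lambda>r. pick (L r))"
    have L0: "L 0 = (\<lambda>_. 1)" by (simp add: L_def)
    have LS: "L (Suc r) = (\<lambda>d. if d \<in> S (t r) then L r d / 2 else L r d)" for r
      unfolding L_def t_def by simp
    have Lpos: "0 < L r d" for r d by (induction r) (auto simp: L0 LS)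
    have Lsum: "0 < sum (L r) C" for r using finC neC Lpos by (intro sum_pos) auto
    have tT: "t r \<in> T" and heavy: "sum (L r) C \<le> real K * sum (L r) (C \<inter> S (t r))" for r
      using pick[of "L r"] Lpos Lsum less_imp_le unfolding t_def by blast+
    have Lval: "L n d = (1 / 2) ^ card {r\<in>{..<n}. d \<in> S (t r)}" for n d
    proof (induction n)
      case (Suc n)
      have "{r\<in>{..<Suc n}. d \<in> S (t r)} =
          (if d \<in> S (t n) then insert n {r\<in>{..<n}. d \<in> S (t r)} else {r\<in>{..<n}. d \<in> S (t r)})"
        by (auto simp: less_Suc_eq)
      then show ?case using Suc by (simp add: LS)
    qed (simp add: L0)
    \<comment> \<open>A member carrying a fraction \<open>1 / K\<close> of the weight is halved, so
      the total weight shrinks at least by this factor.\<close>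
    define a where "a = 1 - 1 / (2 * real K)"
    have a0: "0 \<le> a" using K by (simp add: a_def field_simps)
    have Ldec: "sum (L (Suc r)) C \<le> a * sum (L r) C" for r
    proof -
      have "sum (L (Suc r)) C = (\<Sum>d\<in>C. L r d - (if d \<in> S (t r) then L r d / 2 else 0))"
        by (intro sum.cong refl) (simp add: LS)
      also have "\<dots> = sum (L r) C - sum (L r) (C \<inter> S (t r)) / 2"
        using finC by (simp add: sum_subtractf sum.If_cases sum_divide_distrib)
      also have "\<dots> \<le> sum (L r) C - sum (L r) C / (2 * real K)"
        using heavy[of r] K by (simp add: field_simps)
      finally show ?thesis by (simp add: a_def algebra_simps)
    qed
    have Lbound: "sum (L n) C \<le> a ^ n * card C" for n
    proof (induction n)
      case (Suc n)
      have "sum (L (Suc n)) C \<le> a * (a ^ n * card C)"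
        using Ldec[of n] Suc a0 by (meson mult_left_mono order_trans)
      then show ?case by simp
    qed (simp add: L0)
    define q where "q = card C"
    have q0: "0 < q" using finC neC by (simp add: q_def card_gt_0_iff)
    have a2K: "a ^ (2 * K) \<le> 1 / 2"
    proof -
      have "a \<le> exp (- (1 / (2 * real K)))"
        using exp_ge_add_one_self[of "- (1 / (2 * real K))"] by (simp add: a_def)
      then have "a ^ (2 * K) \<le> exp (- (1 / (2 * real K))) ^ (2 * K)" using a0 by (rule power_mono)
      also have "\<dots> = exp (- 1)"
        using K by (simp add: exp_of_nat_mult[symmetric])
      also have "\<dots> \<le> 1 / 2"
        using exp_ge_add_one_self[of "1::real"] by (simp add: exp_minus field_simps)
      finally show ?thesis .
    qed
    \<comment> \<open>After \<open>n\<close> rounds the total weight is at most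
      \<open>q / 4 ^ q\<close>, less than \<open>1 / 2 ^ q\<close>. So every point was halved more
      than \<open>q\<close> times, that is, it lies in more than a fraction
      \<open>1 / (4 * K)\<close> of the chosen members.\<close>
    define n where "n = 4 * K * q"
    have an: "a ^ n \<le> (1 / 2) ^ (2 * q)"
    proof -
      have "a ^ n = (a ^ (2 * K)) ^ (2 * q)" by (simp add: n_def power_mult[symmetric] algebra_simps)
      also have "\<dots> \<le> (1 / 2) ^ (2 * q)" using a2K a0 by (intro power_mono) auto
      finally show ?thesis .
    qed
    define R where "R = (\<lambda>d. {r\<in>{..<n}. d \<in> S (t r)})"
    have Rlarge: "card {..<n} \<le> 4 * K * card (R d)" if d: "d \<in> C" for d
    proof (rule ccontr)
      assume "\<not> ?thesis"
      then have "card (R d) \<le> q" by (simp add: n_def)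
      then have "(1 / 2) ^ q \<le> (1 / 2 :: real) ^ card (R d)" by (intro power_decreasing) auto
      also have "\<dots> = L n d" by (simp add: Lval R_def)
      also have "\<dots> \<le> sum (L n) C"
        using finC d Lpos by (intro member_le_sum) (auto intro: less_imp_le)
      also have "\<dots> \<le> (1 / 2) ^ (2 * q) * card C"
        using Lbound[of n] an by (meson mult_right_mono of_nat_0_le_iff order_trans)
      also have "\<dots> < (1 / 2) ^ (2 * q) * 2 ^ q"
        using less_exp[of q] by (intro mult_strict_left_mono) (auto simp: q_def)
      also have "\<dots> = (1 / 2) ^ q" by (simp add: mult_2 power_add power_divide)
      finally show False by simp
    qed
    have "\<exists>Z\<subseteq>{..<n}. card Z \<le> M \<and> (\<forall>Q\<in>R ` C. Q \<inter> Z \<noteq> {})"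
    proof (rule M)
      show "{..<n} \<noteq> {}" using K q0 by (auto simp: n_def lessThan_empty_iff)
      show "\<forall>Q\<in>R ` C. card {..<n} \<le> 4 * K * card Q" using Rlarge by blast
      show "\<forall>F\<subseteq>{..<n}. card F = D \<longrightarrow> \<not> shatters (R ` C) F"
      proof (intro allI impI notI)
        fix F assume F: "F \<subseteq> {..<n}" "card F = D" and sh: "shatters (R ` C) F"
        have finF: "finite F" using F finite_subset by blast
        have sh': "\<exists>d\<in>C. \<forall>r\<in>F. d \<in> S (t r) \<longleftrightarrow> r \<in> B" if B: "B \<subseteq> F" for B
        proof -
          obtain d where d: "d \<in> C" "R d \<inter> F = B" using sh B unfolding shatters_def by blast
          have "d \<in> S (t r) \<longleftrightarrow> r \<in> B" if "r \<in> F" for r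
            using d(2) that F(1) unfolding R_def by blast
          then show ?thesis using d by blast
        qed
        have inj: "inj_on t F"
        proof (rule inj_onI, rule ccontr)
          fix r r' assume r: "r \<in> F" "r' \<in> F" "t r = t r'" "r \<noteq> r'"
          then obtain d where d: "\<forall>s\<in>F. d \<in> S (t s) \<longleftrightarrow> s \<in> {r}" using sh'[of "{r}"] by blast
          from bspec[OF d r(1)] bspec[OF d r(2)] show False using r(3,4) by simp
        qed
        have "dual_shattered S C (t ` F)"
          unfolding dual_shattered_def
        proof (intro allI impI)
          fix B assume "B \<subseteq> t ` F"
          obtain d where d: "d \<in> C" "\<forall>r\<in>F. d \<in> S (t r) \<longleftrightarrow> r \<in> {r\<in>F. t r \<in> B}"
            using sh'[of "{r\<in>F. t r \<in> B}"] by blast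
          then show "\<exists>d\<in>C. \<forall>t\<in>t ` F. d \<in> S t \<longleftrightarrow> t \<in> B" by (intro bexI[of _ d]) auto
        qed
        moreover have "t ` F \<subseteq> T" using tT by blast
        moreover have "card (t ` F) = D" using card_image[OF inj] F by simp
        ultimately show False using vc finF by blast
      qed
    qed (auto simp: R_def)
    then obtain Z where Z: "Z \<subseteq> {..<n}" "card Z \<le> M" "\<forall>Q\<in>R ` C. Q \<inter> Z \<noteq> {}" by blast
    have finZ: "finite Z" using Z finite_subset by blast
    have "C \<subseteq> (\<Union>s\<in>t ` Z. S s)"
    proof
      fix d assume "d \<in> C"
      then obtain r where "r \<in> R d" "r \<in> Z" using Z(3) by blast
      then show "d \<in> (\<Union>s\<in>t ` Z. S s)" by (auto simp: R_def)
    qed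
    moreover have "t ` Z \<subseteq> T" using tT by blast
    moreover have "card (t ` Z) \<le> M" using card_image_le[OF finZ, of t] Z(2) by linarith
    ultimately show False using nocover[rule_format, of "t ` Z"] finZ by blast
  qed
  show ?thesis by (rule exI[of _ M], intro allI impI, elim conjE, rule main) assumption+
qed

text \<open>Out-neighbourhoods are light, so in-neighbourhoods are light on average, and vertices with both
  can be chosen greedily.\<close>

lemma conflict_free_set:
  fixes l :: "'d \<Rightarrow> real"
  assumes fin: "finite C" and l0: "\<forall>d. 0 \<le> l d" and pos: "0 < sum l C"
    and refl: "\<And>d. d \<in> C \<Longrightarrow> R d d"
    and light: "\<And>d. d \<in> C \<Longrightarrow> real (2 * N) * sum l {e \<in> C. R d e} \<le> sum l C"
  shows "\<exists>X\<subseteq>C. card X = N \<and> (\<forall>d\<in>X. \<forall>e\<in>X. d \<noteq> e \<longrightarrow> \<not> R d e)"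
proof (cases "N = 0")
  case True
  then show ?thesis by (intro exI[of _ "{}"]) auto
next
  case False
  \<comment> \<open>Choosing a suitable point discards its out-neighbours and its in-neighbours,
    each of weight at most \<open>\<eta>\<close>. Since \<open>2 * N * \<eta>\<close> is the total
    weight, something is left before each of the \<open>N\<close> choices.\<close>
  define \<eta> where "\<eta> = sum l C / real (2 * N)"
  have \<eta>: "sum l {e \<in> C. R d e} \<le> \<eta>" if "d \<in> C" for d
    using light[OF that] False by (simp add: \<eta>_def field_simps)
  have \<eta>0: "0 < \<eta>" using pos False by (simp add: \<eta>_def)
  have "\<exists>X B. X \<subseteq> C \<and> card X = j \<and> finite X \<and> (\<forall>d\<in>X. \<forall>e\<in>X. d \<noteq> e \<longrightarrow> \<not> R d e) \<and> B \<subseteq> C \<and>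
      (\<forall>d\<in>X. \<forall>e\<in>B. \<not> R d e \<and> \<not> R e d) \<and> sum l C - 2 * real j * \<eta> \<le> sum l B" if "j \<le> N" for j
    using that
  proof (induction j)
    case 0
    show ?case by (rule exI[of _ "{}"], rule exI[of _ C]) auto
  next
    case (Suc j)
    then obtain X B where X: "X \<subseteq> C" "card X = j" "finite X" "\<forall>d\<in>X. \<forall>e\<in>X. d \<noteq> e \<longrightarrow> \<not> R d e"
      and B: "B \<subseteq> C" "\<forall>d\<in>X. \<forall>e\<in>B. \<not> R d e \<and> \<not> R e d" "sum l C - 2 * real j * \<eta> \<le> sum l B"
      by (metis Suc_leD)
    have finB: "finite B" using B fin finite_subset by blast
    have "2 * real j * \<eta> < 2 * real N * \<eta>" using Suc.prems \<eta>0 by (intro mult_strict_right_mono) auto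
    also have "\<dots> = sum l C" using False by (simp add: \<eta>_def)
    finally have Bpos: "0 < sum l B" using B(3) by linarith
    have outB: "sum l {e \<in> B. R d e} \<le> \<eta>" if "d \<in> B" for d
    proof -
      have "sum l {e \<in> B. R d e} \<le> sum l {e \<in> C. R d e}"
        using fin B(1) l0 by (intro sum_mono2) auto
      then show ?thesis using \<eta>[of d] that B(1) by (meson order_trans subsetD)
    qed
    have "\<exists>d\<in>B. sum l {e \<in> B. R e d} \<le> \<eta>"
    proof (rule ccontr)
      assume neg: "\<not> ?thesis"
      obtain d0 where d0: "d0 \<in> B" "0 < l d0"
      proof -
        have "\<exists>d\<in>B. 0 < l d"
        proof (rule ccontr)
          assume "\<not> (\<exists>d\<in>B. 0 < l d)"
          then have "sum l B \<le> 0" by (intro sum_nonpos) (auto simp: not_less)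
          then show False using Bpos by simp
        qed
        then show ?thesis using that by blast
      qed
      have "0 < (\<Sum>d\<in>B. l d * (sum l {e \<in> B. R e d} - \<eta>))"
        using neg d0 l0 by (intro sum_pos2[OF finB d0(1)]) (auto simp: not_le intro!: mult_nonneg_nonneg[OF _ less_imp_le])
      also have "\<dots> = (\<Sum>d\<in>B. \<Sum>e\<in>B. if R e d then l d * l e else 0) - (\<Sum>d\<in>B. l d * \<eta>)"
        using finB by (simp add: algebra_simps sum_subtractf sum_distrib_left sum.If_cases Int_def)
      also have "(\<Sum>d\<in>B. \<Sum>e\<in>B. if R e d then l d * l e else 0) = (\<Sum>e\<in>B. \<Sum>d\<in>B. if R e d then l d * l e else 0)"
        by (rule sum.swap)
      also have "\<dots> = (\<Sum>e\<in>B. l e * sum l {d \<in> B. R e d})"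
        using finB by (simp add: sum_distrib_left sum.If_cases Int_def mult.commute)
      also have "\<dots> \<le> (\<Sum>e\<in>B. l e * \<eta>)" using outB l0 by (intro sum_mono mult_left_mono) auto
      finally show False by simp
    qed
    then obtain d where d: "d \<in> B" "sum l {e \<in> B. R e d} \<le> \<eta>" by blast
    define B' where "B' = {e \<in> B. \<not> R d e \<and> \<not> R e d}"
    have dC: "d \<in> C" using d B by blast
    have dX: "d \<notin> X" using B(2) d refl[OF dC] by blast
    have "sum l B \<le> sum l (B' \<union> ({e \<in> B. R d e} \<union> {e \<in> B. R e d}))"
      using finB l0 by (intro sum_mono2) (auto simp: B'_def)
    also have "\<dots> \<le> sum l B' + (sum l {e \<in> B. R d e} + sum l {e \<in> B. R e d})"
    proof -
      have un: "sum l (P \<union> Q) \<le> sum l P + sum l Q" if "finite P" "finite Q" for P Q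
        using that sum.union_inter[of P Q l] sum_nonneg[of "P \<inter> Q" l] l0 by fastforce
      show ?thesis
        using un[of B' "{e \<in> B. R d e} \<union> {e \<in> B. R e d}"] un[of "{e \<in> B. R d e}" "{e \<in> B. R e d}"] finB
        by (simp add: B'_def)
    qed
    finally have "sum l B \<le> sum l B' + 2 * \<eta>" using outB[OF d(1)] d(2) by linarith
    then have w: "sum l C - 2 * real (Suc j) * \<eta> \<le> sum l B'" using B(3) by (simp add: algebra_simps)
    show ?case
    proof (intro exI conjI)
      show "insert d X \<subseteq> C" using dC X by blast
      show "card (insert d X) = Suc j" using X dX by simp
      show "\<forall>u\<in>insert d X. \<forall>v\<in>insert d X. u \<noteq> v \<longrightarrow> \<not> R u v" using X(4) B(2) d(1) by blast
      show "B' \<subseteq> C" using B by (auto simp: B'_def)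
      show "\<forall>u\<in>insert d X. \<forall>e\<in>B'. \<not> R u e \<and> \<not> R e u" using B(2) by (auto simp: B'_def)
    qed (use X w in auto)
  qed
  from this[of N] show ?thesis by blast
qed


section \<open>From control by large balls to control by balls of radius two\<close>

definition ball_controlled :: "nat \<Rightarrow> nat \<Rightarrow> (nat \<Rightarrow> nat) \<Rightarrow> nat \<Rightarrow> bool" where
  "ball_controlled \<omega> d f s \<longleftrightarrow> (\<forall>\<tau>. \<exists>c. \<forall>E (V::nat set). good \<omega> d f E V \<and>
     (\<forall>x\<in>V. colourable E (gball E V x s) \<tau>) \<longrightarrow> colourable E V c)"

lemma ball_controlledE:
  assumes "ball_controlled \<omega> d f s"
  obtains c where "\<And>E (V::nat set). good \<omega> d f E V \<Longrightarrow>
     \<forall>x\<in>V. colourable E (gball E V x s) \<tau> \<Longrightarrow> colourable E V c"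
proof -
  from assms[unfolded ball_controlled_def, THEN spec, of \<tau>]
  obtain c where c: "\<forall>E (V::nat set). good \<omega> d f E V \<and>
     (\<forall>x\<in>V. colourable E (gball E V x s) \<tau>) \<longrightarrow> colourable E V c" by (elim exE)
  show thesis by (rule that[of c]) (use c in blast)
qed

lemma ball_controlled_mono:
  assumes "ball_controlled \<omega> d f s" "s \<le> t"
  shows "ball_controlled \<omega> d f t"
  unfolding ball_controlled_def
proof (rule allI)
  fix \<tau>
  obtain c where c: "\<And>E (V::nat set). good \<omega> d f E V \<Longrightarrow>
     \<forall>x\<in>V. colourable E (gball E V x s) \<tau> \<Longrightarrow> colourable E V c"
    by (rule ball_controlledE[OF assms(1), of \<tau>]) blast
  have "colourable E V c" if "good \<omega> d f E V" "\<forall>x\<in>V. colourable E (gball E V x t) \<tau>" for E and V :: "nat set"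
  proof (rule c[OF that(1)], rule ballI)
    fix x assume "x \<in> V"
    then show "colourable E (gball E V x s) \<tau>"
      using that(2) gball_mono[OF assms(2), of E V x] by (blast intro: colourable_mono)
  qed
  then show "\<exists>c. \<forall>E (V::nat set). good \<omega> d f E V \<and>
     (\<forall>x\<in>V. colourable E (gball E V x t) \<tau>) \<longrightarrow> colourable E V c" by blast
qed

text \<open>At scale 1 no edge joins two parts of the same colour, so all parts of one colour can
  share a palette of \<open>\<tau>\<close> colours; each part lies in a ball of radius
  \<open>f 1\<close>.\<close>

lemma ball_controlled_diameter: "ball_controlled \<omega> d f (f 1)"
  unfolding ball_controlled_def
proof (intro allI exI impI)
  fix \<tau> E and V :: "nat set"
  assume a: "good \<omega> d f E V \<and> (\<forall>x\<in>V. colourable E (gball E V x (f 1)) \<tau>)"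
  then have "tame d f E V" by (simp add: good_def)
  then obtain p :: "nat \<Rightarrow> nat set" and c where pc: "(\<forall>u\<in>V. c u \<le> d) \<and>
     (\<forall>u\<in>V. \<forall>v\<in>V. p u = p v \<longrightarrow> v \<in> gball E V u (f 1)) \<and>
     (\<forall>u\<in>V. \<forall>v\<in>V. c u = c v \<and> v \<in> gball E V u 1 \<longrightarrow> p u = p v)"
    using spec[OF \<open>tame d f E V\<close>[unfolded tame_def], of 1] by (elim exE)
  have "\<forall>u. \<exists>k. u \<in> V \<longrightarrow> (\<forall>v\<in>V. p v = p u \<longrightarrow> k v < \<tau>) \<and>
      (\<forall>v\<in>V. \<forall>v'\<in>V. p v = p u \<and> p v' = p u \<and> E v v' \<longrightarrow> k v \<noteq> (k v' :: nat))"
  proof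
    fix u
    show "\<exists>k. u \<in> V \<longrightarrow> (\<forall>v\<in>V. p v = p u \<longrightarrow> k v < \<tau>) \<and>
      (\<forall>v\<in>V. \<forall>v'\<in>V. p v = p u \<and> p v' = p u \<and> E v v' \<longrightarrow> k v \<noteq> (k v' :: nat))"
    proof (cases "u \<in> V")
      case True
      then obtain k where k: "\<forall>v\<in>gball E V u (f 1). k v < \<tau>"
        "\<forall>v\<in>gball E V u (f 1). \<forall>v'\<in>gball E V u (f 1). E v v' \<longrightarrow> k v \<noteq> k v'"
        using a unfolding colourable_def by blast
      have "v \<in> gball E V u (f 1)" if "v \<in> V" "p v = p u" for v
        using pc True that by metis
      then have "(\<forall>v\<in>V. p v = p u \<longrightarrow> k v < \<tau>)"
        "\<forall>v\<in>V. \<forall>v'\<in>V. p v = p u \<and> p v' = p u \<and> E v v' \<longrightarrow> k v \<noteq> k v'"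
        using k by auto
      then show ?thesis by (intro exI[of _ k]) (intro impI conjI)
    qed auto
  qed
  then obtain k where k: "\<And>u. u \<in> V \<Longrightarrow> (\<forall>v\<in>V. p v = p u \<longrightarrow> k u v < \<tau>) \<and>
      (\<forall>v\<in>V. \<forall>v'\<in>V. p v = p u \<and> p v' = p u \<and> E v v' \<longrightarrow> k u v \<noteq> (k u v' :: nat))"
    by metis
  define rep where "rep = (\<lambda>q. SOME u. u \<in> V \<and> p u = q)"
  have rep: "rep (p u) \<in> V \<and> p (rep (p u)) = p u" if "u \<in> V" for u
    unfolding rep_def by (rule someI[of _ u]) (use that in simp)
  define C where "C = (\<lambda>u. c u * \<tau> + k (rep (p u)) u)"
  have kl: "k (rep (p u)) u < \<tau>" if "u \<in> V" for u
    using k[of "rep (p u)"] rep[OF that] that by metis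
  have C1: "C u < (d + 1) * \<tau>" if "u \<in> V" for u
  proof -
    have "c u * \<tau> \<le> d * \<tau>" using pc that by (intro mult_le_mono1) blast
    from add_le_less_mono[OF this kl[OF that]] show ?thesis by (simp add: C_def algebra_simps)
  qed
  have C2: "C u \<noteq> C v" if uv: "u \<in> V" "v \<in> V" "E u v" for u v
  proof
    assume eq: "C u = C v"
    have \<tau>: "0 < \<tau>" using kl[OF uv(1)] by simp
    have "C u div \<tau> = c u" "C v div \<tau> = c v" using kl[OF uv(1)] kl[OF uv(2)] \<tau> by (simp_all add: C_def)
    then have cc: "c u = c v" using eq by simp
    have "v \<in> gball E V u 1" using uv by simp
    then have pp: "p u = p v" using pc cc uv by blast
    have "k (rep (p u)) u = k (rep (p u)) v" using eq cc pp by (simp add: C_def)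
    then show False using k[of "rep (p u)"] rep[OF uv(1)] uv pp by metis
  qed
  show "colourable E V ((d + 1) * \<tau>)"
    unfolding colourable_def using C1 C2 by blast
qed

text \<open>The two balls live in different graphs. The outer one is taken in \<open>C i\<close>, so
  paths of length \<open>s\<close> from \<open>x i\<close> to later regions stay in
  \<open>C i\<close>; the inner one is taken in \<open>V\<close>, so later regions are far from
  \<open>x i\<close> in the whole graph.\<close>

definition nested ::
  "('a \<Rightarrow> 'a \<Rightarrow> bool) \<Rightarrow> 'a set \<Rightarrow> nat \<Rightarrow> nat \<Rightarrow> (nat \<Rightarrow> 'a) \<Rightarrow> (nat \<Rightarrow> 'a set) \<Rightarrow> bool" where
  "nested E V s m x C \<longleftrightarrow> C 0 = V \<and>
     (\<forall>i<m. x i \<in> C i \<and> C (Suc i) \<subseteq> gball E (C i) (x i) s - gball E V (x i) (s - 1))"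

text \<open>A region of large chromatic number contains a ball of radius \<open>s\<close> of large
  chromatic number, and removing the ball of radius \<open>s - 1\<close> of the whole graph costs
  only \<open>\<tau>\<close> colours.\<close>

lemma nested_spheres:
  assumes "ball_controlled \<omega> d f s"
  shows "\<exists>c. \<forall>E (V::nat set). good \<omega> d f E V \<and> (\<forall>x\<in>V. colourable E (gball E V x (s - 1)) \<tau>) \<and>
     \<not> colourable E V c \<longrightarrow>
     (\<exists>x C. nested E V s m x C \<and> \<not> colourable E (C m) t)"
proof (induction m arbitrary: t)
  case 0
  have "\<exists>x C. nested E V s 0 x C \<and> \<not> colourable E (C 0) t" if "\<not> colourable E V t" for E and V :: "nat set"
    using that by (intro exI[of _ "\<lambda>_. undefined"] exI[of _ "\<lambda>_. V"]) (simp add: nested_def)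
  then show ?case by blast
next
  case (Suc m)
  obtain t' where t': "\<And>E (V::nat set). good \<omega> d f E V \<Longrightarrow>
     \<forall>x\<in>V. colourable E (gball E V x s) (t + \<tau>) \<Longrightarrow> colourable E V t'"
    by (rule ball_controlledE[OF assms, of "t + \<tau>"]) blast
  obtain c where c: "\<And>E (V::nat set). good \<omega> d f E V \<Longrightarrow> \<forall>x\<in>V. colourable E (gball E V x (s - 1)) \<tau> \<Longrightarrow>
     \<not> colourable E V c \<Longrightarrow>
     (\<exists>x C. nested E V s m x C \<and> \<not> colourable E (C m) t')"
    using Suc.IH[of t'] by blast
  have "\<exists>x C. nested E V s (Suc m) x C \<and>
        \<not> colourable E (C (Suc m)) t"
    if V: "good \<omega> d f E V" "\<forall>x\<in>V. colourable E (gball E V x (s - 1)) \<tau>" "\<not> colourable E V c"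
    for E and V :: "nat set"
  proof -
    obtain x C where xC: "C 0 = V"
      "\<forall>i<m. x i \<in> C i \<and> C (Suc i) \<subseteq> gball E (C i) (x i) s - gball E V (x i) (s - 1)"
      "\<not> colourable E (C m) t'"
      using c[OF V] unfolding nested_def by blast
    have CV: "C i \<subseteq> V" if "i \<le> m" for i
      using that
    proof (induction i)
      case (Suc i)
      then have "C (Suc i) \<subseteq> gball E (C i) (x i) s" using xC(2)[rule_format, OF Suc_le_lessD] by blast
      also have "\<dots> \<subseteq> C i" by (rule gball_subset)
      finally show ?case using Suc by auto
    qed (simp add: xC)
    have "\<not> (\<forall>y\<in>C m. colourable E (gball E (C m) y s) (t + \<tau>))"
      using t'[OF good_subset[OF V(1) CV[of m]]] xC(3) by auto
    then obtain y where y: "y \<in> C m" "\<not> colourable E (gball E (C m) y s) (t + \<tau>)" by blast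
    define B where "B = gball E (C m) y s - gball E V y (s - 1)"
    have "\<not> colourable E B t"
    proof
      assume "colourable E B t"
      moreover have "colourable E (gball E V y (s - 1)) \<tau>" using V(2) y(1) CV[of m] by auto
      ultimately have "colourable E (B \<union> gball E V y (s - 1)) (t + \<tau>)" by (rule colourable_Un)
      then have "colourable E (gball E (C m) y s) (t + \<tau>)"
        by (rule colourable_mono) (auto simp: B_def)
      then show False using y by blast
    qed
    then show ?thesis
      using xC y
      by (intro exI[of _ "x(m := y)"] exI[of _ "C(Suc m := B)"]) (auto simp: B_def less_Suc_eq nested_def)
  qed
  then show ?case by blast
qed

lemma sum_UN_le:
  fixes l :: "'a \<Rightarrow> real"
  assumes "finite I" "\<forall>x. 0 \<le> l x" "\<And>i. i \<in> I \<Longrightarrow> finite (A i)"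
  shows "sum l (\<Union>i\<in>I. A i) \<le> (\<Sum>i\<in>I. sum l (A i))"
  using assms(1,3)
proof (induction I)
  case (insert i I)
  have "0 \<le> sum l (A i \<inter> (\<Union>i\<in>I. A i))" using assms(2) by (intro sum_nonneg) auto
  moreover have "sum l (A i \<union> (\<Union>i\<in>I. A i)) + sum l (A i \<inter> (\<Union>i\<in>I. A i)) = sum l (A i) + sum l (\<Union>i\<in>I. A i)"
    using insert by (intro sum.union_inter) auto
  ultimately show ?case using insert by simp
qed simp

text \<open>Otherwise there are many nested spheres of radius \<open>s\<close>. Shortest paths from the centres to
  well chosen vertices of the innermost sphere then form a coarse cube: vertices of two paths can be
  close only at the first step, unless one of the endpoints lies in a small ball.\<close>

lemma ball_controlled_descent:
  assumes ctrl: "ball_controlled \<omega> d f s" and s: "3 \<le> s"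
  shows "ball_controlled \<omega> d f (s - 1)"
  unfolding ball_controlled_def
proof (rule allI)
  fix \<tau>
  obtain Np where Np: "\<And>E (V::nat set) w y. good \<omega> d f E V \<Longrightarrow> \<not> pattern E V {..<Np} w y"
    using no_pattern[of \<omega> d f] by metis
  obtain D where D: "\<And>E (S::nat set) \<rho> pos. tame d f E S \<Longrightarrow> \<not> coarse_cube D (2 * s) E S \<rho> pos"
    using no_coarse_cube[of d f "2 * s"] by metis
  \<comment> \<open>There is one centre for each vertex of the cube and one endpoint for each of its
    \<open>Nc\<close> edges. \<open>L\<close> bounds the number of pairs of a centre and a position
    on a path; \<open>Ds\<close> is chosen for a pigeonhole over these pairs, and \<open>K\<close>
    for a union bound over pairs of them that prepares \<open>conflict_free_set\<close>.\<close>
  define nr where "nr = (2::nat) ^ D"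
  define L where "L = nr * (s + 1)"
  define Ds where "Ds = Np * L + 1"
  define Nc where "Nc = card (cube_edges D)"
  define K where "K = 2 * Nc * (L * L) + 1"
  have "1 \<le> K" by (simp add: K_def)
  from light_weights[OF this, of Ds] obtain M where
    M: "\<And>(C::nat set) (T::(nat \<times> nat \<times> nat) set) S. finite C \<Longrightarrow> C \<noteq> {} \<Longrightarrow>
     (\<forall>F\<subseteq>T. finite F \<and> card F = Ds \<longrightarrow> \<not> dual_shattered S C F) \<Longrightarrow>
     (\<forall>F\<subseteq>T. finite F \<and> card F \<le> M \<longrightarrow> \<not> C \<subseteq> (\<Union>t\<in>F. S t)) \<Longrightarrow>
     (\<exists>l::nat \<Rightarrow> real. (\<forall>d. 0 \<le> l d) \<and> 0 < sum l C \<and> (\<forall>t\<in>T. real K * sum l (C \<inter> S t) < sum l C))"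
    by metis
  obtain c where c: "\<And>E (V::nat set). good \<omega> d f E V \<Longrightarrow> \<forall>x\<in>V. colourable E (gball E V x (s - 1)) \<tau> \<Longrightarrow>
     \<not> colourable E V c \<Longrightarrow>
     (\<exists>x C. nested E V s nr x C \<and> \<not> colourable E (C nr) (M * \<tau>))"
    using nested_spheres[OF ctrl, of \<tau> nr "M * \<tau>"] by blast
  have "colourable E V c"
    if good: "good \<omega> d f E V" and small: "\<forall>x\<in>V. colourable E (gball E V x (s - 1)) \<tau>"
    for E and V :: "nat set"
  proof (rule ccontr)
    assume "\<not> colourable E V c"
    then obtain x C where C0: "C 0 = V"
      and xC: "\<And>i. i < nr \<Longrightarrow> x i \<in> C i"
      and CS: "\<And>i. i < nr \<Longrightarrow> C (Suc i) \<subseteq> gball E (C i) (x i) s - gball E V (x i) (s - 1)"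
      and Cbig: "\<not> colourable E (C nr) (M * \<tau>)"
      using c[OF good small] unfolding nested_def by blast
    have sym: "symp E" and finV: "finite V" using good by (auto simp: good_def)
    have Cdec: "C j \<subseteq> C i" if "i \<le> j" "j \<le> nr" for i j
      using that
    proof (induction j rule: dec_induct)
      case (step j)
      then have "C (Suc j) \<subseteq> gball E (C j) (x j) s" using CS[of j] by auto
      also have "\<dots> \<subseteq> C j" by (rule gball_subset)
      finally show ?case using step by auto
    qed simp
    have CV: "C i \<subseteq> V" if "i \<le> nr" for i using Cdec[of 0 i] that C0 by simp
    define Cn where "Cn = C nr"
    have CnV: "Cn \<subseteq> V" using CV by (simp add: Cn_def)
    have finC: "finite Cn" using CnV finV finite_subset by blast
    have far: "y \<notin> gball E V (x i) (s - 1)" if "i < j" "j \<le> nr" "y \<in> C j" for i j y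
      using Cdec[of "Suc i" j] CS[of i] that by auto
    have "\<exists>p. p 0 = x i \<and> p s = e \<and> (\<forall>h\<le>s. p h \<in> C i) \<and> (\<forall>h<s. E (p h) (p (Suc h)))"
      if "i < nr" "e \<in> Cn" for i e
    proof -
      have "e \<in> C (Suc i)" using that Cdec[of "Suc i" nr] by (auto simp: Cn_def)
      then have "e \<in> gball E (C i) (x i) s" using CS[OF that(1)] by blast
      then obtain p m where p: "m \<le> s" "p 0 = x i" "p m = e" "\<forall>h\<le>m. p h \<in> C i"
        "\<forall>h<m. E (p h) (p (Suc h))" by (rule gball_path)
      have "m = s"
      proof (rule ccontr)
        assume "m \<noteq> s"
        then have ms: "m \<le> s - 1" using p(1) by simp
        have "p m \<in> gball E V (p 0) (m - 0)"
          using p(4,5) CV[of i] that(1) by (intro path_gball) auto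
        then have "e \<in> gball E V (x i) (s - 1)"
          using gball_mono[OF ms, of E V "x i"] p(2,3) by auto
        then show False using far[of i nr e] that by (simp add: Cn_def)
      qed
      then show ?thesis using p by blast
    qed
    then obtain P where P: "\<And>i e. i < nr \<Longrightarrow> e \<in> Cn \<Longrightarrow> P i e 0 = x i \<and> P i e s = e \<and>
        (\<forall>h\<le>s. P i e h \<in> C i) \<and> (\<forall>h<s. E (P i e h) (P i e (Suc h)))"
      by metis
    have PV: "P i e h \<in> V" if "i < nr" "e \<in> Cn" "h \<le> s" for i e h
      using P[OF that(1,2)] CV[of i] that by auto
    define near where "near = (\<lambda>u v. u = v \<or> E u v)"
    have near_sym: "near u v \<Longrightarrow> near v u" for u v using sym by (auto simp: near_def dest: sympD)
    have near_ball: "v \<in> gball E V u 1" if "near u v" "u \<in> V" "v \<in> V" for u v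
      using that by (auto simp: near_def)
    define S where "S = (\<lambda>(w, i, h). {e \<in> Cn. near (P i e h) w})"
    \<comment> \<open>Positions start at 2: if the vertex at position \<open>h \<ge> 2\<close> of a
      path is near \<open>w\<close>, then the endpoint is within
      \<open>1 + (s - h) \<le> s - 1\<close> of \<open>w\<close>. So each \<open>S t\<close> is
      \<open>\<tau>\<close>-colourable, and few of them cannot cover \<open>Cn\<close>.\<close>
    define Lb where "Lb = {..<nr} \<times> {2..s}"
    define T where "T = V \<times> Lb"
    have cLb: "card Lb \<le> L" using mult_le_mono2[of "s - 1" "s + 1" nr] by (simp add: Lb_def L_def)
    have finLb: "finite Lb" by (simp add: Lb_def)
    have Scol: "colourable E (S t) \<tau>" if "t \<in> T" for t
    proof -
      obtain w i h where wih: "t = (w, i, h)" by (cases t)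
      then have t: "t = (w, i, h)" "w \<in> V" "i < nr" "2 \<le> h" "h \<le> s"
        using that by (auto simp: T_def Lb_def)
      have "S t \<subseteq> gball E V w (s - 1)"
      proof
        fix e assume "e \<in> S t"
        then have e: "e \<in> Cn" "near (P i e h) w" by (auto simp: S_def t)
        have "P i e h \<in> gball E V w 1" using near_ball near_sym[OF e(2)] t PV e by auto
        moreover have "P i e s \<in> gball E V (P i e h) (s - h)"
          using P[OF t(3) e(1)] PV[OF t(3) e(1)] t by (intro path_gball) auto
        ultimately have "P i e s \<in> gball E V w (1 + (s - h))" by (rule gball_trans)
        moreover have hs: "1 + (s - h) \<le> s - 1" using t by simp
        ultimately have "P i e s \<in> gball E V w (s - 1)" using gball_mono[OF hs, of E V w] by blast
        then show "e \<in> gball E V w (s - 1)" using P[OF t(3) e(1)] by simp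
      qed
      moreover have "colourable E (gball E V w (s - 1)) \<tau>" using small t by blast
      ultimately show ?thesis using colourable_mono by blast
    qed
    have nocover: "\<forall>F\<subseteq>T. finite F \<and> card F \<le> M \<longrightarrow> \<not> Cn \<subseteq> (\<Union>t\<in>F. S t)"
    proof (intro allI impI notI)
      fix F assume F: "F \<subseteq> T" "finite F \<and> card F \<le> M" "Cn \<subseteq> (\<Union>t\<in>F. S t)"
      have "colourable E (\<Union>t\<in>F. S t) (card F * \<tau>)"
        using F Scol by (intro colourable_UN) auto
      then have "colourable E Cn (M * \<tau>)"
        by (rule colourable_mono) (use F in auto)
      then show False using Cbig by (simp add: Cn_def)
    qed
    \<comment> \<open>By pigeonhole more than \<open>Np\<close> members of a dual shattered family
      share the centre \<open>i\<close> and the position \<open>h\<close>. Each pair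
      \<open>w k\<close>, \<open>w l\<close> is singled out by some endpoint, and the
      \<open>h\<close>-th vertex of the path to it subdivides this pair in a forbidden
      pattern.\<close>
    have noshatter: "\<forall>F\<subseteq>T. finite F \<and> card F = Ds \<longrightarrow> \<not> dual_shattered S Cn F"
    proof (intro allI impI notI)
      fix F assume F: "F \<subseteq> T" "finite F \<and> card F = Ds" and sh: "dual_shattered S Cn F"
      have "\<exists>q\<in>Lb. Np < card {t\<in>F. snd t = q}"
      proof (rule ccontr)
        assume neg: "\<not> ?thesis"
        have "F = (\<Union>q\<in>Lb. {t\<in>F. snd t = q})" using F(1) by (auto simp: T_def)
        then have "card F \<le> (\<Sum>q\<in>Lb. card {t\<in>F. snd t = q})"
          using card_UN_le[OF finLb, of "\<lambda>q. {t\<in>F. snd t = q}"] by simp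
        also have "\<dots> \<le> (\<Sum>q\<in>Lb. Np)" using neg by (intro sum_mono) (auto simp: not_less)
        also have "\<dots> \<le> Np * L" using cLb by simp
        finally show False using F(2) by (simp add: Ds_def)
      qed
      then obtain i h where ih: "(i, h) \<in> Lb" "Np < card {t\<in>F. snd t = (i, h)}" by auto
      define W where "W = fst ` {t\<in>F. snd t = (i, h)}"
      have "inj_on fst {t\<in>F. snd t = (i, h)}" by (auto simp: inj_on_def)
      then have "Np < card W" using ih(2) by (simp add: W_def card_image)
      then obtain W' where W': "W' \<subseteq> W" "card W' = Np"
        using obtain_subset_with_card_n[of Np W] by auto
      have "finite W'" using W' F(2) finite_subset[of W' W] by (simp add: W_def)
      then obtain w where w: "bij_betw w {..<Np} W'"
        using ex_bij_betw_nat_finite W'(2) lessThan_atLeast0 by metis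
      have winj: "w k = w l \<longleftrightarrow> k = l" if "k < Np" "l < Np" for k l
        using bij_betw_imp_inj_on[OF w] that by (auto simp: inj_on_def)
      have wF: "(w k, i, h) \<in> F" if "k < Np" for k
      proof -
        have "w k \<in> W" using bij_betwE[OF w] W'(1) that by auto
        then show ?thesis by (auto simp: W_def)
      qed
      have "\<exists>e\<in>Cn. \<forall>m<Np. near (P i e h) (w m) \<longleftrightarrow> m = k \<or> m = l" if kl: "k < Np" "l < Np" for k l
      proof -
        obtain e where e: "e \<in> Cn" "\<forall>t\<in>F. e \<in> S t \<longleftrightarrow> t \<in> {(w k, i, h), (w l, i, h)}"
          using sh wF[OF kl(1)] wF[OF kl(2)] unfolding dual_shattered_def
          by (metis empty_subsetI insert_subset)
        have "near (P i e h) (w m) \<longleftrightarrow> m = k \<or> m = l" if "m < Np" for m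
          using bspec[OF e(2) wF[OF that]] e(1) winj[OF that kl(1)] winj[OF that kl(2)] by (simp add: S_def)
        then show ?thesis using e(1) by blast
      qed
      then obtain z where z: "\<And>k l. k < Np \<Longrightarrow> l < Np \<Longrightarrow> z k l \<in> Cn \<and>
          (\<forall>m<Np. near (P i (z k l) h) (w m) \<longleftrightarrow> m = k \<or> m = l)"
        by metis
      have "pattern E V {..<Np} w (\<lambda>k l. P i (z k l) h)"
        unfolding pattern_def
      proof (intro conjI ballI impI)
        fix k assume "k \<in> {..<Np}"
        then show "w k \<in> V" using wF[of k] F(1) by (auto simp: T_def)
      next
        fix k l assume "k \<in> {..<Np}" "l \<in> {..<Np}"
        then show "P i (z k l) h \<in> V" using z[of k l] ih(1) by (intro PV) (auto simp: Lb_def)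
      next
        fix k l m assume "k \<in> {..<Np}" "l \<in> {..<Np}" "m \<in> {..<Np}"
        then show "(P i (z k l) h = w m \<or> E (P i (z k l) h) (w m)) \<longleftrightarrow> m = k \<or> m = l"
          using z[of k l] unfolding near_def by simp
      qed
      then show False using Np[OF good] by blast
    qed
    have "Cn \<noteq> {}" using Cbig by (auto simp: Cn_def)
    from M[OF finC this noshatter nocover] obtain l :: "nat \<Rightarrow> real" where
      l0: "\<forall>d. 0 \<le> l d" and lpos: "0 < sum l Cn" and
      light: "\<And>t. t \<in> T \<Longrightarrow> real K * sum l (Cn \<inter> S t) < sum l Cn"
      by blast
    define R where "R = (\<lambda>a e. \<exists>i<nr. \<exists>h\<in>{2..s}. \<exists>i'<nr. \<exists>h'\<le>s. near (P i e h) (P i' a h'))"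
    have Kpos: "0 < real K" using \<open>1 \<le> K\<close> by simp
    have nr0: "0 < nr" by (simp add: nr_def)
    have "\<exists>X\<subseteq>Cn. card X = Nc \<and> (\<forall>d\<in>X. \<forall>e\<in>X. d \<noteq> e \<longrightarrow> \<not> R d e)"
    proof (rule conflict_free_set[OF finC l0 lpos])
      fix a assume "a \<in> Cn"
      have "near (P 0 a 2) (P 0 a 2)" by (simp add: near_def)
      then show "R a a" unfolding R_def using nr0 s
        by (intro exI[of _ 0] conjI bexI[of _ 2] exI[of _ 2]) auto
    next
      fix a assume a: "a \<in> Cn"
      define I where "I = Lb \<times> ({..<nr} \<times> {..s})"
      define t where "t = (\<lambda>((i::nat, h::nat), (i', h')). (P i' a h', i, h))"
      have tT: "t j \<in> T" if "j \<in> I" for j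
        using that a PV by (auto simp: I_def t_def T_def)
      have finI: "finite I" by (simp add: I_def Lb_def)
      have "card I = card Lb * L" by (simp add: I_def L_def card_cartesian_product)
      then have cI: "card I \<le> L * L" using cLb by simp
      have "{e \<in> Cn. R a e} \<subseteq> (\<Union>j\<in>I. Cn \<inter> S (t j))"
      proof
        fix e assume "e \<in> {e \<in> Cn. R a e}"
        then obtain i h i' h' where e: "e \<in> Cn" "i < nr" "h \<in> {2..s}" "i' < nr" "h' \<le> s"
          "near (P i e h) (P i' a h')" unfolding R_def by blast
        then have "((i, h), (i', h')) \<in> I" "e \<in> Cn \<inter> S (t ((i, h), (i', h')))"
          by (auto simp: I_def Lb_def t_def S_def)
        then show "e \<in> (\<Union>j\<in>I. Cn \<inter> S (t j))" by blast
      qed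
      then have "sum l {e \<in> Cn. R a e} \<le> sum l (\<Union>j\<in>I. Cn \<inter> S (t j))"
        using finC finI l0 by (intro sum_mono2) auto
      also have "\<dots> \<le> (\<Sum>j\<in>I. sum l (Cn \<inter> S (t j)))"
        using finC finI l0 by (intro sum_UN_le) auto
      also have "\<dots> \<le> (\<Sum>j\<in>I. sum l Cn / real K)"
      proof (rule sum_mono)
        fix j assume "j \<in> I"
        from less_imp_le[OF light[OF tT[OF this]]] show "sum l (Cn \<inter> S (t j)) \<le> sum l Cn / real K"
          using Kpos by (simp add: pos_le_divide_eq mult.commute)
      qed
      also have "\<dots> = real (card I) * (sum l Cn / real K)" by simp
      also have "\<dots> \<le> real (L * L) * (sum l Cn / real K)"
        using of_nat_mono[OF cI] lpos by (intro mult_right_mono) auto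
      finally have "real (2 * Nc) * sum l {e \<in> Cn. R a e} \<le> real (2 * Nc) * (real (L * L) * (sum l Cn / real K))"
        by (rule mult_left_mono) simp
      also have "\<dots> = real (2 * Nc * (L * L)) / real K * sum l Cn" by simp
      also have "\<dots> \<le> 1 * sum l Cn"
      proof (rule mult_right_mono)
        have "real (2 * Nc * (L * L)) \<le> real K" by (simp only: of_nat_le_iff K_def)
        then show "real (2 * Nc * (L * L)) / real K \<le> 1" using Kpos by (simp only: divide_le_eq_1_pos)
      qed (use lpos in simp)
      finally show "real (2 * Nc) * sum l {e \<in> Cn. R a e} \<le> sum l Cn" by simp
    qed
    then obtain X where X: "X \<subseteq> Cn" "card X = Nc" "\<And>d e. d \<in> X \<Longrightarrow> e \<in> X \<Longrightarrow> d \<noteq> e \<Longrightarrow> \<not> R d e"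
      by blast
    have "finite X" using X finC finite_subset by blast
    then obtain dd where dd: "bij_betw dd (cube_edges D) X"
      using finite_same_card_bij[of "cube_edges D" X] X(2) by (auto simp: Nc_def)
    have ddX: "dd e \<in> X" if "e \<in> cube_edges D" for e using bij_betwE[OF dd] that by blast
    have ddC: "dd e \<in> Cn" if "e \<in> cube_edges D" for e using ddX that X by blast
    have noR: "\<not> R (dd e) (dd e')" if "e \<in> cube_edges D" "e' \<in> cube_edges D" "e \<noteq> e'" for e e'
      using X(3)[OF ddX ddX] that bij_betw_imp_inj_on[OF dd] by (metis inj_onD)
    obtain b where b: "bij_betw b (Pow {..<D}) {0..<card (Pow {..<D})}"
      using ex_bij_betw_finite_nat[of "Pow {..<D}"] by auto
    have bn: "b A < nr" if "e \<in> cube_edges D" "A \<in> ends e" for A e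
      using bij_betwE[OF b] ends_subset[OF that] by (auto simp: card_Pow nr_def)
    have binj: "A = B" if "b A = b B" "A \<subseteq> {..<D}" "B \<subseteq> {..<D}" for A B
      using bij_betw_imp_inj_on[OF b] that unfolding inj_on_def by auto
    \<comment> \<open>A vertex sits at the cube vertices of all centres whose paths contain it; in
      particular \<open>dd e\<close> sits at both ends of \<open>e\<close>.\<close>
    define pos where "pos = (\<lambda>u A. \<exists>e\<in>cube_edges D. \<exists>h\<le>s. A \<in> ends e \<and> u = P (b A) (dd e) h)"
    define H where "H = {u. \<exists>A. pos u A}"
    have "H \<subseteq> V" unfolding H_def pos_def using PV bn ddC by blast
    then have tame: "tame d f E H" using good by (auto simp: good_def)
    have near_cases: "A = B \<or> e = e'"
      if e: "e \<in> cube_edges D" "A \<in> ends e" "h \<le> s" and e': "e' \<in> cube_edges D" "B \<in> ends e'" "h' \<le> s"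
        and nr: "near (P (b A) (dd e) h) (P (b B) (dd e') h')" for A B e e' h h'
    proof (rule ccontr)
      assume neg: "\<not> ?thesis"
      have "\<not> 2 \<le> h"
      proof
        assume "2 \<le> h"
        then have "R (dd e') (dd e)"
          unfolding R_def using nr bn[OF e(1,2)] bn[OF e'(1,2)] e e'
          by (intro exI[of _ "b A"] exI[of _ "b B"] bexI[of _ h] exI[of _ h'] conjI) auto
        then show False using noR[OF e'(1) e(1)] neg by auto
      qed
      then have h1: "h \<le> 1" by simp
      have "\<not> 2 \<le> h'"
      proof
        assume "2 \<le> h'"
        then have "R (dd e) (dd e')"
          unfolding R_def using near_sym[OF nr] bn[OF e(1,2)] bn[OF e'(1,2)] e e'
          by (intro exI[of _ "b B"] exI[of _ "b A"] bexI[of _ h'] exI[of _ h] conjI) auto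
        then show False using noR[OF e(1) e'(1)] neg by auto
      qed
      then have h1': "h' \<le> 1" by simp
      have close: "P i a h \<in> gball E V (x i) 1" if "i < nr" "a \<in> Cn" "h \<le> 1" for i a h
      proof -
        have "P i a h \<in> gball E V (P i a 0) (h - 0)"
          using P[OF that(1,2)] PV[OF that(1,2)] that s by (intro path_gball) auto
        then have "P i a h \<in> gball E V (x i) h" using P[OF that(1,2)] by simp
        then show ?thesis using gball_mono[OF that(3), of E V "x i"] by blast
      qed
      \<comment> \<open>This is where \<open>s\<close> must be at least 3: the path from
        \<open>x j\<close> lies in \<open>C j\<close>, outside the ball of radius
        \<open>s - 1 \<ge> 2\<close> about \<open>x i\<close>, while initial pieces that touch would
        give a vertex of it at distance at most 2.\<close>
      have ordered: False if "i < j" "j < nr" "a \<in> Cn" "a' \<in> Cn" "h \<le> 1" "h' \<le> 1"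
        "near (P i a h) (P j a' h')" for i j a a' h h'
      proof -
        have hs: "h' \<le> s" "h \<le> s" "i < nr" using that s by auto
        have "P j a' h' \<in> gball E V (P i a h) 1" using near_ball[OF that(7)] PV that hs by blast
        with close[OF hs(3) that(3,5)] have "P j a' h' \<in> gball E V (x i) (1 + 1)" by (rule gball_trans)
        moreover have "1 + 1 \<le> s - 1" using s by linarith
        ultimately have "P j a' h' \<in> gball E V (x i) (s - 1)" using gball_mono[of "1 + 1" "s - 1" E V "x i"] by blast
        moreover have "P j a' h' \<in> C j" using P[OF that(2,4)] hs by blast
        ultimately show False using far[OF that(1) _ ] that(2) by fastforce
      qed
      have "b A \<noteq> b B" using binj neg ends_subset[OF e(1,2)] ends_subset[OF e'(1,2)] by blast
      then consider "b A < b B" | "b B < b A" by linarith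
      then show False
      proof cases
        case 1
        then show False using ordered[OF 1 bn[OF e'(1,2)] ddC[OF e(1)] ddC[OF e'(1)] h1 h1' nr] by blast
      next
        case 2
        then show False
          using ordered[OF 2 bn[OF e(1,2)] ddC[OF e'(1)] ddC[OF e(1)] h1' h1 near_sym[OF nr]] by blast
      qed
    qed
    have ddP: "dd e = P (b A) (dd e) s" if "e \<in> cube_edges D" "A \<in> ends e" for e A
      using P[OF bn[OF that] ddC[OF that(1)]] by simp
    have "coarse_cube D (2 * s) E H dd pos"
      unfolding coarse_cube_def
    proof (intro conjI ballI allI impI)
      fix u assume "u \<in> H" then show "\<exists>A. pos u A" by (simp add: H_def)
    next
      fix u A assume "pos u A" then show "A \<subseteq> {..<D}" using ends_subset unfolding pos_def by blast
    next
      fix u v A B assume a: "pos u A \<and> pos v B \<and> (u = v \<or> E u v)"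
      then obtain e h where e: "e \<in> cube_edges D" "h \<le> s" "A \<in> ends e" "u = P (b A) (dd e) h"
        unfolding pos_def by blast
      obtain e' h' where e': "e' \<in> cube_edges D" "h' \<le> s" "B \<in> ends e'" "v = P (b B) (dd e') h'"
        using a unfolding pos_def by blast
      have "A = B \<or> e = e'" using near_cases[OF e(1,3,2) e'(1,3,2)] a e(4) e'(4) by (simp add: near_def)
      then show "sdist A B \<le> 1" using sdist_ends[OF e(3), of B] e'(3) by (cases "A = B") auto
    next
      fix e assume e: "e \<in> cube_edges D"
      have "pos (dd e) (fst e)" unfolding pos_def using ddP[OF e fst_in_ends] fst_in_ends e by blast
      then show "dd e \<in> H" unfolding H_def by blast
    next
      fix e A assume e: "e \<in> cube_edges D" and p: "pos (dd e) A"
      then obtain e' h where e': "e' \<in> cube_edges D" "h \<le> s" "A \<in> ends e'" "dd e = P (b A) (dd e') h"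
        unfolding pos_def by blast
      have "e = e'"
      proof (rule ccontr)
        assume ne: "e \<noteq> e'"
        have "near (P (b (fst e)) (dd e) s) (P (b A) (dd e') h)"
          using ddP[OF e fst_in_ends] e'(4) by (simp add: near_def)
        then have "R (dd e') (dd e)"
          unfolding R_def using bn[OF e fst_in_ends] bn[OF e'(1,3)] e'(2) s
          by (intro exI[of _ "b (fst e)"] exI[of _ "b A"] bexI[of _ s] exI[of _ h] conjI) auto
        then show False using noR[OF e'(1) e] ne by auto
      qed
      then show "A \<in> ends e" using e' by simp
    next
      fix e e' assume e: "e \<in> cube_edges D" "e' \<in> cube_edges D" "ends e \<inter> ends e' \<noteq> {}"
      then obtain A where A: "A \<in> ends e" "A \<in> ends e'" by blast
      have reach: "dd e \<in> gball E H (x (b A)) s" if "e \<in> cube_edges D" "A \<in> ends e" for e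
      proof -
        have "P (b A) (dd e) s \<in> gball E H (P (b A) (dd e) 0) (s - 0)"
        proof (rule path_gball)
          show "\<forall>h. 0 \<le> h \<and> h \<le> s \<longrightarrow> P (b A) (dd e) h \<in> H"
            unfolding H_def pos_def using that by blast
        qed (use P[OF bn[OF that] ddC[OF that(1)]] in auto)
        then show ?thesis using P[OF bn[OF that] ddC[OF that(1)]] by simp
      qed
      have "x (b A) \<in> gball E H (dd e) s" using reach[OF e(1) A(1)] by (rule gball_sym[OF sym])
      then have "dd e' \<in> gball E H (dd e) (s + s)" using reach[OF e(2) A(2)] by (rule gball_trans)
      then show "dd e' \<in> gball E H (dd e) (2 * s)" by (simp add: mult_2)
    qed
    then show False using D[OF tame] by blast
  qed
  then show "\<exists>c. \<forall>E (V::nat set). good \<omega> d f E V \<and>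
     (\<forall>x\<in>V. colourable E (gball E V x (s - 1)) \<tau>) \<longrightarrow> colourable E V c" by blast
qed

theorem ball_controlled_2: "ball_controlled \<omega> d f 2"
proof -
  have "ball_controlled \<omega> d f (2 + k) \<Longrightarrow> ball_controlled \<omega> d f 2" for k
  proof (induction k)
    case (Suc k)
    then have "ball_controlled \<omega> d f (2 + Suc k - 1)" by (intro ball_controlled_descent) auto
    then show ?case using Suc.IH by simp
  qed simp
  moreover have "ball_controlled \<omega> d f (2 + f 1)"
    by (rule ball_controlled_mono[OF ball_controlled_diameter]) simp
  ultimately show ?thesis by blast
qed


section \<open>Graphs with an algebra of internal sets and an ideal of small sets\<close>

text \<open>The intended model is an ultraproduct of finite graphs: \<open>\<I>\<close> consists of the internal sets, and a
  set is small if it is covered by an internal set of bounded chromatic number.\<close>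

locale large_world =
  fixes E :: "'a \<Rightarrow> 'a \<Rightarrow> bool" and V :: "'a set" and \<I> :: "'a set set" and small :: "'a set \<Rightarrow> bool"
    and \<omega> Np :: nat
  assumes E_sym: "E x y \<Longrightarrow> E y x" and E_irrefl: "\<not> E x x"
    and Int_V: "V \<in> \<I>" and Int_sub: "A \<in> \<I> \<Longrightarrow> A \<subseteq> V"
    and Int_Un: "A \<in> \<I> \<Longrightarrow> B \<in> \<I> \<Longrightarrow> A \<union> B \<in> \<I>"
    and Int_Diff: "A \<in> \<I> \<Longrightarrow> B \<in> \<I> \<Longrightarrow> A - B \<in> \<I>"
    and Int_nbh': "Y \<in> \<I> \<Longrightarrow> {x \<in> V. \<exists>y\<in>Y. E y x} \<in> \<I>"
    and Int_single: "x \<in> V \<Longrightarrow> {x} \<in> \<I>"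
    and small_sub: "small A \<Longrightarrow> B \<subseteq> A \<Longrightarrow> small B"
    and small_Un: "small A \<Longrightarrow> small B \<Longrightarrow> small (A \<union> B)"
    and small_single: "x \<in> V \<Longrightarrow> small {x}"
    and small_nbh1: "x \<in> V \<Longrightarrow> small {y \<in> V. E x y}"
    and small_stable: "small A \<Longrightarrow> A \<in> \<I> \<Longrightarrow>
          \<exists>\<F>. finite \<F> \<and> \<F> \<subseteq> \<I> \<and> (\<forall>F\<in>\<F>. \<forall>x\<in>F. \<forall>y\<in>F. \<not> E x y) \<and> A \<subseteq> \<Union>\<F>"
    and V_large: "\<not> small V"
    and two_control: "C \<in> \<I> \<Longrightarrow> \<not> small C \<Longrightarrow> \<exists>x\<in>C. \<not> small {c \<in> C. \<exists>y\<in>C. E y x \<and> E y c}"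
    and clique_bound: "finite K \<Longrightarrow> K \<subseteq> V \<Longrightarrow> complete_set E K \<Longrightarrow> card K \<le> \<omega>"
    and pattern_free: "\<not> pattern E V {..<Np} ww yy"
begin

definition nbh :: "'a set \<Rightarrow> 'a set" where
  "nbh Y = {x \<in> V. \<exists>y\<in>Y. E y x}"

definition comp :: "'a \<Rightarrow> 'a set \<Rightarrow> bool" where
  "comp x K \<longleftrightarrow> (\<forall>k\<in>K. E x k)"

definition near :: "'a \<Rightarrow> 'a \<Rightarrow> bool" where
  "near x y \<longleftrightarrow> x = y \<or> E x y"

definition n2 :: "'a set \<Rightarrow> 'a set \<Rightarrow> 'a set" where
  "n2 C K = {c \<in> C. \<exists>y\<in>C. comp y K \<and> E y c}"

definition jclique :: "nat \<Rightarrow> 'a set \<Rightarrow> bool" where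
  "jclique j K \<longleftrightarrow> finite K \<and> card K = j \<and> complete_set E K"

definition bad :: "'a set \<Rightarrow> 'a set \<Rightarrow> 'a set" where
  "bad Y K = {d \<in> V. \<exists>y\<in>Y. E y d \<and> \<not> comp y K}"

definition kap :: "nat \<Rightarrow> 'a set \<Rightarrow> (nat \<Rightarrow> 'a set) \<Rightarrow> 'a set \<Rightarrow> 'a set" where
  "kap p C X K = {d \<in> n2 C K. \<forall>i<p. d \<in> bad (X i) K}"

definition large :: "'a set \<Rightarrow> bool" where
  "large C \<longleftrightarrow> C \<in> \<I> \<and> \<not> small C"

definition covers :: "'a set \<Rightarrow> 'a set \<Rightarrow> bool" where
  "covers Y C \<longleftrightarrow> (\<forall>c\<in>C. \<exists>y\<in>Y. E y c)"

definition alive :: "nat \<Rightarrow> nat \<Rightarrow> 'a set \<Rightarrow> (nat \<Rightarrow> 'a set) \<Rightarrow> 'a \<Rightarrow> bool" where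
  "alive j p C X b \<longleftrightarrow> (\<exists>K\<subseteq>C. jclique j K \<and> b \<in> K \<and> \<not> small (kap p C X K))"

lemma near_sym: "near x y \<Longrightarrow> near y x"
  unfolding near_def using E_sym by blast

lemma E_commute: "E x y \<longleftrightarrow> E y x"
  using E_sym by blast

section \<open>Closure properties of internal and small sets\<close>

lemma Int_empty: "{} \<in> \<I>"
  using Int_Diff[OF Int_V Int_V] by simp

lemma Int_inter: "A \<in> \<I> \<Longrightarrow> B \<in> \<I> \<Longrightarrow> A \<inter> B \<in> \<I>"
  using Int_Diff[of A "A - B"] Int_Diff[of A B] by (simp add: Diff_Diff_Int)

lemma Int_nbh: "Y \<in> \<I> \<Longrightarrow> nbh Y \<in> \<I>"
  using Int_nbh' by (simp add: nbh_def)

lemma Int_UN: "finite I \<Longrightarrow> (\<And>i. i \<in> I \<Longrightarrow> A i \<in> \<I>) \<Longrightarrow> (\<Union>i\<in>I. A i) \<in> \<I>"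
  by (induction I rule: finite_induct) (auto intro: Int_Un Int_empty)

lemma nbh_single: "x \<in> V \<Longrightarrow> nbh {x} = {y \<in> V. E x y}"
  by (auto simp: nbh_def)

lemma small_nbh: "x \<in> V \<Longrightarrow> small (nbh {x})"
  using small_nbh1 by (simp add: nbh_single)

lemma small_empty: "small {}"
proof -
  have "V \<noteq> {}"
  proof
    assume e: "V = {}"
    then have "\<exists>x\<in>V. \<not> small {c \<in> V. \<exists>y\<in>V. E y x \<and> E y c}"
      using two_control[OF Int_V V_large] by blast
    then show False using e by blast
  qed
  then show ?thesis using small_single small_sub by blast
qed

lemma small_UN: "finite I \<Longrightarrow> (\<And>i. i \<in> I \<Longrightarrow> small (A i)) \<Longrightarrow> small (\<Union>i\<in>I. A i)"
  by (induction I rule: finite_induct) (auto intro: small_Un small_empty)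

lemma small_finite: "finite F \<Longrightarrow> F \<subseteq> V \<Longrightarrow> small F"
  using small_UN[of F "\<lambda>x. {x}"] small_single by auto

lemma Int_finite: "finite F \<Longrightarrow> F \<subseteq> V \<Longrightarrow> F \<in> \<I>"
  using Int_UN[of F "\<lambda>x. {x}"] Int_single by auto

lemma nbh_UN: "nbh F = (\<Union>x\<in>F. nbh {x})"
  by (auto simp: nbh_def)

lemma small_nbh_finite: "finite F \<Longrightarrow> F \<subseteq> V \<Longrightarrow> small (nbh F)"
  using small_UN[of F "\<lambda>x. nbh {x}"] small_nbh nbh_UN[of F] by auto

lemma large_Diff:
  assumes "large C" "S \<in> \<I>" "small S"
  shows "large (C - S)"
  unfolding large_def
proof
  show "C - S \<in> \<I>" using assms Int_Diff by (simp add: large_def)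
  show "\<not> small (C - S)"
  proof
    assume "small (C - S)"
    then have "small ((C - S) \<union> S)" using assms(3) by (rule small_Un)
    then have "small C" by (rule small_sub) auto
    then show False using assms(1) by (simp add: large_def)
  qed
qed

lemma large_sub: "large C \<Longrightarrow> C \<subseteq> V"
  using Int_sub by (simp add: large_def)

lemma large_nonempty: "large C \<Longrightarrow> C \<noteq> {}"
  using small_empty by (auto simp: large_def)

definition zone :: "'a set \<Rightarrow> 'a set" where
  "zone F = nbh F \<union> F"

text \<open>Neighbourhoods of vertices are small, so a large set stays large when it is cleared of
  finitely many vertices and their neighbours. In this way embedded vertices are kept away from the
  regions still in use.\<close>

lemma large_avoid:
  assumes "large C" "finite F" "F \<subseteq> V"
  shows "large (C - zone F)"
  using assms unfolding zone_def
  by (intro large_Diff Int_Un small_Un Int_nbh small_nbh_finite small_finite Int_finite) auto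

lemma zone_near: "c \<in> V \<Longrightarrow> c \<notin> zone F \<Longrightarrow> x \<in> F \<Longrightarrow> \<not> near x c"
  by (auto simp: zone_def near_def nbh_def)

lemma comp_alt: "y \<in> V \<Longrightarrow> K \<subseteq> V \<Longrightarrow> comp y K \<longleftrightarrow> (\<forall>k\<in>K. y \<in> nbh {k})"
  using E_sym by (auto simp: comp_def nbh_def)

lemma Int_comp:
  assumes "C \<in> \<I>" "finite K" "K \<subseteq> V"
  shows "{y \<in> C. comp y K} \<in> \<I>"
proof -
  have "{y \<in> C. comp y K} = C - (\<Union>k\<in>K. C - nbh {k})"
    using comp_alt[OF _ assms(3)] Int_sub[OF assms(1)] by auto
  also have "\<dots> \<in> \<I>" using assms by (intro Int_Diff Int_UN Int_nbh Int_single) auto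
  finally show ?thesis .
qed

lemma Int_n2:
  assumes "C \<in> \<I>" "finite K" "K \<subseteq> V"
  shows "n2 C K \<in> \<I>"
proof -
  have "n2 C K = C \<inter> nbh {y \<in> C. comp y K}"
    using Int_sub[OF assms(1)] by (auto simp: n2_def nbh_def)
  then show ?thesis using Int_inter[OF assms(1) Int_nbh[OF Int_comp[OF assms]]] by simp
qed

lemma Int_bad:
  assumes "Y \<in> \<I>" "finite K" "K \<subseteq> V"
  shows "bad Y K \<in> \<I>"
proof -
  have "bad Y K = nbh (Y - {y \<in> Y. comp y K})" by (auto simp: bad_def nbh_def)
  then show ?thesis using Int_nbh[OF Int_Diff[OF assms(1) Int_comp[OF assms]]] by simp
qed

lemma Int_kap:
  assumes "C \<in> \<I>" "finite K" "K \<subseteq> V" "\<And>i. i < p \<Longrightarrow> X i \<in> \<I>"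
  shows "kap p C X K \<in> \<I>"
  using assms(4)
proof (induction p)
  case 0
  then show ?case using Int_n2[OF assms(1-3)] by (simp add: kap_def)
next
  case (Suc p)
  have "kap (Suc p) C X K = kap p C X K \<inter> bad (X p) K" by (auto simp: kap_def less_Suc_eq)
  then show ?case using Suc Int_inter Int_bad[OF _ assms(2,3)] by simp
qed

lemma n2_mono: "C' \<subseteq> C \<Longrightarrow> n2 C' K \<subseteq> n2 C K"
  by (auto simp: n2_def)

lemma bad_mono: "Y' \<subseteq> Y \<Longrightarrow> bad Y' K \<subseteq> bad Y K"
  by (auto simp: bad_def)

lemma kap_mono: "C' \<subseteq> C \<Longrightarrow> (\<And>i. i < p \<Longrightarrow> X' i \<subseteq> X i) \<Longrightarrow> kap p C' X' K \<subseteq> kap p C X K"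
proof
  fix d assume sub: "C' \<subseteq> C" "\<And>i. i < p \<Longrightarrow> X' i \<subseteq> X i" and d: "d \<in> kap p C' X' K"
  have "d \<in> n2 C K" using d n2_mono[OF sub(1), of K] by (auto simp: kap_def)
  moreover have "d \<in> bad (X i) K" if "i < p" for i
    using d bad_mono[OF sub(2)[OF that], of K] that by (auto simp: kap_def)
  ultimately show "d \<in> kap p C X K" by (simp add: kap_def)
qed

lemma kap_sub: "kap p C X K \<subseteq> C"
  by (auto simp: kap_def n2_def)

end


text \<open>The number \<open>j\<close> is the largest clique size for which some large set is hereditarily heavy; inside
  that set, heaviness fails for \<open>j + 1\<close> on some large subset \<open>W\<close>. With \<open>j = 1\<close>, cliques are
  vertices and lightness replaces triangle-freeness.\<close>

locale clique_world = large_world +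
  fixes W :: "'a set" and j :: nat
  assumes W_large: "large W"
    and j_pos: "1 \<le> j"
    and heavy: "large C \<Longrightarrow> C \<subseteq> W \<Longrightarrow> \<exists>K\<subseteq>C. jclique j K \<and> \<not> small (n2 C K)"
    and light: "K \<subseteq> W \<Longrightarrow> jclique (Suc j) K \<Longrightarrow> small (n2 W K)"
    and saturation: "large C \<Longrightarrow> (\<And>i. i < p \<Longrightarrow> X i \<in> \<I>) \<Longrightarrow>
          (\<And>C'. large C' \<Longrightarrow> C' \<subseteq> C \<Longrightarrow> \<exists>b\<in>C'. alive j p C X b) \<Longrightarrow>
          \<exists>A\<subseteq>C. large A \<and> (\<forall>b\<in>A. alive j p C X b)"

lemma (in large_world) clique_world_exists:
  assumes sat: "\<And>j C p X. large C \<Longrightarrow> (\<And>i. i < p \<Longrightarrow> X i \<in> \<I>) \<Longrightarrow>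
          (\<And>C'. large C' \<Longrightarrow> C' \<subseteq> C \<Longrightarrow> \<exists>b\<in>C'. alive j p C X b) \<Longrightarrow>
          \<exists>A\<subseteq>C. large A \<and> (\<forall>b\<in>A. alive j p C X b)"
  shows "\<exists>W j. clique_world E V \<I> small \<omega> Np W j"
proof -
  define Q where "Q = (\<lambda>j. \<exists>W. large W \<and> (\<forall>C. large C \<and> C \<subseteq> W \<longrightarrow> (\<exists>K\<subseteq>C. jclique j K \<and> \<not> small (n2 C K))))"
  have "Q 1"
    unfolding Q_def
  proof (rule exI[of _ V], intro conjI allI impI)
    show "large V" using V_large Int_V by (simp add: large_def)
    fix C assume C: "large C \<and> C \<subseteq> V"
    then obtain x where x: "x \<in> C" "\<not> small {c \<in> C. \<exists>y\<in>C. E y x \<and> E y c}"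
      using two_control[of C] by (auto simp: large_def)
    moreover have "n2 C {x} = {c \<in> C. \<exists>y\<in>C. E y x \<and> E y c}" by (auto simp: n2_def comp_def)
    moreover have "jclique 1 {x}" by (simp add: jclique_def complete_set_def)
    ultimately show "\<exists>K\<subseteq>C. jclique 1 K \<and> \<not> small (n2 C K)" by (intro exI[of _ "{x}"]) auto
  qed
  have bound: "j \<le> \<omega>" if Qj: "Q j" for j
  proof -
    obtain W where W: "large W" "\<forall>C. large C \<and> C \<subseteq> W \<longrightarrow> (\<exists>K\<subseteq>C. jclique j K \<and> \<not> small (n2 C K))"
      using Qj unfolding Q_def by blast
    have "large W \<and> W \<subseteq> W" using W(1) by simp
    from W(2)[THEN spec, THEN mp, OF this] obtain K where "K \<subseteq> W" "jclique j K" by (elim exE conjE)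
    then show ?thesis using clique_bound[of K] large_sub[OF W(1)] by (auto simp: jclique_def)
  qed
  define j where "j = (GREATEST j. Q j)"
  have Qj: "Q j" unfolding j_def using \<open>Q 1\<close> bound by (rule GreatestI_nat)
  have "1 \<le> j" unfolding j_def using \<open>Q 1\<close> bound by (rule Greatest_le_nat)
  have "\<not> Q (Suc j)"
  proof
    assume "Q (Suc j)"
    then have "Suc j \<le> j" unfolding j_def using bound by (intro Greatest_le_nat)
    then show False by simp
  qed
  obtain W where W: "large W" "\<forall>C. large C \<and> C \<subseteq> W \<longrightarrow> (\<exists>K\<subseteq>C. jclique j K \<and> \<not> small (n2 C K))"
    using Qj unfolding Q_def by blast
  obtain W' where W': "large W'" "W' \<subseteq> W" "\<And>K. K \<subseteq> W' \<Longrightarrow> jclique (Suc j) K \<Longrightarrow> small (n2 W' K)"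
  proof -
    have "\<not> (\<forall>C. large C \<and> C \<subseteq> W \<longrightarrow> (\<exists>K\<subseteq>C. jclique (Suc j) K \<and> \<not> small (n2 C K)))"
    proof
      assume "\<forall>C. large C \<and> C \<subseteq> W \<longrightarrow> (\<exists>K\<subseteq>C. jclique (Suc j) K \<and> \<not> small (n2 C K))"
      with W(1) have "Q (Suc j)" unfolding Q_def by (intro exI[of _ W] conjI)
      then show False using \<open>\<not> Q (Suc j)\<close> by blast
    qed
    then obtain C where "large C" "C \<subseteq> W" "\<not> (\<exists>K\<subseteq>C. jclique (Suc j) K \<and> \<not> small (n2 C K))" by blast
    then show thesis using that[of C] by blast
  qed
  have "clique_world E V \<I> small \<omega> Np W' j"
  proof (unfold_locales)
    fix C assume "large C" "C \<subseteq> W'"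
    then show "\<exists>K\<subseteq>C. jclique j K \<and> \<not> small (n2 C K)" using W(2) W'(2) by blast
  next
    fix C p X
    assume "large C" "\<And>i. i < p \<Longrightarrow> X i \<in> \<I>"
      "\<And>C'. large C' \<Longrightarrow> C' \<subseteq> C \<Longrightarrow> \<exists>b\<in>C'. alive j p C X b"
    then show "\<exists>A\<subseteq>C. large A \<and> (\<forall>b\<in>A. alive j p C X b)" by (rule sat)
  next
    show "large W'" by (rule W'(1))
    show "1 \<le> j" by (rule \<open>1 \<le> j\<close>)
    fix K assume "K \<subseteq> W'" "jclique (Suc j) K"
    then show "small (n2 W' K)" by (rule W'(3))
  qed
  then show ?thesis by blast
qed

context clique_world
begin

definition site :: "nat \<Rightarrow> 'a set \<Rightarrow> (nat \<Rightarrow> 'a set) \<Rightarrow> bool" where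
  "site p C X \<longleftrightarrow> large C \<and> C \<subseteq> W \<and> (\<forall>i<p. X i \<in> \<I> \<and> X i \<subseteq> W \<and> covers (X i) C)"

definition subsite :: "nat \<Rightarrow> 'a set \<Rightarrow> (nat \<Rightarrow> 'a set) \<Rightarrow> 'a set \<Rightarrow> (nat \<Rightarrow> 'a set) \<Rightarrow> bool" where
  "subsite p C' X' C X \<longleftrightarrow> site p C' X' \<and> C' \<subseteq> C \<and> (\<forall>i<p. X' i \<subseteq> X i)"

text \<open>A cover \<open>Y\<close> is nested if, for each clique \<open>K\<close>, almost all vertices at distance two from \<open>K\<close> that
  have a neighbour outside \<open>N(K)\<close> in every \<open>X i\<close> satisfy \<open>N(d) \<inter> Y \<subseteq> N(K)\<close>. In a closed site, every
  choice of a clique produces such a cover; otherwise one more \<open>X i\<close> can be added to a rich site, and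
  repeating this yields a forbidden pattern.\<close>

definition nesting :: "nat \<Rightarrow> 'a set \<Rightarrow> (nat \<Rightarrow> 'a set) \<Rightarrow> 'a set \<Rightarrow> bool" where
  "nesting p C X Y \<longleftrightarrow> (\<forall>K. K \<subseteq> C \<and> jclique j K \<longrightarrow> small (kap p C X K \<inter> bad Y K))"

definition rich :: "nat \<Rightarrow> 'a set \<Rightarrow> (nat \<Rightarrow> 'a set) \<Rightarrow> bool" where
  "rich p C X \<longleftrightarrow> (\<forall>C' X'. subsite p C' X' C X \<longrightarrow> (\<exists>K\<subseteq>C'. jclique j K \<and> \<not> small (kap p C' X' K)))"

definition clique_step :: "nat \<Rightarrow> 'a set \<Rightarrow> (nat \<Rightarrow> 'a set) \<Rightarrow> 'a set \<Rightarrow> 'a set \<Rightarrow> (nat \<Rightarrow> 'a set) \<Rightarrow> bool" where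
  "clique_step p C X K C' X' \<longleftrightarrow> subsite p C' X' C X \<and> C' \<subseteq> kap p C X K \<and>
     (\<forall>c\<in>C'. \<forall>k\<in>K. \<not> near k c) \<and> (\<forall>i<p. \<exists>k\<in>K. \<forall>x\<in>X' i. \<not> E x k)"

definition closed :: "nat \<Rightarrow> 'a set \<Rightarrow> (nat \<Rightarrow> 'a set) \<Rightarrow> bool" where
  "closed p C X \<longleftrightarrow> (\<forall>C1 X1 K C2 X2. subsite p C1 X1 C X \<and> K \<subseteq> C1 \<and> jclique j K \<and> clique_step p C1 X1 K C2 X2 \<longrightarrow>
     (\<exists>C3 X3 Y. subsite p C3 X3 C2 X2 \<and> Y \<in> \<I> \<and> Y \<subseteq> C1 \<and> (\<forall>y\<in>Y. comp y K) \<and> covers Y C3 \<and> nesting p C3 X3 Y))"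

lemma W_V: "W \<subseteq> V"
  using W_large large_sub by blast

lemma site_sub: "site p C X \<Longrightarrow> C \<subseteq> V"
  using W_V by (auto simp: site_def)

lemma subsite_refl: "site p C X \<Longrightarrow> subsite p C X C X"
  by (simp add: subsite_def)

lemma subsite_trans: "subsite p C2 X2 C1 X1 \<Longrightarrow> subsite p C1 X1 C X \<Longrightarrow> subsite p C2 X2 C X"
  unfolding subsite_def by (meson order_trans)

lemma covers_mono: "covers Y C \<Longrightarrow> C' \<subseteq> C \<Longrightarrow> covers Y C'"
  by (auto simp: covers_def)

lemma site_shrink: "site p C X \<Longrightarrow> large C' \<Longrightarrow> C' \<subseteq> C \<Longrightarrow> site p C' X"
  unfolding site_def using covers_mono by blast

lemma nesting_mono:
  assumes "nesting p C X Y" "C' \<subseteq> C" "\<And>i. i < p \<Longrightarrow> X' i \<subseteq> X i" "Y' \<subseteq> Y"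
  shows "nesting p C' X' Y'"
  unfolding nesting_def
proof (intro allI impI)
  fix K assume K: "K \<subseteq> C' \<and> jclique j K"
  then have "K \<subseteq> C \<and> jclique j K" using assms(2) by blast
  then have sm: "small (kap p C X K \<inter> bad Y K)" by (rule assms(1)[unfolded nesting_def, THEN spec, THEN mp])
  have "kap p C' X' K \<subseteq> kap p C X K" using assms(2,3) by (rule kap_mono)
  then have "kap p C' X' K \<inter> bad Y' K \<subseteq> kap p C X K \<inter> bad Y K" using bad_mono[OF assms(4), of K] by blast
  then show "small (kap p C' X' K \<inter> bad Y' K)" by (rule small_sub[OF sm])
qed

lemma rich_mono: "rich p C X \<Longrightarrow> subsite p C' X' C X \<Longrightarrow> rich p C' X'"
  unfolding rich_def using subsite_trans[of p _ _ C' X' C X] by meson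

lemma kap_Int:
  assumes "site p C X" "K \<subseteq> C" "jclique j K"
  shows "kap p C X K \<in> \<I>"
  using assms W_V by (intro Int_kap) (auto simp: site_def large_def jclique_def)

text \<open>Every vertex of \<open>kap p C X K\<close> has, for each \<open>i\<close>, a neighbour
  in \<open>X i\<close> that misses some vertex of \<open>K\<close>. As \<open>K\<close> is finite,
  the same vertex of \<open>K\<close> works for a large set of them; treating the \<open>i\<close>
  in turn, \<open>X i\<close> is cut down to the vertices that miss it.\<close>

lemma exists_clique_step:
  assumes S: "site p C X" and K: "K \<subseteq> C" "jclique j K" and big: "\<not> small (kap p C X K)"
  shows "\<exists>C' X'. clique_step p C X K C' X'"
proof -
  have KV: "K \<subseteq> V" using K site_sub[OF S] by blast
  have finK: "finite K" using K by (simp add: jclique_def)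
  have XI: "X i \<in> \<I>" if "i < p" for i using S that by (simp add: site_def)
  have "\<exists>D \<phi>. large D \<and> D \<subseteq> kap p C X K \<and> (\<forall>i<m. \<phi> i \<in> K \<and> covers (X i - nbh {\<phi> i}) D)" if "m \<le> p" for m
    using that
  proof (induction m)
    case 0
    show ?case using big kap_Int[OF S K]
      by (intro exI[of _ "kap p C X K"]) (auto simp: large_def)
  next
    case (Suc m)
    then obtain D \<phi> where D: "large D" "D \<subseteq> kap p C X K" "\<forall>i<m. \<phi> i \<in> K \<and> covers (X i - nbh {\<phi> i}) D"
      by auto
    have mp: "m < p" using Suc.prems by simp
    have Dk: "D \<inter> nbh (X m - nbh {k}) \<in> \<I>" if "k \<in> K" for k
      using D(1) XI[OF mp] that KV by (intro Int_inter Int_nbh Int_Diff Int_single) (auto simp: large_def)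
    have "D \<subseteq> (\<Union>k\<in>K. D \<inter> nbh (X m - nbh {k}))"
    proof
      fix c assume c: "c \<in> D"
      then obtain y where y: "y \<in> X m" "E y c" "\<not> comp y K" "c \<in> V"
        using D(2) mp by (auto simp: kap_def bad_def)
      then obtain k where "k \<in> K" "\<not> E y k" by (auto simp: comp_def)
      then have "c \<in> nbh (X m - nbh {k})" using y E_sym by (auto simp: nbh_def)
      then show "c \<in> (\<Union>k\<in>K. D \<inter> nbh (X m - nbh {k}))" using \<open>k \<in> K\<close> c by blast
    qed
    then have "\<exists>k\<in>K. \<not> small (D \<inter> nbh (X m - nbh {k}))"
      using D(1) small_UN[OF finK, of "\<lambda>k. D \<inter> nbh (X m - nbh {k})"] small_sub
      unfolding large_def by blast
    then obtain k where k: "k \<in> K" "\<not> small (D \<inter> nbh (X m - nbh {k}))" by blast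
    have "covers (X m - nbh {k}) (D \<inter> nbh (X m - nbh {k}))" by (auto simp: covers_def nbh_def)
    then show ?case
      using D k Dk[OF k(1)] covers_mono
      by (intro exI[of _ "D \<inter> nbh (X m - nbh {k})"] exI[of _ "\<phi>(m := k)"])
        (auto simp: large_def less_Suc_eq)
  qed
  from this[of p] obtain D \<phi> where D: "large D" "D \<subseteq> kap p C X K"
    "\<forall>i<p. \<phi> i \<in> K \<and> covers (X i - nbh {\<phi> i}) D" by auto
  define C' where "C' = D - zone K"
  have C': "large C'" unfolding C'_def using D(1) finK KV by (rule large_avoid)
  have sub: "C' \<subseteq> D" by (auto simp: C'_def)
  have C'C: "C' \<subseteq> C" using sub D(2) kap_sub by blast
  have XV: "X i \<subseteq> W" if "i < p" for i using S that by (simp add: site_def)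
  have "clique_step p C X K C' (\<lambda>i. X i - nbh {\<phi> i})"
    unfolding clique_step_def subsite_def site_def
  proof (intro conjI allI impI ballI)
    show "large C'" by (rule C')
    show "C' \<subseteq> W" using C'C S by (auto simp: site_def)
    show "C' \<subseteq> C" by (rule C'C)
    show "C' \<subseteq> kap p C X K" using sub D(2) by blast
    fix i assume i: "i < p"
    have \<phi>: "\<phi> i \<in> K" using D(3) i by blast
    show "X i - nbh {\<phi> i} \<in> \<I>" using XI[OF i] \<phi> KV by (intro Int_Diff Int_nbh Int_single) auto
    show "X i - nbh {\<phi> i} \<subseteq> W" using XV[OF i] by blast
    show "covers (X i - nbh {\<phi> i}) C'" using D(3) i sub covers_mono by blast
    show "\<exists>k\<in>K. \<forall>x\<in>X i - nbh {\<phi> i}. \<not> E x k"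
      using \<phi> XV[OF i] W_V E_sym by (intro bexI[of _ "\<phi> i"]) (auto simp: nbh_def)
  next
    fix c k assume "c \<in> C'" "k \<in> K"
    then show "\<not> near k c" using zone_near[of c K k] large_sub[OF C'] by (auto simp: C'_def)
  qed auto
  then show ?thesis by blast
qed

text \<open>A record of failed attempts to find a closed site. The vertex \<open>z i h k\<close> joins \<open>k \<in> Kf h\<close> to the
  earlier clique \<open>Kf i\<close>; \<open>a i h\<close> is a vertex of \<open>Kf h\<close> without neighbours in \<open>X i\<close>.\<close>

definition chain ::
  "nat \<Rightarrow> 'a set \<Rightarrow> (nat \<Rightarrow> 'a set) \<Rightarrow> (nat \<Rightarrow> 'a set) \<Rightarrow> (nat \<Rightarrow> nat \<Rightarrow> 'a) \<Rightarrow> (nat \<Rightarrow> nat \<Rightarrow> 'a \<Rightarrow> 'a) \<Rightarrow> bool" where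
  "chain p C X Kf a z \<longleftrightarrow> site p C X \<and> rich p C X \<and>
     (\<forall>i<p. jclique j (Kf i) \<and> Kf i \<subseteq> W \<and> (\<forall>c\<in>C. \<forall>k\<in>Kf i. \<not> near k c)) \<and>
     (\<forall>i<p. \<forall>x\<in>X i. comp x (Kf i)) \<and>
     (\<forall>h<p. \<forall>i<h. a i h \<in> Kf h \<and> (\<forall>x\<in>X i. \<not> E x (a i h)) \<and> (\<forall>k\<in>Kf i. \<forall>k'\<in>Kf h. \<not> E k k') \<and>
        (\<forall>x\<in>X h. \<forall>k\<in>Kf i. \<not> near x k)) \<and>
     (\<forall>h<p. \<forall>i<h. \<forall>k\<in>Kf h. z i h k \<in> W \<and> E (z i h k) k \<and> comp (z i h k) (Kf i) \<and>
        (\<forall>c\<in>C. \<not> near (z i h k) c) \<and>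
        (\<forall>g<p. g < i \<or> h < g \<longrightarrow> (\<forall>k'\<in>Kf g. \<not> near (z i h k) k')) \<and>
        (\<forall>g<h. i < g \<longrightarrow> \<not> near (z i h k) (a i g)))"

context
  fixes p C X Kf a z
  assumes ch: "chain p C X Kf a z"
begin

lemma chain1:
  assumes "i < p"
  shows "jclique j (Kf i) \<and> Kf i \<subseteq> W \<and> (\<forall>c\<in>C. \<forall>k\<in>Kf i. \<not> near k c)"
  by (rule ch[unfolded chain_def, THEN conjunct2, THEN conjunct2, THEN conjunct1,
        THEN spec, THEN mp, OF assms])

lemma chain2:
  assumes "i < p" "x \<in> X i"
  shows "comp x (Kf i)"
  by (rule ch[unfolded chain_def, THEN conjunct2, THEN conjunct2, THEN conjunct2, THEN conjunct1,
        THEN spec, THEN mp, OF assms(1), THEN bspec, OF assms(2)])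

lemma chain3:
  assumes "h < p" "i < h"
  shows "a i h \<in> Kf h \<and> (\<forall>x\<in>X i. \<not> E x (a i h)) \<and> (\<forall>k\<in>Kf i. \<forall>k'\<in>Kf h. \<not> E k k') \<and>
        (\<forall>x\<in>X h. \<forall>k\<in>Kf i. \<not> near x k)"
  by (rule ch[unfolded chain_def, THEN conjunct2, THEN conjunct2, THEN conjunct2, THEN conjunct2,
        THEN conjunct1, THEN spec, THEN mp, OF assms(1), THEN spec, THEN mp, OF assms(2)])

lemma chain4:
  assumes "h < p" "i < h" "k \<in> Kf h"
  shows "z i h k \<in> W \<and> E (z i h k) k \<and> comp (z i h k) (Kf i) \<and>
        (\<forall>c\<in>C. \<not> near (z i h k) c) \<and>
        (\<forall>g<p. g < i \<or> h < g \<longrightarrow> (\<forall>k'\<in>Kf g. \<not> near (z i h k) k')) \<and>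
        (\<forall>g<h. i < g \<longrightarrow> \<not> near (z i h k) (a i g))"
  by (rule ch[unfolded chain_def, THEN conjunct2, THEN conjunct2, THEN conjunct2, THEN conjunct2,
        THEN conjunct2, THEN spec, THEN mp, OF assms(1), THEN spec, THEN mp, OF assms(2),
        THEN bspec, OF assms(3)])

end

text \<open>Failure of closedness yields a clique \<open>K\<close> such that no cover by vertices of
  \<open>C1\<close> complete to \<open>K\<close> becomes nested on a subsite of \<open>C2\<close>.
  Hence adding the cover \<open>Y\<close> of all these vertices as \<open>X p\<close> preserves
  richness. The new connecting vertices are taken from the covers \<open>X1 i\<close> and are
  therefore complete to the earlier cliques \<open>Kf i\<close>.\<close>

lemma chain_step:
  assumes ch: "chain p C X Kf a z" and ncl: "\<not> closed p C X"
  shows "\<exists>C X Kf a z. chain (Suc p) C X Kf a z"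
proof -
  have S: "site p C X" and R: "rich p C X" using ch by (simp_all add: chain_def)
  note k1 = chain1[OF ch] and k2 = chain2[OF ch] and k3 = chain3[OF ch] and k4 = chain4[OF ch]
  from ncl obtain C1 X1 K C2 X2 where
    s1: "subsite p C1 X1 C X" and K: "K \<subseteq> C1" "jclique j K" and st: "clique_step p C1 X1 K C2 X2"
    and none: "\<And>C3 X3 Y. subsite p C3 X3 C2 X2 \<Longrightarrow> Y \<in> \<I> \<Longrightarrow> Y \<subseteq> C1 \<Longrightarrow> (\<forall>y\<in>Y. comp y K) \<Longrightarrow>
        covers Y C3 \<Longrightarrow> \<not> nesting p C3 X3 Y"
    unfolding closed_def by blast
  have site1: "site p C1 X1" and C1C: "C1 \<subseteq> C" and X1X: "\<And>i. i < p \<Longrightarrow> X1 i \<subseteq> X i"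
    using s1 by (auto simp: subsite_def)
  have s2: "subsite p C2 X2 C1 X1" and C2k: "C2 \<subseteq> kap p C1 X1 K" and C2K: "\<And>c k. c \<in> C2 \<Longrightarrow> k \<in> K \<Longrightarrow> \<not> near k c"
    and av: "\<And>i. i < p \<Longrightarrow> \<exists>k\<in>K. \<forall>x\<in>X2 i. \<not> E x k"
    using st unfolding clique_step_def by blast+
  have site2: "site p C2 X2" and C2C1: "C2 \<subseteq> C1" and X2X1: "\<And>i. i < p \<Longrightarrow> X2 i \<subseteq> X1 i"
    using s2 by (auto simp: subsite_def)
  have finK: "finite K" using K by (simp add: jclique_def)
  have C1W: "C1 \<subseteq> W" using site1 by (simp add: site_def)
  have KV: "K \<subseteq> V" using K C1W W_V by blast
  define Y where "Y = {y \<in> C1. comp y K}"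
  have YI: "Y \<in> \<I>" unfolding Y_def using site1 finK KV by (intro Int_comp) (auto simp: site_def large_def)
  have Ycov: "covers Y C2" using C2k by (auto simp: covers_def Y_def kap_def n2_def)
  have "\<forall>i k. \<exists>x. i < p \<and> k \<in> K \<longrightarrow> x \<in> X1 i \<and> E x k"
    using site1 K(1) unfolding site_def covers_def by blast
  then obtain zz where zz: "\<And>i k. i < p \<Longrightarrow> k \<in> K \<Longrightarrow> zz i k \<in> X1 i \<and> E (zz i k) k" by metis
  obtain aa where aa: "\<And>i. i < p \<Longrightarrow> aa i \<in> K \<and> (\<forall>x\<in>X2 i. \<not> E x (aa i))" using av by metis
  define F where "F = (\<lambda>(i, k). zz i k) ` ({..<p} \<times> K)"
  have FW: "F \<subseteq> W" using zz site1 unfolding F_def site_def by fastforce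
  have finF: "finite F" unfolding F_def using finK by simp
  define C' where "C' = C2 - zone F"
  have C': "large C'" unfolding C'_def
    using site2 finF FW W_V by (intro large_avoid) (auto simp: site_def)
  have C'C2: "C' \<subseteq> C2" by (auto simp: C'_def)
  have C'F: "\<not> near (zz i k) c" if "c \<in> C'" "i < p" "k \<in> K" for c i k
  proof (rule zone_near)
    show "c \<in> V" using that large_sub[OF C'] by blast
    show "c \<notin> zone F" using that by (simp add: C'_def)
    show "zz i k \<in> F" using that unfolding F_def by force
  qed
  define X' where "X' = X2(p := Y)"
  have X'i: "X' i \<subseteq> X1 i" "X' i \<subseteq> X i" "X' i = X2 i" if "i < p" for i
    using that X2X1 X1X by (auto simp: X'_def)
  have X'p: "X' p = Y" by (simp add: X'_def)
  have siteS: "site (Suc p) C' X'"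
    unfolding site_def
  proof (intro conjI allI impI)
    show "C' \<subseteq> W" using C'C2 C2C1 C1W by blast
    fix i assume "i < Suc p"
    then consider "i < p" | "i = p" by linarith
    then have "X' i \<in> \<I> \<and> X' i \<subseteq> W \<and> covers (X' i) C'"
    proof cases
      case 1
      then show ?thesis
        using site2 covers_mono[OF _ C'C2] X'i(3) unfolding site_def by auto
    next
      case 2
      then show ?thesis
        using YI Y_def C1W covers_mono[OF Ycov C'C2] X'p by auto
    qed
    then show "X' i \<in> \<I>" "X' i \<subseteq> W" "covers (X' i) C'" by blast+
  qed (rule C')
  have richS: "rich (Suc p) C' X'"
    unfolding rich_def
  proof (intro allI impI)
    fix C3 X3 assume s3: "subsite (Suc p) C3 X3 C' X'"
    have "subsite p C3 X3 C2 X2"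
      unfolding subsite_def site_def
    proof (intro conjI allI impI)
      show "C3 \<subseteq> C2" using s3 C'C2 by (auto simp: subsite_def)
      fix i assume i: "i < p"
      then have "X3 i \<subseteq> X' i" using s3 by (simp add: subsite_def)
      then show "X3 i \<subseteq> X2 i" using X'i(3)[OF i] by simp
    qed (use s3 in \<open>auto simp: subsite_def site_def\<close>)
    moreover have "X3 p \<in> \<I>" "X3 p \<subseteq> Y" "covers (X3 p) C3"
      using s3 X'p unfolding subsite_def site_def by auto
    ultimately have "\<not> nesting p C3 X3 (X3 p)"
      using none[of C3 X3 "X3 p"] unfolding Y_def by blast
    then obtain K3 where "K3 \<subseteq> C3" "jclique j K3" "\<not> small (kap p C3 X3 K3 \<inter> bad (X3 p) K3)"
      unfolding nesting_def by blast
    moreover have "kap p C3 X3 K3 \<inter> bad (X3 p) K3 = kap (Suc p) C3 X3 K3"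
      by (auto simp: kap_def less_Suc_eq)
    ultimately show "\<exists>K\<subseteq>C3. jclique j K \<and> \<not> small (kap (Suc p) C3 X3 K)" by auto
  qed
  define Kf' where "Kf' = Kf(p := K)"
  define a' where "a' = (\<lambda>i h. if h = p then aa i else a i h)"
  define z' where "z' = (\<lambda>i h k. if h = p then zz i k else z i h k)"
  have KC: "K \<subseteq> C" using K C1C by blast
  have C'C: "C' \<subseteq> C" using C'C2 C2C1 C1C by blast
  have Xp: "\<not> near x k" if "x \<in> Y" "i < p" "k \<in> Kf i" for x i k
    using that k1[OF that(2)] C1C near_sym unfolding Y_def by blast
  have KK: "\<not> E k k'" if "i < p" "k \<in> Kf i" "k' \<in> K" for i k k'
    using k1[OF that(1)] that KC unfolding near_def by blast
  have "chain (Suc p) C' X' Kf' a' z'"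
    unfolding chain_def
  proof (intro conjI)
    show "\<forall>i<Suc p. jclique j (Kf' i) \<and> Kf' i \<subseteq> W \<and> (\<forall>c\<in>C'. \<forall>k\<in>Kf' i. \<not> near k c)"
      using k1 K C1W C2K C'C2 C'C by (auto simp: less_Suc_eq Kf'_def)
    show "\<forall>i<Suc p. \<forall>x\<in>X' i. comp x (Kf' i)"
      using k2 X'i(2) X'p by (auto simp: less_Suc_eq Kf'_def Y_def)
    show "\<forall>h<Suc p. \<forall>i<h. a' i h \<in> Kf' h \<and> (\<forall>x\<in>X' i. \<not> E x (a' i h)) \<and> (\<forall>k\<in>Kf' i. \<forall>k'\<in>Kf' h. \<not> E k k') \<and>
        (\<forall>x\<in>X' h. \<forall>k\<in>Kf' i. \<not> near x k)"
    proof (intro allI impI)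
      fix h i assume h: "h < Suc p" "i < h"
      then consider "h < p" | "h = p" by linarith
      then show "a' i h \<in> Kf' h \<and> (\<forall>x\<in>X' i. \<not> E x (a' i h)) \<and> (\<forall>k\<in>Kf' i. \<forall>k'\<in>Kf' h. \<not> E k k') \<and>
        (\<forall>x\<in>X' h. \<forall>k\<in>Kf' i. \<not> near x k)"
      proof cases
        case 1
        then have "a' i h = a i h" "Kf' h = Kf h" "Kf' i = Kf i" "X' i \<subseteq> X i" "X' h \<subseteq> X h"
          using h X'i by (auto simp: a'_def Kf'_def)
        then show ?thesis using k3[OF 1 h(2)] by auto
      next
        case 2
        then have "a' i h = aa i" "Kf' h = K" "Kf' i = Kf i" "X' i = X2 i" "X' h = Y" "i < p"
          using h X'i X'p by (auto simp: a'_def Kf'_def)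
        then show ?thesis using aa KK Xp by auto
      qed
    qed
    show "\<forall>h<Suc p. \<forall>i<h. \<forall>k\<in>Kf' h. z' i h k \<in> W \<and> E (z' i h k) k \<and> comp (z' i h k) (Kf' i) \<and>
        (\<forall>c\<in>C'. \<not> near (z' i h k) c) \<and>
        (\<forall>g<Suc p. g < i \<or> h < g \<longrightarrow> (\<forall>k'\<in>Kf' g. \<not> near (z' i h k) k')) \<and>
        (\<forall>g<h. i < g \<longrightarrow> \<not> near (z' i h k) (a' i g))"
    proof (intro allI impI ballI)
      fix h i k assume h: "h < Suc p" "i < h" "k \<in> Kf' h"
      then consider "h < p" | "h = p" by linarith
      then show "z' i h k \<in> W \<and> E (z' i h k) k \<and> comp (z' i h k) (Kf' i) \<and>
        (\<forall>c\<in>C'. \<not> near (z' i h k) c) \<and>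
        (\<forall>g<Suc p. g < i \<or> h < g \<longrightarrow> (\<forall>k'\<in>Kf' g. \<not> near (z' i h k) k')) \<and>
        (\<forall>g<h. i < g \<longrightarrow> \<not> near (z' i h k) (a' i g))"
      proof cases
        case 1
        then have eq: "z' i h k = z i h k" "Kf' i = Kf i" "k \<in> Kf h"
          using h by (auto simp: z'_def Kf'_def)
        have aeq: "a' i g = a i g" if "g < h" for g using that 1 by (simp add: a'_def)
        note k = k4[OF 1 h(2) eq(3)]
        have "\<not> near (z i h k) k'" if g: "g < Suc p" "g < i \<or> h < g" "k' \<in> Kf' g" for g k'
        proof (cases "g = p")
          case True
          then show ?thesis using k g KC by (auto simp: Kf'_def)
        next
          case False
          then have "g < p" "k' \<in> Kf g" using g by (auto simp: Kf'_def)
          then show ?thesis using k g by blast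
        qed
        then show ?thesis unfolding eq using k aeq C'C by auto
      next
        case 2
        then have eq: "z' i h k = zz i k" "Kf' i = Kf i" "k \<in> K" "i < p"
          using h by (auto simp: z'_def Kf'_def)
        have zX: "zz i k \<in> X1 i" "zz i k \<in> X i" using zz[OF eq(4,3)] X1X[OF eq(4)] by auto
        have zW: "zz i k \<in> W" using zX(1) site1 eq(4) by (auto simp: site_def)
        have c: "comp (zz i k) (Kf i)" using k2[OF eq(4) zX(2)] .
        have lower: "\<not> near (zz i k) k'" if g: "g < Suc p" "g < i \<or> h < g" "k' \<in> Kf' g" for g k'
        proof -
          have "g < i" using g 2 by auto
          then have "k' \<in> Kf g" using g eq(4) by (auto simp: Kf'_def)
          then show ?thesis using k3[OF eq(4) \<open>g < i\<close>] zX(2) by blast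
        qed
        have middle: "\<not> near (zz i k) (a' i g)" if g: "g < h" "i < g" for g
        proof
          assume nr: "near (zz i k) (a' i g)"
          have gp: "g < p" and ag: "a' i g = a i g" using g 2 by (auto simp: a'_def)
          have "\<not> E (zz i k) (a i g)" using k3[OF gp g(2)] zX(2) by blast
          then have zeq: "zz i k = a i g" using nr ag by (simp add: near_def)
          have "card (Kf i) = j" using k1[OF eq(4)] by (simp add: jclique_def)
          then obtain k0 where k0: "k0 \<in> Kf i" using j_pos by fastforce
          then have "E (a i g) k0" using c zeq by (auto simp: comp_def)
          then have "E k0 (a i g)" by (rule E_sym)
          then show False using k3[OF gp g(2)] k0 by blast
        qed
        show ?thesis unfolding eq
          using zW zz[OF eq(4,3)] c C'F eq lower middle by blast
      qed
    qed
  qed (rule siteS, rule richS)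
  then show ?thesis by blast
qed

text \<open>Only the vertex \<open>a i g\<close> of an intermediate clique \<open>Kf g\<close> is
  known to be avoided by \<open>z i h k\<close>. When the vertices of each clique are numbered,
  Ramsey's theorem makes the number of \<open>a i g\<close> constant; the vertices with this number
  become the branch vertices of a forbidden pattern, and the \<open>z\<close> its subdivision
  vertices.\<close>

lemma chain_bounded: "\<exists>N. \<forall>p C X Kf a z. chain p C X Kf a z \<longrightarrow> p < N"
proof -
  obtain N where N: "\<And>H P. finite H \<Longrightarrow> N \<le> card (H::nat set) \<Longrightarrow>
     \<exists>H'\<subseteq>H. card H' = Np + 2 \<and> (\<forall>t<j. (\<forall>X\<in>[H']\<^bsup>2\<^esup>. P t X) \<or> (\<forall>X\<in>[H']\<^bsup>2\<^esup>. \<not> P t X))"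
    using ramsey_simultaneous[of "Np + 2" j 2] by metis
  have False if ch: "chain p C X Kf a z" and p: "N \<le> p" for p C X Kf a z
  proof -
    note k1 = chain1[OF ch] and k3 = chain3[OF ch] and k4 = chain4[OF ch]
    have "\<exists>e. bij_betw e {..<j} (Kf g)" if "g < p" for g
      using k1[OF that] ex_bij_betw_nat_finite[of "Kf g"] lessThan_atLeast0 by (auto simp: jclique_def)
    then obtain e where e: "\<And>g. g < p \<Longrightarrow> bij_betw (e g) {..<j} (Kf g)" by metis
    have "\<exists>t<j. a i h = e h t" if "h < p" "i < h" for h i
    proof -
      have "a i h \<in> e h ` {..<j}"
        using k3[OF that] bij_betw_imp_surj_on[OF e[OF that(1)]] by simp
      then show ?thesis by auto
    qed
    then have "\<forall>i h. \<exists>t. h < p \<and> i < h \<longrightarrow> t < j \<and> a i h = e h t" by blast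
    then obtain \<alpha> where "\<forall>i h. h < p \<and> i < h \<longrightarrow> \<alpha> i h < j \<and> a i h = e h (\<alpha> i h)" by metis
    then have \<alpha>: "\<And>i h. h < p \<Longrightarrow> i < h \<Longrightarrow> \<alpha> i h < j \<and> a i h = e h (\<alpha> i h)" by blast
    obtain H where H: "H \<subseteq> {..<p}" "card H = Np + 2"
      "\<And>t. t < j \<Longrightarrow> (\<forall>X\<in>[H]\<^bsup>2\<^esup>. \<alpha> (Min X) (Max X) = t) \<or> (\<forall>X\<in>[H]\<^bsup>2\<^esup>. \<alpha> (Min X) (Max X) \<noteq> t)"
      using N[of "{..<p}" "\<lambda>t X. \<alpha> (Min X) (Max X) = t"] p by auto
    have finH: "finite H" using H finite_subset by blast
    define q where "q = (\<lambda>i. sorted_list_of_set H ! i)"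
    have qH: "q i \<in> H" if "i < Np + 2" for i
      unfolding q_def using that H(2) finH nth_mem[of i "sorted_list_of_set H"] by simp
    have qless: "q i < q l" if "i < l" "l < Np + 2" for i l
      unfolding q_def using that H(2) finH sorted_wrt_nth_less[OF strict_sorted_list_of_set[of H]] by simp
    have qp: "q i < p" if "i < Np + 2" for i using qH[OF that] H(1) by blast
    have pr: "{q i, q l} \<in> [H]\<^bsup>2\<^esup> \<and> Min {q i, q l} = q i \<and> Max {q i, q l} = q l"
      if "i < l" "l < Np + 2" for i l
      using that qH qless[OF that] by auto
    \<comment> \<open>Reading off the constant requires a pair of indices, hence
      \<open>Np + 2\<close> instead of \<open>Np\<close>.\<close>
    define t where "t = \<alpha> (q 0) (q 1)"
    have t: "t < j" unfolding t_def using \<alpha>[of "q 1" "q 0"] qp[of 1] qless[of 0 1] by auto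
    have hom: "\<alpha> (q i) (q l) = t" if "i < l" "l < Np + 2" for i l
    proof -
      have p01: "{q 0, q 1} \<in> [H]\<^bsup>2\<^esup> \<and> Min {q 0, q 1} = q 0 \<and> Max {q 0, q 1} = q 1" by (rule pr) auto
      then have "\<alpha> (Min {q 0, q 1}) (Max {q 0, q 1}) = t" unfolding t_def by metis
      with p01 have "\<forall>X\<in>[H]\<^bsup>2\<^esup>. \<alpha> (Min X) (Max X) = t" using H(3)[OF t] by blast
      from bspec[OF this conjunct1[OF pr[OF that]]] show ?thesis using pr[OF that] by simp
    qed
    define w where "w = (\<lambda>i. e (q i) t)"
    have wK: "w i \<in> Kf (q i)" if "i < Np + 2" for i
      unfolding w_def using bij_betwE[OF e[OF qp[OF that]]] t by auto
    have aw: "a (q i) (q l) = w l" if "i < l" "l < Np + 2" for i l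
      unfolding w_def using \<alpha>[of "q l" "q i"] hom[OF that] qp[OF that(2)] qless[OF that] by auto
    have "pattern E V {..<Np} w (\<lambda>i h. z (q i) (q h) (w h))"
      unfolding pattern_def
    proof (intro conjI ballI impI)
      fix i assume "i \<in> {..<Np}"
      then show "w i \<in> V" using wK[of i] k1[OF qp[of i]] W_V by auto
    next
      fix i h assume "i \<in> {..<Np}" "h \<in> {..<Np}" and ih: "i < h"
      then have h: "h < Np + 2" by simp
      note k = k4[OF qp[OF h] qless[OF ih h] wK[OF h]]
      show "z (q i) (q h) (w h) \<in> V" using k W_V by blast
      fix l assume "l \<in> {..<Np}"
      then have l: "l < Np + 2" by simp
      have i: "i < Np + 2" using ih h by simp
      consider "l = i" | "l = h" | "l < i" | "i < l" "l < h" | "h < l" by linarith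
      then show "(z (q i) (q h) (w h) = w l \<or> E (z (q i) (q h) (w h)) (w l)) \<longleftrightarrow> l = i \<or> l = h"
      proof cases
        case 1
        then show ?thesis using k wK[OF l] by (auto simp: comp_def)
      next
        case 2
        then show ?thesis using k by blast
      next
        case 3
        then have "\<not> near (z (q i) (q h) (w h)) (w l)" using k wK[OF l] qp[OF l] qless[OF 3 i] by blast
        then show ?thesis using 3 ih by (auto simp: near_def)
      next
        case 4
        then have "\<not> near (z (q i) (q h) (w h)) (a (q i) (q l))"
          using k qless[OF 4(1) l] qless[OF 4(2) h] by blast
        then show ?thesis using 4 aw[OF 4(1) l] by (auto simp: near_def)
      next
        case 5
        then have "\<not> near (z (q i) (q h) (w h)) (w l)" using k wK[OF l] qp[OF l] qless[OF 5 l] by blast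
        then show ?thesis using 5 ih by (auto simp: near_def)
      qed
    qed
    then show False using pattern_free by blast
  qed
  then show ?thesis by (meson not_less)
qed

lemma exists_closed_site: "\<exists>p C X. site p C X \<and> rich p C X \<and> closed p C X"
proof (rule ccontr)
  assume neg: "\<not> ?thesis"
  have "\<exists>C X Kf a z. chain p C X Kf a z" for p
  proof (induction p)
    case 0
    have "site 0 W X" for X using W_large by (simp add: site_def)
    moreover have "rich 0 W X" for X
      unfolding rich_def
    proof (intro allI impI)
      fix C' X' assume "subsite 0 C' X' W X"
      then obtain K where "K \<subseteq> C'" "jclique j K" "\<not> small (n2 C' K)"
        using heavy[of C'] by (auto simp: subsite_def site_def)
      moreover have "kap 0 C' X' K = n2 C' K" for K by (simp add: kap_def)
      ultimately show "\<exists>K\<subseteq>C'. jclique j K \<and> \<not> small (kap 0 C' X' K)" by auto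
    qed
    ultimately show ?case by (auto simp: chain_def)
  next
    case (Suc p)
    then obtain C X Kf a z where ch: "chain p C X Kf a z" by blast
    then have "site p C X" "rich p C X" by (auto simp: chain_def)
    then have "\<not> closed p C X" using neg by blast
    then show ?case using chain_step[OF ch] by blast
  qed
  note ex = this
  obtain N where N: "\<forall>p C X Kf a z. chain p C X Kf a z \<longrightarrow> p < N" using chain_bounded by (elim exE)
  from ex[of N] obtain C X Kf a z where "chain N C X Kf a z" by (elim exE)
  with N have "N < N" by blast
  then show False by simp
qed

end


section \<open>Forks\<close>

locale closed_world = clique_world +
  fixes p :: nat and C0 :: "'a set" and X0 :: "nat \<Rightarrow> 'a set"
  assumes base_site: "site p C0 X0" and base_rich: "rich p C0 X0" and base_closed: "closed p C0 X0"
begin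

definition region :: "'a set \<Rightarrow> (nat \<Rightarrow> 'a set) \<Rightarrow> 'a set set \<Rightarrow> bool" where
  "region C X \<Y> \<longleftrightarrow> subsite p C X C0 X0 \<and> finite \<Y> \<and>
     (\<forall>Y\<in>\<Y>. Y \<in> \<I> \<and> Y \<subseteq> W \<and> covers Y C \<and> nesting p C X Y)"

text \<open>The clique \<open>K\<close> separates two kinds of region. In \<open>C1\<close>
  neighbours in covers are complete to \<open>K\<close>; in \<open>C2\<close> they see
  \<open>b\<close> but are not complete to \<open>K\<close>. With \<open>b\<close> in the role of
  \<open>NewB a v\<close>, the first kind serves \<open>Copy a v\<close> and the second
  \<open>NewC a v\<close>. \<open>K\<close> itself is not embedded.\<close>

definition fork ::
  "'a set \<Rightarrow> (nat \<Rightarrow> 'a set) \<Rightarrow> 'a set set \<Rightarrow> 'a set \<Rightarrow> (nat \<Rightarrow> 'a set) \<Rightarrow> 'a set \<Rightarrow> 'a set \<Rightarrow> bool" where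
  "fork C X \<Y> C1 X1 T K \<longleftrightarrow> region C1 X1 (insert T \<Y>) \<and> C1 \<subseteq> C \<and> T \<subseteq> C \<and> small T \<and> K \<subseteq> C \<and> jclique j K \<and>
     (\<forall>Y\<in>insert T \<Y>. \<forall>c\<in>C1. \<forall>y\<in>Y. E y c \<longrightarrow> comp y K) \<and> (\<forall>c\<in>C1. \<forall>k\<in>K. \<not> near k c) \<and>
     (\<forall>b\<in>T. comp b K \<longrightarrow> (\<exists>C2 X2. region C2 X2 \<Y> \<and> C2 \<subseteq> C \<and>
        (\<forall>Y\<in>\<Y>. \<forall>c\<in>C2. \<forall>y\<in>Y. E y c \<longrightarrow> E y b \<and> \<not> comp y K)))"

lemma region_site: "region C X \<Y> \<Longrightarrow> site p C X"
  by (simp add: region_def subsite_def)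

lemma region_large: "region C X \<Y> \<Longrightarrow> large C"
  by (simp add: region_def subsite_def site_def)

lemma region_W: "region C X \<Y> \<Longrightarrow> C \<subseteq> W"
  by (simp add: region_def subsite_def site_def)

lemma region_shrink:
  assumes "region C X \<Y>" "large C'" "C' \<subseteq> C"
  shows "region C' X \<Y>"
  unfolding region_def
proof (intro conjI ballI)
  show "subsite p C' X C0 X0"
    using assms site_shrink[of p C X C'] unfolding region_def subsite_def by blast
  fix Y assume Y: "Y \<in> \<Y>"
  then show "Y \<in> \<I>" "Y \<subseteq> W" "covers Y C'"
    using assms covers_mono[OF _ assms(3)] by (auto simp: region_def)
  show "nesting p C' X Y"
    by (rule nesting_mono[of p C X Y]) (use assms Y in \<open>auto simp: region_def\<close>)
qed (use assms in \<open>simp add: region_def\<close>)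

lemma region_anti: "region C X \<Y> \<Longrightarrow> \<Z> \<subseteq> \<Y> \<Longrightarrow> region C X \<Z>"
  unfolding region_def by (auto intro: finite_subset)

text \<open>If \<open>b\<close> is complete to a clique \<open>K\<close> of size \<open>j\<close> in
  \<open>W\<close>, this is the second neighbourhood of a clique of size \<open>j + 1\<close> and
  hence small. A vertex of \<open>W\<close> outside it has no neighbour in \<open>W\<close> that is
  complete to \<open>K\<close> and sees \<open>b\<close>.\<close>

definition shadow :: "'a \<Rightarrow> 'a set \<Rightarrow> 'a set" where
  "shadow b K = n2 W (insert b K)"

lemma shadow_Int_small:
  assumes "K \<subseteq> W" "jclique j K" "b \<in> W" "comp b K"
  shows "shadow b K \<in> \<I>" "small (shadow b K)"
proof -
  have fin: "finite K" and card: "card K = j" and cl: "complete_set E K"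
    using assms(2) by (auto simp: jclique_def)
  have "b \<notin> K" using assms(4) E_irrefl by (auto simp: comp_def)
  then have c: "card (insert b K) = Suc j" using fin card by simp
  have cb: "complete_set E (insert b K)"
    unfolding complete_set_def
  proof (intro ballI impI)
    fix u v assume "u \<in> insert b K" "v \<in> insert b K" "u \<noteq> v"
    then consider "u = b" "v \<in> K" | "v = b" "u \<in> K" | "u \<in> K" "v \<in> K" by blast
    then show "E u v"
    proof cases
      case 1
      then show ?thesis using assms(4) by (simp add: comp_def)
    next
      case 2
      then show ?thesis using assms(4) E_sym by (simp add: comp_def)
    next
      case 3
      then show ?thesis using cl \<open>u \<noteq> v\<close> by (simp add: complete_set_def)
    qed
  qed
  have s: "insert b K \<subseteq> W" using assms by blast
  show "shadow b K \<in> \<I>"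
    unfolding shadow_def using s W_V W_large fin by (intro Int_n2) (auto simp: large_def)
  have "jclique (Suc j) (insert b K)" using c cb fin by (simp add: jclique_def)
  then show "small (shadow b K)" unfolding shadow_def by (rule light[OF s])
qed

lemma shadow_avoid: "c \<in> W \<Longrightarrow> c \<notin> shadow b K \<Longrightarrow> z \<in> W \<Longrightarrow> E z c \<Longrightarrow> comp z K \<Longrightarrow> \<not> E z b"
  by (auto simp: shadow_def n2_def comp_def)

text \<open>The vertices of \<open>T\<close> are taken from the alive ones, that is, each of them has its own
  clique in \<open>C\<close> with a large region. The clique \<open>K\<close> is chosen after \<open>T\<close>; since it is complete to the
  relevant part of \<open>T\<close>, lightness separates the region of \<open>b \<in> T\<close> from that of \<open>K\<close>.\<close>

lemma fork_exists:
  assumes reg: "region C X \<Y>"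
  shows "\<exists>C1 X1 T K. fork C X \<Y> C1 X1 T K"
proof -
  have S: "site p C X" and sub0: "subsite p C X C0 X0" and fin\<Y>: "finite \<Y>"
    and \<Y>: "\<And>Y. Y \<in> \<Y> \<Longrightarrow> Y \<in> \<I> \<and> Y \<subseteq> W \<and> covers Y C \<and> nesting p C X Y"
    using reg region_site by (auto simp: region_def)
  have CW: "C \<subseteq> W" and LC: "large C" using reg region_W region_large by auto
  have rich: "rich p C X" using base_rich sub0 by (rule rich_mono)
  have XI: "X i \<in> \<I>" if "i < p" for i using S that by (simp add: site_def)
  have "\<exists>A\<subseteq>C. large A \<and> (\<forall>b\<in>A. alive j p C X b)"
  proof (rule saturation[OF LC XI])
    fix C' assume C': "large C'" "C' \<subseteq> C"
    have "subsite p C' X C X" using site_shrink[OF S C'] C' by (simp add: subsite_def)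
    then obtain K where K: "K \<subseteq> C'" "jclique j K" "\<not> small (kap p C' X K)"
      using rich unfolding rich_def by blast
    have "kap p C' X K \<subseteq> kap p C X K" using C'(2) by (intro kap_mono) auto
    then have big: "\<not> small (kap p C X K)" using K(3) small_sub by blast
    have "K \<noteq> {}" using K(2) j_pos by (auto simp: jclique_def)
    then obtain b where "b \<in> K" by blast
    then show "\<exists>b\<in>C'. alive j p C X b" using K big C'(2) unfolding alive_def by blast
  qed
  then obtain A where A: "A \<subseteq> C" "large A" "\<And>b. b \<in> A \<Longrightarrow> alive j p C X b" by blast
  have SA: "site p A X" using site_shrink[OF S A(2,1)] .
  have subA: "subsite p A X C X" using SA A(1) by (simp add: subsite_def)
  \<comment> \<open>\<open>K0\<close> serves only to obtain the cover \<open>T\<close> from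
    closedness; the clique of the fork is the later \<open>K\<close>. Working inside
    \<open>A\<close> makes all vertices of \<open>T\<close> alive.\<close>
  obtain K0 where K0: "K0 \<subseteq> A" "jclique j K0" "\<not> small (kap p A X K0)"
    using rich subA unfolding rich_def by blast
  obtain C2 X2 where st: "clique_step p A X K0 C2 X2" using exists_clique_step[OF SA K0] by blast
  obtain C3 X3 T where s3: "subsite p C3 X3 C2 X2" and T: "T \<in> \<I>" "T \<subseteq> A" "covers T C3" "nesting p C3 X3 T"
      "\<forall>y\<in>T. comp y K0"
    using base_closed subsite_trans[OF subA sub0] K0(1,2) st unfolding closed_def by blast
  have "K0 \<noteq> {}" using K0(2) j_pos by (auto simp: jclique_def)
  then obtain k0 where k0: "k0 \<in> K0" by blast
  have k0V: "k0 \<in> V" using k0 K0(1) A(1) CW W_V by blast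
  have "T \<subseteq> V" using T(2) A(1) CW W_V by blast
  then have "T \<subseteq> nbh {k0}" using T(5) k0 E_sym by (auto simp: nbh_def comp_def)
  then have smT: "small T" using small_nbh[OF k0V] small_sub by blast
  have s2: "subsite p C2 X2 A X" using st by (simp add: clique_step_def)
  have s3C: "subsite p C3 X3 C X" using subsite_trans[OF s3 subsite_trans[OF s2 subA]] .
  have s30: "subsite p C3 X3 C0 X0" using subsite_trans[OF s3C sub0] .
  have C3C: "C3 \<subseteq> C" using s3C by (simp add: subsite_def)
  have reg3: "region C3 X3 (insert T \<Y>)"
    unfolding region_def
  proof (intro conjI ballI)
    fix Y assume "Y \<in> insert T \<Y>"
    then consider "Y = T" | "Y \<in> \<Y>" by blast
    then have "Y \<in> \<I> \<and> Y \<subseteq> W \<and> covers Y C3 \<and> nesting p C3 X3 Y"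
    proof cases
      case 1
      then show ?thesis using T A(1) CW by blast
    next
      case 2
      have "nesting p C3 X3 Y"
        by (rule nesting_mono[of p C X Y]) (use \<Y>[OF 2] s3C in \<open>auto simp: subsite_def\<close>)
      then show ?thesis using \<Y>[OF 2] covers_mono[OF _ C3C] by blast
    qed
    then show "Y \<in> \<I>" "Y \<subseteq> W" "covers Y C3" "nesting p C3 X3 Y" by blast+
  qed (use s30 fin\<Y> in auto)
  obtain K where K: "K \<subseteq> C3" "jclique j K" "\<not> small (kap p C3 X3 K)"
    using rich s3C unfolding rich_def by blast
  have KW: "K \<subseteq> W" and KV: "K \<subseteq> V" using K(1) C3C CW W_V by auto
  have finK: "finite K" using K(2) by (simp add: jclique_def)
  have S3: "site p C3 X3" using s3 by (simp add: subsite_def)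
  have kapI: "kap p C3 X3 K \<in> \<I>" by (rule kap_Int[OF S3 K(1,2)])
  \<comment> \<open>Nesting bounds the exceptional vertices for each cover: in the rest of
    \<open>kap p C3 X3 K\<close> every neighbour in a cover is complete to \<open>K\<close>.\<close>
  define Z where "Z = (\<Union>Y\<in>insert T \<Y>. kap p C3 X3 K \<inter> bad Y K)"
  have YI: "Y \<in> \<I>" and Ysm: "small (kap p C3 X3 K \<inter> bad Y K)" if "Y \<in> insert T \<Y>" for Y
    using reg3 that K unfolding region_def nesting_def by blast+
  have ZI: "Z \<in> \<I>"
    unfolding Z_def using fin\<Y> YI finK KV by (intro Int_UN Int_inter kapI Int_bad) auto
  have Zs: "small Z" unfolding Z_def using fin\<Y> Ysm by (intro small_UN) auto
  define C1 where "C1 = (kap p C3 X3 K - Z) - zone K"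
  have L1: "large C1"
    unfolding C1_def
    by (intro large_avoid large_Diff ZI Zs finK KV) (use kapI K(3) in \<open>simp add: large_def\<close>)
  have C13: "C1 \<subseteq> C3" using kap_sub[of p C3 X3 K] by (auto simp: C1_def)
  have "fork C X \<Y> C1 X3 T K"
    unfolding fork_def
  proof (intro conjI ballI impI)
    show "region C1 X3 (insert T \<Y>)" by (rule region_shrink[OF reg3 L1 C13])
    show "C1 \<subseteq> C" using C13 C3C by blast
    show "T \<subseteq> C" using T A by blast
    show "small T" by (rule smT)
    show "K \<subseteq> C" using K C3C by blast
    show "jclique j K" by (rule K)
  next
    fix Y c y assume Y: "Y \<in> insert T \<Y>" and c: "c \<in> C1" and y: "y \<in> Y" "E y c"
    have "c \<in> V" using c large_sub[OF L1] by blast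
    show "comp y K"
    proof (rule ccontr)
      assume "\<not> comp y K"
      then have "c \<in> bad Y K" using y \<open>c \<in> V\<close> by (auto simp: bad_def)
      then show False using c Y by (auto simp: C1_def Z_def)
    qed
  next
    fix c k assume "c \<in> C1" "k \<in> K"
    then show "\<not> near k c" using zone_near[of c K k] large_sub[OF L1] by (auto simp: C1_def)
  next
    fix b assume b: "b \<in> T" "comp b K"
    then have bA: "b \<in> A" using T by blast
    then have bW: "b \<in> W" using A CW by blast
    obtain Kb where Kb: "Kb \<subseteq> C" "jclique j Kb" "b \<in> Kb" "\<not> small (kap p C X Kb)"
      using A(3)[OF bA] unfolding alive_def by blast
    have KbV: "Kb \<subseteq> V" using Kb(1) CW W_V by blast
    have finKb: "finite Kb" using Kb(2) by (simp add: jclique_def)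
    have kI: "kap p C X Kb \<in> \<I>" by (rule kap_Int[OF S Kb(1,2)])
    define Z' where "Z' = (\<Union>Y\<in>\<Y>. kap p C X Kb \<inter> bad Y Kb)"
    have "small (kap p C X Kb \<inter> bad Y Kb)" if "Y \<in> \<Y>" for Y
      using \<Y>[OF that] Kb unfolding nesting_def by blast
    then have Z's: "small Z'" unfolding Z'_def using fin\<Y> by (intro small_UN) auto
    have Z'I: "Z' \<in> \<I>"
      unfolding Z'_def using fin\<Y> \<Y> finKb KbV by (intro Int_UN Int_inter kI Int_bad) auto
    note sh = shadow_Int_small[OF KW K(2) bW b(2)]
    \<comment> \<open>Off \<open>Z'\<close> neighbours in covers are complete to \<open>Kb\<close>,
      hence adjacent to \<open>b\<close>; off the shadow no neighbour complete to \<open>K\<close>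
      sees \<open>b\<close>. So these neighbours cannot be complete to \<open>K\<close>.\<close>
    define C4 where "C4 = kap p C X Kb - Z' - shadow b K"
    have L4: "large C4"
      unfolding C4_def by (intro large_Diff Z'I Z's sh) (use kI Kb(4) in \<open>simp add: large_def\<close>)
    have C4C: "C4 \<subseteq> C" using kap_sub[of p C X Kb] by (auto simp: C4_def)
    have "region C4 X \<Y>" by (rule region_shrink[OF reg L4 C4C])
    moreover have "E y b \<and> \<not> comp y K" if "Y \<in> \<Y>" "c \<in> C4" "y \<in> Y" "E y c" for Y c y
    proof -
      have cV: "c \<in> V" "c \<in> W" using that C4C CW W_V by auto
      have "c \<notin> bad Y Kb" using that by (auto simp: C4_def Z'_def)
      then have "comp y Kb" using that cV by (auto simp: bad_def)
      then have "E y b" using Kb(3) by (simp add: comp_def)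
      moreover have "\<not> comp y K"
      proof
        assume "comp y K"
        moreover have "y \<in> W" using \<Y>[OF that(1)] that(3) by blast
        moreover have "c \<notin> shadow b K" using that by (auto simp: C4_def)
        ultimately have "\<not> E y b" using shadow_avoid[OF cV(2)] that(4) by blast
        then show False using \<open>E y b\<close> by blast
      qed
      ultimately show ?thesis by blast
    qed
    ultimately show "\<exists>C2 X2. region C2 X2 \<Y> \<and> C2 \<subseteq> C \<and>
        (\<forall>Y\<in>\<Y>. \<forall>c\<in>C2. \<forall>y\<in>Y. E y c \<longrightarrow> E y b \<and> \<not> comp y K)"
      using C4C by blast
  qed
  then show ?thesis by blast
qed

text \<open>Each \<open>T i\<close> joins the family of covers for all later forks. So a vertex of
  the last region has a neighbour in every \<open>T i\<close>, and its neighbours in earlier covers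
  are complete to all later cliques.\<close>

lemma nested_forks:
  assumes reg: "region C X \<Y>"
  shows "\<exists>Cs Xs T K. Cs 0 = C \<and> region (Cs m) (Xs m) (\<Y> \<union> T ` {..<m}) \<and>
     (\<forall>i<m. fork (Cs i) (Xs i) (\<Y> \<union> T ` {..<i}) (Cs (Suc i)) (Xs (Suc i)) (T i) (K i))"
proof (induction m)
  case 0
  show ?case using reg by (intro exI[of _ "\<lambda>_. C"] exI[of _ "\<lambda>_. X"]) auto
next
  case (Suc m)
  then obtain Cs Xs T K where IH: "Cs 0 = C" "region (Cs m) (Xs m) (\<Y> \<union> T ` {..<m})"
    "\<And>i. i < m \<Longrightarrow> fork (Cs i) (Xs i) (\<Y> \<union> T ` {..<i}) (Cs (Suc i)) (Xs (Suc i)) (T i) (K i)"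
    by blast
  obtain C1 X1 T1 K1 where f: "fork (Cs m) (Xs m) (\<Y> \<union> T ` {..<m}) C1 X1 T1 K1"
    using fork_exists[OF IH(2)] by blast
  define T' where "T' = T(m := T1)"
  have T'im: "T' ` {..<i} = T ` {..<i}" if "i \<le> m" for i
    using that by (auto simp: T'_def)
  have T'S: "\<Y> \<union> T' ` {..<Suc m} = insert T1 (\<Y> \<union> T ` {..<m})"
    using T'im[of m] by (auto simp: lessThan_Suc T'_def)
  show ?case
  proof (rule exI[of _ "Cs(Suc m := C1)"], rule exI[of _ "Xs(Suc m := X1)"], rule exI[of _ T'],
      rule exI[of _ "K(m := K1)"], intro conjI allI impI)
    show "(Cs(Suc m := C1)) 0 = C" using IH by simp
    show "region ((Cs(Suc m := C1)) (Suc m)) ((Xs(Suc m := X1)) (Suc m)) (\<Y> \<union> T' ` {..<Suc m})"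
      using f unfolding T'S by (simp add: fork_def)
    fix i assume "i < Suc m"
    then consider "i < m" | "i = m" by linarith
    then show "fork ((Cs(Suc m := C1)) i) ((Xs(Suc m := X1)) i) (\<Y> \<union> T' ` {..<i}) ((Cs(Suc m := C1)) (Suc i))
       ((Xs(Suc m := X1)) (Suc i)) (T' i) ((K(m := K1)) i)"
    proof cases
      case 1
      then show ?thesis using IH(3)[OF 1] T'im[of i] by (simp add: T'_def)
    next
      case 2
      then show ?thesis using f T'im[of m] by (simp add: T'_def)
    qed
  qed
qed


section \<open>Realising marked graphs\<close>

text \<open>\<open>M\<close> is a separate argument so that \<open>copy_graph\<close>, a plain
  graph, is covered too. The last clause keeps candidates for different marks distinct; when copies
  are substituted, it also shows that a candidate for a mark of one copy misses the other copies,
  which lie in other regions.\<close>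

definition realisation ::
  "('v, 'm) graph_scheme \<Rightarrow> 'v set \<Rightarrow> 'a set \<Rightarrow> 'a set set \<Rightarrow> ('v \<Rightarrow> 'a) \<Rightarrow> ('v \<Rightarrow> 'a set) \<Rightarrow> ('v \<Rightarrow> nat \<Rightarrow> 'a set) \<Rightarrow> bool" where
  "realisation B M C \<Y> \<phi> D XD \<longleftrightarrow>
     (\<forall>u\<in>verts B - M. \<phi> u \<in> C) \<and> inj_on \<phi> (verts B - M) \<and>
     (\<forall>u\<in>verts B - M. \<forall>v\<in>verts B - M. E (\<phi> u) (\<phi> v) \<longleftrightarrow> {u, v} \<in> edges B) \<and>
     (\<forall>a\<in>M. region (D a) (XD a) \<Y> \<and> D a \<subseteq> C \<and> (\<forall>c\<in>D a. \<forall>u\<in>verts B - M. \<not> near (\<phi> u) c) \<and>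
        (\<forall>Y\<in>\<Y>. \<forall>c\<in>D a. \<forall>y\<in>Y. E y c \<longrightarrow> (\<forall>u\<in>verts B - M. E y (\<phi> u) \<longleftrightarrow> {u, a} \<in> edges B))) \<and>
     (\<forall>a\<in>M. \<forall>a'\<in>M. a \<noteq> a' \<longrightarrow> (\<forall>Y\<in>\<Y>. \<forall>y\<in>Y. \<forall>c\<in>D a. \<forall>c'\<in>D a'. \<not> (E y c \<and> E y c')))"

text \<open>Marked vertices are represented by regions \<open>D a\<close>: the members of \<open>\<Y>\<close> provide the vertices
  that will play the role of \<open>a\<close>.\<close>

definition achievable :: "('v, 'm) graph_scheme \<Rightarrow> 'v set \<Rightarrow> bool" where
  "achievable B M \<longleftrightarrow> (\<forall>C X \<Y>. region C X \<Y> \<longrightarrow> (\<exists>\<phi> D XD. realisation B M C \<Y> \<phi> D XD))"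

context
  fixes B :: "('v, 'm) graph_scheme" and M C \<Y> \<phi> D XD
  assumes re: "realisation B M C \<Y> \<phi> D XD"
begin

lemma realisation_vertex: "u \<in> verts B - M \<Longrightarrow> \<phi> u \<in> C"
  using re by (simp add: realisation_def)

lemma realisation_inj: "inj_on \<phi> (verts B - M)"
  using re by (simp add: realisation_def)

lemma realisation_edge: "u \<in> verts B - M \<Longrightarrow> v \<in> verts B - M \<Longrightarrow> E (\<phi> u) (\<phi> v) \<longleftrightarrow> {u, v} \<in> edges B"
  using re by (simp add: realisation_def)

lemma realisation_region: "a \<in> M \<Longrightarrow> region (D a) (XD a) \<Y>"
  using re by (simp add: realisation_def)

lemma realisation_sub: "a \<in> M \<Longrightarrow> D a \<subseteq> C"
  using re by (simp add: realisation_def)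

lemma realisation_far: "a \<in> M \<Longrightarrow> c \<in> D a \<Longrightarrow> u \<in> verts B - M \<Longrightarrow> \<not> near (\<phi> u) c"
  using re by (simp add: realisation_def)

lemma realisation_mark:
  "a \<in> M \<Longrightarrow> Y \<in> \<Y> \<Longrightarrow> c \<in> D a \<Longrightarrow> y \<in> Y \<Longrightarrow> E y c \<Longrightarrow> u \<in> verts B - M \<Longrightarrow> E y (\<phi> u) \<longleftrightarrow> {u, a} \<in> edges B"
  using re unfolding realisation_def by meson

lemma realisation_sep:
  "a \<in> M \<Longrightarrow> a' \<in> M \<Longrightarrow> a \<noteq> a' \<Longrightarrow> Y \<in> \<Y> \<Longrightarrow> y \<in> Y \<Longrightarrow> c \<in> D a \<Longrightarrow> c' \<in> D a' \<Longrightarrow> E y c \<Longrightarrow> E y c' \<Longrightarrow> False"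
  using re unfolding realisation_def by meson

lemma realisation_shrink:
  assumes "\<And>a. a \<in> M \<Longrightarrow> large (D' a) \<and> D' a \<subseteq> D a"
  shows "realisation B M C \<Y> \<phi> D' XD"
  unfolding realisation_def
proof (intro conjI ballI impI notI)
  fix a assume a: "a \<in> M"
  show "region (D' a) (XD a) \<Y>"
    using region_shrink[OF realisation_region[OF a]] assms[OF a] by blast
  show "D' a \<subseteq> C" using realisation_sub[OF a] assms[OF a] by blast
  show False if "c \<in> D' a" "u \<in> verts B - M" "near (\<phi> u) c" for c u
    using realisation_far[OF a _ that(2)] assms[OF a] that by blast
  show "E y (\<phi> u) \<longleftrightarrow> {u, a} \<in> edges B" if "Y \<in> \<Y>" "c \<in> D' a" "y \<in> Y" "E y c" "u \<in> verts B - M" for Y c y u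
    by (rule realisation_mark[OF a that(1) _ that(3,4,5)]) (use assms[OF a] that in blast)
  fix a' assume a': "a' \<in> M" "a \<noteq> a'"
  show False if "Y \<in> \<Y>" "y \<in> Y" "c \<in> D' a" "c' \<in> D' a'" "E y c \<and> E y c'" for Y y c c'
    by (rule realisation_sep[OF a a' that(1,2), of c c']) (use assms[OF a] assms[OF a'(1)] that in blast)+
qed (use realisation_vertex realisation_inj realisation_edge in auto)

lemma realisation_widen: "C \<subseteq> C' \<Longrightarrow> realisation B M C' \<Y> \<phi> D XD"
  unfolding realisation_def
proof (intro conjI ballI impI notI)
  assume sub: "C \<subseteq> C'"
  show "\<phi> u \<in> C'" if "u \<in> verts B - M" for u using realisation_vertex[OF that] sub by blast
  show "D a \<subseteq> C'" if "a \<in> M" for a using realisation_sub[OF that] sub by blast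
  show "E y (\<phi> u) \<longleftrightarrow> {u, a} \<in> edges B"
    if "a \<in> M" "Y \<in> \<Y>" "c \<in> D a" "y \<in> Y" "E y c" "u \<in> verts B - M" for a Y c y u
    using realisation_mark[OF that] .
  show False if "a \<in> M" "a' \<in> M" "a \<noteq> a'" "Y \<in> \<Y>" "y \<in> Y" "c \<in> D a" "c' \<in> D a'" "E y c \<and> E y c'" for a a' Y y c c'
    using realisation_sep[OF that(1-7)] that(8) by blast
  show False if "a \<in> M" "c \<in> D a" "u \<in> verts B - M" "near (\<phi> u) c" for a c u
    using realisation_far[OF that(1-3)] that(4) by blast
qed (use realisation_inj realisation_edge realisation_region in auto)

end

text \<open>A vertex of a clique \<open>K\<close> represents \<open>RootB\<close>, and the region of
  \<open>K\<close> represents the mark: by nesting, up to a small set, the neighbours of this region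
  in covers are complete to \<open>K\<close>.\<close>

lemma achievable_edge: "achievable \<lparr>verts = {RootB, RootA}, edges = {{RootB, RootA}}, marked = {RootA}\<rparr> {RootA}"
  unfolding achievable_def
proof (intro allI impI)
  fix C X \<Y> assume reg: "region C X \<Y>"
  have S: "site p C X" by (rule region_site[OF reg])
  have "subsite p C X C0 X0" using reg by (simp add: region_def)
  then obtain K where K: "K \<subseteq> C" "jclique j K" "\<not> small (kap p C X K)"
    using base_rich unfolding rich_def by blast
  have KV: "K \<subseteq> V" using K(1) site_sub[OF S] by blast
  have finK: "finite K" using K(2) by (simp add: jclique_def)
  have kI: "kap p C X K \<in> \<I>" by (rule kap_Int[OF S K(1,2)])
  have fin\<Y>: "finite \<Y>" and \<Y>: "\<And>Y. Y \<in> \<Y> \<Longrightarrow> Y \<in> \<I> \<and> nesting p C X Y"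
    using reg by (auto simp: region_def)
  define Z where "Z = (\<Union>Y\<in>\<Y>. kap p C X K \<inter> bad Y K)"
  have ZI: "Z \<in> \<I>" unfolding Z_def using fin\<Y> \<Y> finK KV by (intro Int_UN Int_inter kI Int_bad) auto
  have "small (kap p C X K \<inter> bad Y K)" if "Y \<in> \<Y>" for Y
    using \<Y>[OF that] K unfolding nesting_def by blast
  then have Zs: "small Z" unfolding Z_def using fin\<Y> by (intro small_UN) auto
  define D where "D = (kap p C X K - Z) - zone K"
  have L: "large D"
    unfolding D_def by (intro large_avoid large_Diff ZI Zs finK KV) (use kI K(3) in \<open>simp add: large_def\<close>)
  have DC: "D \<subseteq> C" using kap_sub[of p C X K] by (auto simp: D_def)
  have "K \<noteq> {}" using K(2) j_pos by (auto simp: jclique_def)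
  then obtain k where k: "k \<in> K" by blast
  have far: "\<not> near k c" if "c \<in> D" for c
    using zone_near[of c K k] that k large_sub[OF L] by (auto simp: D_def)
  have adj: "E y k" if "Y \<in> \<Y>" "c \<in> D" "y \<in> Y" "E y c" for Y c y
  proof -
    have "c \<in> V" using that(2) large_sub[OF L] by blast
    have "c \<notin> bad Y K" using that by (auto simp: D_def Z_def)
    then have "comp y K" using that \<open>c \<in> V\<close> by (auto simp: bad_def)
    then show ?thesis using k by (simp add: comp_def)
  qed
  have "realisation \<lparr>verts = {RootB, RootA}, edges = {{RootB, RootA}}, marked = {RootA}\<rparr> {RootA} C \<Y>
      (\<lambda>_. k) (\<lambda>_. D) (\<lambda>_. X)"
    unfolding realisation_def
  proof (intro conjI ballI impI)
    show "region D X \<Y>" by (rule region_shrink[OF reg L DC])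
    show "D \<subseteq> C" by (rule DC)
  qed (use k K(1) E_irrefl far adj in \<open>auto simp: doubleton_eq_iff inj_on_def\<close>)
  then show "\<exists>\<phi> D XD. realisation \<lparr>verts = {RootB, RootA}, edges = {{RootB, RootA}}, marked = {RootA}\<rparr> {RootA} C \<Y> \<phi> D XD"
    by blast
qed

end


section \<open>One step of Burling's construction\<close>

definition copy_marks :: "bvert \<Rightarrow> bvert marked_graph \<Rightarrow> bvert set" where
  "copy_marks a B = Copy a ` marked B \<union> NewC a ` marked B"

text \<open>The part of the construction that replaces one marked vertex \<open>a\<close>, without
  the edges to old vertices. Those edges come for free once the copy is placed in the region of
  \<open>a\<close>.\<close>

definition copy_graph :: "bvert \<Rightarrow> bvert marked_graph \<Rightarrow> bvert graph" where
  "copy_graph a B = \<lparr>verts = Copy a ` verts B \<union> NewB a ` marked B \<union> NewC a ` marked B,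
     edges = (`) (Copy a) ` edges B \<union>
       (\<Union>v\<in>marked B. {{Copy a u, NewB a v} | u. u \<in> nbrs B v} \<union> {{NewB a v, NewC a v}})\<rparr>"

lemma image_doubleton_iff:
  assumes "inj f"
  shows "{f u, f v} \<in> (`) f ` S \<longleftrightarrow> {u, v} \<in> S"
proof -
  have "inj ((`) f)" using assms by (simp add: inj_def inj_image_eq_iff)
  moreover have "{f u, f v} = f ` {u, v}" by simp
  ultimately show ?thesis by (simp only: inj_image_mem_iff)
qed

lemma not_image_doubleton: "x \<notin> range f \<Longrightarrow> {x, y} \<notin> (`) f ` S"
  by auto

lemma inj_constructors: "inj (Copy a)" "inj Old"
  by (auto simp: inj_def)

lemma not_range_constructors:
  "NewB a v \<notin> range (Copy b)" "NewC a v \<notin> range (Copy b)" "NewB a v \<notin> range Old"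
  "NewC a v \<notin> range Old" "Copy a v \<notin> range Old" "Old v \<notin> range (Copy b)"
  by auto

lemma copy_graph_edge:
  "{Copy a u, Copy a v} \<in> edges (copy_graph a B) \<longleftrightarrow> {u, v} \<in> edges B"
  "{Copy a u, NewB a v} \<in> edges (copy_graph a B) \<longleftrightarrow> v \<in> marked B \<and> {u, v} \<in> edges B"
  "{NewB a v, Copy a u} \<in> edges (copy_graph a B) \<longleftrightarrow> v \<in> marked B \<and> {u, v} \<in> edges B"
  "{NewB a v, NewB a w} \<notin> edges (copy_graph a B)"
  "{NewB a v, NewC a w} \<in> edges (copy_graph a B) \<longleftrightarrow> v = w \<and> v \<in> marked B"
  "{Copy a u, NewC a w} \<notin> edges (copy_graph a B)"
proof -
  have r: "{NewB a v, y} \<notin> (`) (Copy a) ` edges B" "{NewC a v, y} \<notin> (`) (Copy a) ` edges B" for v y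
    using not_range_constructors by (intro not_image_doubleton; blast)+
  have r': "{y, NewB a v} \<notin> (`) (Copy a) ` edges B" "{y, NewC a v} \<notin> (`) (Copy a) ` edges B" for v y
    using r[of v y] by (simp_all add: insert_commute)
  show "{Copy a u, Copy a v} \<in> edges (copy_graph a B) \<longleftrightarrow> {u, v} \<in> edges B"
    using image_doubleton_iff[OF inj_constructors(1), of a u v "edges B"]
    by (auto simp: copy_graph_def doubleton_eq_iff)
  show e: "{Copy a u, NewB a v} \<in> edges (copy_graph a B) \<longleftrightarrow> v \<in> marked B \<and> {u, v} \<in> edges B"
    using r'(1) by (auto simp: copy_graph_def doubleton_eq_iff nbrs_def)
  then show "{NewB a v, Copy a u} \<in> edges (copy_graph a B) \<longleftrightarrow> v \<in> marked B \<and> {u, v} \<in> edges B"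
    by (simp add: insert_commute)
  show "{NewB a v, NewB a w} \<notin> edges (copy_graph a B)"
    using r(1) by (auto simp: copy_graph_def doubleton_eq_iff)
  show "{NewB a v, NewC a w} \<in> edges (copy_graph a B) \<longleftrightarrow> v = w \<and> v \<in> marked B"
    using r(1) by (auto simp: copy_graph_def doubleton_eq_iff)
  show "{Copy a u, NewC a w} \<notin> edges (copy_graph a B)"
    using r'(2) by (auto simp: copy_graph_def doubleton_eq_iff)
qed

lemma copy_graph_nonmarked:
  "verts (copy_graph a B) - copy_marks a B = Copy a ` (verts B - marked B) \<union> NewB a ` marked B"
  by (auto simp: copy_graph_def copy_marks_def)


lemma marked_graph_facts:
  assumes "is_marked_graph B"
  shows "finite (verts B)" "finite (marked B)" "marked B \<subseteq> verts B"
    "{u, v} \<in> edges B \<Longrightarrow> u \<in> verts B \<and> v \<in> verts B \<and> u \<noteq> v"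
    "u \<in> marked B \<Longrightarrow> v \<in> marked B \<Longrightarrow> {u, v} \<notin> edges B"
proof -
  show f: "finite (verts B)" and s: "marked B \<subseteq> verts B"
    using assms by (auto simp: is_marked_graph_def simple_graph_def)
  then show "finite (marked B)" by (rule finite_subset[rotated])
  have e: "e \<subseteq> verts B \<and> card e = 2 \<and> \<not> e \<subseteq> marked B" if "e \<in> edges B" for e
    using assms that by (auto simp: is_marked_graph_def simple_graph_def)
  show "{u, v} \<in> edges B \<Longrightarrow> u \<in> verts B \<and> v \<in> verts B \<and> u \<noteq> v" using e[of "{u, v}"] by auto
  show "u \<in> marked B \<Longrightarrow> v \<in> marked B \<Longrightarrow> {u, v} \<notin> edges B" using e[of "{u, v}"] by auto
qed

context closed_world
begin

context
  fixes C X \<Y> C1 X1 T K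
  assumes f: "fork C X \<Y> C1 X1 T K"
begin

lemma fork_basic:
  shows "region C1 X1 (insert T \<Y>)" "C1 \<subseteq> C" "T \<subseteq> C" "K \<subseteq> C" "jclique j K" "small T"
  using f by (simp_all add: fork_def)

lemma fork_comp: "Y \<in> insert T \<Y> \<Longrightarrow> c \<in> C1 \<Longrightarrow> y \<in> Y \<Longrightarrow> E y c \<Longrightarrow> comp y K"
  by (rule f[unfolded fork_def, THEN conjunct2, THEN conjunct2, THEN conjunct2, THEN conjunct2, THEN conjunct2, THEN conjunct2,
        THEN conjunct1, THEN bspec, THEN bspec, THEN bspec, THEN mp])

lemma fork_far: "c \<in> C1 \<Longrightarrow> k \<in> K \<Longrightarrow> \<not> near k c"
  by (rule f[unfolded fork_def, THEN conjunct2, THEN conjunct2, THEN conjunct2, THEN conjunct2, THEN conjunct2, THEN conjunct2,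
        THEN conjunct2, THEN conjunct1, THEN bspec, THEN bspec])

lemma fork_second:
  "b \<in> T \<Longrightarrow> comp b K \<Longrightarrow> \<exists>C2 X2. region C2 X2 \<Y> \<and> C2 \<subseteq> C \<and>
     (\<forall>Y\<in>\<Y>. \<forall>c\<in>C2. \<forall>y\<in>Y. E y c \<longrightarrow> E y b \<and> \<not> comp y K)"
  by (rule f[unfolded fork_def, THEN conjunct2, THEN conjunct2, THEN conjunct2, THEN conjunct2, THEN conjunct2, THEN conjunct2,
        THEN conjunct2, THEN conjunct2, THEN bspec, THEN mp])

end

text \<open>The vertices \<open>b l\<close> realise the vertices \<open>b\<^sup>a\<^sub>v\<close>; the fork that produced \<open>b l\<close> also provides the
  region for \<open>c\<^sup>a\<^sub>v\<close>, and the innermost region carries the copy of \<open>B\<close>.\<close>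

lemma achievable_copy:
  assumes mg: "is_marked_graph B" and ach: "achievable B (marked B)"
  shows "achievable (copy_graph a B) (copy_marks a B)"
  unfolding achievable_def
proof (intro allI impI)
  fix C X \<Y> assume reg: "region C X \<Y>"
  note mgf = marked_graph_facts[OF mg]
  define m where "m = card (marked B)"
  obtain v where v: "bij_betw v {..<m} (marked B)"
    using ex_bij_betw_nat_finite[OF mgf(2)] lessThan_atLeast0 unfolding m_def by metis
  define ix where "ix = the_inv_into {..<m} v"
  have vM: "v l \<in> marked B" if "l < m" for l using bij_betwE[OF v] that by blast
  have ixm: "ix w < m" and vix: "v (ix w) = w" if "w \<in> marked B" for w
    using that v the_inv_into_into[of v "{..<m}" w "{..<m}"] f_the_inv_into_f[of v "{..<m}" w]
    unfolding ix_def bij_betw_def by auto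
  obtain Cs Xs T K where Cs0: "Cs 0 = C" and regm: "region (Cs m) (Xs m) (\<Y> \<union> T ` {..<m})"
    and F: "\<And>i. i < m \<Longrightarrow> fork (Cs i) (Xs i) (\<Y> \<union> T ` {..<i}) (Cs (Suc i)) (Xs (Suc i)) (T i) (K i)"
    using nested_forks[OF reg, of m] by blast
  have F1: "region (Cs (Suc i)) (Xs (Suc i)) (insert (T i) (\<Y> \<union> T ` {..<i}))" "Cs (Suc i) \<subseteq> Cs i"
    "T i \<subseteq> Cs i" "K i \<subseteq> Cs i" "jclique j (K i)" if "i < m" for i
    using fork_basic(1-5)[OF F[OF that]] .
  have F2: "comp y (K i)" if "i < m" "Y \<in> insert (T i) (\<Y> \<union> T ` {..<i})" "c \<in> Cs (Suc i)" "y \<in> Y" "E y c" for i Y c y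
    using fork_comp[OF F[OF that(1)] that(2-5)] .
  have F3: "\<not> near k c" if "i < m" "c \<in> Cs (Suc i)" "k \<in> K i" for i c k
    using fork_far[OF F[OF that(1)] that(2,3)] .
  have F4: "\<exists>C2 X2. region C2 X2 (\<Y> \<union> T ` {..<i}) \<and> C2 \<subseteq> Cs i \<and>
        (\<forall>Y\<in>\<Y> \<union> T ` {..<i}. \<forall>c\<in>C2. \<forall>y\<in>Y. E y c \<longrightarrow> E y b \<and> \<not> comp y (K i))"
    if "i < m" "b \<in> T i" "comp b (K i)" for i b
    using fork_second[OF F[OF that(1)] that(2,3)] .
  have Cmono: "Cs l \<subseteq> Cs i" if "i \<le> l" "l \<le> m" for i l
    using that
  proof (induction l rule: dec_induct)
    case (step l)
    then show ?case using F1(2)[of l] by auto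
  qed simp
  have CsC: "Cs l \<subseteq> C" if "l \<le> m" for l using Cmono[of 0 l] that Cs0 by simp
  have CW: "C \<subseteq> W" by (rule region_W[OF reg])
  have CsW: "Cs l \<subseteq> W" if "l \<le> m" for l using CsC[OF that] CW by blast
  have KW: "K i \<subseteq> W" if "i < m" for i using F1(4)[OF that] CsW[of i] that by auto
  have \<Y>W: "Y \<subseteq> W" if "Y \<in> \<Y>" for Y using reg that by (simp add: region_def)
  \<comment> \<open>The copy is realised with the \<open>T i\<close> as further covers. A vertex of
    \<open>T l\<close> with a neighbour in \<open>D (v l)\<close> is then a candidate for the mark
    \<open>v l\<close>, so it has exactly the neighbours in the copy that
    \<open>NewB a (v l)\<close> should have.\<close>
  obtain \<psi> D XD where re: "realisation B (marked B) (Cs m) (\<Y> \<union> T ` {..<m}) \<psi> D XD"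
    using ach regm unfolding achievable_def by blast
  note re_v = realisation_vertex[OF re] and re_inj = realisation_inj[OF re] and re_e = realisation_edge[OF re]
    and re_r = realisation_region[OF re] and re_s = realisation_sub[OF re] and re_f = realisation_far[OF re]
    and re_m = realisation_mark[OF re] and re_p = realisation_sep[OF re]
  define Dv where "Dv = (\<lambda>l. D (v l))"
  have DvL: "large (Dv l)" and DvC: "Dv l \<subseteq> Cs m" if "l < m" for l
    using region_large[OF re_r[OF vM[OF that]]] re_s[OF vM[OF that]] by (auto simp: Dv_def)
  have bcomp: "comp b (K l)" if "i \<le> l" "l < m" "b \<in> T i" "c \<in> Cs m" "E b c" for i l b c
  proof (rule F2[OF that(2) _ _ that(3,5)])
    show "T i \<in> insert (T l) (\<Y> \<union> T ` {..<l})" using that(1) by (cases "i = l") auto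
    show "c \<in> Cs (Suc l)" using Cmono[of "Suc l" m] that by auto
  qed
  have TW: "T i \<subseteq> W" if "i < m" for i using F1(3)[OF that] CsW[of i] that by auto
  \<comment> \<open>The \<open>b l\<close> must be pairwise non-adjacent. Earlier ones are complete
    to \<open>K n\<close>, so a point of \<open>Dv n\<close> outside their shadows has a neighbour
    in \<open>T n\<close>, also complete to \<open>K n\<close>, that misses all of them.\<close>
  have "\<exists>b. \<forall>l<n. b l \<in> T l \<and> (\<exists>c\<in>Dv l. E (b l) c) \<and> (\<forall>i<l. \<not> E (b l) (b i))" if "n \<le> m" for n
    using that
  proof (induction n)
    case (Suc n)
    then obtain b where b: "\<And>l. l < n \<Longrightarrow> b l \<in> T l \<and> (\<exists>c\<in>Dv l. E (b l) c) \<and> (\<forall>i<l. \<not> E (b l) (b i))"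
      by auto
    have nm: "n < m" using Suc.prems by simp
    have bK: "comp (b i) (K n)" if "i < n" for i
    proof -
      obtain c where "c \<in> Dv i" "E (b i) c" using b[OF \<open>i < n\<close>] by blast
      then show ?thesis using bcomp[of i n "b i" c] b[OF \<open>i < n\<close>] DvC[of i] \<open>i < n\<close> nm by auto
    qed
    have bW: "b i \<in> W" if "i < n" for i using b[OF that] TW[of i] that nm by auto
    have "large (Dv n - (\<Union>i\<in>{..<n}. shadow (b i) (K n)))"
      using shadow_Int_small[OF KW[OF nm] F1(5)[OF nm] bW bK]
      by (intro large_Diff DvL nm Int_UN small_UN) auto
    then obtain c where c: "c \<in> Dv n" "\<And>i. i < n \<Longrightarrow> c \<notin> shadow (b i) (K n)"
      using large_nonempty by blast
    have cm: "c \<in> Cs m" using c(1) DvC[OF nm] by blast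
    have cS: "c \<in> Cs (Suc n)" using Cmono[of "Suc n" m] cm nm by auto
    have "covers (T n) (Cs (Suc n))" using F1(1)[OF nm] by (simp add: region_def)
    then obtain z where z: "z \<in> T n" "E z c" using cS unfolding covers_def by blast
    have zK: "comp z (K n)" using bcomp[OF _ nm z(1) cm z(2)] by simp
    have "\<not> E z (b i)" if "i < n" for i
      using shadow_avoid[of c "b i" "K n" z] c(2)[OF that] zK z TW[OF nm] cm CsW[of m] by blast
    then show ?case using b z c(1)
      by (intro exI[of _ "b(n := z)"]) (auto simp: less_Suc_eq)
  qed auto
  from this[of m] obtain b where b: "\<And>l. l < m \<Longrightarrow> b l \<in> T l \<and> (\<exists>c\<in>Dv l. E (b l) c) \<and> (\<forall>i<l. \<not> E (b l) (b i))"
    by auto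
  have "\<forall>l. \<exists>c. l < m \<longrightarrow> c \<in> Dv l \<and> E (b l) c" using b by blast
  then obtain cc where cc: "\<And>l. l < m \<Longrightarrow> cc l \<in> Dv l \<and> E (b l) (cc l)" by metis
  have bT: "b l \<in> T l" if "l < m" for l using b[OF that] by blast
  have bK: "comp (b i) (K l)" if "i \<le> l" "l < m" for i l
    using bcomp[OF that bT, of "cc i"] cc[of i] DvC[of i] that by auto
  have bW: "b l \<in> W" if "l < m" for l using bT[OF that] TW[OF that] by blast
  have bC: "b l \<in> Cs l" if "l < m" for l using bT[OF that] F1(3)[OF that] by blast
  have b\<psi>: "E (b l) (\<psi> u) \<longleftrightarrow> {u, v l} \<in> edges B" if "l < m" "u \<in> verts B - marked B" for l u
    by (rule re_m[of "v l" "T l" "cc l"]) (use that vM[of l] bT cc in \<open>auto simp: Dv_def\<close>)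
  have b\<psi>ne: "b l \<noteq> \<psi> u" if "l < m" "u \<in> verts B - marked B" for l u
    using re_f[of "v l" "cc l" u] that vM[of l] cc[of l] by (auto simp: Dv_def near_def)
  have bb: "b l \<noteq> b i" "\<not> E (b l) (b i)" if "i < l" "l < m" for i l
  proof -
    show "\<not> E (b l) (b i)" using b[OF that(2)] that(1) by blast
    show "b l \<noteq> b i"
    proof
      assume eq: "b l = b i"
      have im: "i < m" using that by simp
      have "K i \<noteq> {}" using F1(5)[OF im] j_pos by (auto simp: jclique_def)
      then obtain k where k: "k \<in> K i" by blast
      have "b l \<in> Cs (Suc i)" using bC[OF that(2)] Cmono[of "Suc i" l] that by auto
      then have "\<not> near k (b l)" using F3[OF im _ k] by blast
      moreover have "E (b i) k" using bK[OF order_refl im] k by (simp add: comp_def)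
      ultimately show False using eq E_sym by (auto simp: near_def)
    qed
  qed
  have bb': "i = l" if "b i = b l" "i < m" "l < m" for i l
    using bb(1)[of i l] bb(1)[of l i] that by (cases i l rule: linorder_cases) auto
  have bbE: "\<not> E (b i) (b l)" if "i < m" "l < m" for i l
    using bb(2)[of i l] bb(2)[of l i] that E_irrefl E_commute by (cases i l rule: linorder_cases) auto
  define F0 where "F0 = \<psi> ` (verts B - marked B) \<union> b ` {..<m}"
  have finF0: "finite F0" using mgf by (simp add: F0_def)
  have \<psi>m: "\<psi> u \<in> Cs m" if "u \<in> verts B - marked B" for u using re_v[OF that] .
  have F0C: "F0 \<subseteq> C"
  proof
    fix x assume "x \<in> F0"
    then consider u where "u \<in> verts B - marked B" "x = \<psi> u" | l where "l < m" "x = b l"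
      by (auto simp: F0_def)
    then show "x \<in> C"
    proof cases
      case 1
      then show ?thesis using \<psi>m CsC[of m] by blast
    next
      case 2
      then show ?thesis using bC CsC[of l] by auto
    qed
  qed
  have F0V: "F0 \<subseteq> V" using F0C CW W_V by blast
  have shad: "shadow (b i) (K l) \<in> \<I>" "small (shadow (b i) (K l))" if "i \<le> l" "l < m" for i l
    using shadow_Int_small[OF KW[OF that(2)] F1(5)[OF that(2)] bW bK[OF that]] that by auto
  \<comment> \<open>The regions for the marks of the copy of \<open>B\<close>. Their candidates in
    \<open>\<Y>\<close> are complete to every \<open>K i\<close>; off the shadows they miss every
    \<open>b i\<close>, as the construction demands.\<close>
  define DC where "DC = (\<lambda>l. (Dv l - (\<Union>i\<in>{..<m}. shadow (b i) (K i))) - zone F0)"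
  have DCL: "large (DC l)" if "l < m" for l
    unfolding DC_def using shad by (intro large_avoid large_Diff DvL that Int_UN small_UN finF0 F0V) auto
  have DCsub: "DC l \<subseteq> Dv l" for l by (auto simp: DC_def)
  have DCm: "c \<in> Cs m" if "l < m" "c \<in> DC l" for l c using that DCsub[of l] DvC[of l] by blast
  have DCK: "comp y (K i)" if "l < m" "c \<in> DC l" "i < m" "Y \<in> \<Y>" "y \<in> Y" "E y c" for l c i Y y
  proof (rule F2[OF that(3) _ _ that(5,6)])
    show "c \<in> Cs (Suc i)" using DCm[OF that(1,2)] Cmono[of "Suc i" m] that(3) by auto
  qed (use that in auto)
  have DCb: "\<not> E y (b i)" if "l < m" "c \<in> DC l" "i < m" "Y \<in> \<Y>" "y \<in> Y" "E y c" for l c i Y y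
  proof (rule shadow_avoid[OF _ _ _ that(6) DCK[OF that]])
    show "c \<in> W" using DCm[OF that(1,2)] CsW[of m] by blast
    show "c \<notin> shadow (b i) (K i)" using that(2,3) by (auto simp: DC_def)
    show "y \<in> W" using \<Y>W that by blast
  qed
  have "\<forall>l. \<exists>C2 X2. l < m \<longrightarrow> region C2 X2 (\<Y> \<union> T ` {..<l}) \<and> C2 \<subseteq> Cs l \<and>
        (\<forall>Y\<in>\<Y> \<union> T ` {..<l}. \<forall>c\<in>C2. \<forall>y\<in>Y. E y c \<longrightarrow> E y (b l) \<and> \<not> comp y (K l))"
  proof
    fix l
    show "\<exists>C2 X2. l < m \<longrightarrow> region C2 X2 (\<Y> \<union> T ` {..<l}) \<and> C2 \<subseteq> Cs l \<and>
        (\<forall>Y\<in>\<Y> \<union> T ` {..<l}. \<forall>c\<in>C2. \<forall>y\<in>Y. E y c \<longrightarrow> E y (b l) \<and> \<not> comp y (K l))"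
    proof (cases "l < m")
      case True
      from F4[OF True bT[OF True] bK[OF order_refl True]] show ?thesis by (elim exE) (intro exI impI)
    qed simp
  qed
  then obtain N XN where N: "\<And>l. l < m \<Longrightarrow> region (N l) (XN l) (\<Y> \<union> T ` {..<l}) \<and> N l \<subseteq> Cs l \<and>
        (\<forall>Y\<in>\<Y> \<union> T ` {..<l}. \<forall>c\<in>N l. \<forall>y\<in>Y. E y c \<longrightarrow> E y (b l) \<and> \<not> comp y (K l))"
    by metis
  \<comment> \<open>The region for \<open>NewC a (v l)\<close>. Its candidates see
    \<open>b l\<close> but are not complete to \<open>K l\<close>. Off the shadows they miss
    \<open>b i\<close> for \<open>i < l\<close>. They miss everything chosen inside
    \<open>Cs (Suc l)\<close>, that is, the later \<open>b i\<close> and the copy, because seeing a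
    vertex there would make them complete to \<open>K l\<close>.\<close>
  define DN where "DN = (\<lambda>l. (N l - (\<Union>i\<in>{..<l}. shadow (b i) (K i))) - zone F0)"
  have DNL: "large (DN l)" if "l < m" for l
    unfolding DN_def using shad N[OF that] region_large that
    by (intro large_avoid large_Diff Int_UN small_UN finF0 F0V) auto
  have DNsub: "DN l \<subseteq> N l" for l by (auto simp: DN_def)
  have DNCs: "DN l \<subseteq> Cs l" if "l < m" for l using DNsub N[OF that] by blast
  have DN1: "E y (b l)" "\<not> comp y (K l)" if "l < m" "c \<in> DN l" "Y \<in> \<Y>" "y \<in> Y" "E y c" for l c Y y
    using N[OF that(1)] DNsub[of l] that by blast+
  have DNK: "comp y (K i)" if "l < m" "c \<in> DN l" "i < l" "Y \<in> \<Y>" "y \<in> Y" "E y c" for l c i Y y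
  proof (rule F2[OF _ _ _ that(5,6)])
    show "c \<in> Cs (Suc i)" using DNCs[OF that(1)] Cmono[of "Suc i" l] that by auto
  qed (use that in auto)
  have DNb: "E y (b i) \<longleftrightarrow> i = l" if "l < m" "c \<in> DN l" "i < m" "Y \<in> \<Y>" "y \<in> Y" "E y c" for l c i Y y
  proof (cases i l rule: linorder_cases)
    case less
    have "\<not> E y (b i)"
    proof (rule shadow_avoid[OF _ _ _ that(6) DNK[OF that(1,2) less that(4-6)]])
      show "c \<in> W" using DNCs[OF that(1)] CsW[of l] that by auto
      show "c \<notin> shadow (b i) (K i)" using that(2) less by (auto simp: DN_def)
      show "y \<in> W" using \<Y>W that by blast
    qed
    then show ?thesis using less by simp
  next
    case equal
    then show ?thesis using DN1(1)[OF that(1,2,4-6)] by simp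
  next
    case greater
    have "\<not> E y (b i)"
    proof
      assume "E y (b i)"
      moreover have "b i \<in> Cs (Suc l)" using bC[OF that(3)] Cmono[of "Suc l" i] greater that(3) by auto
      ultimately have "comp y (K l)" using that by (intro F2[OF that(1), of Y]) auto
      then show False using DN1(2)[OF that(1,2,4-6)] by blast
    qed
    then show ?thesis using greater by simp
  qed
  have DN\<psi>: "\<not> E y (\<psi> u)" if "l < m" "c \<in> DN l" "u \<in> verts B - marked B" "Y \<in> \<Y>" "y \<in> Y" "E y c" for l c u Y y
  proof
    assume "E y (\<psi> u)"
    moreover have "\<psi> u \<in> Cs (Suc l)" using \<psi>m[OF that(3)] Cmono[of "Suc l" m] that(1) by auto
    ultimately have "comp y (K l)" using that by (intro F2[OF that(1), of Y]) auto
    then show False using DN1(2)[OF that(1,2,4-6)] by blast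
  qed
  define \<phi>' where "\<phi>' = (\<lambda>x. case x of Copy _ u \<Rightarrow> \<psi> u | NewB _ w \<Rightarrow> b (ix w) | _ \<Rightarrow> undefined)"
  define D' where "D' = (\<lambda>x. case x of Copy _ u \<Rightarrow> DC (ix u) | NewC _ w \<Rightarrow> DN (ix w) | _ \<Rightarrow> undefined)"
  define XD' where "XD' = (\<lambda>x. case x of Copy _ u \<Rightarrow> XD u | NewC _ w \<Rightarrow> XN (ix w) | _ \<Rightarrow> undefined)"
  have regC: "region (DC (ix u)) (XD u) \<Y>" "DC (ix u) \<subseteq> C" if "u \<in> marked B" for u
  proof -
    have "region (D u) (XD u) \<Y>" using re_r[OF that] by (rule region_anti) auto
    moreover have "DC (ix u) \<subseteq> D u" using DCsub[of "ix u"] vix[OF that] by (simp add: Dv_def)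
    ultimately show "region (DC (ix u)) (XD u) \<Y>" using region_shrink DCL ixm[OF that] by blast
    show "DC (ix u) \<subseteq> C" using DCm[OF ixm[OF that]] CsC[of m] by blast
  qed
  have regN: "region (DN (ix w)) (XN (ix w)) \<Y>" "DN (ix w) \<subseteq> C" if "w \<in> marked B" for w
  proof -
    have "region (N (ix w)) (XN (ix w)) \<Y>" using conjunct1[OF N[OF ixm[OF that]]] by (rule region_anti) auto
    then show "region (DN (ix w)) (XN (ix w)) \<Y>" using region_shrink DNL DNsub ixm[OF that] by blast
    show "DN (ix w) \<subseteq> C" using DNCs[OF ixm[OF that]] CsC[of "ix w"] ixm[OF that] by auto
  qed
  have ixinj: "ix u = ix w \<longleftrightarrow> u = w" if "u \<in> marked B" "w \<in> marked B" for u w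
    using vix[OF that(1)] vix[OF that(2)] by metis
  have far0: "\<not> near x c" if "x \<in> F0" "c \<in> DC l \<or> c \<in> DN l" "c \<in> V" for x c l
    using zone_near[OF that(3) _ that(1)] that(2) by (auto simp: DC_def DN_def)
  have \<phi>F0: "\<phi>' x \<in> F0" if "x \<in> verts (copy_graph a B) - copy_marks a B" for x
    using that ixm unfolding copy_graph_nonmarked by (auto simp: \<phi>'_def F0_def)
  have D'V: "D' x \<subseteq> C" "region (D' x) (XD' x) \<Y>" if "x \<in> copy_marks a B" for x
    using that unfolding copy_marks_def by (elim UnE imageE; simp add: D'_def XD'_def regC regN)+
  have "realisation (copy_graph a B) (copy_marks a B) C \<Y> \<phi>' D' XD'"
    unfolding realisation_def
  proof (intro conjI ballI impI)
    fix x assume x: "x \<in> verts (copy_graph a B) - copy_marks a B"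
    show "\<phi>' x \<in> C" using \<phi>F0[OF x] F0C by blast
  next
    show "inj_on \<phi>' (verts (copy_graph a B) - copy_marks a B)"
    proof (rule inj_onI)
      fix x y
      assume x: "x \<in> verts (copy_graph a B) - copy_marks a B" and y: "y \<in> verts (copy_graph a B) - copy_marks a B"
        and eq: "\<phi>' x = \<phi>' y"
      consider (1) u u' where "x = Copy a u" "y = Copy a u'" "u \<in> verts B - marked B" "u' \<in> verts B - marked B"
        | (2) u w where "x = Copy a u" "y = NewB a w" "u \<in> verts B - marked B" "w \<in> marked B"
        | (3) u w where "y = Copy a u" "x = NewB a w" "u \<in> verts B - marked B" "w \<in> marked B"
        | (4) w w' where "x = NewB a w" "y = NewB a w'" "w \<in> marked B" "w' \<in> marked B"
        using x y unfolding copy_graph_nonmarked by blast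
      then show "x = y"
      proof cases
        case 1
        then show ?thesis using eq re_inj by (auto simp: \<phi>'_def dest: inj_onD)
      next
        case 2
        then show ?thesis using eq b\<psi>ne[OF ixm, of w u] by (simp add: \<phi>'_def)
      next
        case 3
        then show ?thesis using eq b\<psi>ne[OF ixm, of w u] by (simp add: \<phi>'_def)
      next
        case 4
        then have "ix w = ix w'" using eq bb' ixm by (simp add: \<phi>'_def)
        then show ?thesis using 4 ixinj by simp
      qed
    qed
  next
    fix x y
    assume x: "x \<in> verts (copy_graph a B) - copy_marks a B" and y: "y \<in> verts (copy_graph a B) - copy_marks a B"
    consider (1) u u' where "x = Copy a u" "y = Copy a u'" "u \<in> verts B - marked B" "u' \<in> verts B - marked B"
      | (2) u w where "x = Copy a u" "y = NewB a w" "u \<in> verts B - marked B" "w \<in> marked B"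
      | (3) u w where "y = Copy a u" "x = NewB a w" "u \<in> verts B - marked B" "w \<in> marked B"
      | (4) w w' where "x = NewB a w" "y = NewB a w'" "w \<in> marked B" "w' \<in> marked B"
      using x y unfolding copy_graph_nonmarked by blast
    then show "E (\<phi>' x) (\<phi>' y) \<longleftrightarrow> {x, y} \<in> edges (copy_graph a B)"
    proof cases
      case 1
      then show ?thesis using re_e by (simp add: \<phi>'_def copy_graph_edge)
    next
      case 2
      then have "E (\<phi>' y) (\<phi>' x) \<longleftrightarrow> {u, w} \<in> edges B"
        using b\<psi>[OF ixm[OF 2(4)] 2(3)] vix by (simp add: \<phi>'_def)
      then show ?thesis using 2 E_commute[of "\<phi>' x"] by (simp add: copy_graph_edge)
    next
      case 3
      then have "E (\<phi>' x) (\<phi>' y) \<longleftrightarrow> {u, w} \<in> edges B"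
        using b\<psi>[OF ixm[OF 3(4)] 3(3)] vix by (simp add: \<phi>'_def)
      then show ?thesis using 3 by (simp add: copy_graph_edge)
    next
      case 4
      then show ?thesis using bbE ixm by (simp add: \<phi>'_def copy_graph_edge)
    qed
  next
    fix x assume x: "x \<in> copy_marks a B"
    show "region (D' x) (XD' x) \<Y>" "D' x \<subseteq> C" using D'V x by blast+
    fix c u assume c: "c \<in> D' x" and u: "u \<in> verts (copy_graph a B) - copy_marks a B"
    have "c \<in> V" using c D'V(1)[OF x] CW W_V by blast
    moreover have "\<exists>l. c \<in> DC l \<or> c \<in> DN l" using c x by (auto simp: copy_marks_def D'_def)
    ultimately show "\<not> near (\<phi>' u) c" using far0[OF \<phi>F0[OF u]] by blast
  next
    fix x Y c y u
    assume x: "x \<in> copy_marks a B" and Y: "Y \<in> \<Y>" and c: "c \<in> D' x" and y: "y \<in> Y" "E y c"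
      and u: "u \<in> verts (copy_graph a B) - copy_marks a B"
    consider (1) u' w where "u = Copy a u'" "x = Copy a w" "u' \<in> verts B - marked B" "w \<in> marked B"
      | (2) u' w where "u = Copy a u'" "x = NewC a w" "u' \<in> verts B - marked B" "w \<in> marked B"
      | (3) u' w where "u = NewB a u'" "x = Copy a w" "u' \<in> marked B" "w \<in> marked B"
      | (4) u' w where "u = NewB a u'" "x = NewC a w" "u' \<in> marked B" "w \<in> marked B"
      using x u unfolding copy_graph_nonmarked unfolding copy_marks_def by blast
    then show "E y (\<phi>' u) \<longleftrightarrow> {u, x} \<in> edges (copy_graph a B)"
    proof cases
      case 1
      then have "c \<in> D w" using c DCsub[of "ix w"] vix by (auto simp: D'_def Dv_def)
      then have "E y (\<psi> u') \<longleftrightarrow> {u', w} \<in> edges B" using re_m[of w Y c y u'] 1 Y y by auto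
      then show ?thesis using 1 by (simp add: \<phi>'_def copy_graph_edge)
    next
      case 2
      then have "\<not> E y (\<psi> u')" using DN\<psi>[OF ixm[OF 2(4)] _ 2(3) Y y] c by (simp add: D'_def)
      then show ?thesis using 2 by (simp add: \<phi>'_def copy_graph_edge)
    next
      case 3
      then have "\<not> E y (b (ix u'))" using DCb[OF ixm[OF 3(4)] _ ixm[OF 3(3)] Y y] c by (simp add: D'_def)
      moreover have "{u', w} \<notin> edges B" using mgf(5) 3 by blast
      ultimately show ?thesis using 3 mgf(5) copy_graph_edge(3)[of a u' w B] by (simp add: \<phi>'_def)
    next
      case 4
      then have "E y (b (ix u')) \<longleftrightarrow> ix u' = ix w"
        using DNb[OF ixm[OF 4(4)] _ ixm[OF 4(3)] Y y] c by (simp add: D'_def)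
      then show ?thesis using 4 ixinj by (auto simp: \<phi>'_def copy_graph_edge)
    qed
  next
    \<comment> \<open>A common candidate for two such regions would be both complete and not
      complete to one of the cliques \<open>K i\<close>.\<close>
    have mixed: False if "w \<in> marked B" "w' \<in> marked B" "Y \<in> \<Y>" "y \<in> Y" "c \<in> DC (ix w)" "c' \<in> DN (ix w')"
      "E y c" "E y c'" for w w' Y y c c'
      using DCK[OF ixm[OF that(1)] that(5) ixm[OF that(2)] that(3,4,7)] DN1(2)[OF ixm[OF that(2)] that(6,3,4,8)]
      by blast
    have new: False if "w \<in> marked B" "w' \<in> marked B" "ix w < ix w'" "Y \<in> \<Y>" "y \<in> Y" "c \<in> DN (ix w)" "c' \<in> DN (ix w')"
      "E y c" "E y c'" for w w' Y y c c'
      using DNK[OF ixm[OF that(2)] that(7,3,4,5,9)] DN1(2)[OF ixm[OF that(1)] that(6,4,5,8)] by blast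
    fix x x' Y y c c'
    assume x: "x \<in> copy_marks a B" and x': "x' \<in> copy_marks a B" and ne: "x \<noteq> x'" and Y: "Y \<in> \<Y>" "y \<in> Y"
      and c: "c \<in> D' x" "c' \<in> D' x'"
    show "\<not> (E y c \<and> E y c')"
    proof
      assume E: "E y c \<and> E y c'"
      consider (1) w w' where "x = Copy a w" "x' = Copy a w'" "w \<in> marked B" "w' \<in> marked B"
        | (2) w w' where "x = Copy a w" "x' = NewC a w'" "w \<in> marked B" "w' \<in> marked B"
        | (3) w w' where "x = NewC a w" "x' = Copy a w'" "w \<in> marked B" "w' \<in> marked B"
        | (4) w w' where "x = NewC a w" "x' = NewC a w'" "w \<in> marked B" "w' \<in> marked B"
        using x x' unfolding copy_marks_def by blast
      then show False
      proof cases
        case 1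
        have "c \<in> D w" "c' \<in> D w'"
          using c DCsub[of "ix w"] DCsub[of "ix w'"] vix 1 by (auto simp: D'_def Dv_def)
        then show False using re_p[of w w' Y y c c'] 1 ne Y E by auto
      next
        case 2
        then show False using mixed[OF 2(3,4) Y, of c c'] c E 2 by (simp add: D'_def)
      next
        case 3
        then show False using mixed[OF 3(4,3) Y, of c' c] c E 3 by (simp add: D'_def)
      next
        case 4
        then have "ix w \<noteq> ix w'" using ne ixinj by auto
        then consider "ix w < ix w'" | "ix w' < ix w" by linarith
        then show False
        proof cases
          case 1
          then show False using new[OF 4(3,4) 1 Y, of c c'] c E 4 by (simp add: D'_def)
        next
          case 2
          then show False using new[OF 4(4,3) 2 Y, of c' c] c E 4 by (simp add: D'_def)
        qed
      qed
    qed
  qed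
  then show "\<exists>\<phi> D XD. realisation (copy_graph a B) (copy_marks a B) C \<Y> \<phi> D XD" by blast
qed

end

section \<open>Edges of a step, sorted by the copies that own their ends\<close>

fun owner :: "bvert \<Rightarrow> bvert option" where
  "owner (Copy a v) = Some a"
| "owner (NewB a v) = Some a"
| "owner (NewC a v) = Some a"
| "owner _ = None"

lemma owner_copy_graph:
  "x \<in> verts (copy_graph a B) \<Longrightarrow> owner x = Some a"
  "x \<in> copy_marks a B \<Longrightarrow> owner x = Some a"
  "e \<in> edges (copy_graph a B) \<Longrightarrow> x \<in> e \<Longrightarrow> owner x = Some a"
  by (auto simp: copy_graph_def copy_marks_def)

text \<open>Regrouped in this way, a step consists of the old nonmarked part and the copies, joined
  only by edges from the neighbours of \<open>a\<close> to the marks of its copy.\<close>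

lemma burling_step_alt:
  assumes "is_marked_graph B"
  shows "verts (burling_step B) = Old ` nonmarked B \<union> (\<Union>a\<in>marked B. verts (copy_graph a B))"
    "marked (burling_step B) = (\<Union>a\<in>marked B. copy_marks a B)"
    "edges (burling_step B) = (`) Old ` nonmarked_edges B \<union> (\<Union>a\<in>marked B. edges (copy_graph a B)) \<union>
      (\<Union>a\<in>marked B. {{Old u, y} | u y. u \<in> nbrs B a \<and> y \<in> copy_marks a B})"
proof -
  have "marked B \<subseteq> verts B" by (rule marked_graph_facts(3)[OF assms])
  then show "verts (burling_step B) = Old ` nonmarked B \<union> (\<Union>a\<in>marked B. verts (copy_graph a B))"
    by (auto simp: burling_step_def Let_def copy_graph_def)
  show "marked (burling_step B) = (\<Union>a\<in>marked B. copy_marks a B)"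
    by (auto simp: burling_step_def Let_def copy_marks_def)
  have R: "(\<Union>v\<in>marked B. {{Old u, y} | u y. u \<in> nbrs B a \<and> y \<in> {Copy a v, NewC a v}}) =
      {{Old u, y} | u y. u \<in> nbrs B a \<and> y \<in> copy_marks a B}" for a
    by (auto simp: copy_marks_def)
  have step: "edges (burling_step B) = (`) Old ` nonmarked_edges B \<union>
      (\<Union>a\<in>marked B. (`) (Copy a) ` edges B \<union>
           (\<Union>v\<in>marked B. {{Copy a u, NewB a v} | u. u \<in> nbrs B v} \<union> {{NewB a v, NewC a v}} \<union>
              {{Old u, y} | u y. u \<in> nbrs B a \<and> y \<in> {Copy a v, NewC a v}}))"
    by (simp only: burling_step_def Let_def graph.select_convs)
  show "edges (burling_step B) = (`) Old ` nonmarked_edges B \<union> (\<Union>a\<in>marked B. edges (copy_graph a B)) \<union>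
      (\<Union>a\<in>marked B. {{Old u, y} | u y. u \<in> nbrs B a \<and> y \<in> copy_marks a B})"
    unfolding step R[symmetric] copy_graph_def graph.select_convs by (simp only: UN_Un_distrib Un_ac)
qed

lemma burling_step_edge:
  assumes mg: "is_marked_graph B"
  shows "{Old u, Old v} \<in> edges (burling_step B) \<longleftrightarrow> {u, v} \<in> nonmarked_edges B"
    and "owner x = Some a \<Longrightarrow> owner y = Some a \<Longrightarrow> a \<in> marked B \<Longrightarrow>
           {x, y} \<in> edges (burling_step B) \<longleftrightarrow> {x, y} \<in> edges (copy_graph a B)"
    and "owner x = Some a \<Longrightarrow> owner y = Some a' \<Longrightarrow> a \<noteq> a' \<Longrightarrow> {x, y} \<notin> edges (burling_step B)"
    and "owner x = Some a \<Longrightarrow> {Old u, x} \<in> edges (burling_step B) \<longleftrightarrow>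
           a \<in> marked B \<and> {u, a} \<in> edges B \<and> x \<in> copy_marks a B"
proof -
  note e = burling_step_alt(3)[OF mg]
  have c: "{Old u, y} \<notin> edges (copy_graph a B)" for u y a
    using owner_copy_graph(3)[of "{Old u, y}" a B "Old u"] by auto
  have c': "{x, y} \<notin> edges (copy_graph b B)" if "owner x = Some a" "b \<noteq> a" for x y a b
    using owner_copy_graph(3)[of "{x, y}" b B x] that by auto
  have o: "{x, y} \<notin> (`) Old ` S" if "owner x = Some a" for x y a S
  proof (rule not_image_doubleton)
    show "x \<notin> range Old" using that by auto
  qed
  have m: "Old v \<notin> copy_marks a B" for v a using owner_copy_graph(2)[of "Old v" a B] by auto
  show "{Old u, Old v} \<in> edges (burling_step B) \<longleftrightarrow> {u, v} \<in> nonmarked_edges B"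
    unfolding e using c m image_doubleton_iff[OF inj_constructors(2), of u v "nonmarked_edges B"]
    by (auto simp: doubleton_eq_iff)
  show "{x, y} \<in> edges (burling_step B) \<longleftrightarrow> {x, y} \<in> edges (copy_graph a B)"
    if "owner x = Some a" "owner y = Some a" "a \<in> marked B"
  proof -
    have "(\<exists>b\<in>marked B. {x, y} \<in> edges (copy_graph b B)) \<longleftrightarrow> {x, y} \<in> edges (copy_graph a B)"
      using c'[OF that(1), of _ y] that(3) by metis
    then show ?thesis unfolding e using o[OF that(1)] that(1,2) by (auto simp: doubleton_eq_iff)
  qed
  show "{x, y} \<notin> edges (burling_step B)" if "owner x = Some a" "owner y = Some a'" "a \<noteq> a'"
  proof -
    have "{x, y} \<notin> edges (copy_graph b B)" for b
      using c'[OF that(1), of b y] c'[OF that(2), of b x] that(3) by (cases "b = a") (auto simp: insert_commute)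
    then show ?thesis unfolding e using o[OF that(1)] that by (auto simp: doubleton_eq_iff)
  qed
  show "{Old u, x} \<in> edges (burling_step B) \<longleftrightarrow> a \<in> marked B \<and> {u, a} \<in> edges B \<and> x \<in> copy_marks a B"
    if "owner x = Some a"
  proof -
    have "{Old u, x} \<notin> (`) Old ` S" for S using o[OF that, of "Old u"] by (simp add: insert_commute)
    moreover have "b = a" if "x \<in> copy_marks b B" for b
      using owner_copy_graph(2)[OF that] \<open>owner x = Some a\<close> by simp
    ultimately show ?thesis unfolding e using c that
      by (auto simp: doubleton_eq_iff nbrs_def)
  qed
qed

context closed_world
begin

text \<open>The copies are realised one after another inside the regions \<open>D a\<close> of a
  realisation of \<open>B\<close>. Every copy is finite, so the other regions can be cleared of its
  neighbourhood. A candidate for a mark of the copy of \<open>a\<close> is also a candidate for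
  \<open>a\<close>, which gives its adjacencies to old vertices; by separation it misses the other
  copies.\<close>

lemma achievable_step:
  assumes mg: "is_marked_graph B" and ach: "achievable B (marked B)"
  shows "achievable (burling_step B) (marked (burling_step B))"
  unfolding achievable_def
proof (intro allI impI)
  fix C X \<Y> assume reg: "region C X \<Y>"
  note mgf = marked_graph_facts[OF mg]
  let ?A = "marked B"
  define NM where "NM = (\<lambda>a. verts (copy_graph a B) - copy_marks a B)"
  have finNM: "finite (NM a)" for a unfolding NM_def copy_graph_nonmarked using mgf by simp
  have CW: "C \<subseteq> W" by (rule region_W[OF reg])
  obtain \<phi> D XD where re: "realisation B ?A C \<Y> \<phi> D XD"
    using ach reg unfolding achievable_def by blast
  \<comment> \<open>\<open>D0\<close> holds the regions still to be filled and \<open>Dc\<close> the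
    regions for the marks of the copies already placed. The vertices of each placed copy are kept
    away from the unfilled regions, from the other copies and from the mark regions of the other
    copies.\<close>
  define sep where "sep = (\<lambda>F D0 \<psi> Dc. \<forall>a\<in>F. \<forall>u\<in>NM a. (\<forall>a'\<in>?A - F. \<forall>c\<in>D0 a'. \<not> near (\<psi> a u) c) \<and>
      (\<forall>a'\<in>F. a' \<noteq> a \<longrightarrow> (\<forall>u'\<in>NM a'. \<not> near (\<psi> a u) (\<psi> a' u')) \<and>
         (\<forall>x\<in>copy_marks a' B. \<forall>c\<in>Dc a' x. \<not> near (\<psi> a u) c)))"
  have DL: "large (D a)" "D a \<subseteq> C" if "a \<in> ?A" for a
    using region_large[OF realisation_region[OF re that]] realisation_sub[OF re that] by auto
  have "\<exists>D0 \<psi> Dc XDc. (\<forall>a\<in>?A. large (D0 a) \<and> D0 a \<subseteq> D a) \<and>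
      (\<forall>a\<in>F. realisation (copy_graph a B) (copy_marks a B) (D a) \<Y> (\<psi> a) (Dc a) (XDc a)) \<and> sep F D0 \<psi> Dc"
    if "finite F" "F \<subseteq> ?A" for F
    using that
  proof (induction F)
    case empty
    show ?case by (rule exI[of _ D]) (use DL in \<open>auto simp: sep_def\<close>)
  next
    case (insert a F)
    have aA: "a \<in> ?A" and FA: "F \<subseteq> ?A" and aF: "a \<notin> F" using insert by auto
    from insert.IH[OF FA] obtain D0 \<psi> Dc XDc where IH0: "(\<forall>a\<in>?A. large (D0 a) \<and> D0 a \<subseteq> D a) \<and>
      (\<forall>a\<in>F. realisation (copy_graph a B) (copy_marks a B) (D a) \<Y> (\<psi> a) (Dc a) (XDc a)) \<and> sep F D0 \<psi> Dc"
      by (elim exE)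
    have IH: "\<And>a. a \<in> ?A \<Longrightarrow> large (D0 a) \<and> D0 a \<subseteq> D a"
      "\<And>a. a \<in> F \<Longrightarrow> realisation (copy_graph a B) (copy_marks a B) (D a) \<Y> (\<psi> a) (Dc a) (XDc a)"
      "sep F D0 \<psi> Dc" using IH0 by simp_all
    have "region (D0 a) (XD a) \<Y>"
      using region_shrink[OF realisation_region[OF re aA]] IH(1)[OF aA] by blast
    then obtain \<psi>0 Dc0 XDc0 where re0: "realisation (copy_graph a B) (copy_marks a B) (D0 a) \<Y> \<psi>0 Dc0 XDc0"
      using achievable_copy[OF mg ach, of a] unfolding achievable_def by blast
    define P where "P = \<psi>0 ` NM a"
    have finP: "finite P" using finNM by (simp add: P_def)
    have PD: "P \<subseteq> D0 a" using realisation_vertex[OF re0] by (auto simp: P_def NM_def)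
    have PV: "P \<subseteq> V" using PD IH(1)[OF aA] DL(2)[OF aA] CW W_V by blast
    define D0' where "D0' = (\<lambda>a'. D0 a' - zone P)"
    define \<psi>' where "\<psi>' = \<psi>(a := \<psi>0)"
    define Dc' where "Dc' = (\<lambda>a'. if a' = a then Dc0 else (\<lambda>x. Dc a' x - zone P))"
    define XDc' where "XDc' = XDc(a := XDc0)"
    have farP: "\<not> near (\<psi>0 u) c" if "u \<in> NM a" "c \<in> S - zone P" "S \<subseteq> V" for u c S
      using zone_near[of c P "\<psi>0 u"] that by (auto simp: P_def)
    have D0V: "D0 a' \<subseteq> V" if "a' \<in> ?A" for a' using IH(1)[OF that] DL(2)[OF that] CW W_V by blast
    have DcL: "large (Dc a' x)" if "a' \<in> F" "x \<in> copy_marks a' B" for a' x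
      by (rule region_large[OF realisation_region[OF IH(2)[OF that(1)] that(2)]])
    have sepE: "\<And>a1 u a' c. a1 \<in> F \<Longrightarrow> u \<in> NM a1 \<Longrightarrow> a' \<in> ?A \<Longrightarrow> a' \<notin> F \<Longrightarrow> c \<in> D0 a' \<Longrightarrow> \<not> near (\<psi> a1 u) c"
      "\<And>a1 u a' u'. a1 \<in> F \<Longrightarrow> u \<in> NM a1 \<Longrightarrow> a' \<in> F \<Longrightarrow> a' \<noteq> a1 \<Longrightarrow> u' \<in> NM a' \<Longrightarrow> \<not> near (\<psi> a1 u) (\<psi> a' u')"
      "\<And>a1 u a' x c. a1 \<in> F \<Longrightarrow> u \<in> NM a1 \<Longrightarrow> a' \<in> F \<Longrightarrow> a' \<noteq> a1 \<Longrightarrow> x \<in> copy_marks a' B \<Longrightarrow> c \<in> Dc a' x \<Longrightarrow> \<not> near (\<psi> a1 u) c"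
      using IH(3) unfolding sep_def by blast+
    have \<psi>0D: "\<psi>0 u \<in> D0 a" if "u \<in> NM a" for u using PD that by (auto simp: P_def)
    have Dc0D: "Dc0 x \<subseteq> D0 a" if "x \<in> copy_marks a B" for x by (rule realisation_sub[OF re0 that])
    show ?case
    proof (rule exI[of _ D0'], rule exI[of _ \<psi>'], rule exI[of _ Dc'], rule exI[of _ XDc'], intro conjI ballI)
      fix a' assume a': "a' \<in> ?A"
      show "large (D0' a')" unfolding D0'_def using IH(1)[OF a'] finP PV by (intro large_avoid) auto
      show "D0' a' \<subseteq> D a'" using IH(1)[OF a'] by (auto simp: D0'_def)
    next
      fix a' assume "a' \<in> insert a F"
      then consider "a' = a" | "a' \<in> F" "a' \<noteq> a" using aF by blast
      then show "realisation (copy_graph a' B) (copy_marks a' B) (D a') \<Y> (\<psi>' a') (Dc' a') (XDc' a')"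
      proof cases
        case 1
        then show ?thesis
          using realisation_widen[OF re0, of "D a"] IH(1)[OF aA] by (simp add: \<psi>'_def Dc'_def XDc'_def)
      next
        case 2
        have "realisation (copy_graph a' B) (copy_marks a' B) (D a') \<Y> (\<psi> a') (\<lambda>x. Dc a' x - zone P) (XDc a')"
          by (rule realisation_shrink[OF IH(2)[OF 2(1)]]) (use large_avoid[OF DcL[OF 2(1)] finP PV] in auto)
        then show ?thesis using 2 by (simp add: \<psi>'_def Dc'_def XDc'_def)
      qed
    next
      show "sep (insert a F) D0' \<psi>' Dc'"
        unfolding sep_def
      proof (intro ballI conjI impI)
        fix a1 u a' c assume a1: "a1 \<in> insert a F" and u: "u \<in> NM a1" and a': "a' \<in> ?A - insert a F" and c: "c \<in> D0' a'"
        show "\<not> near (\<psi>' a1 u) c"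
        proof (cases "a1 = a")
          case True
          then show ?thesis using farP[of u c "D0 a'"] u c D0V a' by (auto simp: \<psi>'_def D0'_def)
        next
          case False
          then show ?thesis using sepE(1)[of a1 u a' c] a1 u c a' by (auto simp: \<psi>'_def D0'_def)
        qed
      next
        fix a1 u a' u' assume a1: "a1 \<in> insert a F" and u: "u \<in> NM a1" and a': "a' \<in> insert a F" "a' \<noteq> a1"
          and u': "u' \<in> NM a'"
        consider "a1 = a" "a' \<in> F" "a' \<noteq> a" | "a' = a" "a1 \<in> F" "a1 \<noteq> a" | "a1 \<in> F" "a' \<in> F" "a1 \<noteq> a" "a' \<noteq> a"
          using a1 a' by blast
        then show "\<not> near (\<psi>' a1 u) (\<psi>' a' u')"
        proof cases
          case 1
          have "\<not> near (\<psi> a' u') (\<psi>0 u)" using sepE(1)[OF 1(2) u' aA aF \<psi>0D] u 1 by blast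
          then show ?thesis using 1 near_sym by (auto simp: \<psi>'_def)
        next
          case 2
          have "\<not> near (\<psi> a1 u) (\<psi>0 u')" using sepE(1)[OF 2(2) u aA aF \<psi>0D] u' 2 by blast
          then show ?thesis using 2 by (simp add: \<psi>'_def)
        next
          case 3
          then show ?thesis using sepE(2)[OF 3(1) u 3(2) a'(2) u'] by (simp add: \<psi>'_def)
        qed
      next
        fix a1 u a' x c assume a1: "a1 \<in> insert a F" and u: "u \<in> NM a1" and a': "a' \<in> insert a F" "a' \<noteq> a1"
          and x: "x \<in> copy_marks a' B" and c: "c \<in> Dc' a' x"
        consider "a1 = a" "a' \<in> F" "a' \<noteq> a" | "a' = a" "a1 \<in> F" "a1 \<noteq> a" | "a1 \<in> F" "a' \<in> F" "a1 \<noteq> a" "a' \<noteq> a"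
          using a1 a' by blast
        then show "\<not> near (\<psi>' a1 u) c"
        proof cases
          case 1
          then show ?thesis
            using farP[of u c "Dc a' x"] u c large_sub[OF DcL[OF 1(2) x]] by (auto simp: \<psi>'_def Dc'_def)
        next
          case 2
          have "c \<in> D0 a" using c x 2 Dc0D[of x] by (auto simp: Dc'_def)
          then show ?thesis using sepE(1)[OF 2(2) u aA aF] 2 by (simp add: \<psi>'_def)
        next
          case 3
          have "c \<in> Dc a' x" using c 3 by (simp add: Dc'_def)
          then show ?thesis using sepE(3)[OF 3(1) u 3(2) a'(2) x] 3 by (simp add: \<psi>'_def)
        qed
      qed
    qed
  qed
  from this[OF mgf(2) order_refl] obtain D0 \<psi> Dc XDc where rec0: "(\<forall>a\<in>?A. large (D0 a) \<and> D0 a \<subseteq> D a) \<and>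
      (\<forall>a\<in>?A. realisation (copy_graph a B) (copy_marks a B) (D a) \<Y> (\<psi> a) (Dc a) (XDc a)) \<and> sep ?A D0 \<psi> Dc"
    by (elim exE)
  have rec: "\<And>a. a \<in> ?A \<Longrightarrow> realisation (copy_graph a B) (copy_marks a B) (D a) \<Y> (\<psi> a) (Dc a) (XDc a)"
    and sp: "sep ?A D0 \<psi> Dc" using rec0 by simp_all
  have sp1: "\<not> near (\<psi> a u) (\<psi> a' u')" if "a \<in> ?A" "u \<in> NM a" "a' \<in> ?A" "a' \<noteq> a" "u' \<in> NM a'" for a u a' u'
    using sp that unfolding sep_def by blast
  have sp2: "\<not> near (\<psi> a u) c" if "a \<in> ?A" "u \<in> NM a" "a' \<in> ?A" "a' \<noteq> a" "x \<in> copy_marks a' B" "c \<in> Dc a' x"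
    for a u a' x c
    using sp that unfolding sep_def by blast
  define own where "own = (\<lambda>x. the (owner x))"
  define \<phi>' where "\<phi>' = (\<lambda>x. case x of Old u \<Rightarrow> \<phi> u | _ \<Rightarrow> \<psi> (own x) x)"
  define D' where "D' = (\<lambda>x. Dc (own x) x)"
  define XD' where "XD' = (\<lambda>x. XDc (own x) x)"
  have \<phi>'c: "\<phi>' x = \<psi> a x" if "owner x = Some a" for x a
    using that by (cases x) (auto simp: \<phi>'_def own_def)
  have \<phi>'o: "\<phi>' (Old u) = \<phi> u" for u by (simp add: \<phi>'_def)
  have NMo: "owner x = Some a" if "x \<in> NM a" for x a using that owner_copy_graph(1) by (auto simp: NM_def)
  have D'c: "D' x = Dc a x" "XD' x = XDc a x" if "x \<in> copy_marks a B" for x a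
    using owner_copy_graph(2)[OF that] by (auto simp: D'_def XD'_def own_def)
  have nonm: "verts (burling_step B) - marked (burling_step B) = Old ` (verts B - ?A) \<union> (\<Union>a\<in>?A. NM a)"
  proof -
    have o: "Old u \<notin> copy_marks a B" for u a using owner_copy_graph(2)[of "Old u" a B] by auto
    have c: "x \<notin> copy_marks b B" if "x \<in> verts (copy_graph a B)" "a \<noteq> b" for x a b
      using owner_copy_graph(1)[OF that(1)] owner_copy_graph(2)[of x b B] that(2) by auto
    have "(\<Union>a\<in>?A. verts (copy_graph a B)) - (\<Union>b\<in>?A. copy_marks b B) = (\<Union>a\<in>?A. NM a)"
    proof (intro set_eqI iffI)
      fix x assume "x \<in> (\<Union>a\<in>?A. verts (copy_graph a B)) - (\<Union>b\<in>?A. copy_marks b B)"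
      then show "x \<in> (\<Union>a\<in>?A. NM a)" by (auto simp: NM_def)
    next
      fix x assume "x \<in> (\<Union>a\<in>?A. NM a)"
      then obtain a where a: "a \<in> ?A" "x \<in> verts (copy_graph a B)" "x \<notin> copy_marks a B" by (auto simp: NM_def)
      then have "x \<notin> copy_marks b B" for b using c[OF a(2), of b] by (cases "a = b") auto
      then show "x \<in> (\<Union>a\<in>?A. verts (copy_graph a B)) - (\<Union>b\<in>?A. copy_marks b B)" using a by auto
    qed
    moreover have "Old ` (verts B - ?A) - (\<Union>b\<in>?A. copy_marks b B) = Old ` (verts B - ?A)" using o by auto
    ultimately show ?thesis
      unfolding burling_step_alt(1,2)[OF mg] nonmarked_def Un_Diff by simp
  qed
  have \<psi>D: "\<psi> a x \<in> D a" if "a \<in> ?A" "x \<in> NM a" for a x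
    using realisation_vertex[OF rec[OF that(1)]] that(2) by (simp add: NM_def)
  have DcD: "Dc a x \<subseteq> D a" if "a \<in> ?A" "x \<in> copy_marks a B" for a x
    by (rule realisation_sub[OF rec[OF that(1)] that(2)])
  have old: "\<not> near (\<phi> u) (\<psi> a x)" if "u \<in> verts B - ?A" "a \<in> ?A" "x \<in> NM a" for u a x
    by (rule realisation_far[OF re that(2) \<psi>D[OF that(2,3)] that(1)])
  have marks: "marked (burling_step B) = (\<Union>a\<in>?A. copy_marks a B)" by (rule burling_step_alt(2)[OF mg])
  have pairs: "P x y" if x: "x \<in> verts (burling_step B) - marked (burling_step B)"
    and y: "y \<in> verts (burling_step B) - marked (burling_step B)"
    and P1: "\<And>u v. u \<in> verts B - ?A \<Longrightarrow> v \<in> verts B - ?A \<Longrightarrow> P (Old u) (Old v)"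
    and P2: "\<And>u a x. u \<in> verts B - ?A \<Longrightarrow> a \<in> ?A \<Longrightarrow> x \<in> NM a \<Longrightarrow> P (Old u) x \<and> P x (Old u)"
    and P3: "\<And>a x y. a \<in> ?A \<Longrightarrow> x \<in> NM a \<Longrightarrow> y \<in> NM a \<Longrightarrow> P x y"
    and P4: "\<And>a b x y. a \<in> ?A \<Longrightarrow> b \<in> ?A \<Longrightarrow> a \<noteq> b \<Longrightarrow> x \<in> NM a \<Longrightarrow> y \<in> NM b \<Longrightarrow> P x y"
    for x y and P :: "bvert \<Rightarrow> bvert \<Rightarrow> bool"
  proof -
    consider u where "u \<in> verts B - ?A" "x = Old u" | a where "a \<in> ?A" "x \<in> NM a" using x nonm by blast
    note cx = this
    consider v where "v \<in> verts B - ?A" "y = Old v" | b where "b \<in> ?A" "y \<in> NM b" using y nonm by blast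
    note cy = this
    show ?thesis
    proof (cases rule: cx)
      case (1 u)
      show ?thesis by (cases rule: cy) (use 1 P1 P2 in blast)+
    next
      case (2 a)
      show ?thesis
      proof (cases rule: cy)
        case (1 v)
        then show ?thesis using 2 P2 by blast
      next
        case (2 b)
        then show ?thesis using \<open>a \<in> ?A\<close> \<open>x \<in> NM a\<close> P3 P4 by (cases "a = b") auto
      qed
    qed
  qed
  have noNM: "x \<notin> copy_marks a B" if "x \<in> NM b" for x a b
  proof
    assume "x \<in> copy_marks a B"
    then have "owner x = Some a" by (rule owner_copy_graph(2))
    then have "a = b" using NMo[OF that] by simp
    then show False using that \<open>x \<in> copy_marks a B\<close> by (simp add: NM_def)
  qed
  have "realisation (burling_step B) (marked (burling_step B)) C \<Y> \<phi>' D' XD'"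
    unfolding realisation_def
  proof (intro conjI ballI impI)
    fix x assume "x \<in> verts (burling_step B) - marked (burling_step B)"
    then consider u where "u \<in> verts B - ?A" "x = Old u" | a where "a \<in> ?A" "x \<in> NM a" using nonm by blast
    then show "\<phi>' x \<in> C"
    proof cases
      case 1
      then show ?thesis using realisation_vertex[OF re] \<phi>'o by simp
    next
      case 2
      then show ?thesis using \<psi>D DL(2) \<phi>'c[OF NMo] by auto
    qed
  next
    show "inj_on \<phi>' (verts (burling_step B) - marked (burling_step B))"
    proof (rule inj_onI)
      fix x y
      assume x: "x \<in> verts (burling_step B) - marked (burling_step B)"
        and y: "y \<in> verts (burling_step B) - marked (burling_step B)" and eq: "\<phi>' x = \<phi>' y"
      have "\<phi>' x = \<phi>' y \<longrightarrow> x = y"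
      proof (rule pairs[OF x y])
        fix u v assume "u \<in> verts B - ?A" "v \<in> verts B - ?A"
        then show "\<phi>' (Old u) = \<phi>' (Old v) \<longrightarrow> Old u = Old v"
          using realisation_inj[OF re] by (auto simp: \<phi>'o dest: inj_onD)
      next
        fix u a x assume "u \<in> verts B - ?A" "a \<in> ?A" "x \<in> NM a"
        then show "(\<phi>' (Old u) = \<phi>' x \<longrightarrow> Old u = x) \<and> (\<phi>' x = \<phi>' (Old u) \<longrightarrow> x = Old u)"
          using old[of u a x] \<phi>'c[OF NMo, of x a] \<phi>'o[of u] by (auto simp: near_def)
      next
        fix a x y assume a: "a \<in> ?A" and xy: "x \<in> NM a" "y \<in> NM a"
        show "\<phi>' x = \<phi>' y \<longrightarrow> x = y"
          using realisation_inj[OF rec[OF a]] xy \<phi>'c[OF NMo] by (auto simp: NM_def dest: inj_onD)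
      next
        fix a b x y assume "a \<in> ?A" "b \<in> ?A" "a \<noteq> b" "x \<in> NM a" "y \<in> NM b"
        then show "\<phi>' x = \<phi>' y \<longrightarrow> x = y"
          using sp1[of a x b y] \<phi>'c[OF NMo, of x a] \<phi>'c[OF NMo, of y b] by (auto simp: near_def)
      qed
      then show "x = y" using eq by blast
    qed
  next
    fix x y
    assume x: "x \<in> verts (burling_step B) - marked (burling_step B)"
      and y: "y \<in> verts (burling_step B) - marked (burling_step B)"
    show "E (\<phi>' x) (\<phi>' y) \<longleftrightarrow> {x, y} \<in> edges (burling_step B)"
    proof (rule pairs[OF x y])
      fix u v assume uv: "u \<in> verts B - ?A" "v \<in> verts B - ?A"
      then have "{u, v} \<in> nonmarked_edges B \<longleftrightarrow> {u, v} \<in> edges B"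
        by (simp add: nonmarked_edges_def nonmarked_def)
      then show "E (\<phi>' (Old u)) (\<phi>' (Old v)) \<longleftrightarrow> {Old u, Old v} \<in> edges (burling_step B)"
        using realisation_edge[OF re uv] burling_step_edge(1)[OF mg] by (simp add: \<phi>'o)
    next
      fix u a x assume u: "u \<in> verts B - ?A" and a: "a \<in> ?A" and x: "x \<in> NM a"
      have "\<not> E (\<phi>' (Old u)) (\<phi>' x)"
        using old[OF u a x] \<phi>'c[OF NMo[OF x]] \<phi>'o[of u] by (simp add: near_def)
      moreover have "{Old u, x} \<notin> edges (burling_step B)"
        using burling_step_edge(4)[OF mg NMo[OF x]] noNM[OF x] by blast
      ultimately show "(E (\<phi>' (Old u)) (\<phi>' x) \<longleftrightarrow> {Old u, x} \<in> edges (burling_step B)) \<and>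
          (E (\<phi>' x) (\<phi>' (Old u)) \<longleftrightarrow> {x, Old u} \<in> edges (burling_step B))"
        using E_commute[of "\<phi>' x"] by (simp add: insert_commute)
    next
      fix a x y assume a: "a \<in> ?A" and xy: "x \<in> NM a" "y \<in> NM a"
      show "E (\<phi>' x) (\<phi>' y) \<longleftrightarrow> {x, y} \<in> edges (burling_step B)"
        using realisation_edge[OF rec[OF a], of x y] xy burling_step_edge(2)[OF mg NMo[OF xy(1)] NMo[OF xy(2)] a]
          \<phi>'c[OF NMo[OF xy(1)]] \<phi>'c[OF NMo[OF xy(2)]] by (simp add: NM_def)
    next
      fix a b x y assume ab: "a \<in> ?A" "b \<in> ?A" "a \<noteq> b" and x: "x \<in> NM a" and y: "y \<in> NM b"
      show "E (\<phi>' x) (\<phi>' y) \<longleftrightarrow> {x, y} \<in> edges (burling_step B)"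
        using sp1[OF ab(1) x ab(2) _ y] ab(3) burling_step_edge(3)[OF mg NMo[OF x] NMo[OF y] ab(3)]
          \<phi>'c[OF NMo[OF x]] \<phi>'c[OF NMo[OF y]] by (auto simp: near_def)
    qed
  next
    fix x assume "x \<in> marked (burling_step B)"
    then obtain a where a: "a \<in> ?A" and x: "x \<in> copy_marks a B" using marks by blast
    note ra = rec[OF a]
    show "region (D' x) (XD' x) \<Y>" using realisation_region[OF ra x] D'c[OF x] by simp
    show "D' x \<subseteq> C" using DcD[OF a x] DL(2)[OF a] D'c(1)[OF x] by simp
    { fix c u assume c: "c \<in> D' x" and u: "u \<in> verts (burling_step B) - marked (burling_step B)"
      have cD: "c \<in> Dc a x" using c D'c(1)[OF x] by simp
      consider v where "v \<in> verts B - ?A" "u = Old v" | b where "b \<in> ?A" "u \<in> NM b" using u nonm by blast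
      then show "\<not> near (\<phi>' u) c"
      proof cases
        case 1
        then show ?thesis using realisation_far[OF re a _ 1(1)] DcD[OF a x] cD \<phi>'o by auto
      next
        case 2
        then show ?thesis
          using realisation_far[OF ra x cD, of u] sp2[OF 2(1,2) a _ x cD] \<phi>'c[OF NMo[OF 2(2)]]
          by (cases "a = b") (auto simp: NM_def)
      qed }
    fix Y c y u assume Y: "Y \<in> \<Y>" and c: "c \<in> D' x" and y: "y \<in> Y" "E y c"
      and u: "u \<in> verts (burling_step B) - marked (burling_step B)"
    have cD: "c \<in> Dc a x" using c D'c(1)[OF x] by simp
    have cDa: "c \<in> D a" using cD DcD[OF a x] by blast
    have ox: "owner x = Some a" by (rule owner_copy_graph(2)[OF x])
    consider (1) v where "v \<in> verts B - ?A" "u = Old v" | (2) b where "b \<in> ?A" "u \<in> NM b" using u nonm by blast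
    then show "E y (\<phi>' u) \<longleftrightarrow> {u, x} \<in> edges (burling_step B)"
    proof cases
      case 1
      then show ?thesis
        using realisation_mark[OF re a Y cDa y 1(1)] burling_step_edge(4)[OF mg ox, of v] a x \<phi>'o by simp
    next
      case 2
      note ub = \<phi>'c[OF NMo[OF 2(2)]]
      show ?thesis
      proof (cases "a = b")
        case True
        then show ?thesis
          using realisation_mark[OF ra x Y cD y, of u] 2 ub burling_step_edge(2)[OF mg NMo[OF 2(2)] _ 2(1), of x] ox
          by (simp add: NM_def)
      next
        case False
        have "\<not> E y (\<psi> b u)"
          using realisation_sep[OF re a 2(1) False Y y(1) cDa \<psi>D[OF 2] y(2)] by blast
        then show ?thesis using ub burling_step_edge(3)[OF mg NMo[OF 2(2)] ox] False by auto
      qed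
    qed
  next
    fix x x' Y y c c'
    assume x: "x \<in> marked (burling_step B)" and x': "x' \<in> marked (burling_step B)" and ne: "x \<noteq> x'"
      and Y: "Y \<in> \<Y>" "y \<in> Y" and c: "c \<in> D' x" "c' \<in> D' x'"
    obtain a where a: "a \<in> ?A" "x \<in> copy_marks a B" using x marks by blast
    obtain a' where a': "a' \<in> ?A" "x' \<in> copy_marks a' B" using x' marks by blast
    have cD: "c \<in> Dc a x" "c' \<in> Dc a' x'" using c D'c(1)[OF a(2)] D'c(1)[OF a'(2)] by auto
    show "\<not> (E y c \<and> E y c')"
    proof (cases "a = a'")
      case True
      then show ?thesis using realisation_sep[OF rec[OF a(1)] a(2) _ ne Y cD(1), of c'] a' cD by auto
    next
      case False
      then show ?thesis
        using realisation_sep[OF re a(1) a'(1) False Y, of c c'] DcD[OF a] DcD[OF a'] cD by auto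
    qed
  qed
  then show "\<exists>\<phi> D XD. realisation (burling_step B) (marked (burling_step B)) C \<Y> \<phi> D XD" by blast
qed

lemma achievable_burling: "achievable (burling (Suc (Suc k))) (marked (burling (Suc (Suc k))))"
proof (induction k)
  case 0
  show ?case using achievable_edge by simp
next
  case (Suc k)
  then show ?case using achievable_step is_marked_graph_burling[of "Suc k"] by simp
qed

text \<open>Only now are the marked vertices chosen. They have to be pairwise non-adjacent, so the
  single cover offered must be stable. A fork provides a small cover; it is covered by finitely many
  stable internal sets, and its intersection with one of them still covers a large region.\<close>

theorem marked_graph_embeds:
  assumes mg: "is_marked_graph B" and ach: "achievable B (marked B)"
  shows "\<exists>\<psi>. inj_on \<psi> (verts B) \<and> \<psi> ` verts B \<subseteq> V \<and>
     (\<forall>u\<in>verts B. \<forall>v\<in>verts B. E (\<psi> u) (\<psi> v) \<longleftrightarrow> {u, v} \<in> edges B)"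
proof -
  note mgf = marked_graph_facts[OF mg]
  have "region C0 X0 {}" using base_site by (simp add: region_def subsite_refl)
  from fork_exists[OF this] obtain C1 X1 T K where f: "fork C0 X0 {} C1 X1 T K" by blast
  have r1: "region C1 X1 {T}" and smT: "small T" using fork_basic[OF f] by auto
  have T: "T \<in> \<I>" "T \<subseteq> W" "covers T C1" "nesting p C1 X1 T" using r1 by (auto simp: region_def)
  obtain \<F> where \<F>: "finite \<F>" "\<F> \<subseteq> \<I>" "\<forall>F\<in>\<F>. \<forall>x\<in>F. \<forall>y\<in>F. \<not> E x y" "T \<subseteq> \<Union>\<F>"
    using small_stable[OF smT T(1)] by blast
  have L1: "large C1" by (rule region_large[OF r1])
  have "C1 \<subseteq> (\<Union>F\<in>\<F>. C1 \<inter> nbh (T \<inter> F))"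
  proof
    fix c assume c: "c \<in> C1"
    then obtain y where y: "y \<in> T" "E y c" using T(3) unfolding covers_def by blast
    then obtain F where "F \<in> \<F>" "y \<in> F" using \<F>(4) by blast
    then show "c \<in> (\<Union>F\<in>\<F>. C1 \<inter> nbh (T \<inter> F))"
      using c y large_sub[OF L1] by (auto simp: nbh_def)
  qed
  then have "\<exists>F\<in>\<F>. \<not> small (C1 \<inter> nbh (T \<inter> F))"
    using small_UN[OF \<F>(1), of "\<lambda>F. C1 \<inter> nbh (T \<inter> F)"] small_sub L1 unfolding large_def by blast
  then obtain F where F: "F \<in> \<F>" "\<not> small (C1 \<inter> nbh (T \<inter> F))" by blast
  define Y where "Y = T \<inter> F"
  define C2 where "C2 = C1 \<inter> nbh Y"
  have YI: "Y \<in> \<I>" unfolding Y_def using T(1) F(1) \<F>(2) by (intro Int_inter) auto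
  have YW: "Y \<subseteq> W" using T(2) by (auto simp: Y_def)
  have L2: "large C2" using F(2) L1 YI Int_inter Int_nbh by (auto simp: large_def C2_def Y_def)
  have stab: "\<not> E x y" if "x \<in> Y" "y \<in> Y" for x y using that \<F>(3) F(1) by (auto simp: Y_def)
  have C21: "C2 \<subseteq> C1" by (auto simp: C2_def)
  have r2: "region C2 X1 {Y}"
    unfolding region_def
  proof (intro conjI ballI)
    show "subsite p C2 X1 C0 X0" using region_shrink[OF r1 L2 C21] by (simp add: region_def)
    fix Z assume "Z \<in> {Y}"
    then have Z: "Z = Y" by simp
    show "Z \<in> \<I>" "Z \<subseteq> W" using Z YI YW by auto
    show "covers Z C2" using Z by (auto simp: covers_def C2_def nbh_def)
    show "nesting p C2 X1 Z" by (rule nesting_mono[OF T(4) C21]) (auto simp: Z Y_def)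
  qed simp
  then obtain \<phi> D XD where re: "realisation B (marked B) C2 {Y} \<phi> D XD"
    using ach unfolding achievable_def by blast
  have "\<exists>y c. y \<in> Y \<and> c \<in> D a \<and> E y c" if "a \<in> marked B" for a
  proof -
    have "region (D a) (XD a) {Y}" by (rule realisation_region[OF re that])
    then have "covers Y (D a)" "D a \<noteq> {}" using region_large large_nonempty by (auto simp: region_def)
    then show ?thesis by (auto simp: covers_def)
  qed
  then obtain z cc where z: "\<And>a. a \<in> marked B \<Longrightarrow> z a \<in> Y \<and> cc a \<in> D a \<and> E (z a) (cc a)" by metis
  define \<psi> where "\<psi> = (\<lambda>x. if x \<in> marked B then z x else \<phi> x)"
  have zz: "a = a'" if "z a = z a'" "a \<in> marked B" "a' \<in> marked B" for a a'
    using realisation_sep[OF re that(2,3), of Y "z a" "cc a" "cc a'"] z[OF that(2)] z[OF that(3)] that(1) by auto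
  have zE: "E (z a) (\<phi> u) \<longleftrightarrow> {u, a} \<in> edges B" if "a \<in> marked B" "u \<in> verts B - marked B" for a u
    by (rule realisation_mark[OF re that(1)]) (use z[OF that(1)] that in auto)
  have zne: "z a \<noteq> \<phi> u" if "a \<in> marked B" "u \<in> verts B - marked B" for a u
    using realisation_far[OF re that(1) _ that(2), of "cc a"] z[OF that(1)] by (auto simp: near_def)
  have "inj_on \<psi> (verts B)"
  proof (rule inj_onI)
    fix x y assume "x \<in> verts B" "y \<in> verts B" "\<psi> x = \<psi> y"
    then show "x = y"
      using zz zne[of x y] zne[of y x] realisation_inj[OF re]
      by (cases "x \<in> marked B"; cases "y \<in> marked B") (auto simp: \<psi>_def dest: inj_onD)
  qed
  moreover have "\<psi> ` verts B \<subseteq> V"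
    using z YW W_V realisation_vertex[OF re] large_sub[OF L2] by (auto simp: \<psi>_def)
  moreover have "E (\<psi> u) (\<psi> v) \<longleftrightarrow> {u, v} \<in> edges B" if uv: "u \<in> verts B" "v \<in> verts B" for u v
  proof (cases "u \<in> marked B"; cases "v \<in> marked B")
    assume "u \<in> marked B" "v \<in> marked B"
    then show ?thesis using z stab mgf(5) by (auto simp: \<psi>_def)
  next
    assume "u \<in> marked B" "v \<notin> marked B"
    then show ?thesis using zE[of u v] uv by (simp add: \<psi>_def insert_commute)
  next
    assume "u \<notin> marked B" "v \<in> marked B"
    then show ?thesis using zE[of v u] uv E_commute[of "\<phi> u"] by (simp add: \<psi>_def)
  next
    assume "u \<notin> marked B" "v \<notin> marked B"
    then show ?thesis using realisation_edge[OF re, of u v] uv by (simp add: \<psi>_def)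
  qed
  ultimately show ?thesis by blast
qed

end

theorem (in clique_world) burling_embeds:
  "\<exists>\<psi>. inj_on \<psi> (verts (burling (Suc (Suc k)))) \<and> \<psi> ` verts (burling (Suc (Suc k))) \<subseteq> V \<and>
     (\<forall>u\<in>verts (burling (Suc (Suc k))). \<forall>v\<in>verts (burling (Suc (Suc k))).
        E (\<psi> u) (\<psi> v) \<longleftrightarrow> {u, v} \<in> edges (burling (Suc (Suc k))))"
proof -
  obtain p C X where base: "site p C X" "rich p C X" "closed p C X" using exists_closed_site by blast
  interpret closed_world E V \<I> small \<omega> Np W j p C X
    by unfold_locales (rule base)+
  show ?thesis
    by (rule marked_graph_embeds[OF _ achievable_burling])
      (use is_marked_graph_burling[of "Suc k"] in blast)
qed


section \<open>Ultraproducts\<close>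

text \<open>A nonprincipal ultrafilter, obtained by Zorn's lemma as a minimal proper filter below
  \<open>sequentially\<close>; chains are bounded by their infima.\<close>

lemma exists_ultrafilter:
  "\<exists>U::nat filter. U \<noteq> bot \<and> U \<le> sequentially \<and> (\<forall>P. eventually P U \<or> eventually (\<lambda>n. \<not> P n) U)"
proof -
  define A where "A = {F::nat filter. F \<noteq> bot \<and> F \<le> sequentially}"
  define r where "r = (\<lambda>F G::nat filter. G \<le> F)"
  have "\<exists>m\<in>A. \<forall>a\<in>A. r m a \<longrightarrow> a = m"
  proof (rule predicate_Zorn)
    show "partial_order_on A (relation_of r A)"
      by (rule partial_order_on_relation_ofI) (auto simp: r_def)
    fix C assume C: "C \<in> Chains (relation_of r A)"
    then have CA: "C \<subseteq> A" and lin: "\<And>F G. F \<in> C \<Longrightarrow> G \<in> C \<Longrightarrow> F \<le> G \<or> G \<le> F"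
      unfolding Chains_def relation_of_def r_def by auto
    show "\<exists>u\<in>A. \<forall>a\<in>C. r a u"
    proof (cases "C = {}")
      case True
      then show ?thesis by (intro bexI[of _ sequentially]) (auto simp: A_def)
    next
      case False
      have ev: "eventually P (Inf C) \<longleftrightarrow> (\<exists>F\<in>C. eventually P F)" for P
      proof (rule eventually_Inf_base[OF False])
        fix F G assume FG: "F \<in> C" "G \<in> C"
        show "\<exists>x\<in>C. x \<le> inf F G" using lin[OF FG] FG by (auto intro: bexI[of _ F] bexI[of _ G])
      qed
      have "Inf C \<noteq> bot"
      proof
        assume "Inf C = bot"
        then have "eventually (\<lambda>_. False) (Inf C)" by simp
        then obtain F where "F \<in> C" "eventually (\<lambda>_. False) F" using ev by blast
        then show False using CA trivial_limit_def by (auto simp: A_def)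
      qed
      moreover obtain F where "F \<in> C" using False by blast
      then have "Inf C \<le> sequentially" using CA Inf_lower[of F C] order_trans by (auto simp: A_def)
      ultimately show ?thesis by (intro bexI[of _ "Inf C"]) (auto simp: A_def r_def Inf_lower)
    qed
  qed
  then obtain U where U: "U \<in> A" and max: "\<And>F. F \<in> A \<Longrightarrow> F \<le> U \<Longrightarrow> F = U" by (auto simp: r_def)
  have "eventually P U \<or> eventually (\<lambda>n. \<not> P n) U" for P
  proof (rule ccontr)
    assume neg: "\<not> ?thesis"
    define F where "F = inf U (principal {n. P n})"
    have evF: "eventually Q F \<longleftrightarrow> eventually (\<lambda>n. P n \<longrightarrow> Q n) U" for Q
      by (simp add: F_def eventually_inf_principal)
    have "F \<noteq> bot"
    proof
      assume "F = bot"
      then have "eventually (\<lambda>_. False) F" by simp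
      then show False using neg by (simp add: evF)
    qed
    moreover have FU: "F \<le> U" by (simp add: F_def)
    ultimately have "F \<in> A" using U by (auto simp: A_def)
    then have "F = U" using max FU by blast
    moreover have "eventually P F" by (simp add: evF)
    ultimately show False using neg by simp
  qed
  then show ?thesis using U by (auto simp: A_def)
qed

text \<open>The bound \<open>c1\<close> in \<open>nb\<close> will be supplied by the induction on
  the clique number.\<close>

locale ultraproduct =
  fixes U :: "nat filter" and En :: "nat \<Rightarrow> nat \<Rightarrow> nat \<Rightarrow> bool" and Vn :: "nat \<Rightarrow> nat set"
    and \<omega> d :: nat and f :: "nat \<Rightarrow> nat" and c1 :: nat
  assumes U_bot: "U \<noteq> bot" and U_seq: "U \<le> sequentially"
    and ultra: "eventually P U \<or> eventually (\<lambda>n. \<not> P n) U"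
    and good: "good \<omega> d f (En n) (Vn n)"
    and nb: "x \<in> Vn n \<Longrightarrow> colourable (En n) {y \<in> Vn n. En n x y} c1"
    and big: "\<not> colourable (En n) (Vn n) n"
begin

abbreviation ev :: "(nat \<Rightarrow> bool) \<Rightarrow> bool" where
  "ev P \<equiv> eventually P U"

lemma ev_not: "ev (\<lambda>n. \<not> P n) \<longleftrightarrow> \<not> ev P"
proof
  assume a: "ev (\<lambda>n. \<not> P n)"
  show "\<not> ev P"
  proof
    assume "ev P"
    with a have "ev (\<lambda>n. False)" by eventually_elim simp
    then show False using U_bot by simp
  qed
qed (use ultra[of P] in blast)

lemma ev_conj: "ev (\<lambda>n. P n \<and> Q n) \<longleftrightarrow> ev P \<and> ev Q"
  by (rule eventually_conj_iff)

lemma ev_disj: "ev (\<lambda>n. P n \<or> Q n) \<longleftrightarrow> ev P \<or> ev Q"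
  using ev_not[of "\<lambda>n. \<not> P n \<and> \<not> Q n"] ev_conj[of "\<lambda>n. \<not> P n" "\<lambda>n. \<not> Q n"] ev_not[of P] ev_not[of Q] by simp

lemma ev_const: "ev (\<lambda>n. P) \<longleftrightarrow> P"
  using U_bot by (cases P) auto

lemma ev_ball: "finite S \<Longrightarrow> ev (\<lambda>n. \<forall>x\<in>S. P x n) \<longleftrightarrow> (\<forall>x\<in>S. ev (P x))"
  by (induction S rule: finite_induct) (simp_all add: ev_conj)

lemma ev_bex: "finite S \<Longrightarrow> ev (\<lambda>n. \<exists>x\<in>S. P x n) \<longleftrightarrow> (\<exists>x\<in>S. ev (P x))"
  by (induction S rule: finite_induct) (simp_all add: ev_disj ev_const)

lemma ev_mp: "ev P \<Longrightarrow> (\<And>n. P n \<Longrightarrow> Q n) \<Longrightarrow> ev Q"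
  by (rule eventually_mono)

lemma ev_ex: "ev P \<Longrightarrow> \<exists>n. P n"
  using eventually_happens[of P U] U_bot by auto

lemma ev_ge: "ev (\<lambda>n. M \<le> n)"
  using filter_leD[OF U_seq eventually_ge_at_top[of M]] .

text \<open>Elements of the ultraproduct are canonical representatives of sequences.\<close>

definition rep :: "(nat \<Rightarrow> nat) \<Rightarrow> (nat \<Rightarrow> nat)" where
  "rep x = (SOME y. ev (\<lambda>n. x n = y n))"

definition R :: "(nat \<Rightarrow> nat) set" where
  "R = range rep"

lemma rep_ev: "ev (\<lambda>n. x n = rep x n)"
  unfolding rep_def by (rule someI[of _ x]) simp

lemma rep_cong: "ev (\<lambda>n. x n = y n) \<Longrightarrow> rep x = rep y"
proof -
  assume a: "ev (\<lambda>n. x n = y n)"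
  have "ev (\<lambda>n. x n = z n) \<longleftrightarrow> ev (\<lambda>n. y n = z n)" for z
  proof
    assume "ev (\<lambda>n. x n = z n)"
    with a show "ev (\<lambda>n. y n = z n)" by eventually_elim simp
  next
    assume "ev (\<lambda>n. y n = z n)"
    with a show "ev (\<lambda>n. x n = z n)" by eventually_elim simp
  qed
  then show ?thesis unfolding rep_def by simp
qed

lemma rep_R: "rep x \<in> R"
  by (simp add: R_def)

lemma R_rep: "x \<in> R \<Longrightarrow> rep x = x"
  unfolding R_def using rep_cong[OF rep_ev] by auto

lemma R_eq: "x \<in> R \<Longrightarrow> y \<in> R \<Longrightarrow> x = y \<longleftrightarrow> ev (\<lambda>n. x n = y n)"
proof (rule iffI)
  assume a: "x \<in> R" "y \<in> R" "ev (\<lambda>n. x n = y n)"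
  have "x = rep x" using R_rep[OF a(1)] by (rule sym)
  also have "\<dots> = rep y" by (rule rep_cong[OF a(3)])
  also have "\<dots> = y" by (rule R_rep[OF a(2)])
  finally show "x = y" .
qed simp

lemma pick: "ev (\<lambda>n. \<exists>x. P n x) \<Longrightarrow> \<exists>x\<in>R. ev (\<lambda>n. P n (x n))"
proof -
  assume a: "ev (\<lambda>n. \<exists>x. P n x)"
  define x where "x = (\<lambda>n. SOME x. P n x)"
  from a have "ev (\<lambda>n. P n (x n))" by eventually_elim (simp add: x_def someI_ex)
  with rep_ev[of x] have "ev (\<lambda>n. P n (rep x n))" by eventually_elim simp
  then show ?thesis using rep_R by blast
qed

text \<open>The existential step of Los's theorem for quantifiers bounded by an internal
  set.\<close>

lemma ev_bex_internal: "ev (\<lambda>n. \<exists>x\<in>A n. P n x) \<longleftrightarrow> (\<exists>x\<in>R. ev (\<lambda>n. x n \<in> A n) \<and> ev (\<lambda>n. P n (x n)))"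
proof
  assume "ev (\<lambda>n. \<exists>x\<in>A n. P n x)"
  then have "ev (\<lambda>n. \<exists>x. x \<in> A n \<and> P n x)" by (rule ev_mp) auto
  from pick[OF this] show "\<exists>x\<in>R. ev (\<lambda>n. x n \<in> A n) \<and> ev (\<lambda>n. P n (x n))" by (simp add: ev_conj)
next
  assume "\<exists>x\<in>R. ev (\<lambda>n. x n \<in> A n) \<and> ev (\<lambda>n. P n (x n))"
  then obtain x where "ev (\<lambda>n. x n \<in> A n)" "ev (\<lambda>n. P n (x n))" by blast
  then show "ev (\<lambda>n. \<exists>x\<in>A n. P n x)" by eventually_elim blast
qed

section \<open>Internal and small sets of the ultraproduct\<close>

definition I :: "(nat \<Rightarrow> nat set) \<Rightarrow> (nat \<Rightarrow> nat) set" where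
  "I A = {x \<in> R. ev (\<lambda>n. x n \<in> A n)}"

definition E :: "(nat \<Rightarrow> nat) \<Rightarrow> (nat \<Rightarrow> nat) \<Rightarrow> bool" where
  "E x y \<longleftrightarrow> ev (\<lambda>n. En n (x n) (y n))"

definition internal :: "(nat \<Rightarrow> nat) set set" where
  "internal = {I A | A. \<forall>n. A n \<subseteq> Vn n}"

definition small :: "(nat \<Rightarrow> nat) set \<Rightarrow> bool" where
  "small S \<longleftrightarrow> (\<exists>A T. (\<forall>n. A n \<subseteq> Vn n) \<and> S \<subseteq> I A \<and> ev (\<lambda>n. colourable (En n) (A n) T))"

definition Np :: nat where
  "Np = (SOME N. \<forall>E (V::nat set) w y. good \<omega> d f E V \<longrightarrow> \<not> pattern E V {..<N} w y)"

lemma En_sym: "En n x y \<Longrightarrow> En n y x" and En_irrefl: "\<not> En n x x" and Vn_finite: "finite (Vn n)"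
  using good[of n] by (auto simp: good_def irreflp_def dest: sympD)

lemma I_R: "x \<in> I A \<Longrightarrow> x \<in> R"
  by (simp add: I_def)

lemma I_Un: "I A \<union> I B = I (\<lambda>n. A n \<union> B n)"
  by (auto simp: I_def ev_disj)

lemma I_Diff: "I A - I B = I (\<lambda>n. A n - B n)"
  by (auto simp: I_def ev_conj ev_not)

lemma I_subset: "I A \<subseteq> I B \<longleftrightarrow> ev (\<lambda>n. A n \<subseteq> B n)"
proof
  assume sub: "I A \<subseteq> I B"
  show "ev (\<lambda>n. A n \<subseteq> B n)"
  proof (rule ccontr)
    assume "\<not> ?thesis"
    then have "ev (\<lambda>n. \<not> A n \<subseteq> B n)" by (simp add: ev_not)
    then have "ev (\<lambda>n. \<exists>x. x \<in> A n \<and> x \<notin> B n)" by (rule ev_mp) blast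
    from pick[OF this] obtain x where "x \<in> R" "ev (\<lambda>n. x n \<in> A n \<and> x n \<notin> B n)" by blast
    then have "x \<in> I A" "x \<notin> I B" by (auto simp: I_def ev_conj ev_not)
    then show False using sub by blast
  qed
next
  assume a: "ev (\<lambda>n. A n \<subseteq> B n)"
  show "I A \<subseteq> I B"
  proof
    fix x assume "x \<in> I A"
    then have "x \<in> R" "ev (\<lambda>n. x n \<in> A n)" by (auto simp: I_def)
    with a have "ev (\<lambda>n. x n \<in> B n)" by (auto elim: eventually_elim2)
    then show "x \<in> I B" using \<open>x \<in> R\<close> by (simp add: I_def)
  qed
qed

lemma smallI: "(\<And>n. A n \<subseteq> Vn n) \<Longrightarrow> S \<subseteq> I A \<Longrightarrow> ev (\<lambda>n. colourable (En n) (A n) T) \<Longrightarrow> small S"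
  unfolding small_def by (intro exI conjI allI)

lemma small_I:
  assumes "\<And>n. A n \<subseteq> Vn n"
  shows "small (I A) \<longleftrightarrow> (\<exists>T. ev (\<lambda>n. colourable (En n) (A n) T))"
proof
  assume "small (I A)"
  then obtain B T where "I A \<subseteq> I B" and B: "ev (\<lambda>n. colourable (En n) (B n) T)"
    unfolding small_def by blast
  then have "ev (\<lambda>n. A n \<subseteq> B n)" by (simp add: I_subset)
  with B have "ev (\<lambda>n. colourable (En n) (A n) T)" by eventually_elim (auto intro: colourable_mono)
  then show "\<exists>T. ev (\<lambda>n. colourable (En n) (A n) T)" by blast
qed (use assms in \<open>auto simp: small_def\<close>)

lemma not_small_I:
  assumes "\<And>n. A n \<subseteq> Vn n"
  shows "\<not> small (I A) \<longleftrightarrow> (\<forall>T. ev (\<lambda>n. \<not> colourable (En n) (A n) T))"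
  using small_I[OF assms] by (simp add: ev_not)

lemma colourable_single: "colourable (En n) {x} 1"
  unfolding colourable_def using En_irrefl by (intro exI[of _ "\<lambda>_. 0"]) auto

text \<open>At every index choose the vertex whose second neighbourhood has the largest chromatic
  number. If this number were bounded, then so would be those of all second neighbourhoods and, as
  neighbourhoods are bounded too, of all balls of radius 2; \<open>ball_controlled_2\<close> would
  then bound the whole set.\<close>

lemma two_control:
  assumes A: "\<And>n. A n \<subseteq> Vn n" and large: "\<not> small (I A)"
  shows "\<exists>x\<in>I A. \<not> small {c \<in> I A. \<exists>y\<in>I A. E y x \<and> E y c}"
proof -
  define S where "S = (\<lambda>n x. {c \<in> A n. \<exists>y\<in>A n. En n y x \<and> En n y c})"
  define g where "g = (\<lambda>n x. LEAST T. colourable (En n) (S n x) T)"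
  have finS: "finite (S n x)" for n x
    using A[of n] Vn_finite[of n] finite_subset unfolding S_def by (metis (no_types, lifting) mem_Collect_eq subsetI)
  have col_fin: "\<exists>T. colourable (En n) B T" if "finite B" for n B
    using colourable_UN[OF that, of "En n" "\<lambda>x. {x}" 1] colourable_single by auto
  have g1: "colourable (En n) (S n x) (g n x)" for n x
    unfolding g_def by (rule LeastI_ex[OF col_fin[OF finS]])
  have g2: "g n x \<le> T" if "colourable (En n) (S n x) T" for n x T
    unfolding g_def using that by (rule Least_le)
  have "ev (\<lambda>n. A n \<noteq> {})"
  proof -
    have "ev (\<lambda>n. \<not> colourable (En n) (A n) 0)" using not_small_I[OF A] large by blast
    then show ?thesis by (rule ev_mp) auto
  qed
  then have "ev (\<lambda>n. \<exists>x. x \<in> A n \<and> (\<forall>y\<in>A n. g n y \<le> g n x))"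
  proof (rule ev_mp)
    fix n assume "A n \<noteq> {}"
    have fin: "finite (A n)" using A Vn_finite finite_subset by blast
    then have "Max (g n ` A n) \<in> g n ` A n" using \<open>A n \<noteq> {}\<close> by (intro Max_in) auto
    then obtain x where x: "x \<in> A n" "Max (g n ` A n) = g n x" by blast
    have "g n y \<le> g n x" if "y \<in> A n" for y using Max_ge[of "g n ` A n" "g n y"] fin that x(2) by simp
    then show "\<exists>x. x \<in> A n \<and> (\<forall>y\<in>A n. g n y \<le> g n x)" using x(1) by blast
  qed
  from pick[OF this] obtain x where x: "x \<in> R" "ev (\<lambda>n. x n \<in> A n)" "ev (\<lambda>n. \<forall>y\<in>A n. g n y \<le> g n (x n))"
    by (auto simp: ev_conj)
  have xA: "x \<in> I A" using x by (simp add: I_def)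
  have set_eq: "{c \<in> I A. \<exists>y\<in>I A. E y x \<and> E y c} = I (\<lambda>n. S n (x n))"
  proof -
    have "c \<in> I (\<lambda>n. S n (x n)) \<longleftrightarrow> c \<in> I A \<and> (\<exists>y\<in>I A. E y x \<and> E y c)" for c
      unfolding S_def I_def E_def by (auto simp: ev_conj ev_bex_internal)
    then show ?thesis by blast
  qed
  have SV: "S n y \<subseteq> Vn n" for n y using A[of n] by (auto simp: S_def)
  have "\<not> small (I (\<lambda>n. S n (x n)))"
  proof
    assume "small (I (\<lambda>n. S n (x n)))"
    then obtain T where T: "ev (\<lambda>n. colourable (En n) (S n (x n)) T)" using small_I[of "\<lambda>n. S n (x n)"] SV by auto
    from ball_controlledE[OF ball_controlled_2, of \<omega> d f "1 + c1 + T"] obtain c where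
      c: "\<And>E (V::nat set). good \<omega> d f E V \<Longrightarrow>
         \<forall>x\<in>V. colourable E (gball E V x 2) (1 + c1 + T) \<Longrightarrow> colourable E V c" by blast
    from T x(3) have "ev (\<lambda>n. colourable (En n) (A n) c)"
    proof eventually_elim
      case (elim n)
      show ?case
      proof (rule c[OF good_subset[OF good A]], rule ballI)
        fix y assume y: "y \<in> A n"
        have "g n y \<le> T" using elim(2) y g2[OF elim(1)] le_trans by blast
        then have Sy: "colourable (En n) (S n y) T" using colourable_mono[OF g1] by blast
        have "y \<in> Vn n" using y A by blast
        then have "colourable (En n) (({y} \<union> {z \<in> Vn n. En n y z}) \<union> S n y) (1 + c1 + T)"
          by (intro colourable_Un colourable_single nb Sy)
        moreover have "gball (En n) (A n) y 2 \<subseteq> ({y} \<union> {z \<in> Vn n. En n y z}) \<union> S n y"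
          using A[of n] En_sym by (auto simp: numeral_2_eq_2 S_def)
        ultimately show "colourable (En n) (gball (En n) (A n) y 2) (1 + c1 + T)"
          using colourable_mono by blast
      qed
    qed
    then show False using large small_I[OF A] by blast
  qed
  then have "\<not> small {c \<in> I A. \<exists>y\<in>I A. E y x \<and> E y c}" unfolding set_eq .
  then show ?thesis using xA by blast
qed

lemma stable_cover:
  assumes A: "\<And>n. A n \<subseteq> Vn n" and small: "small (I A)"
  shows "\<exists>\<F>. finite \<F> \<and> \<F> \<subseteq> internal \<and> (\<forall>F\<in>\<F>. \<forall>x\<in>F. \<forall>y\<in>F. \<not> E x y) \<and> I A \<subseteq> \<Union>\<F>"
proof -
  obtain T where T: "ev (\<lambda>n. colourable (En n) (A n) T)" using small small_I[OF A] by blast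
  define c where "c = (\<lambda>n. SOME c. (\<forall>u\<in>A n. c u < T) \<and> (\<forall>u\<in>A n. \<forall>v\<in>A n. En n u v \<longrightarrow> c u \<noteq> c v))"
  have c: "ev (\<lambda>n. (\<forall>u\<in>A n. c n u < T) \<and> (\<forall>u\<in>A n. \<forall>v\<in>A n. En n u v \<longrightarrow> c n u \<noteq> c n v))"
    using T
  proof (rule ev_mp)
    fix n assume "colourable (En n) (A n) T"
    then show "(\<forall>u\<in>A n. c n u < T) \<and> (\<forall>u\<in>A n. \<forall>v\<in>A n. En n u v \<longrightarrow> c n u \<noteq> c n v)"
      unfolding c_def colourable_def by (rule someI_ex)
  qed
  define F where "F = (\<lambda>t. I (\<lambda>n. {x \<in> A n. c n x = t}))"
  show ?thesis
  proof (intro exI conjI ballI)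
    show "finite (F ` {..<T})" by simp
    have "F t \<in> internal" for t
      unfolding F_def internal_def using A by blast
    then show "F ` {..<T} \<subseteq> internal" by blast
    fix S x y assume "S \<in> F ` {..<T}" "x \<in> S" "y \<in> S"
    then obtain t where xy: "ev (\<lambda>n. x n \<in> A n \<and> c n (x n) = t)" "ev (\<lambda>n. y n \<in> A n \<and> c n (y n) = t)"
      by (auto simp: F_def I_def)
    show "\<not> E x y"
    proof
      assume "E x y"
      with xy c have "ev (\<lambda>n. False)" unfolding E_def by eventually_elim metis
      then show False by (simp add: ev_const)
    qed
  next
    show "I A \<subseteq> \<Union> (F ` {..<T})"
    proof
      fix x assume x: "x \<in> I A"
      then have "ev (\<lambda>n. x n \<in> A n)" by (simp add: I_def)
      with c have "ev (\<lambda>n. \<exists>t\<in>{..<T}. x n \<in> A n \<and> c n (x n) = t)" by eventually_elim auto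
      then have "\<exists>t\<in>{..<T}. ev (\<lambda>n. x n \<in> A n \<and> c n (x n) = t)" unfolding ev_bex[OF finite_lessThan] .
      then obtain t where "t < T" "ev (\<lambda>n. x n \<in> A n \<and> c n (x n) = t)" by blast
      then show "x \<in> \<Union> (F ` {..<T})" using I_R[OF x] by (auto simp: F_def I_def)
    qed
  qed
qed

lemma near_iff: "x \<in> R \<Longrightarrow> y \<in> R \<Longrightarrow> (x = y \<or> E x y) \<longleftrightarrow> ev (\<lambda>n. x n = y n \<or> En n (x n) (y n))"
  by (simp add: ev_disj R_eq E_def)

lemma ev_iff_const: "ev (\<lambda>n. P n \<longleftrightarrow> Q) \<longleftrightarrow> (ev P \<longleftrightarrow> Q)"
  by (cases Q) (simp_all add: ev_not)

lemma no_pattern_internal: "\<not> pattern E (I Vn) {..<Np} w y"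
proof
  assume p: "pattern E (I Vn) {..<Np} w y"
  have pE: "\<forall>E (V::nat set) w y. good \<omega> d f E V \<longrightarrow> \<not> pattern E V {..<Np} w y"
    unfolding Np_def by (rule someI_ex[OF no_pattern])
  have w: "w i \<in> I Vn" if "i < Np" for i using p that by (simp add: pattern_def)
  have y: "y i j \<in> I Vn" "\<And>l. l < Np \<Longrightarrow> (y i j = w l \<or> E (y i j) (w l)) \<longleftrightarrow> l = i \<or> l = j"
    if "i < j" "j < Np" for i j
    using p that by (auto simp: pattern_def)
  have 1: "ev (\<lambda>n. \<forall>i\<in>{..<Np}. w i n \<in> Vn n)"
    using w by (simp add: ev_ball I_def)
  have 2: "ev (\<lambda>n. \<forall>i\<in>{..<Np}. \<forall>j\<in>{..<Np}. i < j \<longrightarrow> y i j n \<in> Vn n \<and>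
      (\<forall>l\<in>{..<Np}. (y i j n = w l n \<or> En n (y i j n) (w l n)) \<longleftrightarrow> l = i \<or> l = j))"
  proof (subst ev_ball, simp, intro ballI, subst ev_ball, simp, intro ballI)
    fix i j assume ij: "i \<in> {..<Np}" "j \<in> {..<Np}"
    show "ev (\<lambda>n. i < j \<longrightarrow> y i j n \<in> Vn n \<and>
      (\<forall>l\<in>{..<Np}. (y i j n = w l n \<or> En n (y i j n) (w l n)) \<longleftrightarrow> l = i \<or> l = j))"
    proof (cases "i < j")
      case True
      have "ev (\<lambda>n. (y i j n = w l n \<or> En n (y i j n) (w l n)) \<longleftrightarrow> l = i \<or> l = j)" if "l < Np" for l
        unfolding ev_iff_const
        using y(2)[OF True _ that] near_iff[OF I_R[OF y(1)[OF True]] I_R[OF w[OF that]]] ij by simp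
      moreover have "ev (\<lambda>n. y i j n \<in> Vn n)" using y(1)[OF True] ij by (simp add: I_def)
      ultimately show ?thesis using True by (simp add: ev_conj ev_ball)
    qed (simp add: ev_const)
  qed
  from 1 2 have "ev (\<lambda>n. pattern (En n) (Vn n) {..<Np} (\<lambda>i. w i n) (\<lambda>i j. y i j n))"
    by eventually_elim (simp add: pattern_def)
  then show False using pE good ev_ex by blast
qed

lemma clique_bound_internal:
  assumes "finite K" "K \<subseteq> I Vn" "complete_set E K"
  shows "card K \<le> \<omega>"
proof -
  have 1: "ev (\<lambda>n. \<forall>k\<in>K. k n \<in> Vn n)" using assms(1,2) by (auto simp: ev_ball I_def)
  have 2: "ev (\<lambda>n. \<forall>k\<in>K. \<forall>l\<in>K. k \<noteq> l \<longrightarrow> En n (k n) (l n))"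
  proof (subst ev_ball[OF assms(1)], intro ballI, subst ev_ball[OF assms(1)], intro ballI)
    fix k l assume "k \<in> K" "l \<in> K"
    then show "ev (\<lambda>n. k \<noteq> l \<longrightarrow> En n (k n) (l n))"
      using assms(3) by (cases "k = l") (auto simp: complete_set_def E_def ev_const)
  qed
  from 1 2 have "ev (\<lambda>n. card K \<le> \<omega>)"
  proof eventually_elim
    case (elim n)
    have inj: "inj_on (\<lambda>k. k n) K"
    proof (rule inj_onI, rule ccontr)
      fix k l assume "k \<in> K" "l \<in> K" "k n = l n" "k \<noteq> l"
      then show False using elim(2) En_irrefl by metis
    qed
    have "complete_set (En n) ((\<lambda>k. k n) ` K)"
      unfolding complete_set_def
    proof (intro ballI impI)
      fix u v assume "u \<in> (\<lambda>k. k n) ` K" "v \<in> (\<lambda>k. k n) ` K" "u \<noteq> v"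
      then obtain k l where "k \<in> K" "l \<in> K" "u = k n" "v = l n" by blast
      then show "En n u v" using elim(2) \<open>u \<noteq> v\<close> by auto
    qed
    moreover have "(\<lambda>k. k n) ` K \<subseteq> Vn n" using elim(1) by auto
    ultimately have "card ((\<lambda>k. k n) ` K) \<le> \<omega>" using good[of n] unfolding good_def by blast
    then show ?case using card_image[OF inj] by simp
  qed
  then show ?thesis by (simp add: ev_const)
qed

sublocale W: large_world E "I Vn" internal small \<omega> Np
proof (unfold_locales)
  show "E y x" if "E x y" for x y
    using that unfolding E_def by (rule ev_mp) (rule En_sym)
  show "\<not> E x x" for x by (simp add: E_def En_irrefl ev_const)
  show "I Vn \<in> internal" by (auto simp: internal_def)
  show "A \<subseteq> I Vn" if "A \<in> internal" for A
  proof -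
    obtain B where "A = I B" "\<forall>n. B n \<subseteq> Vn n" using \<open>A \<in> internal\<close> by (auto simp: internal_def)
    then show ?thesis by (simp add: I_subset)
  qed
  show "A \<union> B \<in> internal" if "A \<in> internal" "B \<in> internal" for A B
  proof -
    obtain A' B' where "A = I A'" "\<forall>n. A' n \<subseteq> Vn n" "B = I B'" "\<forall>n. B' n \<subseteq> Vn n"
      using \<open>A \<in> internal\<close> \<open>B \<in> internal\<close> by (auto simp: internal_def)
    then have "A \<union> B = I (\<lambda>n. A' n \<union> B' n)" "\<forall>n. A' n \<union> B' n \<subseteq> Vn n" by (auto simp: I_Un)
    then show ?thesis unfolding internal_def by blast
  qed
  show "A - B \<in> internal" if "A \<in> internal" "B \<in> internal" for A B
  proof -
    obtain A' B' where "A = I A'" "\<forall>n. A' n \<subseteq> Vn n" "B = I B'" "\<forall>n. B' n \<subseteq> Vn n"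
      using \<open>A \<in> internal\<close> \<open>B \<in> internal\<close> by (auto simp: internal_def)
    then have "A - B = I (\<lambda>n. A' n - B' n)" "\<forall>n. A' n - B' n \<subseteq> Vn n" by (auto simp: I_Diff)
    then show ?thesis unfolding internal_def by blast
  qed
  show "{x \<in> I Vn. \<exists>y\<in>Y. E y x} \<in> internal" if "Y \<in> internal" for Y
  proof -
    obtain Y' where Y': "Y = I Y'" "\<forall>n. Y' n \<subseteq> Vn n" using \<open>Y \<in> internal\<close> by (auto simp: internal_def)
    have "{x \<in> I Vn. \<exists>y\<in>Y. E y x} = I (\<lambda>n. {x \<in> Vn n. \<exists>y\<in>Y' n. En n y x})"
      unfolding Y' I_def E_def by (auto simp: ev_conj ev_bex_internal)
    then show ?thesis unfolding internal_def by blast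
  qed
  show "{x} \<in> internal" if "x \<in> I Vn" for x
  proof -
    have "{x} = I (\<lambda>n. {x n} \<inter> Vn n)"
      using that R_eq by (auto simp: I_def ev_conj)
    then show ?thesis unfolding internal_def by blast
  qed
  show "small B" if "small A" "B \<subseteq> A" for A B
    using that unfolding small_def by (meson order_trans)
  show "small (A \<union> B)" if "small A" "small B" for A B
  proof -
    obtain A' T where A': "\<forall>n. A' n \<subseteq> Vn n" "A \<subseteq> I A'" "ev (\<lambda>n. colourable (En n) (A' n) T)"
      using \<open>small A\<close> by (auto simp: small_def)
    obtain B' T' where B': "\<forall>n. B' n \<subseteq> Vn n" "B \<subseteq> I B'" "ev (\<lambda>n. colourable (En n) (B' n) T')"
      using \<open>small B\<close> by (auto simp: small_def)
    show ?thesis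
    proof (rule smallI)
      show "ev (\<lambda>n. colourable (En n) (A' n \<union> B' n) (T + T'))"
        using A'(3) B'(3) by eventually_elim (rule colourable_Un)
      show "A \<union> B \<subseteq> I (\<lambda>n. A' n \<union> B' n)" unfolding I_Un[symmetric] using A'(2) B'(2) by blast
      show "A' n \<union> B' n \<subseteq> Vn n" for n using A'(1) B'(1) by blast
    qed
  qed
  show "small {x}" if "x \<in> I Vn" for x
  proof -
    show ?thesis
    proof (rule smallI)
      show "{x} \<subseteq> I (\<lambda>n. {x n} \<inter> Vn n)" using that by (auto simp: I_def ev_conj)
      show "ev (\<lambda>n. colourable (En n) ({x n} \<inter> Vn n) 1)"
        by (rule always_eventually, rule allI, rule colourable_mono[OF colourable_single]) auto
    qed auto
  qed
  show "small {y \<in> I Vn. E x y}" if "x \<in> I Vn" for x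
  proof -
    show ?thesis
    proof (rule smallI)
      show "{y \<in> I Vn. E x y} \<subseteq> I (\<lambda>n. {y \<in> Vn n. En n (x n) y})" by (auto simp: I_def E_def ev_conj)
      have "ev (\<lambda>n. x n \<in> Vn n)" using that by (simp add: I_def)
      then show "ev (\<lambda>n. colourable (En n) {y \<in> Vn n. En n (x n) y} c1)" by (rule ev_mp) (rule nb)
    qed auto
  qed
  show "\<exists>\<F>. finite \<F> \<and> \<F> \<subseteq> internal \<and> (\<forall>F\<in>\<F>. \<forall>x\<in>F. \<forall>y\<in>F. \<not> E x y) \<and> A \<subseteq> \<Union>\<F>"
    if "small A" "A \<in> internal" for A
  proof -
    obtain A' where A': "A = I A'" "\<forall>n. A' n \<subseteq> Vn n" using \<open>A \<in> internal\<close> by (auto simp: internal_def)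
    then show ?thesis using stable_cover[of A'] \<open>small A\<close> by blast
  qed
  show "\<not> small (I Vn)"
  proof -
    have "ev (\<lambda>n. \<not> colourable (En n) (Vn n) T)" for T
      using ev_ge[of T] by (rule ev_mp) (use big colourable_mono in blast)
    then show ?thesis using not_small_I[of Vn] by blast
  qed
  show "\<exists>x\<in>C. \<not> small {c \<in> C. \<exists>y\<in>C. E y x \<and> E y c}" if "C \<in> internal" "\<not> small C" for C
  proof -
    obtain A where "C = I A" "\<forall>n. A n \<subseteq> Vn n" using \<open>C \<in> internal\<close> by (auto simp: internal_def)
    then show ?thesis using two_control[of A] \<open>\<not> small C\<close> by blast
  qed
  show "card K \<le> \<omega>" if "finite K" "K \<subseteq> I Vn" "complete_set E K" for K
    using clique_bound_internal[OF that] .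
  show "\<not> pattern E (I Vn) {..<Np} w y" for w y by (rule no_pattern_internal)
qed

definition kapn :: "nat \<Rightarrow> nat \<Rightarrow> (nat \<Rightarrow> nat set) \<Rightarrow> (nat \<Rightarrow> nat \<Rightarrow> nat set) \<Rightarrow> nat set \<Rightarrow> nat set" where
  "kapn n p A X K = {c \<in> A n. (\<exists>y\<in>A n. (\<forall>k\<in>K. En n y k) \<and> En n y c) \<and>
     (\<forall>i\<in>{..<p}. \<exists>x\<in>X i n. En n x c \<and> \<not> (\<forall>k\<in>K. En n x k))}"

text \<open>Los's theorem for \<open>kap\<close>; finiteness of \<open>K\<close> lets the quantifier
  over \<open>K\<close> commute with the ultrafilter.\<close>

lemma kap_internal:
  assumes K: "finite K" and A: "\<And>n. A n \<subseteq> Vn n" and X: "\<And>i. i < p \<Longrightarrow> Y i = I (X i)"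
  shows "W.kap p (I A) Y K = I (\<lambda>n. kapn n p A X ((\<lambda>k. k n) ` K))"
proof -
  have comp: "W.comp y K \<longleftrightarrow> ev (\<lambda>n. \<forall>k\<in>(\<lambda>k. k n) ` K. En n (y n) k)" for y
    using K by (simp add: W.comp_def E_def ev_ball)
  have n2: "c \<in> W.n2 (I A) K \<longleftrightarrow> c \<in> R \<and> ev (\<lambda>n. c n \<in> A n \<and> (\<exists>y\<in>A n. (\<forall>k\<in>(\<lambda>k. k n) ` K. En n y k) \<and> En n y (c n)))" for c
    unfolding W.n2_def comp E_def I_def ev_conj ev_bex_internal by blast
  have bad: "c \<in> W.bad (Y i) K \<longleftrightarrow> ev (\<lambda>n. \<exists>x\<in>X i n. En n x (c n) \<and> \<not> (\<forall>k\<in>(\<lambda>k. k n) ` K. En n x k))"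
    if "i < p" "c \<in> I Vn" for c i
    unfolding W.bad_def comp E_def X[OF that(1)] ev_conj ev_bex_internal ev_not
    using that(2) by (auto simp: I_def)
  have AV: "c \<in> I A \<Longrightarrow> c \<in> I Vn" for c using I_subset[of A Vn] A by auto
  have "c \<in> W.kap p (I A) Y K \<longleftrightarrow> c \<in> I (\<lambda>n. kapn n p A X ((\<lambda>k. k n) ` K))" for c
  proof -
    have "c \<in> I (\<lambda>n. kapn n p A X ((\<lambda>k. k n) ` K)) \<longleftrightarrow>
      c \<in> R \<and> ev (\<lambda>n. c n \<in> A n \<and> (\<exists>y\<in>A n. (\<forall>k\<in>(\<lambda>k. k n) ` K. En n y k) \<and> En n y (c n))) \<and>
      (\<forall>i\<in>{..<p}. ev (\<lambda>n. \<exists>x\<in>X i n. En n x (c n) \<and> \<not> (\<forall>k\<in>(\<lambda>k. k n) ` K. En n x k)))"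
      unfolding I_def kapn_def mem_Collect_eq by (simp only: ev_conj ev_ball finite_lessThan conj_assoc)
    also have "\<dots> \<longleftrightarrow> c \<in> W.n2 (I A) K \<and> (\<forall>i<p. c \<in> W.bad (Y i) K)"
    proof (cases "c \<in> W.n2 (I A) K")
      case True
      then have "c \<in> I Vn" using AV by (auto simp: W.n2_def)
      then show ?thesis using True n2[of c] bad[of _ c] by auto
    qed (use n2[of c] in blast)
    finally show ?thesis by (simp add: W.kap_def)
  qed
  then show ?thesis by blast
qed

text \<open>Countable saturation: the thresholds \<open>T\<close> for being alive can be made to tend to infinity
  along the sequence, while the set of alive vertices remains large.\<close>

lemma saturation_internal:
  assumes C: "W.large C" and Y: "\<And>i. i < p \<Longrightarrow> Y i \<in> internal"
    and al: "\<And>C'. W.large C' \<Longrightarrow> C' \<subseteq> C \<Longrightarrow> \<exists>b\<in>C'. W.alive j p C Y b"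
  shows "\<exists>A\<subseteq>C. W.large A \<and> (\<forall>b\<in>A. W.alive j p C Y b)"
proof -
  have "C \<in> internal" using C by (simp add: W.large_def)
  then obtain A where A: "C = I A" "\<And>n. A n \<subseteq> Vn n" by (auto simp: internal_def)
  have "\<exists>X. i < p \<longrightarrow> Y i = I X" for i using Y[of i] unfolding internal_def by blast
  then obtain X where X: "\<And>i. i < p \<Longrightarrow> Y i = I (X i)" by metis
  define P where "P = (\<lambda>T n b K. K \<subseteq> A n \<and> finite K \<and> card K = j \<and> complete_set (En n) K \<and> b \<in> K \<and>
      \<not> colourable (En n) (kapn n p A X K) T)"
  define L where "L = (\<lambda>T n. {b \<in> A n. \<exists>K. P T n b K})"
  have LA: "L T n \<subseteq> A n" and LV: "L T n \<subseteq> Vn n" for T n using A(2)[of n] by (auto simp: L_def)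
  have kapV: "kapn n p A X K \<subseteq> Vn n" for n K using A(2)[of n] by (auto simp: kapn_def)
  \<comment> \<open>If \<open>I (L T)\<close> were small, its complement in \<open>C\<close> would
    contain an alive vertex. The clique witnessing this meets the threshold \<open>T\<close> at
    almost all indices and so puts the vertex into \<open>I (L T)\<close>.\<close>
  have big: "\<not> small (I (L T))" for T
  proof
    assume sm: "small (I (L T))"
    have "I (L T) \<in> internal" using LV by (auto simp: internal_def)
    then have "W.large (C - I (L T))" using W.large_Diff[OF C] sm by blast
    then obtain b where b: "b \<in> C" "b \<notin> I (L T)" "W.alive j p C Y b" using al by blast
    then obtain K where K: "K \<subseteq> C" "W.jclique j K" "b \<in> K" "\<not> small (W.kap p C Y K)"
      unfolding W.alive_def by blast
    have finK: "finite K" and cK: "card K = j" and clK: "complete_set E K" using K(2) by (auto simp: W.jclique_def)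
    have eq: "W.kap p C Y K = I (\<lambda>n. kapn n p A X ((\<lambda>k. k n) ` K))"
      unfolding A(1) by (rule kap_internal[OF finK A(2) X])
    have "ev (\<lambda>n. \<not> colourable (En n) (kapn n p A X ((\<lambda>k. k n) ` K)) T)"
      using K(4) not_small_I[of "\<lambda>n. kapn n p A X ((\<lambda>k. k n) ` K)"] kapV unfolding eq by blast
    moreover have "ev (\<lambda>n. \<forall>k\<in>K. k n \<in> A n)" using K(1) finK by (auto simp: ev_ball A(1) I_def)
    moreover have "ev (\<lambda>n. \<forall>k\<in>K. \<forall>l\<in>K. k \<noteq> l \<longrightarrow> En n (k n) (l n))"
    proof (subst ev_ball[OF finK], intro ballI, subst ev_ball[OF finK], intro ballI)
      fix k l assume "k \<in> K" "l \<in> K"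
      then show "ev (\<lambda>n. k \<noteq> l \<longrightarrow> En n (k n) (l n))"
        using clK by (cases "k = l") (auto simp: complete_set_def E_def ev_const)
    qed
    ultimately have "ev (\<lambda>n. b n \<in> L T n)"
    proof eventually_elim
      case (elim n)
      have inj: "inj_on (\<lambda>k. k n) K"
      proof (rule inj_onI, rule ccontr)
        fix k l assume "k \<in> K" "l \<in> K" "k n = l n" "k \<noteq> l"
        then show False using elim(3) En_irrefl by metis
      qed
      have "complete_set (En n) ((\<lambda>k. k n) ` K)"
        unfolding complete_set_def
      proof (intro ballI impI)
        fix u v assume "u \<in> (\<lambda>k. k n) ` K" "v \<in> (\<lambda>k. k n) ` K" "u \<noteq> v"
        then obtain k l where "k \<in> K" "l \<in> K" "u = k n" "v = l n" by blast
        then show "En n u v" using elim(3) \<open>u \<noteq> v\<close> by auto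
      qed
      then have "P T n (b n) ((\<lambda>k. k n) ` K)"
        unfolding P_def using elim finK cK card_image[OF inj] K(3) by auto
      moreover have "b n \<in> A n" using elim(2) K(3) by blast
      ultimately show ?case unfolding L_def by blast
    qed
    then have "b \<in> I (L T)" using b(1) by (simp add: I_def A(1))
    then show False using b(2) by blast
  qed
  have evL: "ev (\<lambda>n. \<not> colourable (En n) (L T n) M)" for T M
    using big[of T] not_small_I[of "L T"] LV by blast
  \<comment> \<open>\<open>\<tau> n\<close> will be the largest threshold up to \<open>n\<close>
    that leaves \<open>L\<close> hard to colour. It tends to infinity, since each fixed threshold
    satisfies \<open>Q\<close> at almost all indices; the alternative \<open>T = 0\<close> makes the
    maximum exist at every index.\<close>
  define Q where "Q = (\<lambda>n T. T \<le> n \<and> (T = 0 \<or> \<not> colourable (En n) (L T n) T))"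
  define \<tau> where "\<tau> = (\<lambda>n. GREATEST T. Q n T)"
  have Q0: "Q n 0" for n by (simp add: Q_def)
  have Qn: "T \<le> n" if "Q n T" for n T using that by (simp add: Q_def)
  have Q\<tau>: "Q n (\<tau> n)" for n unfolding \<tau>_def using Q0 Qn by (rule GreatestI_nat)
  have le\<tau>: "T \<le> \<tau> n" if "Q n T" for n T unfolding \<tau>_def using that Qn by (rule Greatest_le_nat)
  have ev\<tau>: "ev (\<lambda>n. M \<le> \<tau> n)" for M
    using ev_ge[of M] evL[of M M] by eventually_elim (rule le\<tau>, simp add: Q_def)
  define A1 where "A1 = (\<lambda>n. L (\<tau> n) n)"
  have A1V: "A1 n \<subseteq> Vn n" for n using LV by (simp add: A1_def)
  have "\<not> small (I A1)"
  proof -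
    have "ev (\<lambda>n. \<not> colourable (En n) (A1 n) M)" for M
      using ev\<tau>[of "Suc M"]
    proof (rule ev_mp)
      fix n assume "Suc M \<le> \<tau> n"
      then have "\<not> colourable (En n) (L (\<tau> n) n) (\<tau> n)" "M \<le> \<tau> n" using Q\<tau>[of n] by (auto simp: Q_def)
      then show "\<not> colourable (En n) (A1 n) M" using colourable_mono unfolding A1_def by blast
    qed
    then show ?thesis using not_small_I[of A1] A1V by blast
  qed
  moreover have "I A1 \<in> internal" using A1V by (auto simp: internal_def)
  ultimately have "W.large (I A1)" by (simp add: W.large_def)
  moreover have "I A1 \<subseteq> C" unfolding A(1) I_subset using LA by (simp add: A1_def)
  moreover have "W.alive j p C Y b" if b: "b \<in> I A1" for b
  proof -
    have bR: "b \<in> R" and bev: "ev (\<lambda>n. b n \<in> L (\<tau> n) n)" using b by (auto simp: I_def A1_def)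
    define Kn where "Kn = (\<lambda>n. SOME K. P (\<tau> n) n (b n) K)"
    have evK: "ev (\<lambda>n. P (\<tau> n) n (b n) (Kn n))"
      using bev by (rule ev_mp) (auto simp: L_def Kn_def intro: someI_ex)
    define e where "e = (\<lambda>n. SOME e. bij_betw e {..<j} (Kn n))"
    have eve: "ev (\<lambda>n. bij_betw (e n) {..<j} (Kn n))"
      using evK
    proof (rule ev_mp)
      fix n assume "P (\<tau> n) n (b n) (Kn n)"
      then have "\<exists>e. bij_betw e {..<j} (Kn n)"
        using ex_bij_betw_nat_finite[of "Kn n"] lessThan_atLeast0 by (auto simp: P_def)
      then show "bij_betw (e n) {..<j} (Kn n)" unfolding e_def by (rule someI_ex)
    qed
    \<comment> \<open>Cliques of the fixed size \<open>j\<close> are transferred through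
      enumerations: the \<open>i\<close>-th vertices of the cliques \<open>Kn n\<close> together
      form one vertex of \<open>K\<close>.\<close>
    define k where "k = (\<lambda>i. rep (\<lambda>n. e n i))"
    define K where "K = k ` {..<j}"
    have kR: "k i \<in> R" for i by (simp add: k_def rep_R)
    have evk: "ev (\<lambda>n. \<forall>i\<in>{..<j}. k i n = e n i)"
      unfolding ev_ball[OF finite_lessThan] k_def using rep_ev by (auto simp: eq_commute)
    have img: "ev (\<lambda>n. (\<lambda>k. k n) ` K = Kn n)"
      using eve evk
    proof eventually_elim
      case (elim n)
      have "(\<lambda>k. k n) ` K = (\<lambda>i. k i n) ` {..<j}" by (simp add: K_def image_image)
      also have "\<dots> = e n ` {..<j}" using elim(2) by (intro image_cong) auto
      finally show ?case using elim(1) by (simp add: bij_betw_def)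
    qed
    have kA: "k i \<in> I A" if "i < j" for i
    proof -
      have "ev (\<lambda>n. k i n \<in> A n)"
        using eve evk evK
      proof eventually_elim
        case (elim n)
        then have "k i n \<in> Kn n" using that bij_betwE[OF elim(1)] by auto
        then show ?case using elim(3) by (auto simp: P_def)
      qed
      then show ?thesis using kR by (simp add: I_def)
    qed
    have adj: "E (k i) (k l)" if "i < j" "l < j" "i \<noteq> l" for i l
      unfolding E_def using eve evk evK
    proof eventually_elim
      case (elim n)
      have "e n i \<in> Kn n" "e n l \<in> Kn n" using bij_betwE[OF elim(1)] that by auto
      moreover have "e n i \<noteq> e n l" using bij_betw_imp_inj_on[OF elim(1)] that by (auto dest: inj_onD)
      ultimately have "En n (e n i) (e n l)" using elim(3) by (auto simp: P_def complete_set_def)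
      then show ?case using elim(2) that by simp
    qed
    have "inj_on k {..<j}"
    proof (rule inj_onI, rule ccontr)
      fix i l assume "i \<in> {..<j}" "l \<in> {..<j}" "k i = k l" "i \<noteq> l"
      then show False using adj[of i l] W.E_irrefl by auto
    qed
    then have cK: "card K = j" by (simp add: K_def card_image)
    have jK: "W.jclique j K"
      unfolding W.jclique_def using cK adj by (auto simp: K_def complete_set_def)
    have "ev (\<lambda>n. \<exists>i\<in>{..<j}. b n = e n i)"
      using eve evK
    proof eventually_elim
      case (elim n)
      then have "b n \<in> e n ` {..<j}" by (simp add: P_def bij_betw_def)
      then show ?case by auto
    qed
    then obtain i where i: "i < j" "ev (\<lambda>n. b n = e n i)" by (auto simp: ev_bex)
    have "rep b = k i" unfolding k_def by (rule rep_cong[OF i(2)])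
    then have bK: "b \<in> K" using R_rep[OF bR] i(1) by (simp add: K_def)
    have finK: "finite K" by (simp add: K_def)
    have eq: "W.kap p C Y K = I (\<lambda>n. kapn n p A X ((\<lambda>k. k n) ` K))"
      unfolding A(1) by (rule kap_internal[OF finK A(2) X])
    have "ev (\<lambda>n. \<not> colourable (En n) (kapn n p A X ((\<lambda>k. k n) ` K)) M)" for M
      using img evK ev\<tau>[of M]
    proof eventually_elim
      case (elim n)
      show ?case
      proof
        assume "colourable (En n) (kapn n p A X ((\<lambda>k. k n) ` K)) M"
        then have "colourable (En n) (kapn n p A X (Kn n)) (\<tau> n)"
          unfolding elim(1) by (rule colourable_mono[OF _ order_refl elim(3)])
        then show False using elim(2) by (simp add: P_def)
      qed
    qed
    then have "\<not> small (W.kap p C Y K)"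
      unfolding eq using not_small_I[of "\<lambda>n. kapn n p A X ((\<lambda>k. k n) ` K)"] kapV by blast
    moreover have "K \<subseteq> C" using kA A(1) by (auto simp: K_def)
    ultimately show ?thesis using jK bK unfolding W.alive_def by blast
  qed
  ultimately show ?thesis by blast
qed

lemma burling_embeds_somewhere:
  "\<exists>n \<psi>. inj_on \<psi> (verts (burling (Suc (Suc k)))) \<and> \<psi> ` verts (burling (Suc (Suc k))) \<subseteq> Vn n \<and>
     (\<forall>u\<in>verts (burling (Suc (Suc k))). \<forall>v\<in>verts (burling (Suc (Suc k))).
        En n (\<psi> u) (\<psi> v) \<longleftrightarrow> {u, v} \<in> edges (burling (Suc (Suc k))))"
proof -
  let ?B = "burling (Suc (Suc k))"
  have "\<exists>S j. clique_world E (I Vn) internal small \<omega> Np S j"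
  proof (rule W.clique_world_exists)
    fix j C p Y
    assume a: "W.large C" "\<And>i. i < p \<Longrightarrow> Y i \<in> internal"
      "\<And>C'. W.large C' \<Longrightarrow> C' \<subseteq> C \<Longrightarrow> \<exists>b\<in>C'. W.alive j p C Y b"
    show "\<exists>A\<subseteq>C. W.large A \<and> (\<forall>b\<in>A. W.alive j p C Y b)" by (rule saturation_internal[OF a])
  qed
  then obtain S j where cw: "clique_world E (I Vn) internal small \<omega> Np S j" by (elim exE)
  obtain \<psi> where \<psi>: "inj_on \<psi> (verts ?B)" "\<psi> ` verts ?B \<subseteq> I Vn"
    "\<And>u v. u \<in> verts ?B \<Longrightarrow> v \<in> verts ?B \<Longrightarrow> E (\<psi> u) (\<psi> v) \<longleftrightarrow> {u, v} \<in> edges ?B"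
    using clique_world.burling_embeds[OF cw, of k] by blast
  have fin: "finite (verts ?B)"
    using is_marked_graph_burling[of "Suc k"] by (simp add: is_marked_graph_def simple_graph_def)
  have \<psi>R: "\<psi> u \<in> R" if "u \<in> verts ?B" for u using that \<psi>(2) I_R by blast
  have 1: "ev (\<lambda>n. \<forall>u\<in>verts ?B. \<psi> u n \<in> Vn n)" using \<psi>(2) by (auto simp: ev_ball[OF fin] I_def)
  have 2: "ev (\<lambda>n. \<forall>u\<in>verts ?B. \<forall>v\<in>verts ?B. En n (\<psi> u n) (\<psi> v n) \<longleftrightarrow> {u, v} \<in> edges ?B)"
    using \<psi>(3) by (simp add: ev_ball[OF fin] ev_iff_const E_def)
  have 3: "ev (\<lambda>n. \<forall>u\<in>verts ?B. \<forall>v\<in>verts ?B. \<psi> u n = \<psi> v n \<longleftrightarrow> u = v)"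
  proof -
    have "ev (\<lambda>n. \<psi> u n = \<psi> v n) \<longleftrightarrow> u = v" if "u \<in> verts ?B" "v \<in> verts ?B" for u v
      using R_eq[OF \<psi>R[OF that(1)] \<psi>R[OF that(2)]] inj_on_eq_iff[OF \<psi>(1) that] by simp
    then show ?thesis by (simp add: ev_ball[OF fin] ev_iff_const)
  qed
  from 1 2 3 have "ev (\<lambda>n. inj_on (\<lambda>u. \<psi> u n) (verts ?B) \<and> (\<lambda>u. \<psi> u n) ` verts ?B \<subseteq> Vn n \<and>
     (\<forall>u\<in>verts ?B. \<forall>v\<in>verts ?B. En n (\<psi> u n) (\<psi> v n) \<longleftrightarrow> {u, v} \<in> edges ?B))"
    by eventually_elim (auto simp: inj_on_def)
  then obtain n where "inj_on (\<lambda>u. \<psi> u n) (verts ?B) \<and> (\<lambda>u. \<psi> u n) ` verts ?B \<subseteq> Vn n \<and>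
     (\<forall>u\<in>verts ?B. \<forall>v\<in>verts ?B. En n (\<psi> u n) (\<psi> v n) \<longleftrightarrow> {u, v} \<in> edges ?B)"
    using ev_ex by blast
  then show ?thesis by (intro exI[of _ n] exI[of _ "\<lambda>u. \<psi> u n"])
qed

end

section \<open>Induction on the clique number\<close>

definition burling_free :: "nat \<Rightarrow> ('a \<Rightarrow> 'a \<Rightarrow> bool) \<Rightarrow> 'a set \<Rightarrow> bool" where
  "burling_free k E V \<longleftrightarrow> \<not> (\<exists>\<psi>. inj_on \<psi> (verts (burling k)) \<and> \<psi> ` verts (burling k) \<subseteq> V \<and>
     (\<forall>u\<in>verts (burling k). \<forall>v\<in>verts (burling k). E (\<psi> u) (\<psi> v) \<longleftrightarrow> {u, v} \<in> edges (burling k)))"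

lemma burling_free_subset: "burling_free k E V \<Longrightarrow> S \<subseteq> V \<Longrightarrow> burling_free k E S"
  unfolding burling_free_def by (meson order_trans)

lemma bounded_colouring:
  "\<exists>c. \<forall>E (V::nat set). good \<omega> d f E V \<and> burling_free (Suc (Suc k)) E V \<longrightarrow> colourable E V c"
proof (induction \<omega>)
  case 0
  have "colourable E V 0" if "good 0 d f E V" for E and V :: "nat set"
  proof -
    have "V = {}"
    proof (rule ccontr)
      assume "V \<noteq> {}"
      then obtain x where "{x} \<subseteq> V" by blast
      moreover have "complete_set E {x}" by (simp add: complete_set_def)
      ultimately have "card {x} \<le> 0" using that unfolding good_def by blast
      then show False by simp
    qed
    then show ?thesis by simp
  qed
  then show ?case by blast
next
  case (Suc \<omega>)
  then obtain c1 where c1: "\<And>E (V::nat set). good \<omega> d f E V \<Longrightarrow> burling_free (Suc (Suc k)) E V \<Longrightarrow> colourable E V c1"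
    by blast
  show ?case
  proof (rule ccontr)
    assume neg: "\<not> ?case"
    then have "\<forall>n. \<exists>E (V::nat set). good (Suc \<omega>) d f E V \<and> burling_free (Suc (Suc k)) E V \<and> \<not> colourable E V n"
      by blast
    then obtain En and Vn :: "nat \<Rightarrow> nat set" where
      En: "\<And>n. good (Suc \<omega>) d f (En n) (Vn n)" "\<And>n. burling_free (Suc (Suc k)) (En n) (Vn n)"
        "\<And>n. \<not> colourable (En n) (Vn n) n"
      by metis
    obtain U :: "nat filter" where U: "U \<noteq> bot" "U \<le> sequentially"
      "\<And>P. eventually P U \<or> eventually (\<lambda>n. \<not> P n) U"
      using exists_ultrafilter by blast
    have nb: "colourable (En n) {y \<in> Vn n. En n x y} c1" if x: "x \<in> Vn n" for n x
    proof (rule c1)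
      let ?N = "{y \<in> Vn n. En n x y}"
      have g: "good (Suc \<omega>) d f (En n) ?N" by (rule good_subset[OF En(1)]) auto
      have sym: "symp (En n)" and irr: "\<not> En n x x" using En(1)[of n] by (auto simp: good_def irreflp_def)
      have "card K \<le> \<omega>" if K: "K \<subseteq> ?N" "complete_set (En n) K" for K
      proof -
        have fin: "finite K" using K(1) En(1)[of n] finite_subset by (fastforce simp: good_def)
        have xK: "x \<notin> K" using K(1) irr by auto
        have "complete_set (En n) (insert x K)"
          using K sym unfolding complete_set_def by (auto dest: sympD)
        moreover have "insert x K \<subseteq> Vn n" using K x by auto
        ultimately have "card (insert x K) \<le> Suc \<omega>" using En(1)[of n] unfolding good_def by blast
        then show ?thesis using fin xK by simp
      qed
      then show "good \<omega> d f (En n) ?N" using g unfolding good_def by blast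
      show "burling_free (Suc (Suc k)) (En n) ?N" by (rule burling_free_subset[OF En(2)]) auto
    qed
    interpret ultraproduct U En Vn "Suc \<omega>" d f c1
      by unfold_locales (rule U En nb; assumption?)+
    show False using burling_embeds_somewhere[of k] En(2) unfolding burling_free_def by blast
  qed
qed


section \<open>Distances and control functions\<close>

lemma ball_path_between:
  assumes "y \<in> gball (\<lambda>u v. {u, v} \<in> edges G) (verts G) x n"
  shows "\<exists>p. path_between G x p y \<and> length p \<le> Suc n"
  using assms
proof (induction n arbitrary: y)
  case 0
  then show ?case by (intro exI[of _ "[x]"]) (auto simp: path_between_def)
next
  case (Suc n)
  let ?E = "\<lambda>u v. {u, v} \<in> edges G"
  show ?case
  proof (cases "y \<in> gball ?E (verts G) x n")
    case True
    then show ?thesis using Suc.IH le_SucI by blast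
  next
    case False
    then obtain u where u: "u \<in> gball ?E (verts G) x n" "{u, y} \<in> edges G" "y \<in> verts G"
      using Suc.prems by auto
    then obtain p where p: "path_between G x p u" "length p \<le> Suc n" using Suc.IH by blast
    note pd = p(1)[unfolded path_between_def]
    \<comment> \<open>Paths have no repeated vertices; if \<open>y\<close> already lies on the path,
      the path is cut there.\<close>
    show ?thesis
    proof (cases "y \<in> set p")
      case True
      then obtain i where i: "i < length p" "p ! i = y" by (auto simp: in_set_conv_nth)
      have "path_between G x (take (Suc i) p) y"
        unfolding path_between_def
      proof (intro conjI allI impI)
        show "last (take (Suc i) p) = y" using i pd by (simp add: last_conv_nth)
        show "set (take (Suc i) p) \<subseteq> verts G" using pd set_take_subset[of "Suc i" p] by blast
      qed (use pd i in auto)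
      then show ?thesis using p(2) by (intro exI[of _ "take (Suc i) p"]) auto
    next
      case False
      have "path_between G x (p @ [y]) y"
        unfolding path_between_def
      proof (intro conjI allI impI)
        fix i assume i: "Suc i < length (p @ [y])"
        show "{(p @ [y]) ! i, (p @ [y]) ! Suc i} \<in> edges G"
        proof (cases "Suc i < length p")
          case True
          then show ?thesis using pd by (simp add: nth_append)
        next
          case False
          then have "Suc i = length p" using i by simp
          moreover then have "p ! i = u" using pd by (metis diff_Suc_1 last_conv_nth)
          ultimately show ?thesis using u by (simp add: nth_append)
        qed
      qed (use pd False u in auto)
      then show ?thesis using p(2) by (intro exI[of _ "p @ [y]"]) auto
    qed
  qed
qed

lemma gdist_le_iff_ball:
  "gdist G x y \<le> enat n \<longleftrightarrow> y \<in> gball (\<lambda>u v. {u, v} \<in> edges G) (verts G) x n"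
proof
  let ?E = "\<lambda>u v. {u, v} \<in> edges G"
  assume le: "gdist G x y \<le> enat n"
  have "\<exists>p. path_between G x p y \<and> length p - 1 \<le> n"
  proof (rule ccontr)
    assume "\<not> ?thesis"
    then have "enat (Suc n) \<le> gdist G x y"
      unfolding gdist_def by (intro INF_greatest) auto
    then have "enat (Suc n) \<le> enat n" using le by (rule order_trans)
    then show False by simp
  qed
  then obtain p where p: "path_between G x p y" "length p - 1 \<le> n" by blast
  note pd = p(1)[unfolded path_between_def]
  have len: "0 < length p" using pd by simp
  have "p ! (length p - 1) \<in> gball ?E (verts G) (p ! 0) (length p - 1 - 0)"
  proof (rule path_gball)
    show "\<forall>h. 0 \<le> h \<and> h \<le> length p - 1 \<longrightarrow> p ! h \<in> verts G"
    proof (intro allI impI)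
      fix h assume "0 \<le> h \<and> h \<le> length p - 1"
      then have "h < length p" using len by linarith
      then have "p ! h \<in> set p" by (rule nth_mem)
      then show "p ! h \<in> verts G" using pd by blast
    qed
  qed (use pd in auto)
  moreover have "p ! (length p - 1) = y" "p ! 0 = x"
    using pd by (auto simp: last_conv_nth hd_conv_nth)
  ultimately have "y \<in> gball ?E (verts G) x (length p - 1)" by simp
  then show "y \<in> gball ?E (verts G) x n" using gball_mono[OF p(2), of ?E "verts G" x] by blast
next
  assume "y \<in> gball (\<lambda>u v. {u, v} \<in> edges G) (verts G) x n"
  from ball_path_between[OF this] obtain p where p: "path_between G x p y" "length p \<le> Suc n" by blast
  then have "gdist G x y \<le> enat (length p - 1)" unfolding gdist_def by (intro INF_lower) simp
  also have "\<dots> \<le> enat n" using p(2) by simp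
  finally show "gdist G x y \<le> enat n" .
qed

lemma control_function_tame:
  assumes "control_function d f G"
  shows "tame d f (\<lambda>u v. {u, v} \<in> edges G) (verts G)"
  unfolding tame_def
proof (rule allI)
  fix \<delta>
  let ?E = "\<lambda>u v. {u, v} \<in> edges G"
  obtain \<P> where P: "partition_on (verts G) \<P>" "multi_disjoint_at G (d + 1) \<delta> \<P>"
    "\<forall>S\<in>\<P>. gdiam G S \<le> enat (f \<delta>)"
    using assms unfolding control_function_def by blast
  obtain \<V> where V: "\<P> = (\<Union>i\<in>{1..d + 1}. \<V> i)" "\<forall>i\<in>{1..d + 1}. disjoint_family_at G \<delta> (\<V> i)"
    using P(2) unfolding multi_disjoint_at_def by blast
  have un: "\<Union>\<P> = verts G" using P(1) by (simp add: partition_on_def)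
  have "\<forall>u. \<exists>X. u \<in> verts G \<longrightarrow> u \<in> X \<and> X \<in> \<P>" using un by blast
  then obtain p where p: "\<And>u. u \<in> verts G \<Longrightarrow> u \<in> p u \<and> p u \<in> \<P>" by metis
  have "\<forall>u. \<exists>i. u \<in> verts G \<longrightarrow> i \<in> {1..d + 1} \<and> p u \<in> \<V> i" using p V(1) by blast
  then obtain c where c: "\<And>u. u \<in> verts G \<Longrightarrow> c u \<in> {1..d + 1} \<and> p u \<in> \<V> (c u)" by metis
  show "\<exists>(p :: 'a \<Rightarrow> 'a set) c. (\<forall>u\<in>verts G. c u \<le> d) \<and>
     (\<forall>u\<in>verts G. \<forall>v\<in>verts G. p u = p v \<longrightarrow> v \<in> gball ?E (verts G) u (f \<delta>)) \<and>
     (\<forall>u\<in>verts G. \<forall>v\<in>verts G. c u = c v \<and> v \<in> gball ?E (verts G) u \<delta> \<longrightarrow> p u = p v)"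
  \<comment> \<open>Colours are shifted from \<open>{1..d + 1}\<close> to
    \<open>{0..d}\<close>.\<close>
  proof (rule exI[of _ p], rule exI[of _ "\<lambda>u. c u - 1"], intro conjI ballI impI)
    fix u assume "u \<in> verts G"
    then show "c u - 1 \<le> d" using c[of u] by auto
  next
    fix u v assume uv: "u \<in> verts G" "v \<in> verts G" "p u = p v"
    have "gdist G u v \<le> gdiam G (p u)"
      unfolding gdiam_def using p uv by (intro SUP_upper2[of u] SUP_upper) auto
    also have "\<dots> \<le> enat (f \<delta>)" using P(3) p uv(1) by blast
    finally show "v \<in> gball ?E (verts G) u (f \<delta>)" by (simp add: gdist_le_iff_ball)
  next
    fix u v assume uv: "u \<in> verts G" "v \<in> verts G" and a: "c u - 1 = c v - 1 \<and> v \<in> gball ?E (verts G) u \<delta>"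
    have "1 \<le> c u" "1 \<le> c v" using c[OF uv(1)] c[OF uv(2)] by auto
    then have cc: "c u = c v" using conjunct1[OF a] by linarith
    show "p u = p v"
    proof (rule ccontr)
      assume ne: "p u \<noteq> p v"
      have "disjoint_family_at G \<delta> (\<V> (c u))" using V(2) c uv by blast
      then have "(INF x\<in>p u. INF y\<in>p v. gdist G x y) > enat \<delta>"
        unfolding disjoint_family_at_def using c[OF uv(1)] c[OF uv(2)] cc ne by auto
      moreover have "(INF x\<in>p u. INF y\<in>p v. gdist G x y) \<le> gdist G u v"
        using p uv by (intro INF_lower2[of u] INF_lower) auto
      moreover have "gdist G u v \<le> enat \<delta>" using a by (simp add: gdist_le_iff_ball)
      ultimately show False by simp
    qed
  qed
qed

lemma gball_cong:
  assumes "\<And>u v. u \<in> S \<Longrightarrow> v \<in> S \<Longrightarrow> E u v = E' u v"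
  shows "gball E S x n = gball E' S x n"
proof (induction n)
  case (Suc n)
  have "{v \<in> S. \<exists>u\<in>gball E' S x n. E u v} = {v \<in> S. \<exists>u\<in>gball E' S x n. E' u v}"
    using assms gball_subset[of E' S x n] by blast
  then show ?case using Suc by simp
qed simp

lemma tame_cong:
  assumes "tame d f E' S" "\<And>u v. u \<in> S \<Longrightarrow> v \<in> S \<Longrightarrow> E u v = E' u v"
  shows "tame d f E S"
proof -
  have "gball E S = gball E' S" using gball_cong[of S E E'] assms(2) by blast
  then show ?thesis using assms(1) by (simp add: tame_def)
qed

lemma good_of_control:
  assumes G: "simple_graph G" and ctrl: "\<And>S. S \<subseteq> verts G \<Longrightarrow> S \<noteq> {} \<Longrightarrow> control_function d f (induced G S)"
  shows "good (clique_number G) d f (\<lambda>u v. {u, v} \<in> edges G) (verts G)"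
  unfolding good_def
proof (intro conjI allI impI)
  let ?E = "\<lambda>u v. {u, v} \<in> edges G"
  show fin: "finite (verts G)" using G by (simp add: simple_graph_def)
  show "symp ?E" by (rule sympI) (simp add: insert_commute)
  show "irreflp ?E"
  proof (rule irreflpI, rule notI)
    fix x assume "{x, x} \<in> edges G"
    then have "card {x, x} = 2" using G unfolding simple_graph_def by blast
    then show False by simp
  qed
  fix S assume S: "S \<subseteq> verts G"
  show "tame d f ?E S"
  proof (cases "S = {}")
    case True
    then show ?thesis by (simp add: tame_def)
  next
    case False
    have "tame d f (\<lambda>u v. {u, v} \<in> edges (induced G S)) (verts (induced G S))"
      by (rule control_function_tame[OF ctrl[OF S False]])
    then have "tame d f (\<lambda>u v. {u, v} \<in> edges (induced G S)) S" by (simp add: induced_def)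
    then show ?thesis by (rule tame_cong) (simp add: induced_def)
  qed
next
  let ?E = "\<lambda>u v. {u, v} \<in> edges G"
  fix K assume K: "K \<subseteq> verts G" "complete_set ?E K"
  have fin: "finite (verts G)" using G by (simp add: simple_graph_def)
  have "Defs.clique G K" using K by (simp add: Defs.clique_def complete_set_def)
  then have "card K \<in> {card K | K. Defs.clique G K}" by blast
  moreover have "finite {card K | K. Defs.clique G K}"
  proof (rule finite_subset)
    show "{card K | K. Defs.clique G K} \<subseteq> card ` Pow (verts G)" by (auto simp: Defs.clique_def)
  qed (use fin in simp)
  ultimately show "card K \<le> clique_number G" unfolding clique_number_def by (intro Max_ge)
qed

lemma burling_free_burling_number:
  assumes G: "simple_graph G"
  shows "burling_free (Suc (burling_number G)) (\<lambda>u v. {u, v} \<in> edges G) (verts G)"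
  unfolding burling_free_def
proof
  let ?n = "Suc (burling_number G)"
  assume "\<exists>\<psi>. inj_on \<psi> (verts (burling ?n)) \<and> \<psi> ` verts (burling ?n) \<subseteq> verts G \<and>
     (\<forall>u\<in>verts (burling ?n). \<forall>v\<in>verts (burling ?n). {\<psi> u, \<psi> v} \<in> edges G \<longleftrightarrow> {u, v} \<in> edges (burling ?n))"
  then obtain \<psi> where \<psi>: "inj_on \<psi> (verts (burling ?n))" "\<psi> ` verts (burling ?n) \<subseteq> verts G"
    "\<And>u v. u \<in> verts (burling ?n) \<Longrightarrow> v \<in> verts (burling ?n) \<Longrightarrow> {\<psi> u, \<psi> v} \<in> edges G \<longleftrightarrow> {u, v} \<in> edges (burling ?n)"
    by blast
  let ?S = "\<psi> ` verts (burling ?n)"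
  have "verts (burling ?n) \<noteq> {}"
    using is_marked_graph_burling[of "burling_number G"] by (auto simp: is_marked_graph_def simple_graph_def)
  then have "induced_subgraph (induced G ?S) G" unfolding induced_subgraph_def using \<psi>(2) by blast
  moreover have "graph_iso (graph.truncate (burling ?n)) (induced G ?S)"
    unfolding graph_iso_def
  proof (rule exI[of _ \<psi>], intro conjI ballI)
    show "bij_betw \<psi> (verts (graph.truncate (burling ?n))) (verts (induced G ?S))"
      using \<psi>(1) by (simp add: bij_betw_def induced_def)
    fix u v assume "u \<in> verts (graph.truncate (burling ?n))" "v \<in> verts (graph.truncate (burling ?n))"
    then have uv: "u \<in> verts (burling ?n)" "v \<in> verts (burling ?n)" by simp_all
    show "{u, v} \<in> edges (graph.truncate (burling ?n)) \<longleftrightarrow> {\<psi> u, \<psi> v} \<in> edges (induced G ?S)"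
      using \<psi>(3)[OF uv] uv by (simp add: induced_def)
  qed
  ultimately have "?n \<in> {k. 1 \<le> k \<and> contains_burling G k}" by (auto simp: contains_burling_def)
  then have "?n \<le> burling_number G"
    unfolding burling_number_def using finite_contains_burling[OF G] by (intro Max_ge)
  then show False by simp
qed

lemma burling_number_pos:
  assumes "simple_graph G"
  shows "1 \<le> burling_number G"
  unfolding burling_number_def
  using finite_contains_burling[OF assms] contains_burling_1[OF assms] by (intro Max_ge) auto

lemma chromatic_number_le:
  assumes G: "simple_graph G" and col: "colourable (\<lambda>u v. {u, v} \<in> edges G) (verts G) k"
  shows "chromatic_number G \<le> k"
proof -
  obtain c where c: "\<forall>u\<in>verts G. c u < k" "\<forall>u\<in>verts G. \<forall>v\<in>verts G. {u, v} \<in> edges G \<longrightarrow> c u \<noteq> c v"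
    using col unfolding colourable_def by blast
  have "proper_colouring G k (\<lambda>u. Suc (c u))"
    unfolding proper_colouring_def
  proof (intro conjI allI impI)
    show "(\<lambda>u. Suc (c u)) ` verts G \<subseteq> {1..k}" using c(1) by (auto simp: Suc_le_eq)
    fix u v assume e: "{u, v} \<in> edges G"
    then have "{u, v} \<subseteq> verts G" using G unfolding simple_graph_def by blast
    then show "Suc (c u) \<noteq> Suc (c v)" using c(2) e by simp
  qed
  then show ?thesis unfolding chromatic_number_def by (intro Least_le) blast
qed

theorem theorem1p4:
  fixes \<G> :: "nat graph set"
  assumes "graph_class \<G>" and "hereditary \<G>" and "asdim \<G> < \<infinity>"
  shows "burling_controlled \<G>"
proof -
  have "{d. \<exists>f. \<forall>G\<in>\<G>. control_function d f G} \<noteq> {}"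
  proof
    assume none: "{d. \<exists>f. \<forall>G\<in>\<G>. control_function d f G} = {}"
    have "asdim \<G> = \<infinity>" unfolding asdim_def none by (simp add: top_enat_def)
    then show False using assms(3) by simp
  qed
  then obtain d f where ctrl: "\<And>G. G \<in> \<G> \<Longrightarrow> control_function d f G" by blast
  have "\<forall>m n. \<exists>c. \<forall>E (V::nat set). good m d f E V \<and> burling_free (Suc (Suc n)) E V \<longrightarrow> colourable E V c"
    using bounded_colouring by blast
  then obtain F where F: "\<And>m n E (V::nat set). good m d f E V \<Longrightarrow> burling_free (Suc (Suc n)) E V \<Longrightarrow>
      colourable E V (F m n)"
    by metis
  show ?thesis
    unfolding burling_controlled_def
  \<comment> \<open>The excluded graph has index \<open>burling_number H + 1\<close>, which is at
    least 2 because \<open>burling_number H\<close> is positive; writing it as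
    \<open>Suc (Suc (n - 1))\<close> gives the form used in \<open>bounded_colouring\<close>. The
    maximum with 1 makes the bound positive.\<close>
  proof (rule exI[of _ "\<lambda>(m, n). max 1 (F m (n - 1))"], intro conjI ballI allI impI)
    fix G H assume G: "G \<in> \<G>" and H: "induced_subgraph H G"
    have HG: "H \<in> \<G>" using assms(2) G H unfolding hereditary_def by blast
    have sH: "simple_graph H" using assms(1) HG unfolding graph_class_def by blast
    have "control_function d f (induced H S)" if "S \<subseteq> verts H" "S \<noteq> {}" for S
    proof -
      have "induced_subgraph (induced H S) H" using that unfolding induced_subgraph_def by blast
      then have "induced H S \<in> \<G>" using assms(2) HG unfolding hereditary_def by blast
      then show ?thesis by (rule ctrl)
    qed
    then have "good (clique_number H) d f (\<lambda>u v. {u, v} \<in> edges H) (verts H)"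
      by (rule good_of_control[OF sH])
    moreover have "Suc (burling_number H) = Suc (Suc (burling_number H - 1))"
      using burling_number_pos[OF sH] by simp
    then have "burling_free (Suc (Suc (burling_number H - 1))) (\<lambda>u v. {u, v} \<in> edges H) (verts H)"
      using burling_free_burling_number[OF sH] by metis
    ultimately have "colourable (\<lambda>u v. {u, v} \<in> edges H) (verts H) (F (clique_number H) (burling_number H - 1))"
      by (rule F)
    then have "chromatic_number H \<le> F (clique_number H) (burling_number H - 1)"
      by (rule chromatic_number_le[OF sH])
    then show "chromatic_number H \<le> (\<lambda>(m, n). max 1 (F m (n - 1))) (clique_number H, burling_number H)"
      by simp
  qed simp
qed


end
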